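(* Let $p>5$ be an integer. There exist a solution $w(t)$ of $\partial_t u+\partial_x^3u+\partial_x(u^p)=0$ defined for all $t\ge 0$, a real number $c_+>0$ and a function $t\mapsto\rho(t)\in\mathbb{R}$ such that: (i) $\|w(t)-Q_{c_+}(\cdot-\rho(t))\|_{H^1(\mathbb{R})}\to 0$ as $t\to+\infty$; (ii) for all $c>0$ and all $x_0\in\mathbb{R}$, $w(0)\neq Q_c(\cdot+x_0)$.
   Context: The equation is the generalized Korteweg-de Vries equation (gKdV), $u$ real valued. "Solution" means $H^1$ solution in the sense of Kenig–Ponce–Vega: the Cauchy problem is locally well posed in $H^1(\mathbb{R})$, the solution is continuous in time with values in $H^1(\mathbb{R})$ and unique in some class $Y_T\subset C^0([0,T],H^1(\mathbb{R}))$. $Q(x)=\left(\frac{p+1}{2\cosh^2\left(\frac{p-1}{2}x\right)}\right)^{\frac1{p-1}}$ is the unique positive even $H^1$ solution of $Q''+Q^p=Q$, and for $c>0$, $Q_c(x)=c^{\frac1{p-1}}Q(\sqrt c\,x)$. *)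

theory Defs
  imports "HOL-Analysis.Analysis"
begin

text \<open>
  Elements of $L^2(\mathbb{R})$ and $H^1(\mathbb{R})$ are represented by Borel functions
  \<^typ>\<open>real \<Rightarrow> real\<close>; every notion below depends only on the class of such a Borel function modulo
  equality almost everywhere.
\<close>

definition test_function :: "(real \<Rightarrow> real) \<Rightarrow> bool" where
  "test_function \<phi> \<longleftrightarrow>
     (\<forall>k x. ((deriv ^^ k) \<phi>) differentiable (at x)) \<and> (\<exists>R. \<forall>x. \<bar>x\<bar> > R \<longrightarrow> \<phi> x = 0)"

definition locally_integrable :: "(real \<Rightarrow> real) \<Rightarrow> bool" where
  "locally_integrable f \<longleftrightarrow> (\<forall>a b. set_integrable lborel {a..b} f)"

definition has_weak_deriv :: "(real \<Rightarrow> real) \<Rightarrow> (real \<Rightarrow> real) \<Rightarrow> bool" where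
  "has_weak_deriv f g \<longleftrightarrow>
     locally_integrable f \<and> locally_integrable g \<and>
     (\<forall>\<phi>. test_function \<phi> \<longrightarrow>
        (LINT x|lborel. f x * deriv \<phi> x) = - (LINT x|lborel. g x * \<phi> x))"

text \<open>The weak derivative is unique up to a null set, so the choice below is harmless.\<close>

definition weak_deriv :: "(real \<Rightarrow> real) \<Rightarrow> real \<Rightarrow> real" where
  "weak_deriv f = (SOME g. has_weak_deriv f g)"

definition L2 :: "(real \<Rightarrow> real) \<Rightarrow> bool" where
  "L2 f \<longleftrightarrow> f \<in> borel_measurable lborel \<and> integrable lborel (\<lambda>x. (f x)\<^sup>2)"

definition H1 :: "(real \<Rightarrow> real) \<Rightarrow> bool" where
  "H1 f \<longleftrightarrow> L2 f \<and> (\<exists>g. has_weak_deriv f g \<and> L2 g)"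

definition H1_norm :: "(real \<Rightarrow> real) \<Rightarrow> real" where
  "H1_norm f = sqrt ((LINT x|lborel. (f x)\<^sup>2) + (LINT x|lborel. (weak_deriv f x)\<^sup>2))"

definition continuous_in_H1 :: "(real \<Rightarrow> real \<Rightarrow> real) \<Rightarrow> bool" where
  "continuous_in_H1 u \<longleftrightarrow>
     (\<forall>t\<ge>0. H1 (u t)) \<and>
     (\<forall>t\<ge>0. ((\<lambda>s. H1_norm (\<lambda>x. u s x - u t x)) \<longlongrightarrow> 0) (at t within {0..}))"

text \<open>
  The equation $\partial_t u = - \partial_x^3 u - \partial_x(u^p)$ holds in the sense of
  distributions in $x$ for every $t \ge 0$. For $u \in C^0([0,\infty),H^1)$ the right-hand side
  is continuous in time when tested against \<open>\<phi>\<close>, so this is the same as the equation in the sense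
  of space-time distributions, and the same as the Duhamel integral equation.
\<close>

definition satisfies_gKdV :: "nat \<Rightarrow> (real \<Rightarrow> real \<Rightarrow> real) \<Rightarrow> bool" where
  "satisfies_gKdV p u \<longleftrightarrow>
     (\<forall>\<phi>. test_function \<phi> \<longrightarrow> (\<forall>t\<ge>0.
        ((\<lambda>s. LINT x|lborel. u s x * \<phi> x) has_real_derivative
           (LINT x|lborel. u t x * (deriv ^^ 3) \<phi> x + (u t x) ^ p * deriv \<phi> x))
         (at t within {0..})))"

text \<open>
  The resolution space on $[0,T]$: the Kenig--Ponce--Vega space for regularity $s > 3/4$,
  taken at $s = 1$. Besides continuity in $H^1$ it asks for
  $u \in L^2_x L^\infty_T$ (maximal function),
  $\partial_x u \in L^4_T L^\infty_x$ (Strichartz) and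
  $\partial_x^2 u \in L^\infty_x L^2_T$ (Kato smoothing).
  The suprema are expressed by majorants: since \<open>u t\<close> is only determined up to a null set
  for each \<open>t\<close>, the supremum over \<open>t\<close> is the one in the lattice of classes of functions of \<open>x\<close>.
\<close>

definition KPV_class :: "real \<Rightarrow> (real \<Rightarrow> real \<Rightarrow> real) \<Rightarrow> bool" where
  "KPV_class T u \<longleftrightarrow>
     (\<exists>M. L2 M \<and> (\<forall>t\<in>{0..T}. AE x in lborel. \<bar>u t x\<bar> \<le> M x)) \<and>
     (\<exists>m. set_integrable lborel {0..T} (\<lambda>t. (m t) ^ 4) \<and>
        (AE t in lborel. t \<in> {0..T} \<longrightarrow> (AE x in lborel. \<bar>weak_deriv (u t) x\<bar> \<le> m t))) \<and>
     (\<exists>z C. (\<lambda>(t, x). z t x) \<in> borel_measurable (lborel \<Otimes>\<^sub>M lborel) \<and>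
        (AE t in lborel. t \<in> {0..T} \<longrightarrow> has_weak_deriv (weak_deriv (u t)) (z t)) \<and>
        (AE x in lborel. set_integrable lborel {0..T} (\<lambda>t. (z t x)\<^sup>2) \<and>
           (LINT t:{0..T}|lborel. (z t x)\<^sup>2) \<le> C))"

definition global_gKdV_solution :: "nat \<Rightarrow> (real \<Rightarrow> real \<Rightarrow> real) \<Rightarrow> bool" where
  "global_gKdV_solution p u \<longleftrightarrow>
     continuous_in_H1 u \<and> satisfies_gKdV p u \<and> (\<forall>T>0. KPV_class T u)"

definition Q :: "nat \<Rightarrow> real \<Rightarrow> real" where
  "Q p x = ((real p + 1) / (2 * (cosh ((real p - 1) / 2 * x))\<^sup>2)) powr (1 / (real p - 1))"

definition Qc :: "nat \<Rightarrow> real \<Rightarrow> real \<Rightarrow> real" where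
  "Qc p c x = c powr (1 / (real p - 1)) * Q p (sqrt c * x)"

end

theory Submission
  imports Defs "HOL-Complex_Analysis.Great_Picard" "HOL-Computational_Algebra.Formal_Power_Series"
begin

text \<open>
  The solution leaves the soliton along its unstable direction. In the frame moving with \<open>Q\<close>, make the ansatz
  \<open>w(t, x) = \<Sum>k. (\<epsilon> exp (- e0 t)) ^ k * Z k (x - t)\<close> with \<open>Z 0 = Q\<close>. Then \<open>Z 1\<close> has to be an eigenfunction,
  with eigenvalue \<open>e0\<close>, of the linearized operator, and \<open>Z k\<close> has to solve the linearized equation at the spectral parameter
  \<open>k * e0\<close> with a right-hand side built from the earlier coefficients.

  Writing \<open>k * e0 = \<nu> ^ 3 - \<nu>\<close>, the equation for \<open>Z k\<close> becomes \<open>Z k = linT \<nu> (q * Z k + \<dots>)\<close> with the explicit inverse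
  \<open>linT \<nu>\<close> of the constant coefficient part and \<open>q = p * Q ^ (p - 1)\<close>. An eigenvalue exists because the Evans function is
  negative near \<open>\<nu> = 1\<close>, which is where \<open>p > 5\<close> is used, and tends to \<open>1\<close> as \<open>\<nu> \<rightarrow> \<infinity>\<close>. Taking for \<open>e0\<close> the
  largest eigenvalue, no \<open>k * e0\<close> with \<open>k \<ge> 2\<close> is an eigenvalue, so that the recursion can be solved; the majorants
  \<open>\<delta> / k\<^sup>2\<close>, which are stable under convolution, make the series converge.

  If \<open>w(0)\<close> were a rescaled and translated soliton for every small \<open>\<epsilon>\<close>, then \<open>w'' + w ^ p\<close> would be a multiple of \<open>w\<close>
  at \<open>t = 0\<close>. At first order in \<open>\<epsilon>\<close> this makes \<open>Z 1\<close> a multiple of \<open>Q'\<close>, which lies in the kernel of the linearized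
  operator and not in an eigenspace with \<open>e0 > 0\<close>.
\<close>

section \<open>Resolvents on weighted spaces\<close>

text \<open>The linearized operator is of third order and not self-adjoint, so neither a variational
  principle nor Sturm oscillation yields its real eigenvalue. The eigenvalue comes instead from the
  solution that behaves like \<open>exp (\<nu> * x)\<close> at \<open>-\<infinity>\<close>: after
  division by this exponential it solves a Volterra equation, uniformly in
  \<open>\<nu> \<ge> 1\<close>, and its limit at \<open>+\<infinity>\<close> is the Evans function.
  At \<open>\<nu> = 1\<close> this solution is a multiple of \<open>Q'\<close>. Beyond
  \<open>\<nu> = 1\<close> the sign is read off at the origin rather than at infinity: up to
  positive factors the Evans function is a square of second order in \<open>\<nu> - 1\<close> plus a
  term of first order whose sign is that of the derivative of the soliton mass with respect to the
  speed. Every operator involved is composed of resolvents \<open>(d/dx + \<gamma>)^-1\<close>,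
  because the roots of the characteristic cubic are explicit in \<open>\<nu>\<close>. One kernel
  estimate therefore suffices, provided that the weight is left arbitrary: exponential weights give
  decay at either end, a weight built from the integral of the potential makes the Volterra operator
  a contraction, and truncated weights make suprema finite that are to be absorbed.\<close>

definition causal_resolvent :: "complex \<Rightarrow> (real \<Rightarrow> complex) \<Rightarrow> real \<Rightarrow> complex" where
  "causal_resolvent \<gamma> f x = (LINT t:{..x}|lborel. exp (- \<gamma> * of_real (x - t)) * f t)"

text \<open>Bounds always have the form \<open>norm (f x) \<le> C / w x\<close>. Growth is
  restricted only in the direction in which a causal kernel looks back, so increasing, decreasing
  and truncated weights are all covered; a negative \<open>b\<close> forces the weight to
  decrease.\<close>

definition weight_growth :: "real \<Rightarrow> (real \<Rightarrow> real) \<Rightarrow> bool" where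
  "weight_growth b w \<longleftrightarrow> (\<forall>x. w x > 0) \<and> (\<forall>x t. t \<le> x \<longrightarrow> w x \<le> exp (b * (x - t)) * w t)"

lemma weight_growthD: "weight_growth b w \<Longrightarrow> t \<le> x \<Longrightarrow> w x \<le> exp (b * (x - t)) * w t"
  by (simp add: weight_growth_def)

lemma has_bochner_integral_exp_atMost:
  fixes c x :: real assumes "c > 0"
  shows "has_bochner_integral lborel (\<lambda>t. indicator {..x} t *\<^sub>R exp (- c * (x - t))) (1 / c)"
proof -
  have "((\<lambda>z::real. - exp (- c * z) / c) \<longlongrightarrow> - 0 / c) at_top"
    by (intro tendsto_intros filterlim_compose[OF exp_at_bot]
        filterlim_tendsto_neg_mult_at_bot[OF tendsto_const _ filterlim_ident]) (use assms in auto)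
  then have "((\<lambda>z::real. - exp (- c * z) / c) \<longlongrightarrow> 0) at_top" by simp
  then have "(\<integral>\<^sup>+z. ennreal (exp (- c * z)) * indicator {0..} z \<partial>lborel) = 0 - (- exp (- c * 0) / c)"
    by (intro nn_integral_FTC_atLeast[of "\<lambda>z. exp (- c * z)" 0 "\<lambda>z. - exp (- c * z) / c"])
      (auto intro!: derivative_eq_intros simp: assms less_imp_neq[OF assms, symmetric])
  then have "(\<integral>\<^sup>+z. ennreal (indicator {0..} z *\<^sub>R exp (- c * z)) \<partial>lborel) = ennreal (1 / c)"
    by (simp add: ennreal_mult' ennreal_indicator mult.commute)
  then have "has_bochner_integral lborel (\<lambda>z. indicator {0..} z *\<^sub>R exp (- c * z)) (1 / c)"
    by (intro has_bochner_integral_nn_integral) (use assms in auto)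
  then have "has_bochner_integral lborel (\<lambda>t. indicator {0..} (x + (-1) * t) *\<^sub>R exp (- c * (x + (-1) * t))) ((1 / c) /\<^sub>R \<bar>-1\<bar>)"
    by (subst (asm) lborel_has_bochner_integral_real_affine_iff[of "-1" _ _ x]) auto
  moreover have "indicator {0..} (x + (-1) * t) = (indicator {..x} t :: real)" for t
    by (auto split: split_indicator)
  ultimately show ?thesis by simp
qed

locale dominated_by_weight =
  fixes \<gamma> :: complex and b C :: real and w :: "real \<Rightarrow> real" and f :: "real \<Rightarrow> complex"
  assumes weight: "weight_growth b w" and b_less: "b < Re \<gamma>"
    and cont: "continuous_on UNIV f" and bound: "\<And>x. norm (f x) \<le> C / w x"
begin

lemma weight_pos: "w x > 0"
  using weight by (auto simp: weight_growth_def)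

lemma C_nonneg: "C \<ge> 0"
  using order_trans[OF norm_ge_zero bound[of 0]] weight_pos[of 0] by (simp add: zero_le_divide_iff)

text \<open>The growth condition moves the weight from \<open>t\<close> to \<open>x\<close> at the
  price \<open>exp (b * (x - t))\<close>, which the kernel can pay because
  \<open>b < Re \<gamma>\<close>. What remains has total mass
  \<open>1 / (Re \<gamma> - b)\<close>.\<close>

lemma integrand_bound:
  assumes "t \<le> x"
  shows "norm (exp (- \<gamma> * of_real (x - t)) * f t) \<le> (C / w x) * exp (- (Re \<gamma> - b) * (x - t))"
proof -
  have "w x \<le> exp (b * (x - t)) * w t" using weight assms by (auto simp: weight_growth_def)
  then have "1 / w t \<le> exp (b * (x - t)) / w x"
    using weight_pos[of t] weight_pos[of x] by (simp add: field_simps)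
  then have "norm (f t) \<le> C * (exp (b * (x - t)) / w x)"
    using bound[of t] C_nonneg mult_left_mono[of "1 / w t" "exp (b * (x - t)) / w x" C] by simp
  then have "norm (exp (- \<gamma> * of_real (x - t)) * f t) \<le> exp (- Re \<gamma> * (x - t)) * (C * (exp (b * (x - t)) / w x))"
    unfolding norm_mult by (intro mult_mono) auto
  also have "\<dots> = (C / w x) * (exp (- Re \<gamma> * (x - t)) * exp (b * (x - t)))" by simp
  also have "exp (- Re \<gamma> * (x - t)) * exp (b * (x - t)) = exp (- (Re \<gamma> - b) * (x - t))"
    by (simp add: exp_add[symmetric] algebra_simps)
  finally show ?thesis .
qed

lemma integrable: "set_integrable lborel {..x} (\<lambda>t. exp (- \<gamma> * of_real (x - t)) * f t)"
proof (rule set_integrable_bound)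
  show "set_integrable lborel {..x} (\<lambda>t. (C / w x) * exp (- (Re \<gamma> - b) * (x - t)))"
    using has_bochner_integral_exp_atMost[of "Re \<gamma> - b" x] b_less
    by (intro set_integrable_mult_right) (auto simp: set_integrable_def dest: integrable.intros)
  have "continuous_on UNIV (\<lambda>t. exp (- \<gamma> * of_real (x - t)) * f t)"
    by (intro continuous_intros cont)
  then show "set_borel_measurable lborel {..x} (\<lambda>t. exp (- \<gamma> * of_real (x - t)) * f t)"
    unfolding set_borel_measurable_def
    by (intro borel_measurable_scaleR) (auto intro: borel_measurable_continuous_onI)
  show "AE t in lborel. t \<in> {..x} \<longrightarrow>
      norm (exp (- \<gamma> * of_real (x - t)) * f t) \<le> norm ((C / w x) * exp (- (Re \<gamma> - b) * (x - t)))"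
    using integrand_bound unfolding real_norm_def
    by (intro AE_I2 impI order_trans[OF _ abs_ge_self]) blast
qed

lemma norm_le: "norm (causal_resolvent \<gamma> f x) \<le> C / ((Re \<gamma> - b) * w x)"
proof -
  note e = has_bochner_integral_exp_atMost[of "Re \<gamma> - b" x]
  have "norm (causal_resolvent \<gamma> f x) \<le> (LINT t:{..x}|lborel. (C / w x) * exp (- (Re \<gamma> - b) * (x - t)))"
    unfolding causal_resolvent_def
  proof (rule set_integral_norm_bound[OF integrable, THEN order_trans], rule set_integral_mono)
    show "set_integrable lborel {..x} (\<lambda>t. norm (exp (- \<gamma> * of_real (x - t)) * f t))"
      using integrable by (rule set_integrable_norm)
    show "set_integrable lborel {..x} (\<lambda>t. (C / w x) * exp (- (Re \<gamma> - b) * (x - t)))"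
      using e b_less by (intro set_integrable_mult_right) (auto simp: set_integrable_def dest: integrable.intros)
  qed (use integrand_bound in auto)
  also have "\<dots> = (C / w x) * (LINT t:{..x}|lborel. exp (- (Re \<gamma> - b) * (x - t)))"
    by (rule set_integral_mult_right)
  also have "(LINT t:{..x}|lborel. exp (- (Re \<gamma> - b) * (x - t))) = 1 / (Re \<gamma> - b)"
    using has_bochner_integral_integral_eq[OF e] b_less by (simp add: set_lebesgue_integral_def)
  finally show ?thesis by (simp add: field_simps)
qed

text \<open>Cutting the improper integral at a finite \<open>a\<close> leaves an ordinary integral
  with variable upper limit, to which the fundamental theorem of calculus applies.\<close>

lemma split:
  assumes "a \<le> x"
  shows "causal_resolvent \<gamma> f x = exp (- \<gamma> * of_real (x - a)) *
    (causal_resolvent \<gamma> f a + integral {a..x} (\<lambda>t. exp (\<gamma> * of_real (t - a)) * f t))"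
proof -
  let ?g = "\<lambda>t. exp (- \<gamma> * of_real (x - t)) * f t"
  have U: "{..x} = {..a} \<union> {a<..x}" using assms by auto
  have i1: "set_integrable lborel {..a} ?g" and i2: "set_integrable lborel {a<..x} ?g"
    and i3: "set_integrable lborel {a..x} ?g"
    using integrable[of x] assms by (auto elim!: set_integrable_subset)
  have e1: "- \<gamma> * of_real (x - t) = - \<gamma> * of_real (x - a) + - \<gamma> * of_real (a - t)" for t
    by (simp add: algebra_simps)
  have eq: "?g t = exp (- \<gamma> * of_real (x - a)) * (exp (- \<gamma> * of_real (a - t)) * f t)" for t
    unfolding e1[of t] exp_add mult.assoc ..
  have e2: "- \<gamma> * of_real (x - t) = - \<gamma> * of_real (x - a) + \<gamma> * of_real (t - a)" for t
    by (simp add: algebra_simps)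
  have eq2: "?g t = exp (- \<gamma> * of_real (x - a)) * (exp (\<gamma> * of_real (t - a)) * f t)" for t
    unfolding e2[of t] exp_add mult.assoc ..
  have "causal_resolvent \<gamma> f x = (LINT t:{..a}|lborel. ?g t) + (LINT t:{a<..x}|lborel. ?g t)"
    unfolding causal_resolvent_def U by (rule set_integral_Un[OF _ i1 i2]) auto
  also have "(LINT t:{a<..x}|lborel. ?g t) = (LINT t:{a..x}|lborel. ?g t)"
    unfolding set_lebesgue_integral_def
    by (rule integral_cong_AE) (use i2 i3 AE_lborel_singleton[of a] in
      \<open>auto simp: set_integrable_def elim!: eventually_mono split: split_indicator\<close>)
  also have "\<dots> = integral {a..x} ?g"
    by (rule set_borel_integral_eq_integral(2)[OF i3])
  also have "\<dots> = exp (- \<gamma> * of_real (x - a)) * integral {a..x} (\<lambda>t. exp (\<gamma> * of_real (t - a)) * f t)"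
    unfolding eq2 by (rule integral_mult_right)
  also have "(LINT t:{..a}|lborel. ?g t) = exp (- \<gamma> * of_real (x - a)) * causal_resolvent \<gamma> f a"
    unfolding eq causal_resolvent_def by (rule set_integral_mult_right)
  finally show ?thesis by (simp add: algebra_simps)
qed

lemma has_vector_derivative:
  "(causal_resolvent \<gamma> f has_vector_derivative f x - \<gamma> * causal_resolvent \<gamma> f x) (at x)"
proof -
  define a where "a = x - 1"
  let ?h = "\<lambda>t. exp (\<gamma> * of_real (t - a)) * f t"
  let ?E = "\<lambda>y. exp (- \<gamma> * of_real (y - a))"
  let ?I = "\<lambda>y. causal_resolvent \<gamma> f a + integral {a..y} ?h"
  have ch: "continuous_on {a..x+1} ?h"
    by (intro continuous_intros continuous_on_subset[OF cont]) auto
  have "((\<lambda>y. integral {a..y} ?h) has_vector_derivative ?h x) (at x within {a..x+1})"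
    by (rule integral_has_vector_derivative[OF ch]) (auto simp: a_def)
  then have "((\<lambda>y. integral {a..y} ?h) has_vector_derivative ?h x) (at x)"
    by (simp add: at_within_Icc_at a_def)
  then have dI: "(?I has_vector_derivative ?h x) (at x)"
    by (auto intro!: derivative_eq_intros)
  have dE: "(?E has_vector_derivative - \<gamma> * ?E x) (at x)"
    by (rule has_vector_derivative_eq_rhs,
        rule field_vector_diff_chain_at[of "\<lambda>y. - \<gamma> * of_real (y - a)" "- \<gamma>" x exp, unfolded o_def])
      (auto intro!: derivative_eq_intros)
  have "((\<lambda>y. ?E y * ?I y) has_vector_derivative (?E x * ?h x + - \<gamma> * ?E x * ?I x)) (at x)"
    by (rule has_vector_derivative_mult[OF dE dI])
  moreover have A: "?E x * ?h x = f x"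
    unfolding mult.assoc[symmetric] exp_add[symmetric] by simp
  moreover have B: "?E x * ?I x = causal_resolvent \<gamma> f x"
    by (rule split[symmetric]) (simp add: a_def)
  have "?E x * ?h x + - \<gamma> * ?E x * ?I x = f x - \<gamma> * causal_resolvent \<gamma> f x"
    by (simp only: A mult.assoc B) simp
  ultimately have "((\<lambda>y. ?E y * ?I y) has_vector_derivative f x - \<gamma> * causal_resolvent \<gamma> f x) (at x)"
    by (simp only:)
  then show ?thesis
  proof (rule has_vector_derivative_transform_within_open)
    show "open {a<..}" "x \<in> {a<..}" by (auto simp: a_def)
    show "?E y * ?I y = causal_resolvent \<gamma> f y" if "y \<in> {a<..}" for y
      by (rule split[symmetric]) (use that in simp)
  qed
qed

lemma continuous_on_resolvent: "continuous_on UNIV (causal_resolvent \<gamma> f)"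
  using has_vector_derivative
  by (auto simp: continuous_on_eq_continuous_at intro: has_vector_derivative_continuous)

end

lemma causal_resolvent_mult: "causal_resolvent \<gamma> (\<lambda>x. c * f x) x = c * causal_resolvent \<gamma> f x"
proof -
  have "causal_resolvent \<gamma> (\<lambda>x. c * f x) x = (LINT t:{..x}|lborel. c * (exp (- \<gamma> * of_real (x - t)) * f t))"
    unfolding causal_resolvent_def by (simp add: mult_ac)
  then show ?thesis
    unfolding causal_resolvent_def by (simp only: set_integral_mult_right)
qed

lemma causal_resolvent_add:
  assumes "dominated_by_weight \<gamma> b C w f" "dominated_by_weight \<gamma> b' C' w' g"
  shows "causal_resolvent \<gamma> (\<lambda>x. f x + g x) x = causal_resolvent \<gamma> f x + causal_resolvent \<gamma> g x"
  unfolding causal_resolvent_def distrib_left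
  by (intro set_integral_add dominated_by_weight.integrable[OF assms(1)] dominated_by_weight.integrable[OF assms(2)])

text \<open>The difference of two solutions is a multiple of \<open>exp (- \<gamma> * x)\<close>,
  which towards \<open>-\<infinity>\<close> grows faster than \<open>1 / w\<close> can; so the
  multiple is zero. Later identities between resolvents are proved by comparing differential
  equations through this lemma.\<close>

lemma first_order_unique:
  fixes u v :: "real \<Rightarrow> complex"
  assumes w: "weight_growth b w" and b: "b < Re \<gamma>"
    and u: "\<And>x. (u has_vector_derivative g x - \<gamma> * u x) (at x)"
    and v: "\<And>x. (v has_vector_derivative g x - \<gamma> * v x) (at x)"
    and M: "\<And>x. norm (u x - v x) \<le> M / w x"
  shows "u x = v x"
proof -
  define d where "d y = exp (\<gamma> * of_real y) * (u y - v y)" for y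
  have E: "((\<lambda>y. exp (\<gamma> * of_real y)) has_vector_derivative \<gamma> * exp (\<gamma> * of_real y)) (at y)" for y
    by (rule has_vector_derivative_eq_rhs,
        rule field_vector_diff_chain_at[of "\<lambda>y. \<gamma> * of_real y" \<gamma> y exp, unfolded o_def])
      (auto intro!: derivative_eq_intros)
  have dv: "((\<lambda>y. u y - v y) has_vector_derivative - \<gamma> * (u y - v y)) (at y)" for y
    using has_vector_derivative_diff[OF u[of y] v[of y]] by (simp add: algebra_simps)
  have "(d has_vector_derivative 0) (at y)" for y
    using has_vector_derivative_mult[OF E[of y] dv[of y]] unfolding d_def by (simp add: algebra_simps)
  then obtain c where c: "d y = c" for y
    using has_vector_derivative_zero_constant[of UNIV d] by auto
  have eq: "u y - v y = c * exp (- \<gamma> * of_real y)" for y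
    using c[of y] by (simp add: d_def exp_minus field_simps)
  have w0: "w 0 > 0" and w_pos: "w y > 0" for y using w by (auto simp: weight_growth_def)
  have bd: "norm c * exp ((Re \<gamma> - b) * real n) \<le> M / w 0" for n :: nat
  proof -
    have 1: "norm c * exp (Re \<gamma> * real n) \<le> M / w (- real n)"
      using M[of "- real n"] by (simp add: eq norm_mult)
    have "w 0 \<le> exp (b * (0 - (- real n))) * w (- real n)"
      by (rule weight_growthD[OF w]) simp
    then have 2: "1 / w (- real n) \<le> exp (b * real n) / w 0"
      using w0 w_pos[of "- real n"] by (simp add: field_simps)
    have "M / w (- real n) \<ge> 0" using 1 by (meson norm_ge_zero mult_nonneg_nonneg exp_ge_zero order_trans)
    then have "M \<ge> 0" using w_pos[of "- real n"] by (simp add: zero_le_divide_iff)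
    then have "M / w (- real n) \<le> M * (exp (b * real n) / w 0)"
      using mult_left_mono[OF 2, of M] by simp
    with 1 have "norm c * exp (Re \<gamma> * real n) \<le> (M / w 0) * exp (b * real n)" by simp
    then have "norm c * (exp (Re \<gamma> * real n) / exp (b * real n)) \<le> M / w 0"
      by (simp add: field_simps)
    then show ?thesis by (simp add: exp_diff[symmetric] algebra_simps)
  qed
  have "c = 0"
  proof (rule ccontr)
    assume "c \<noteq> 0"
    define e where "e = Re \<gamma> - b"
    obtain n :: nat where n: "real n > (M / w 0) / (norm c * e)" using reals_Archimedean2 by blast
    have "exp (e * real n) > e * real n" using exp_ge_add_one_self[of "e * real n"] by linarith
    moreover have "e * real n * norm c > M / w 0"
    proof -
      have "norm c * e > 0" using \<open>c \<noteq> 0\<close> b by (simp add: e_def)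
      then have "M / w 0 < real n * (norm c * e)" using n by (simp only: pos_divide_less_eq)
      then show ?thesis by (simp only: mult_ac)
    qed
    ultimately have "norm c * exp (e * real n) > M / w 0"
      using \<open>c \<noteq> 0\<close> by (smt (verit) mult.commute mult_strict_right_mono zero_less_norm_iff)
    with bd[of n] show False by (simp add: e_def)
  qed
  then show ?thesis using eq[of x] by simp
qed

text \<open>Both sides solve \<open>u' = (\<delta> - \<gamma>) * causal_resolvent \<delta> f -
  \<gamma> * u\<close> and are bounded by a multiple of \<open>1 / w\<close>, so uniqueness replaces
  an interchange of integrals.\<close>

lemma resolvent_identity:
  assumes f: "dominated_by_weight \<gamma> b C w f" and g: "b < Re \<delta>"
  shows "causal_resolvent \<gamma> f x - causal_resolvent \<delta> f x =
    (\<delta> - \<gamma>) * causal_resolvent \<gamma> (causal_resolvent \<delta> f) x"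
proof -
  interpret f: dominated_by_weight \<gamma> b C w f by fact
  interpret f': dominated_by_weight \<delta> b C w f
    by standard (use f.weight g f.cont f.bound in auto)
  interpret h: dominated_by_weight \<gamma> b "C / (Re \<delta> - b)" w "causal_resolvent \<delta> f"
    by standard (use f.weight f.b_less f'.continuous_on_resolvent f'.norm_le in auto)
  let ?u = "\<lambda>x. causal_resolvent \<gamma> f x - causal_resolvent \<delta> f x"
  let ?v = "\<lambda>x. (\<delta> - \<gamma>) * causal_resolvent \<gamma> (causal_resolvent \<delta> f) x"
  show ?thesis
  proof (rule first_order_unique[OF f.weight f.b_less, of ?u "\<lambda>x. (\<delta> - \<gamma>) * causal_resolvent \<delta> f x" ?v])
    fix x
    show "(?u has_vector_derivative (\<delta> - \<gamma>) * causal_resolvent \<delta> f x - \<gamma> * ?u x) (at x)"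
      by (rule has_vector_derivative_eq_rhs[OF has_vector_derivative_diff[OF f.has_vector_derivative f'.has_vector_derivative]])
        algebra
    show "(?v has_vector_derivative (\<delta> - \<gamma>) * causal_resolvent \<delta> f x - \<gamma> * ?v x) (at x)"
      by (rule has_vector_derivative_eq_rhs[OF has_vector_derivative_mult_right[OF h.has_vector_derivative]])
        algebra
    have "norm (?u x - ?v x) \<le> norm (causal_resolvent \<gamma> f x) + norm (causal_resolvent \<delta> f x) +
        norm (\<delta> - \<gamma>) * norm (causal_resolvent \<gamma> (causal_resolvent \<delta> f) x)"
      using norm_triangle_ineq4[of "causal_resolvent \<gamma> f x - causal_resolvent \<delta> f x" "?v x"]
        norm_triangle_ineq4[of "causal_resolvent \<gamma> f x" "causal_resolvent \<delta> f x"]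
      unfolding norm_mult by linarith
    also have "\<dots> \<le> C / ((Re \<gamma> - b) * w x) + C / ((Re \<delta> - b) * w x) +
        norm (\<delta> - \<gamma>) * (C / (Re \<delta> - b) / ((Re \<gamma> - b) * w x))"
      by (intro add_mono mult_left_mono f.norm_le f'.norm_le h.norm_le) auto
    also have "\<dots> = (C / (Re \<gamma> - b) + C / (Re \<delta> - b) + norm (\<delta> - \<gamma>) * C / (Re \<delta> - b) / (Re \<gamma> - b)) / w x"
      by (simp add: add_divide_distrib mult.commute)
    finally show "norm (?u x - ?v x) \<le> \<dots>" .
  qed
qed

text \<open>The pair \<open>u = response h r c F\<close>, \<open>k = coresponse h r c F\<close> is the bounded solution of \<open>u' = F - k\<close>,
  \<open>k' = (2 * h - c) * F - 2 * h * k + (h\<^sup>2 - r\<^sup>2) * u\<close>. Here \<open>r\<close> is real or purely imaginary, so that \<open>r\<^sup>2\<close> is real.\<close>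

definition inner_response :: "real \<Rightarrow> complex \<Rightarrow> real \<Rightarrow> (real \<Rightarrow> real) \<Rightarrow> real \<Rightarrow> complex" where
  "inner_response h r c F x =
     of_real (F x) - (of_real h + r - of_real c) * causal_resolvent (of_real h + r) (\<lambda>t. of_real (F t)) x"

text \<open>With \<open>D = d/dx\<close>, \<open>inner_response\<close> is the multiplier
  \<open>(D + c) / (D + h + r)\<close>, and inverting the second factor gives
  \<open>(D + c) / ((D + h)^2 - r^2)\<close>. The multiplier has real coefficients as soon as
  \<open>r^2\<close> is real, even if \<open>r\<close> is not.\<close>

definition complex_response :: "real \<Rightarrow> complex \<Rightarrow> real \<Rightarrow> (real \<Rightarrow> real) \<Rightarrow> real \<Rightarrow> complex" where
  "complex_response h r c F = causal_resolvent (of_real h - r) (inner_response h r c F)"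

definition response :: "real \<Rightarrow> complex \<Rightarrow> real \<Rightarrow> (real \<Rightarrow> real) \<Rightarrow> real \<Rightarrow> real" where
  "response h r c F x = Re (complex_response h r c F x)"

definition coresponse :: "real \<Rightarrow> complex \<Rightarrow> real \<Rightarrow> (real \<Rightarrow> real) \<Rightarrow> real \<Rightarrow> real" where
  "coresponse h r c F x = Re ((of_real h + r - of_real c) * causal_resolvent (of_real h + r) (\<lambda>t. of_real (F t)) x
     + (of_real h - r) * complex_response h r c F x)"

definition inner_const :: "real \<Rightarrow> complex \<Rightarrow> real \<Rightarrow> real \<Rightarrow> real" where
  "inner_const h r c b = norm (of_real h + r - of_real c) / (h + Re r - b)"

definition response_const :: "real \<Rightarrow> complex \<Rightarrow> real \<Rightarrow> real \<Rightarrow> real" where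
  "response_const h r c b = (1 + inner_const h r c b) / (h - Re r - b)"

locale damped =
  fixes h :: real and r :: complex and c b C :: real and w F :: "real \<Rightarrow> real"
  assumes weight: "weight_growth b w" and b_less: "b < h - Re r" "b < h + Re r" and r2: "Im (r\<^sup>2) = 0"
    and contF: "continuous_on UNIV F" and boundF: "\<And>x. \<bar>F x\<bar> \<le> C / w x"
begin

sublocale outer: dominated_by_weight "of_real h + r" b C w "\<lambda>t. of_real (F t)"
  by standard (use weight b_less boundF contF in \<open>auto intro!: continuous_intros\<close>)

lemma inner_bound: "norm (inner_response h r c F x) \<le> C * (1 + inner_const h r c b) / w x"
proof -
  have "norm (inner_response h r c F x) \<le> \<bar>F x\<bar> + norm (of_real h + r - of_real c) *
      norm (causal_resolvent (of_real h + r) (\<lambda>t. of_real (F t)) x)"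
    unfolding inner_response_def by (rule norm_triangle_le_diff) (simp add: norm_mult)
  also have "\<dots> \<le> C / w x + norm (of_real h + r - of_real c) * (C / ((h + Re r - b) * w x))"
    using outer.norm_le[of x] by (intro add_mono mult_left_mono boundF) auto
  finally show ?thesis
    by (simp add: inner_const_def add_divide_distrib distrib_left mult.commute)
qed

sublocale inner: dominated_by_weight "of_real h - r" b "C * (1 + inner_const h r c b)" w "inner_response h r c F"
proof
  show "continuous_on UNIV (inner_response h r c F)"
    unfolding inner_response_def
    by (intro continuous_intros outer.continuous_on_resolvent contF)
qed (use weight b_less inner_bound in auto)

lemma abs_response_le: "\<bar>response h r c F x\<bar> \<le> C * response_const h r c b / w x"
  using inner.norm_le[of x] abs_Re_le_cmod[of "complex_response h r c F x"]
  by (simp add: response_def complex_response_def response_const_def mult.commute)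

lemma abs_coresponse_le:
  "\<bar>coresponse h r c F x\<bar> \<le> C * (inner_const h r c b + norm (of_real h - r) * response_const h r c b) / w x"
proof -
  have "\<bar>coresponse h r c F x\<bar> \<le> norm (of_real h + r - of_real c) *
      norm (causal_resolvent (of_real h + r) (\<lambda>t. of_real (F t)) x) + norm (of_real h - r) * norm (complex_response h r c F x)"
    unfolding coresponse_def norm_mult[symmetric]
    by (rule order_trans[OF abs_Re_le_cmod norm_triangle_ineq])
  also have "\<dots> \<le> norm (of_real h + r - of_real c) * (C / ((h + Re r - b) * w x)) +
      norm (of_real h - r) * (C * (1 + inner_const h r c b) / ((h - Re r - b) * w x))"
    using outer.norm_le[of x] inner.norm_le[of x]
    by (intro add_mono mult_left_mono) (auto simp: complex_response_def)
  also have "\<dots> = C * (inner_const h r c b + norm (of_real h - r) * response_const h r c b) / w x"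
    by (simp add: inner_const_def response_const_def add_divide_distrib distrib_left mult_ac)
  finally show ?thesis .
qed

lemma response_deriv: "(response h r c F has_real_derivative F x - coresponse h r c F x) (at x)"
proof -
  have "((\<lambda>x. Re (complex_response h r c F x)) has_vector_derivative
      Re (inner_response h r c F x - (of_real h - r) * complex_response h r c F x)) (at x)"
    unfolding complex_response_def
    by (rule bounded_linear.has_vector_derivative[OF bounded_linear_Re inner.has_vector_derivative])
  then show ?thesis
    by (simp add: response_def[abs_def] coresponse_def inner_response_def has_real_derivative_iff_has_vector_derivative
        algebra_simps)
qed

lemma coresponse_deriv:
  "(coresponse h r c F has_real_derivative
     (2 * h - c) * F x - 2 * h * coresponse h r c F x + (h\<^sup>2 - Re (r\<^sup>2)) * response h r c F x) (at x)"
proof -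
  let ?\<beta> = "of_real h + r - of_real c" and ?\<delta> = "of_real h + r" and ?\<gamma> = "of_real h - r"
  let ?R = "causal_resolvent ?\<delta> (\<lambda>t. of_real (F t))" and ?g = "complex_response h r c F"
  have r2': "r\<^sup>2 = of_real (Re (r\<^sup>2))" using r2 by (simp add: complex_eq_iff)
  have eq: "?\<beta> * (of_real (F x) - ?\<delta> * ?R x) + ?\<gamma> * (inner_response h r c F x - ?\<gamma> * ?g x)
     = of_real (2 * h - c) * of_real (F x) - of_real (2 * h) * (?\<beta> * ?R x + ?\<gamma> * ?g x)
       + of_real (h\<^sup>2 - Re (r\<^sup>2)) * ?g x"
    unfolding inner_response_def of_real_diff of_real_mult of_real_power r2'[symmetric]
    by (simp add: algebra_simps power2_eq_square)
  have "((\<lambda>x. Re (?\<beta> * ?R x + ?\<gamma> * ?g x)) has_vector_derivative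
      Re (?\<beta> * (of_real (F x) - ?\<delta> * ?R x) + ?\<gamma> * (inner_response h r c F x - ?\<gamma> * ?g x))) (at x)"
    unfolding complex_response_def
    by (intro bounded_linear.has_vector_derivative[OF bounded_linear_Re] has_vector_derivative_add
        has_vector_derivative_mult_right outer.has_vector_derivative inner.has_vector_derivative)
  also have "Re (?\<beta> * (of_real (F x) - ?\<delta> * ?R x) + ?\<gamma> * (inner_response h r c F x - ?\<gamma> * ?g x))
     = (2 * h - c) * F x - 2 * h * Re (?\<beta> * ?R x + ?\<gamma> * ?g x) + (h\<^sup>2 - Re (r\<^sup>2)) * Re (?g x)"
    unfolding eq by (simp only: of_real_mult[symmetric] plus_complex.sel minus_complex.sel times_complex.sel
        Re_complex_of_real Im_complex_of_real mult_zero_left diff_zero)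
  finally show ?thesis
    by (simp only: has_real_derivative_iff_has_vector_derivative coresponse_def[abs_def] response_def)
qed

text \<open>The combination \<open>v = (k - (h - r) * u) / (h + r - c)\<close> decouples:
  \<open>v' = F - (h + r) * v\<close>. Uniqueness for first-order equations determines
  \<open>v\<close>, and with \<open>v\<close> known the equation for \<open>u\<close> is again of
  first order.\<close>

lemma response_unique:
  assumes nz: "of_real h + r \<noteq> of_real c"
    and u: "\<And>x. (u has_real_derivative F x - k x) (at x)"
    and k: "\<And>x. (k has_real_derivative (2 * h - c) * F x - 2 * h * k x + (h\<^sup>2 - Re (r\<^sup>2)) * u x) (at x)"
    and Mu: "\<And>x. \<bar>u x\<bar> \<le> M / w x" and Mk: "\<And>x. \<bar>k x\<bar> \<le> M / w x"
  shows "u x = response h r c F x"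
proof -
  let ?\<beta> = "of_real h + r - of_real c" and ?\<delta> = "of_real h + r" and ?\<gamma> = "of_real h - r"
  let ?R = "causal_resolvent ?\<delta> (\<lambda>t. of_real (F t))"
  define v where "v x = (of_real (k x) - ?\<gamma> * of_real (u x)) / ?\<beta>" for x
  have r2': "r\<^sup>2 = of_real (Re (r\<^sup>2))" using r2 by (simp add: complex_eq_iff)
  have nz': "?\<beta> \<noteq> 0" using nz by simp
  have du: "((\<lambda>x. of_real (u x)) has_vector_derivative of_real (F x - k x)) (at x)" for x
    using u[of x] unfolding has_real_derivative_iff_has_vector_derivative by (rule bounded_linear.has_vector_derivative[OF bounded_linear_of_real])
  have dk: "((\<lambda>x. of_real (k x)) has_vector_derivative
      of_real ((2 * h - c) * F x - 2 * h * k x + (h\<^sup>2 - Re (r\<^sup>2)) * u x)) (at x)" for x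
    using k[of x] unfolding has_real_derivative_iff_has_vector_derivative by (rule bounded_linear.has_vector_derivative[OF bounded_linear_of_real])
  have dv: "(v has_vector_derivative of_real (F x) - ?\<delta> * v x) (at x)" for x
  proof -
    have "(v has_vector_derivative (of_real ((2 * h - c) * F x - 2 * h * k x + (h\<^sup>2 - Re (r\<^sup>2)) * u x)
        - ?\<gamma> * of_real (F x - k x)) / ?\<beta>) (at x)"
      unfolding v_def
      by (intro has_vector_derivative_divide has_vector_derivative_diff has_vector_derivative_mult_right du dk)
    moreover have "of_real ((2 * h - c) * F x - 2 * h * k x + (h\<^sup>2 - Re (r\<^sup>2)) * u x) - ?\<gamma> * of_real (F x - k x)
        = ?\<beta> * of_real (F x) - ?\<delta> * (of_real (k x) - ?\<gamma> * of_real (u x))"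
      unfolding of_real_diff of_real_mult of_real_add of_real_power r2'[symmetric]
      by (simp add: algebra_simps power2_eq_square)
    moreover have "(?\<beta> * of_real (F x) - ?\<delta> * (of_real (k x) - ?\<gamma> * of_real (u x))) / ?\<beta>
        = of_real (F x) - ?\<delta> * v x"
      unfolding v_def diff_divide_distrib[of "?\<beta> * of_real (F x)"] times_divide_eq_right
      by (subst nonzero_mult_div_cancel_left[OF nz']) (rule refl)
    ultimately show ?thesis
      by (simp only:)
  qed
  have absw: "\<bar>u x\<bar> / 1 \<le> M / w x" for x using Mu by simp
  have bv: "norm (v x - ?R x) \<le> ((M + norm ?\<gamma> * M) / norm ?\<beta> + C / (h + Re r - b)) / w x" for x
  proof -
    have "norm (v x) \<le> (\<bar>k x\<bar> + norm ?\<gamma> * \<bar>u x\<bar>) / norm ?\<beta>"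
      unfolding v_def norm_divide
      by (intro divide_right_mono norm_triangle_le_diff) (auto simp: norm_mult)
    also have "\<dots> \<le> (M / w x + norm ?\<gamma> * (M / w x)) / norm ?\<beta>"
      by (intro divide_right_mono add_mono mult_left_mono Mu Mk) auto
    finally have "norm (v x) \<le> (M / w x + norm ?\<gamma> * (M / w x)) / norm ?\<beta>" .
    then have "norm (v x - ?R x) \<le> (M / w x + norm ?\<gamma> * (M / w x)) / norm ?\<beta> + C / ((h + Re r - b) * w x)"
      using outer.norm_le[of x] norm_triangle_ineq4[of "v x" "?R x"] by simp
    then show ?thesis by (simp add: add_divide_distrib mult.commute)
  qed
  have vR: "v x = ?R x" for x
    by (rule first_order_unique[OF weight _ dv outer.has_vector_derivative bv]) (use b_less in auto)
  have "of_real (u x) = complex_response h r c F x"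
    unfolding complex_response_def
  proof (rule first_order_unique[OF weight _ _ inner.has_vector_derivative])
    show "b < Re ?\<gamma>" using b_less by simp
    fix x
    have "inner_response h r c F x - ?\<gamma> * of_real (u x) = of_real (F x) - of_real (k x)"
      using nz' by (simp add: inner_response_def vR[symmetric] v_def)
    then show "((\<lambda>x. of_real (u x)) has_vector_derivative inner_response h r c F x - ?\<gamma> * of_real (u x)) (at x)"
      using du[of x] by simp
    show "norm (of_real (u x) - causal_resolvent ?\<gamma> (inner_response h r c F) x)
        \<le> (M + C * (1 + inner_const h r c b) / (h - Re r - b)) / w x"
      using inner.norm_le[of x] Mu[of x]
        norm_triangle_ineq4[of "of_real (u x)" "causal_resolvent ?\<gamma> (inner_response h r c F) x"]
      by (simp add: add_divide_distrib)
  qed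
  then show ?thesis by (metis response_def Re_complex_of_real)
qed

lemma isCont_response: "continuous_on UNIV (response h r c F)"
  using response_deriv by (auto simp: continuous_on_eq_continuous_at intro: DERIV_isCont)

end

lemma response_mult: "response h r c (\<lambda>x. s * F x) x = s * response h r c F x"
proof -
  have "inner_response h r c (\<lambda>x. s * F x) = (\<lambda>x. of_real s * inner_response h r c F x)"
    by (rule ext) (simp add: inner_response_def causal_resolvent_mult algebra_simps)
  then have "complex_response h r c (\<lambda>x. s * F x) x = of_real s * complex_response h r c F x"
    by (simp add: complex_response_def causal_resolvent_mult)
  then show ?thesis by (simp add: response_def)
qed

lemma response_add:
  assumes "damped h r b C w F" "damped h r b C' w' G"
  shows "response h r c (\<lambda>x. F x + G x) x = response h r c F x + response h r c G x"
proof -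
  interpret F: damped h r c b C w F by fact
  interpret G: damped h r c b C' w' G by fact
  have "inner_response h r c (\<lambda>x. F x + G x) = (\<lambda>x. inner_response h r c F x + inner_response h r c G x)"
    unfolding inner_response_def of_real_add
      causal_resolvent_add[OF F.outer.dominated_by_weight_axioms G.outer.dominated_by_weight_axioms]
    by (rule ext) (simp add: algebra_simps)
  then have "complex_response h r c (\<lambda>x. F x + G x) x = complex_response h r c F x + complex_response h r c G x"
    by (simp add: complex_response_def causal_resolvent_add[OF F.inner.dominated_by_weight_axioms G.inner.dominated_by_weight_axioms])
  then show ?thesis by (simp add: response_def)
qed

lemma response_diff:
  assumes "damped h r b C w F" "damped h r b C' w' G"
  shows "response h r c (\<lambda>x. F x - G x) x = response h r c F x - response h r c G x"
proof -
  interpret G: damped h r c b C' w' G by fact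
  have "damped h r b C' w' (\<lambda>x. - 1 * G x)"
    by standard (use G.weight G.b_less G.r2 G.boundF G.contF in \<open>auto intro!: continuous_intros\<close>)
  from response_add[OF assms(1) this, of c x] show ?thesis
    using response_mult[of h r c "-1" G x] by simp
qed

text \<open>By the resolvent identity the difference is the parameter difference times a composition
  of two resolvents, each of which costs a factor \<open>1 / e\<close>.\<close>

lemma norm_resolvent_diff_le:
  assumes f: "dominated_by_weight \<gamma> b C w f" and d: "b < Re \<delta>"
    and e: "e > 0" "e \<le> Re \<gamma> - b" "e \<le> Re \<delta> - b"
  shows "norm (causal_resolvent \<gamma> f x - causal_resolvent \<delta> f x) \<le> norm (\<gamma> - \<delta>) * (C / e\<^sup>2) / w x"
proof -
  interpret f: dominated_by_weight \<gamma> b C w f by fact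
  interpret f': dominated_by_weight \<delta> b C w f
    by standard (use f.weight d f.cont f.bound in auto)
  interpret h: dominated_by_weight \<gamma> b "C / (Re \<delta> - b)" w "causal_resolvent \<delta> f"
    by standard (use f.weight f.b_less f'.continuous_on_resolvent f'.norm_le in auto)
  have "norm (causal_resolvent \<gamma> (causal_resolvent \<delta> f) x) \<le> C / (Re \<delta> - b) / ((Re \<gamma> - b) * w x)"
    by (rule h.norm_le)
  also have "\<dots> = C / ((Re \<delta> - b) * (Re \<gamma> - b)) / w x" by simp
  also have "\<dots> \<le> C / e\<^sup>2 / w x"
    using e f.weight_pos[of x] f.C_nonneg
    by (intro divide_right_mono divide_left_mono) (auto simp: power2_eq_square intro!: mult_mono mult_pos_pos)
  finally have *: "norm (causal_resolvent \<gamma> (causal_resolvent \<delta> f) x) \<le> C / e\<^sup>2 / w x" .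
  have "norm (causal_resolvent \<gamma> f x - causal_resolvent \<delta> f x) = norm (\<delta> - \<gamma>) * norm (causal_resolvent \<gamma> (causal_resolvent \<delta> f) x)"
    by (simp add: resolvent_identity[OF f d] norm_mult)
  also have "\<dots> \<le> norm (\<delta> - \<gamma>) * (C / e\<^sup>2 / w x)" by (intro mult_left_mono *) auto
  finally show ?thesis by (simp add: norm_minus_commute)
qed

text \<open>Lipschitz dependence on the parameters with a constant that does not see the weight. It
  is used both for the continuity of the Evans function and for the norm continuity of a family of
  integral operators. The term \<open>norm (r - r')\<close> stays separate because the square root
  \<open>r\<close> is not Lipschitz in \<open>\<nu>\<close> where the discriminant changes
  sign.\<close>

lemma response_param_diff:
  fixes h h' c c' :: real and r r' :: complex
  assumes d: "damped h r b C w F" and d': "damped h' r' b C w F"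
    and e: "e > 0" "e \<le> h - Re r - b" "e \<le> h + Re r - b" "e \<le> h' - Re r' - b" "e \<le> h' + Re r' - b"
    and L: "norm (of_real h + r - of_real c) \<le> L" "norm (of_real h' + r' - of_real c') \<le> L"
  shows "\<bar>response h r c F x - response h' r' c' F x\<bar>
    \<le> C * (2 * (1 + L / e) / e\<^sup>2 * (\<bar>h - h'\<bar> + norm (r - r') + \<bar>c - c'\<bar>)) / w x"
proof -
  interpret d: damped h r c b C w F by fact
  interpret d': damped h' r' c' b C w F by fact
  define D where "D = \<bar>h - h'\<bar> + norm (r - r') + \<bar>c - c'\<bar>"
  have nh: "norm (of_real h - of_real h' :: complex) = \<bar>h - h'\<bar>" for h h'
    by (metis norm_of_real of_real_diff)
  have D0: "D \<ge> 0" and L0: "L \<ge> 0" using order_trans[OF norm_ge_zero L(1)] by (auto simp: D_def)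
  have C0: "C \<ge> 0" by (rule d.outer.C_nonneg)
  have wp: "w x > 0" for x by (rule d.outer.weight_pos)
  let ?R = "causal_resolvent (of_real h + r) (\<lambda>t. of_real (F t))"
  let ?R' = "causal_resolvent (of_real h' + r') (\<lambda>t. of_real (F t))"
  let ?\<beta> = "of_real h + r - of_real c" and ?\<beta>' = "of_real h' + r' - of_real c'"
  have R: "norm (?R x) \<le> C / e / w x" for x
  proof -
    have "norm (?R x) \<le> C / ((h + Re r - b) * w x)" using d.outer.norm_le[of x] by simp
    also have "\<dots> = C / (h + Re r - b) / w x" by simp
    also have "\<dots> \<le> C / e / w x"
      using e C0 wp[of x] by (intro divide_right_mono divide_left_mono) auto
    finally show ?thesis .
  qed
  have dR: "norm (?R x - ?R' x) \<le> D * (C / e\<^sup>2) / w x" for x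
  proof -
    have "norm (?R x - ?R' x) \<le> norm ((of_real h + r) - (of_real h' + r')) * (C / e\<^sup>2) / w x"
      using e d'.b_less by (intro norm_resolvent_diff_le[OF d.outer.dominated_by_weight_axioms]) auto
    also have "norm ((of_real h + r) - (of_real h' + r')) \<le> D"
      using norm_triangle_ineq[of "of_real h - of_real h'" "r - r'"] nh[of h h']
      by (simp add: D_def algebra_simps)
    finally show ?thesis using wp[of x] C0 e by (simp add: divide_right_mono mult_right_mono)
  qed
  have d\<beta>: "norm (?\<beta> - ?\<beta>') \<le> D"
    using norm_triangle_ineq[of "of_real h - of_real h'" "r - r'"] nh[of h h'] nh[of c c']
      norm_triangle_ineq4[of "of_real h - of_real h' + (r - r')" "of_real c - of_real c'"]
    by (simp add: D_def algebra_simps)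
  have dG: "norm (inner_response h r c F x - inner_response h' r' c' F x) \<le> C * ((1 / e + L / e\<^sup>2) * D) / w x" for x
  proof -
    have "inner_response h r c F x - inner_response h' r' c' F x = - ((?\<beta> - ?\<beta>') * ?R x + ?\<beta>' * (?R x - ?R' x))"
      unfolding inner_response_def by algebra
    then have "norm (inner_response h r c F x - inner_response h' r' c' F x)
        \<le> norm (?\<beta> - ?\<beta>') * norm (?R x) + norm ?\<beta>' * norm (?R x - ?R' x)"
      unfolding norm_mult[symmetric] by (simp only: norm_minus_cancel norm_triangle_ineq)
    also have "\<dots> \<le> D * (C / e / w x) + L * (D * (C / e\<^sup>2) / w x)"
      by (intro add_mono mult_mono d\<beta> R dR L) (use D0 L0 in auto)
    also have "\<dots> = C * ((1 / e + L / e\<^sup>2) * D) / w x" by (simp add: add_divide_distrib distrib_left distrib_right mult_ac)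
    finally show ?thesis .
  qed
  interpret dom: dominated_by_weight "of_real h' - r'" b "C * ((1 / e + L / e\<^sup>2) * D)" w
    "\<lambda>x. inner_response h r c F x - inner_response h' r' c' F x"
    by standard (use d.weight d'.b_less dG d.inner.cont d'.inner.cont in \<open>auto intro!: continuous_intros\<close>)
  interpret dom2: dominated_by_weight "of_real h' - r'" b "C * (1 + inner_const h r c b)" w "inner_response h r c F"
    by standard (use d.weight d'.b_less d.inner_bound d.inner.cont in auto)
  interpret dom3: dominated_by_weight "of_real h' - r'" b "C * (1 + inner_const h' r' c' b)" w "\<lambda>x. (-1) * inner_response h' r' c' F x"
    by standard (use d.weight d'.b_less d'.inner_bound d'.inner.cont in \<open>auto intro!: continuous_intros\<close>)
  have icl: "inner_const h r c b \<le> L / e"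
    unfolding inner_const_def using e L L0 by (intro frac_le) auto
  have icn: "inner_const h r c b \<ge> 0"
    unfolding inner_const_def using e by (intro divide_nonneg_nonneg) auto
  \<comment> \<open>A change of the outer kernel with fixed argument, plus a change of the argument
    under the new kernel; only the former requires the resolvent identity.\<close>
  have eq: "complex_response h r c F x - complex_response h' r' c' F x =
     (causal_resolvent (of_real h - r) (inner_response h r c F) x - causal_resolvent (of_real h' - r') (inner_response h r c F) x)
     + causal_resolvent (of_real h' - r') (\<lambda>x. inner_response h r c F x - inner_response h' r' c' F x) x"
    using causal_resolvent_add[OF dom2.dominated_by_weight_axioms dom3.dominated_by_weight_axioms, of x]
    by (simp add: complex_response_def causal_resolvent_mult[of _ "-1", simplified])
  have g1: "norm (causal_resolvent (of_real h - r) (inner_response h r c F) x - causal_resolvent (of_real h' - r') (inner_response h r c F) x)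
     \<le> D * (C * (1 + L / e) / e\<^sup>2) / w x"
  proof -
    have "norm (causal_resolvent (of_real h - r) (inner_response h r c F) x - causal_resolvent (of_real h' - r') (inner_response h r c F) x)
       \<le> norm ((of_real h - r) - (of_real h' - r')) * (C * (1 + inner_const h r c b) / e\<^sup>2) / w x"
      using e d'.b_less by (intro norm_resolvent_diff_le[OF d.inner.dominated_by_weight_axioms]) auto
    also have "\<dots> \<le> D * (C * (1 + L / e) / e\<^sup>2) / w x"
    proof (intro divide_right_mono mult_mono mult_left_mono add_left_mono icl)
      show "norm ((of_real h - r) - (of_real h' - r')) \<le> D"
        using norm_triangle_ineq4[of "of_real h - of_real h'" "r - r'"] nh[of h h']
        by (simp add: D_def algebra_simps)
      show "0 \<le> C * (1 + inner_const h r c b) / e\<^sup>2" using d.inner.C_nonneg by simp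
    qed (use D0 C0 wp[of x] icn in auto)
    finally show ?thesis .
  qed
  have g2: "norm (causal_resolvent (of_real h' - r') (\<lambda>x. inner_response h r c F x - inner_response h' r' c' F x) x)
     \<le> C * ((1 / e + L / e\<^sup>2) * D) / e / w x"
  proof -
    have "norm (causal_resolvent (of_real h' - r') (\<lambda>x. inner_response h r c F x - inner_response h' r' c' F x) x)
       \<le> C * ((1 / e + L / e\<^sup>2) * D) / ((h' - Re r' - b) * w x)" using dom.norm_le[of x] by simp
    also have "\<dots> = C * ((1 / e + L / e\<^sup>2) * D) / (h' - Re r' - b) / w x" by simp
    also have "\<dots> \<le> C * ((1 / e + L / e\<^sup>2) * D) / e / w x"
      using e C0 D0 L0 wp[of x] by (intro divide_right_mono divide_left_mono mult_nonneg_nonneg add_nonneg_nonneg) auto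
    finally show ?thesis .
  qed
  have "\<bar>response h r c F x - response h' r' c' F x\<bar> \<le> norm (complex_response h r c F x - complex_response h' r' c' F x)"
    using abs_Re_le_cmod[of "complex_response h r c F x - complex_response h' r' c' F x"] by (simp add: response_def)
  also have "\<dots> \<le> D * (C * (1 + L / e) / e\<^sup>2) / w x + C * ((1 / e + L / e\<^sup>2) * D) / e / w x"
    unfolding eq using g1 g2 by (rule norm_triangle_mono)
  also have "\<dots> = C * (2 * (1 + L / e) / e\<^sup>2 * D) / w x"
    using e(1) by (simp add: add_divide_distrib distrib_left distrib_right power2_eq_square mult_ac)
  finally show ?thesis by (simp add: D_def)
qed

section \<open>Causal and anticausal resolvents with a real parameter\<close>

definition fwd :: "real \<Rightarrow> (real \<Rightarrow> real) \<Rightarrow> real \<Rightarrow> real" where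
  "fwd \<nu> f x = Re (causal_resolvent (of_real \<nu>) (\<lambda>t. of_real (f t)) x)"

text \<open>The bounded inverse of \<open>\<nu> - d/dx\<close> integrates from
  \<open>+\<infinity>\<close>; reflection of the line reduces it to the causal case.\<close>

definition bwd :: "real \<Rightarrow> (real \<Rightarrow> real) \<Rightarrow> real \<Rightarrow> real" where
  "bwd \<nu> f x = fwd \<nu> (\<lambda>t. f (- t)) (- x)"

locale fwd_dominated =
  fixes \<nu> b C :: real and w f :: "real \<Rightarrow> real"
  assumes weight: "weight_growth b w" and b_less: "b < \<nu>"
    and cont: "continuous_on UNIV f" and bound: "\<And>x. \<bar>f x\<bar> \<le> C / w x"
begin

sublocale dom: dominated_by_weight "of_real \<nu>" b C w "\<lambda>t. of_real (f t)"
  by standard (use weight b_less bound cont in \<open>auto intro!: continuous_intros\<close>)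

lemma abs_fwd_le: "\<bar>fwd \<nu> f x\<bar> \<le> C / ((\<nu> - b) * w x)"
  using dom.norm_le[of x] abs_Re_le_cmod[of "causal_resolvent (of_real \<nu>) (\<lambda>t. of_real (f t)) x"]
  by (simp add: fwd_def)

lemma fwd_deriv: "(fwd \<nu> f has_real_derivative f x - \<nu> * fwd \<nu> f x) (at x)"
  using bounded_linear.has_vector_derivative[OF bounded_linear_Re dom.has_vector_derivative[of x]]
  by (simp add: fwd_def[abs_def] has_real_derivative_iff_has_vector_derivative)

lemma fwd_cont: "continuous_on UNIV (fwd \<nu> f)"
  using fwd_deriv by (auto simp: continuous_on_eq_continuous_at intro: DERIV_isCont)

lemma fwd_unique:
  assumes u: "\<And>x. (u has_real_derivative f x - \<nu> * u x) (at x)" and M: "\<And>x. \<bar>u x\<bar> \<le> M / w x"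
  shows "u x = fwd \<nu> f x"
proof -
  have "of_real (u x) = causal_resolvent (of_real \<nu>) (\<lambda>t. of_real (f t)) x"
  proof (rule first_order_unique[OF weight _ _ dom.has_vector_derivative])
    fix x
    show "((\<lambda>x. of_real (u x)) has_vector_derivative of_real (f x) - of_real \<nu> * of_real (u x)) (at x)"
      using bounded_linear.has_vector_derivative[OF bounded_linear_of_real u[of x, unfolded has_real_derivative_iff_has_vector_derivative]]
      by simp
    show "norm (of_real (u x) - causal_resolvent (of_real \<nu>) (\<lambda>t. of_real (f t)) x) \<le> (M + C / (\<nu> - b)) / w x"
      using dom.norm_le[of x] M[of x]
        norm_triangle_ineq4[of "of_real (u x)" "causal_resolvent (of_real \<nu>) (\<lambda>t. of_real (f t)) x"]
      by (simp add: add_divide_distrib)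
  qed (use b_less in auto)
  then show ?thesis by (metis fwd_def Re_complex_of_real)
qed

end

lemma fwd_mult: "fwd \<nu> (\<lambda>x. c * f x) x = c * fwd \<nu> f x"
  by (simp add: fwd_def causal_resolvent_mult)

lemma fwd_add:
  assumes "fwd_dominated \<nu> b C w f" "fwd_dominated \<nu> b' C' w' g"
  shows "fwd \<nu> (\<lambda>x. f x + g x) x = fwd \<nu> f x + fwd \<nu> g x"
proof -
  interpret f: fwd_dominated \<nu> b C w f by fact
  interpret g: fwd_dominated \<nu> b' C' w' g by fact
  show ?thesis
    by (simp add: fwd_def causal_resolvent_add[OF f.dom.dominated_by_weight_axioms g.dom.dominated_by_weight_axioms])
qed

lemma fwd_param_diff:
  assumes "fwd_dominated \<nu> b C w f" and e: "e > 0" "e \<le> \<nu> - b" "e \<le> \<nu>' - b"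
  shows "\<bar>fwd \<nu> f x - fwd \<nu>' f x\<bar> \<le> \<bar>\<nu> - \<nu>'\<bar> * (C / e\<^sup>2) / w x"
proof -
  interpret f: fwd_dominated \<nu> b C w f by fact
  have "norm (of_real \<nu> - of_real \<nu>' :: complex) = \<bar>\<nu> - \<nu>'\<bar>" by (metis norm_of_real of_real_diff)
  then show ?thesis
    using norm_resolvent_diff_le[OF f.dom.dominated_by_weight_axioms, of "of_real \<nu>'" e x] e
     abs_Re_le_cmod[of "causal_resolvent (of_real \<nu>) (\<lambda>t. of_real (f t)) x - causal_resolvent (of_real \<nu>') (\<lambda>t. of_real (f t)) x"]
    by (simp add: fwd_def)
qed

lemma bwd_deriv:
  assumes "fwd_dominated \<nu> b C w (\<lambda>t. f (- t))"
  shows "(bwd \<nu> f has_real_derivative \<nu> * bwd \<nu> f x - f x) (at x)"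
proof -
  interpret f: fwd_dominated \<nu> b C w "\<lambda>t. f (- t)" by fact
  have "((\<lambda>x. fwd \<nu> (\<lambda>t. f (- t)) (- x)) has_real_derivative
     (f (- (- x)) - \<nu> * fwd \<nu> (\<lambda>t. f (- t)) (- x)) * (- 1)) (at x)"
    by (rule DERIV_chain2[OF f.fwd_deriv]) (auto intro!: derivative_eq_intros)
  then show ?thesis by (simp add: bwd_def[abs_def] algebra_simps)
qed

lemma bwd_unique:
  assumes "fwd_dominated \<nu> b C w (\<lambda>t. f (- t))"
    and u: "\<And>x. (u has_real_derivative \<nu> * u x - f x) (at x)" and M: "\<And>x. \<bar>u x\<bar> \<le> M / w (- x)"
  shows "u x = bwd \<nu> f x"
proof -
  interpret f: fwd_dominated \<nu> b C w "\<lambda>t. f (- t)" by fact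
  have "u (- y) = fwd \<nu> (\<lambda>t. f (- t)) y" for y
  proof (rule f.fwd_unique)
    fix x show "((\<lambda>y. u (- y)) has_real_derivative f (- x) - \<nu> * u (- x)) (at x)"
      by (rule DERIV_cong[OF DERIV_chain2[OF u]]) (auto intro!: derivative_eq_intros)
    show "\<bar>u (- x)\<bar> \<le> M / w x" using M[of "- x"] by simp
  qed
  from this[of "- x"] show ?thesis by (simp add: bwd_def)
qed

section \<open>The constant coefficient problem\<close>

text \<open>The roots of \<open>X ^ 3 - X = \<nu> ^ 3 - \<nu>\<close> are \<open>\<nu>\<close> and \<open>- \<nu> / 2 \<plusminus> disc_root \<nu>\<close>; \<open>gap \<nu>\<close> is the distance of the
  latter two from the imaginary axis.\<close>

definition disc_root :: "real \<Rightarrow> complex" where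
  "disc_root \<nu> = Complex (sqrt (max 0 (1 - 3 * \<nu>\<^sup>2 / 4))) (sqrt (max 0 (3 * \<nu>\<^sup>2 / 4 - 1)))"

definition gap :: "real \<Rightarrow> real" where "gap \<nu> = \<nu> / 2 - Re (disc_root \<nu>)"

lemma disc_root_sq: "(disc_root \<nu>)\<^sup>2 = of_real (1 - 3 * \<nu>\<^sup>2 / 4)"
  by (auto simp: complex_eq_iff disc_root_def power2_eq_square max_def)

lemma Im_disc_root_sq: "Im ((disc_root \<nu>)\<^sup>2) = 0" and Re_disc_root_sq: "Re ((disc_root \<nu>)\<^sup>2) = 1 - 3 * \<nu>\<^sup>2 / 4"
  unfolding disc_root_sq by simp_all

lemma Re_disc_root_nonneg: "Re (disc_root \<nu>) \<ge> 0"
  by (simp add: disc_root_def)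

lemma norm_disc_root_le: assumes "\<nu> \<ge> 1" shows "norm (disc_root \<nu>) \<le> \<nu>"
proof (rule power2_le_imp_le)
  have "(norm (disc_root \<nu>))\<^sup>2 = \<bar>1 - 3 * \<nu>\<^sup>2 / 4\<bar>"
    using disc_root_sq[of \<nu>] by (metis norm_of_real norm_power)
  also have "\<dots> \<le> \<nu>\<^sup>2" using one_le_power[OF assms, of 2] by (simp add: abs_le_iff)
  finally show "(norm (disc_root \<nu>))\<^sup>2 \<le> \<nu>\<^sup>2" .
qed (use assms in simp)

text \<open>Writing both parts with \<open>max 0\<close> turns the passage from real to imaginary
  values, at \<open>\<nu>^2 = 4 / 3\<close>, into a single continuous formula. Nothing better than
  continuity may be expected there.\<close>

lemma continuous_on_disc_root: "continuous_on A disc_root"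
proof -
  have "continuous_on A (\<lambda>\<nu>. Complex (sqrt (max 0 (1 - 3 * \<nu>\<^sup>2 / 4))) (sqrt (max 0 (3 * \<nu>\<^sup>2 / 4 - 1))))"
    unfolding Complex_eq by (intro continuous_intros) auto
  then show ?thesis by (simp add: disc_root_def[abs_def])
qed

text \<open>For positive \<open>\<nu>\<close> the inequality
  \<open>1 - 3 * \<nu>^2 / 4 < \<nu>^2 / 4\<close> says precisely that \<open>\<nu> > 1\<close>. For
  these \<open>\<nu>\<close> two characteristic roots lie strictly to the left of the imaginary axis
  and one to the right.\<close>

lemma Re_disc_root_less: assumes "\<nu> > 1" shows "Re (disc_root \<nu>) < \<nu> / 2"
proof -
  have "\<nu>\<^sup>2 > 1" using assms by (simp add: power2_eq_square less_1_mult)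
  then have "sqrt (max 0 (1 - 3 * \<nu>\<^sup>2 / 4)) < sqrt ((\<nu> / 2)\<^sup>2)"
    by (intro real_sqrt_less_mono) (auto simp: power_divide max_def)
  then show ?thesis using assms by (simp add: disc_root_def)
qed

lemma gap_pos: "\<nu> > 1 \<Longrightarrow> gap \<nu> > 0"
  using Re_disc_root_less by (simp add: gap_def)

lemma gap_mono: assumes "0 \<le> \<nu>" "\<nu> \<le> \<nu>'" shows "gap \<nu> \<le> gap \<nu>'"
proof -
  have "\<nu>\<^sup>2 \<le> \<nu>'\<^sup>2" using assms by (intro power_mono) auto
  then have "Re (disc_root \<nu>') \<le> Re (disc_root \<nu>)" by (simp add: disc_root_def)
  then show ?thesis using assms by (simp add: gap_def)
qed

lemma gap_le: "gap \<nu> \<le> \<nu> / 2" using Re_disc_root_nonneg by (simp add: gap_def)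

lemma gap_eq: assumes "\<nu> \<ge> 2" shows "gap \<nu> = \<nu> / 2"
proof -
  have "\<nu>\<^sup>2 \<ge> 4" using power_mono[OF assms, of 2] by simp
  then show ?thesis by (simp add: gap_def disc_root_def)
qed

lemma weight_growth_exp_abs:
  assumes "a \<ge> 0" shows "weight_growth a (\<lambda>x. exp (a * \<bar>x\<bar>))"
  unfolding weight_growth_def
proof (intro conjI allI impI)
  fix x t :: real assume "t \<le> x"
  then have "a * \<bar>x\<bar> \<le> a * (x - t) + a * \<bar>t\<bar>"
    using assms by (simp add: distrib_left[symmetric] mult_left_mono)
  then show "exp (a * \<bar>x\<bar>) \<le> exp (a * (x - t)) * exp (a * \<bar>t\<bar>)"
    by (simp add: exp_add[symmetric])
qed simp

text \<open>With \<open>D = d/dx\<close> this is the multiplier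
  \<open>D / (\<nu>^3 - \<nu> - D^3 + D)\<close>. The denominator factors as
  \<open>(\<nu> - D) * (D^2 + \<nu> * D + \<nu>^2 - 1)\<close>: the root in the right half-plane
  requires the anticausal resolvent, the other two the causal one.\<close>

definition linT :: "real \<Rightarrow> (real \<Rightarrow> real) \<Rightarrow> real \<Rightarrow> real" where
  "linT \<nu> f = bwd \<nu> (response (\<nu> / 2) (disc_root \<nu>) 0 f)"

text \<open>The derivatives are written through the first-order equations of the factors instead of
  \<open>deriv\<close>, so that bounds on the factors give bounds on them.\<close>

definition linT' :: "real \<Rightarrow> (real \<Rightarrow> real) \<Rightarrow> real \<Rightarrow> real" where
  "linT' \<nu> f x = \<nu> * linT \<nu> f x - response (\<nu> / 2) (disc_root \<nu>) 0 f x"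

definition linT'' :: "real \<Rightarrow> (real \<Rightarrow> real) \<Rightarrow> real \<Rightarrow> real" where
  "linT'' \<nu> f x = \<nu> * linT' \<nu> f x - f x + coresponse (\<nu> / 2) (disc_root \<nu>) 0 f x"

locale lin_problem =
  fixes \<nu> a C :: real and f :: "real \<Rightarrow> real"
  assumes a0: "a \<ge> 0" and a_gap: "a < gap \<nu>" and nu: "\<nu> > 1"
    and contf: "continuous_on UNIV f" and boundf: "\<And>x. \<bar>f x\<bar> \<le> C / exp (a * \<bar>x\<bar>)"
begin

sublocale damped "\<nu> / 2" "disc_root \<nu>" 0 a C "\<lambda>x. exp (a * \<bar>x\<bar>)" f
  by standard (use weight_growth_exp_abs[OF a0] a_gap Re_disc_root_nonneg[of \<nu>] Im_disc_root_sq contf boundf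
      in \<open>auto simp: gap_def\<close>)

abbreviation "g \<equiv> response (\<nu> / 2) (disc_root \<nu>) 0 f"
abbreviation "k \<equiv> coresponse (\<nu> / 2) (disc_root \<nu>) 0 f"
abbreviation "rc \<equiv> response_const (\<nu> / 2) (disc_root \<nu>) 0 a"

lemma a_nu: "a < \<nu>" using a_gap gap_le[of \<nu>] nu by simp

lemma B_eq: "(\<nu> / 2)\<^sup>2 - Re ((disc_root \<nu>)\<^sup>2) = \<nu>\<^sup>2 - 1"
  by (simp add: Re_disc_root_sq power_divide)

lemma k_deriv: "(k has_real_derivative \<nu> * f x - \<nu> * k x + (\<nu>\<^sup>2 - 1) * g x) (at x)"
  using coresponse_deriv[of x] unfolding B_eq by simp

lemma g_cont: "continuous_on UNIV g" by (rule isCont_response)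

sublocale fw: fwd_dominated \<nu> a "C * rc" "\<lambda>x. exp (a * \<bar>x\<bar>)" "\<lambda>t. g (- t)"
proof
  show "continuous_on UNIV (\<lambda>t. g (- t))"
    by (intro continuous_on_compose2[OF g_cont] continuous_intros) auto
  show "\<bar>g (- x)\<bar> \<le> C * rc / exp (a * \<bar>x\<bar>)" for x
    using abs_response_le[of "- x"] by simp
qed (use weight a_nu in auto)

lemma linT_deriv: "(linT \<nu> f has_real_derivative linT' \<nu> f x) (at x)"
  using bwd_deriv[OF fw.fwd_dominated_axioms, of x] by (simp add: linT_def linT'_def)

lemma linT'_deriv: "(linT' \<nu> f has_real_derivative linT'' \<nu> f x) (at x)"
  unfolding linT'_def[abs_def] linT''_def
  by (rule derivative_eq_intros linT_deriv response_deriv refl)+ (simp add: linT'_def algebra_simps)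

text \<open>The forcing of the third-order equation is \<open>- f'\<close>. Leaving \<open>f\<close>
  under the derivative together with \<open>linT''\<close> gives the equation a classical meaning
  for continuous \<open>f\<close>.\<close>

lemma linT_ode: "((\<lambda>x. linT'' \<nu> f x + f x) has_real_derivative linT' \<nu> f x + (\<nu> ^ 3 - \<nu>) * linT \<nu> f x) (at x)"
proof -
  have "((\<lambda>x. \<nu> * linT' \<nu> f x + k x) has_real_derivative
      \<nu> * linT'' \<nu> f x + (\<nu> * f x - \<nu> * k x + (\<nu>\<^sup>2 - 1) * g x)) (at x)"
    by (rule derivative_eq_intros linT'_deriv k_deriv refl)+ simp
  moreover have "\<nu> * linT'' \<nu> f x + (\<nu> * f x - \<nu> * k x + (\<nu>\<^sup>2 - 1) * g x) = linT' \<nu> f x + (\<nu> ^ 3 - \<nu>) * linT \<nu> f x"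
    unfolding linT''_def linT'_def by (simp add: algebra_simps power2_eq_square power3_eq_cube)
  ultimately show ?thesis by (simp add: linT''_def)
qed

lemma abs_linT_le: "\<bar>linT \<nu> f x\<bar> \<le> C * (rc / (\<nu> - a)) / exp (a * \<bar>x\<bar>)"
  using fw.abs_fwd_le[of "- x"] by (simp add: linT_def bwd_def)

lemma abs_linT'_le: "\<bar>linT' \<nu> f x\<bar> \<le> C * (\<nu> * (rc / (\<nu> - a)) + rc) / exp (a * \<bar>x\<bar>)"
proof -
  have "\<bar>linT' \<nu> f x\<bar> \<le> \<nu> * \<bar>linT \<nu> f x\<bar> + \<bar>g x\<bar>"
    unfolding linT'_def using nu by (intro order_trans[OF abs_triangle_ineq4]) (simp add: abs_mult)
  also have "\<dots> \<le> \<nu> * (C * (rc / (\<nu> - a)) / exp (a * \<bar>x\<bar>)) + C * rc / exp (a * \<bar>x\<bar>)"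
    using nu by (intro add_mono mult_left_mono abs_linT_le abs_response_le) auto
  finally show ?thesis by (simp add: add_divide_distrib distrib_left mult_ac)
qed

text \<open>The third-order equation is presented as a first-order system with
  \<open>u = \<nu> * Z - Z'\<close> and \<open>q = f - u'\<close>. Uniqueness is applied to the
  causal pair \<open>(u, q)\<close> and afterwards, in the reflected direction, to
  \<open>Z\<close>.\<close>

lemma linT_unique:
  assumes Z: "\<And>x. (Z has_real_derivative \<nu> * Z x - u x) (at x)"
    and u: "\<And>x. (u has_real_derivative f x - q x) (at x)"
    and q: "\<And>x. (q has_real_derivative \<nu> * f x - \<nu> * q x + (\<nu>\<^sup>2 - 1) * u x) (at x)"
    and MZ: "\<And>x. \<bar>Z x\<bar> \<le> M / exp (a * \<bar>x\<bar>)" and Mu: "\<And>x. \<bar>u x\<bar> \<le> M / exp (a * \<bar>x\<bar>)"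
    and Mq: "\<And>x. \<bar>q x\<bar> \<le> M / exp (a * \<bar>x\<bar>)"
  shows "Z x = linT \<nu> f x"
proof -
  have nz: "of_real (\<nu> / 2) + disc_root \<nu> \<noteq> of_real 0"
    using nu Re_disc_root_nonneg[of \<nu>] by (auto simp: complex_eq_iff)
  have "u x = g x" for x
    by (rule response_unique[OF nz u _ Mu Mq]) (use q in \<open>simp add: B_eq[simplified]\<close>)
  then have "u = g" by auto
  then show ?thesis
    unfolding linT_def
    by (intro bwd_unique[OF fw.fwd_dominated_axioms]) (use Z MZ in auto)
qed

end

lemma linT_mult: "linT \<nu> (\<lambda>x. s * f x) x = s * linT \<nu> f x"
  unfolding linT_def bwd_def using fwd_mult[of \<nu> s] by (simp add: response_mult[abs_def])

lemma linT_add: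
  assumes "lin_problem \<nu> a C f" "lin_problem \<nu> a C' g"
  shows "linT \<nu> (\<lambda>x. f x + g x) x = linT \<nu> f x + linT \<nu> g x"
proof -
  interpret f: lin_problem \<nu> a C f by fact
  interpret g: lin_problem \<nu> a C' g by fact
  have "response (\<nu> / 2) (disc_root \<nu>) 0 (\<lambda>x. f x + g x) =
    (\<lambda>x. response (\<nu> / 2) (disc_root \<nu>) 0 f x + response (\<nu> / 2) (disc_root \<nu>) 0 g x)"
    by (rule ext) (rule response_add[OF f.damped_axioms g.damped_axioms])
  then show ?thesis
    by (simp add: linT_def bwd_def fwd_add[OF f.fw.fwd_dominated_axioms g.fw.fwd_dominated_axioms])
qed

text \<open>The factor \<open>3\<close> is \<open>1 + 2\<close>: one for changing the rate of the
  anticausal kernel and two for changing its argument, which is estimated by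
  \<open>response_param_diff\<close>. The additional kernel turns \<open>e^2\<close> into
  \<open>e^3\<close>.\<close>

lemma linT_param_diff:
  assumes p: "lin_problem \<nu> a C f" and p': "lin_problem \<nu>' a C f"
    and e: "e > 0" "e \<le> gap \<nu> - a" "e \<le> gap \<nu>' - a" and L: "2 * \<nu> \<le> L" "2 * \<nu>' \<le> L"
  shows "\<bar>linT \<nu> f x - linT \<nu>' f x\<bar>
    \<le> C * (3 * (1 + L / e) / e ^ 3 * (\<bar>\<nu> - \<nu>'\<bar> + norm (disc_root \<nu> - disc_root \<nu>'))) / exp (a * \<bar>x\<bar>)"
proof -
  interpret p: lin_problem \<nu> a C f by fact
  interpret p': lin_problem \<nu>' a C f by fact
  define D where "D = \<bar>\<nu> - \<nu>'\<bar> + norm (disc_root \<nu> - disc_root \<nu>')"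
  have D0: "D \<ge> 0" by (simp add: D_def)
  have C0: "C \<ge> 0" by (rule p.outer.C_nonneg)
  have L0: "L \<ge> 0" using L p.nu by simp
  have n: "norm (of_real (\<nu> / 2) + disc_root \<nu>) \<le> L" if "\<nu> > 1" "2 * \<nu> \<le> L" for \<nu>
    using norm_triangle_ineq[of "of_real (\<nu> / 2)" "disc_root \<nu>"] norm_disc_root_le[of \<nu>] that
    by (simp add: norm_divide)
  have rd: "\<bar>p.g x - p'.g x\<bar> \<le> C * (2 * (1 + L / e) / e\<^sup>2 * D) / exp (a * \<bar>x\<bar>)" for x
  proof -
    have "\<bar>p.g x - p'.g x\<bar> \<le> C * (2 * (1 + L / e) / e\<^sup>2 *
       (\<bar>\<nu> / 2 - \<nu>' / 2\<bar> + norm (disc_root \<nu> - disc_root \<nu>') + \<bar>0 - 0\<bar>)) / exp (a * \<bar>x\<bar>)"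
      using e Re_disc_root_nonneg[of \<nu>] Re_disc_root_nonneg[of \<nu>'] n[OF p.nu L(1)] n[OF p'.nu L(2)]
      by (intro response_param_diff[OF p.damped_axioms p'.damped_axioms]) (auto simp: gap_def)
    also have "\<dots> \<le> C * (2 * (1 + L / e) / e\<^sup>2 * D) / exp (a * \<bar>x\<bar>)"
      using C0 L0 e unfolding D_def
      by (intro divide_right_mono mult_left_mono) (auto simp: abs_if field_simps)
    finally show ?thesis .
  qed
  have e\<nu>: "e \<le> \<nu> - a" "e \<le> \<nu>' - a" using e gap_le[of \<nu>] gap_le[of \<nu>'] p.nu p'.nu by auto
  interpret d: fwd_dominated \<nu>' a "C * (2 * (1 + L / e) / e\<^sup>2 * D)" "\<lambda>x. exp (a * \<bar>x\<bar>)" "\<lambda>t. p.g (- t) - p'.g (- t)"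
  proof
    show "continuous_on UNIV (\<lambda>t. p.g (- t) - p'.g (- t))"
      by (intro continuous_intros continuous_on_compose2[OF p.g_cont] continuous_on_compose2[OF p'.g_cont]) auto
    show "\<bar>p.g (- x) - p'.g (- x)\<bar> \<le> C * (2 * (1 + L / e) / e\<^sup>2 * D) / exp (a * \<bar>x\<bar>)" for x
      using rd[of "- x"] by simp
  qed (use p.weight p'.a_nu in auto)
  have "fwd_dominated \<nu>' a (C * p.rc) (\<lambda>x. exp (a * \<bar>x\<bar>)) (\<lambda>t. p.g (- t))"
    using p.fw.fwd_dominated_axioms p'.a_nu by (simp add: fwd_dominated_def)
  moreover have "fwd_dominated \<nu>' a (C * p'.rc) (\<lambda>x. exp (a * \<bar>x\<bar>)) (\<lambda>t. - 1 * p'.g (- t))"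
    using p'.fw.fwd_dominated_axioms unfolding fwd_dominated_def by (auto intro!: continuous_intros)
  ultimately have "fwd \<nu>' (\<lambda>t. p.g (- t) + - 1 * p'.g (- t)) y = fwd \<nu>' (\<lambda>t. p.g (- t)) y + fwd \<nu>' (\<lambda>t. - 1 * p'.g (- t)) y" for y
    by (rule fwd_add)
  then have s: "fwd \<nu>' (\<lambda>t. p.g (- t) - p'.g (- t)) y = fwd \<nu>' (\<lambda>t. p.g (- t)) y - fwd \<nu>' (\<lambda>t. p'.g (- t)) y" for y
    unfolding fwd_mult by simp
  have rcL: "p.rc \<le> (1 + L / e) / e"
    unfolding response_const_def inner_const_def
    using e L0 Re_disc_root_nonneg[of \<nu>] n[OF p.nu L(1)]
    by (intro frac_le add_left_mono add_nonneg_nonneg) (auto simp: gap_def)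
  have "\<bar>linT \<nu> f x - linT \<nu>' f x\<bar> \<le> \<bar>fwd \<nu> (\<lambda>t. p.g (- t)) (- x) - fwd \<nu>' (\<lambda>t. p.g (- t)) (- x)\<bar>
     + \<bar>fwd \<nu>' (\<lambda>t. p.g (- t) - p'.g (- t)) (- x)\<bar>"
    unfolding s by (simp add: linT_def bwd_def)
  also have "\<dots> \<le> \<bar>\<nu> - \<nu>'\<bar> * (C * p.rc / e\<^sup>2) / exp (a * \<bar>- x\<bar>)
      + C * (2 * (1 + L / e) / e\<^sup>2 * D) / ((\<nu>' - a) * exp (a * \<bar>- x\<bar>))"
    by (intro add_mono fwd_param_diff[OF p.fw.fwd_dominated_axioms] d.abs_fwd_le e e\<nu>)
  also have "\<dots> \<le> D * (C * ((1 + L / e) / e) / e\<^sup>2) / exp (a * \<bar>x\<bar>)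
      + C * (2 * (1 + L / e) / e\<^sup>2 * D) / e / exp (a * \<bar>x\<bar>)"
  proof (rule add_mono)
    have rc0: "0 \<le> C * p.rc"
      using p.fw.dom.C_nonneg .
    show "\<bar>\<nu> - \<nu>'\<bar> * (C * p.rc / e\<^sup>2) / exp (a * \<bar>- x\<bar>) \<le> D * (C * ((1 + L / e) / e) / e\<^sup>2) / exp (a * \<bar>x\<bar>)"
      unfolding abs_minus_cancel
      using C0 D0 rcL rc0 by (intro divide_right_mono mult_mono mult_left_mono divide_nonneg_nonneg) (auto simp: D_def)
    have "C * (2 * (1 + L / e) / e\<^sup>2 * D) / ((\<nu>' - a) * exp (a * \<bar>- x\<bar>)) = C * (2 * (1 + L / e) / e\<^sup>2 * D) / (\<nu>' - a) / exp (a * \<bar>x\<bar>)"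
      by simp
    also have "\<dots> \<le> C * (2 * (1 + L / e) / e\<^sup>2 * D) / e / exp (a * \<bar>x\<bar>)"
      using e e\<nu> C0 D0 L0 by (intro divide_right_mono divide_left_mono mult_nonneg_nonneg) auto
    finally show "C * (2 * (1 + L / e) / e\<^sup>2 * D) / ((\<nu>' - a) * exp (a * \<bar>- x\<bar>)) \<le> \<dots>" .
  qed
  also have "\<dots> = C * (3 * (1 + L / e) / e ^ 3 * D) / exp (a * \<bar>x\<bar>)"
  proof -
    have "D * (C * ((1 + L / e) / e) / e\<^sup>2) = 1 * (C * ((1 + L / e) / e ^ 3 * D))"
      and "C * (2 * (1 + L / e) / e\<^sup>2 * D) / e = 2 * (C * ((1 + L / e) / e ^ 3 * D))"
      by (simp_all add: power2_eq_square power3_eq_cube mult_ac)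
    then show ?thesis by (simp only: add_divide_distrib[symmetric] distrib_right[symmetric]) simp
  qed
  finally show ?thesis by (simp add: D_def)
qed

section \<open>The Evans function\<close>

locale soliton =
  fixes p :: nat
  assumes p5: "p > 5"
begin

abbreviation "n \<equiv> real p - 1"
definition "th x = tanh (n / 2 * x)"
definition "Q1 x = - th x * Q p x"
definition "Q2 x = Q p x - Q p x ^ p"
definition "q x = real p * Q p x ^ (p - 1)"

lemma n5: "n \<ge> 5" using p5 by simp

lemma n_eq: "real (p - 1) = n" using p5 by simp

lemma Q_pos: "Q p x > 0"
  using p5 cosh_real_pos[of "n / 2 * x"] by (simp add: Q_def)

lemma Q_power: "Q p x ^ (p - 1) = (real p + 1) / (2 * (cosh (n / 2 * x))\<^sup>2)"
proof -
  have "Q p x ^ (p - 1) = Q p x powr n"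
    using Q_pos[of x] p5 by (simp add: powr_realpow[symmetric] n_eq)
  also have "\<dots> = (real p + 1) / (2 * (cosh (n / 2 * x))\<^sup>2)"
    using n5 cosh_real_pos[of "n / 2 * x"] by (simp add: Q_def powr_powr)
  finally show ?thesis .
qed

lemma sech_sq: "1 / (cosh (n / 2 * x))\<^sup>2 = 1 - (th x)\<^sup>2"
proof -
  have "(th x)\<^sup>2 = (sinh (n / 2 * x))\<^sup>2 / (cosh (n / 2 * x))\<^sup>2"
    unfolding th_def tanh_def power_divide ..
  moreover have "(cosh (n / 2 * x))\<^sup>2 \<noteq> 0" using cosh_real_pos[of "n / 2 * x"] by simp
  ultimately show ?thesis
    by (simp add: cosh_square_eq divide_simps left_diff_distrib)
qed

text \<open>Together with \<open>Q' = - th * Q\<close> this turns identities between the soliton,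
  its derivatives and the potential into polynomial identities in \<open>th\<close>.\<close>

lemma Q_power_th: "Q p x ^ (p - 1) = (real p + 1) / 2 * (1 - (th x)\<^sup>2)"
  unfolding Q_power sech_sq[symmetric] by simp

lemma q_th: "q x = real p * (real p + 1) / 2 * (1 - (th x)\<^sup>2)"
  unfolding q_def Q_power_th by simp

lemma th_bound: "\<bar>th x\<bar> < 1"
  using tanh_real_bounds[of "n / 2 * x"] by (auto simp: th_def abs_if)

lemma th_deriv: "(th has_real_derivative n / 2 * (1 - (th x)\<^sup>2)) (at x)"
  unfolding th_def[abs_def]
  by (rule derivative_eq_intros refl | simp)+

lemma Q_deriv: "(Q p has_real_derivative Q1 x) (at x)"
proof -
  have c: "cosh (n / 2 * x) > 0" by (rule cosh_real_pos)
  have b: "(real p + 1) / (2 * (cosh (n / 2 * x))\<^sup>2) > 0" using c p5 by simp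
  define A where "A x = (real p + 1) / (2 * (cosh (n / 2 * x))\<^sup>2)" for x
  have A: "A x = (real p + 1) / 2 * (1 - (th x)\<^sup>2)" for x
    unfolding A_def sech_sq[symmetric] by simp
  have "(A has_real_derivative - n * th x * A x) (at x)"
    unfolding A[abs_def]
    by (rule derivative_eq_intros th_deriv refl)+ (simp add: field_simps power2_eq_square)
  then have "((\<lambda>x. A x powr (1 / n)) has_real_derivative (1 / n) * A x powr (1 / n - 1) * (- n * th x * A x)) (at x)"
    using DERIV_fun_powr[of A "- n * th x * A x" x "1 / n"] b[folded A_def] by simp
  moreover have "(1 / n) * A x powr (1 / n - 1) * (- n * th x * A x) = Q1 x"
  proof -
    have "A x powr (1 / n - 1) * A x = A x powr (1 / n)"
      using b by (simp add: A_def powr_diff)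
    then have "(1 / n) * A x powr (1 / n - 1) * (- n * th x * A x) = (1 / n) * (- n * th x) * A x powr (1 / n)"
      by (simp add: mult_ac)
    also have "\<dots> = - th x * A x powr (1 / n)" using n5 by (simp add: field_simps)
    also have "\<dots> = Q1 x" by (simp add: Q1_def Q_def A_def)
    finally show ?thesis .
  qed
  ultimately show ?thesis by (simp add: Q_def[abs_def] A_def)
qed

lemma Q_pow_Suc: "Q p x ^ p = Q p x ^ (p - 1) * Q p x"
  using p5 by (cases p) auto

lemma Q1_deriv: "(Q1 has_real_derivative Q2 x) (at x)"
proof -
  have "(Q1 has_real_derivative - (n / 2 * (1 - (th x)\<^sup>2)) * Q p x + - th x * Q1 x) (at x)"
    unfolding Q1_def[abs_def] by (rule derivative_eq_intros th_deriv Q_deriv refl)+ (simp add: Q1_def)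
  moreover have "- (n / 2 * (1 - (th x)\<^sup>2)) * Q p x + - th x * Q1 x = Q2 x"
    unfolding Q2_def Q_pow_Suc Q_power_th Q1_def by (simp add: field_simps power2_eq_square)
  ultimately show ?thesis by simp
qed

lemma Q2_deriv: "(Q2 has_real_derivative (1 - q x) * Q1 x) (at x)"
  unfolding Q2_def[abs_def]
  by (rule derivative_eq_intros Q_deriv refl)+ (simp add: q_def algebra_simps)

lemma Q_even: "Q p (- x) = Q p x" by (simp add: Q_def)

lemma q_even: "q (- x) = q x" by (simp add: q_def Q_even)

lemma q_pos: "q x > 0" using Q_pos p5 by (simp add: q_def)

lemma cosh_bounds: "exp \<bar>y\<bar> / 2 \<le> cosh y" "cosh y \<le> exp \<bar>y\<bar>" for y :: real
  by (auto simp: cosh_def abs_if)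

lemma Q_power_bounds: "exp (- \<bar>x\<bar>) ^ (p - 1) \<le> Q p x ^ (p - 1)" "Q p x ^ (p - 1) \<le> 2 * (real p + 1) * exp (- \<bar>x\<bar>) ^ (p - 1)"
proof -
  have e: "exp (- \<bar>x\<bar>) ^ (p - 1) = 1 / (exp \<bar>n / 2 * x\<bar>)\<^sup>2"
  proof -
    have "exp (- \<bar>x\<bar>) ^ (p - 1) = exp (- (n * \<bar>x\<bar>))"
      using exp_of_nat_mult[of "p - 1" "- \<bar>x\<bar>"] unfolding n_eq by simp
    moreover have "(exp \<bar>n / 2 * x\<bar>)\<^sup>2 = exp (n * \<bar>x\<bar>)"
      using n5 by (simp add: power2_eq_square exp_add[symmetric] abs_mult)
    ultimately show ?thesis by (simp add: exp_minus inverse_eq_divide)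
  qed
  have "1 / (exp \<bar>n / 2 * x\<bar>)\<^sup>2 \<le> 1 / (cosh (n / 2 * x))\<^sup>2"
    using cosh_bounds[of "n / 2 * x"] cosh_real_pos[of "n / 2 * x"]
    by (intro divide_left_mono power_mono) auto
  also have "\<dots> \<le> (real p + 1) / 2 * (1 / (cosh (n / 2 * x))\<^sup>2)"
    using p5 by (simp add: divide_simps)
  finally show "exp (- \<bar>x\<bar>) ^ (p - 1) \<le> Q p x ^ (p - 1)"
    unfolding e Q_power by simp
  have "1 / (cosh (n / 2 * x))\<^sup>2 \<le> 1 / (exp \<bar>n / 2 * x\<bar> / 2)\<^sup>2"
    using cosh_bounds[of "n / 2 * x"] by (intro divide_left_mono power_mono) auto
  then have "(real p + 1) / 2 * (1 / (cosh (n / 2 * x))\<^sup>2) \<le> (real p + 1) / 2 * (1 / (exp \<bar>n / 2 * x\<bar> / 2)\<^sup>2)"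
    by (intro mult_left_mono) auto
  then show "Q p x ^ (p - 1) \<le> 2 * (real p + 1) * exp (- \<bar>x\<bar>) ^ (p - 1)"
    unfolding e Q_power by (simp add: power_divide field_simps)
qed

lemma Q_lower: "exp (- \<bar>x\<bar>) \<le> Q p x"
  using power_mono_iff[of "exp (- \<bar>x\<bar>)" "Q p x" "p - 1"] Q_power_bounds(1)[of x] Q_pos[of x] p5 by simp

abbreviation "CQ \<equiv> 2 * (real p + 1)"

lemma Q_upper: "Q p x \<le> CQ * exp (- \<bar>x\<bar>)"
proof -
  have "Q p x ^ (p - 1) \<le> CQ ^ 1 * exp (- \<bar>x\<bar>) ^ (p - 1)" using Q_power_bounds(2)[of x] by simp
  also have "\<dots> \<le> CQ ^ (p - 1) * exp (- \<bar>x\<bar>) ^ (p - 1)"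
    using p5 by (intro mult_right_mono power_increasing) auto
  finally have "Q p x ^ (p - 1) \<le> (CQ * exp (- \<bar>x\<bar>)) ^ (p - 1)" by (simp only: power_mult_distrib)
  then show ?thesis
    using power_mono_iff[of "Q p x" "CQ * exp (- \<bar>x\<bar>)" "p - 1"] Q_pos[of x] p5 by simp
qed

lemma Q1_bound: "\<bar>Q1 x\<bar> \<le> Q p x"
  using th_bound[of x] Q_pos[of x] by (simp add: Q1_def abs_mult)

lemma q_bound_n: "q x \<le> real p * CQ * exp (- \<bar>x\<bar>) ^ (p - 1)"
  using mult_left_mono[OF Q_power_bounds(2)[of x], of "real p"] unfolding q_def by (simp only: mult.assoc of_nat_0_le_iff)

lemma exp_pow_le: "exp (- \<bar>x\<bar>) ^ (p - 1) \<le> exp (- \<bar>x\<bar>)" for x :: real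
  using power_decreasing[of 1 "p - 1" "exp (- \<bar>x\<bar>)"] p5 by simp

lemma q_bound: "q x \<le> real p * CQ * exp (- \<bar>x\<bar>)"
  by (rule order_trans[OF q_bound_n mult_left_mono[OF exp_pow_le]]) simp

lemma q_le: "q x \<le> real p * CQ"
  by (rule order_trans[OF q_bound mult_right_le_one_le]) auto

lemma Q_le: "Q p x \<le> CQ"
  by (rule order_trans[OF Q_upper mult_right_le_one_le]) auto

lemma Q2_eq: "Q2 x = Q p x * (1 - q x / real p)"
  unfolding Q2_def Q_pow_Suc q_def using p5 by (simp add: field_simps)

lemma Q2_bound: "\<bar>Q2 x\<bar> \<le> CQ * Q p x"
proof -
  have "\<bar>1 - q x / real p\<bar> \<le> CQ"
    using q_le[of x] q_pos[of x] p5 by (auto simp: abs_le_iff field_simps)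
  then show ?thesis unfolding Q2_eq abs_mult using Q_pos[of x] by (simp add: mult.commute)
qed

lemma cont_Q: "continuous_on A (Q p)"
  using Q_deriv Q1_deriv Q2_deriv DERIV_isCont by (blast intro: continuous_at_imp_continuous_on)+

lemma cont_q: "continuous_on A q"
  unfolding q_def[abs_def] by (intro continuous_intros cont_Q)

text \<open>The integral of the potential from \<open>-\<infinity>\<close> to \<open>x\<close>, with
  \<open>Phi_max\<close> the integral over the line. It acts as the clock in the Gronwall-type
  weight \<open>exp (4 * Phi)\<close>.\<close>

definition "Phi x = real p * (real p + 1) / n * (1 + th x)"
definition "Phi_max = 2 * real p * (real p + 1) / n"

lemma Phi_deriv: "(Phi has_real_derivative q x) (at x)"
  unfolding Phi_def[abs_def] q_th
  by (rule derivative_eq_intros th_deriv refl)+ (use n5 in \<open>simp add: field_simps\<close>)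

lemma Phi_bounds: "0 \<le> Phi x" "Phi x \<le> Phi_max"
proof -
  show "0 \<le> Phi x" using th_bound[of x] n5 by (simp add: Phi_def)
  have "real p * (real p + 1) / n * (1 + th x) \<le> real p * (real p + 1) / n * 2"
    using th_bound[of x] n5 by (intro mult_left_mono) auto
  then show "Phi x \<le> Phi_max" by (simp add: Phi_def Phi_max_def)
qed

lemma Phi_max_pos: "Phi_max > 0" using p5 by (simp add: Phi_max_def)

lemma Phi_tendsto: "(Phi \<longlongrightarrow> Phi_max) at_top"
proof -
  have "filterlim (\<lambda>x. n / 2 * x) at_top at_top"
    using n5 by (intro filterlim_tendsto_pos_mult_at_top[OF tendsto_const _ filterlim_ident]) auto
  then have "(th \<longlongrightarrow> 1) at_top"
    unfolding th_def[abs_def] by (rule filterlim_compose[OF tanh_real_at_top])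
  then have "(Phi \<longlongrightarrow> real p * (real p + 1) / n * (1 + 1)) at_top"
    unfolding Phi_def[abs_def] by (intro tendsto_intros)
  then show ?thesis by (simp add: Phi_max_def mult_ac)
qed

lemma cont_Phi: "continuous_on A Phi"
  using Phi_deriv DERIV_isCont by (blast intro: continuous_at_imp_continuous_on)

text \<open>The amplitude of the tail, \<open>Q p x \<approx> cQ * exp (- \<bar>x\<bar>)\<close>.
  Accordingly \<open>ell\<close> is the soliton without its exponential factor, normalised to the
  limit \<open>1\<close> at \<open>-\<infinity>\<close>.\<close>

definition "cQ = (2 * (real p + 1)) powr (1 / n)"
definition "ell x = exp (- x) * Q p x / cQ"

lemma cQ_pos: "cQ > 0" using p5 by (simp add: cQ_def)

lemma ell_eq: "ell x = (1 + exp (n * x)) powr (- 2 / n)"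
proof -
  have c: "cosh (n / 2 * x) > 0" by (rule cosh_real_pos)
  have e: "exp (n / 2 * x) * exp (n / 2 * x) = exp (n * x)"
  proof -
    have "n * x = n / 2 * x + n / 2 * x" by simp
    then show ?thesis by (metis exp_add)
  qed
  have ch: "2 * cosh (n / 2 * x) * exp (n / 2 * x) = 1 + exp (n * x)"
  proof -
    define E where "E = exp (n / 2 * x)"
    have "E > 0" by (simp add: E_def)
    then have "2 * ((E + inverse E) / 2) * E = 1 + E * E" by (simp add: field_simps)
    then show ?thesis
      unfolding E_def e by (simp add: cosh_field_def exp_minus)
  qed
  have "(real p + 1) / (2 * (cosh (n / 2 * x))\<^sup>2) = 2 * (real p + 1) * exp (n * x) / (2 * cosh (n / 2 * x) * exp (n / 2 * x))\<^sup>2"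
  proof -
    define K E where "K = cosh (n / 2 * x)" and "E = exp (n / 2 * x)"
    have "K > 0" "E > 0" using c by (simp_all add: K_def E_def)
    then have "(real p + 1) / (2 * K\<^sup>2) = 2 * (real p + 1) * (E * E) / (2 * K * E)\<^sup>2"
      by (simp add: field_simps power2_eq_square)
    then show ?thesis unfolding K_def E_def e .
  qed
  also have "(2 * cosh (n / 2 * x) * exp (n / 2 * x))\<^sup>2 = (1 + exp (n * x)) powr 2"
    unfolding ch by (rule powr_numeral[symmetric]) (simp add: add_nonneg_nonneg)
  finally have "Q p x = (2 * (real p + 1) * exp (n * x) * (1 + exp (n * x)) powr - 2) powr (1 / n)"
    unfolding Q_def powr_minus divide_inverse[symmetric] by (simp only:)
  also have "\<dots> = cQ * exp (n * x) powr (1 / n) * ((1 + exp (n * x)) powr - 2) powr (1 / n)"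
    using p5 by (simp add: powr_mult cQ_def)
  also have "exp (n * x) powr (1 / n) = exp x" using n5 by (simp add: powr_def)
  also have "((1 + exp (n * x)) powr - 2) powr (1 / n) = (1 + exp (n * x)) powr (- 2 / n)"
    by (simp add: powr_powr)
  finally show ?thesis using cQ_pos by (simp add: ell_def exp_minus field_simps)
qed

lemma ell_bounds: "0 < ell x" "ell x \<le> 1" "1 - ell x \<le> exp (n * x)"
proof -
  show "0 < ell x" using Q_pos cQ_pos by (simp add: ell_def)
  have "(1 + exp (n * x)) powr (- 2 / n) \<le> (1 + exp (n * x)) powr 0"
    using n5 by (intro powr_mono) auto
  moreover have "1 + exp (n * x) \<noteq> 0" using exp_gt_zero[of "n * x"] by linarith
  ultimately show "ell x \<le> 1" unfolding ell_eq by simp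
  have "(1 + exp (n * x)) powr (- 1) \<le> (1 + exp (n * x)) powr (- 2 / n)"
    using n5 by (intro powr_mono) (auto simp: field_simps)
  moreover have "(1 + exp (n * x)) powr (- 1) \<ge> 1 - exp (n * x)"
    by (simp add: powr_minus add_pos_pos divide_simps algebra_simps)
  ultimately show "1 - ell x \<le> exp (n * x)" unfolding ell_eq by linarith
qed

lemma exp_n_le: "x \<le> 0 \<Longrightarrow> exp (n * x) \<le> exp x"
  using mult_right_mono_neg[of 1 n x] n5 by simp

lemma th_lower: "1 + th x \<le> 2 * exp (n * x)"
proof -
  have "1 + th x = 2 * (1 - 1 / (1 + exp (n * x)))"
  proof -
    have "th x = (exp (n / 2 * x) - exp (- (n / 2 * x))) / (exp (n / 2 * x) + exp (- (n / 2 * x)))"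
      unfolding th_def tanh_altdef ..
    also have "\<dots> = (exp (n * x) - 1) / (exp (n * x) + 1)"
    proof -
      define E where "E = exp (n / 2 * x)"
      have E: "E > 0" "exp (- (n / 2 * x)) = 1 / E" "exp (n * x) = E * E"
        by (simp_all add: E_def exp_minus inverse_eq_divide exp_add[symmetric])
      show ?thesis unfolding E E_def[symmetric] using E(1)
        by (simp add: divide_simps add_pos_pos) 
    qed
    finally have "th x = (exp (n * x) - 1) / (exp (n * x) + 1)" .
    moreover have "exp (n * x) + 1 \<noteq> 0" using exp_gt_zero[of "n * x"] by linarith
    ultimately show ?thesis by (simp add: divide_simps add.commute distrib_right)
  qed
  also have "\<dots> \<le> 2 * exp (n * x)"
  proof -
    define E where "E = exp (n * x)"
    have "E > 0" by (simp add: E_def)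
    then have "1 - 1 / (1 + E) \<le> E" by (simp add: divide_simps)
    then show ?thesis by (simp add: E_def)
  qed
  finally show ?thesis .
qed

end

text \<open>A comparison principle that stands in for integration over a half-line. The bound by
  \<open>- K * exp x\<close> excludes a negative limit at \<open>-\<infinity>\<close>; since
  \<open>K\<close> does not enter the conclusion, a crude a priori bound is good enough.\<close>

lemma nonneg_if_nondecreasing_from_bot:
  fixes h :: "real \<Rightarrow> real"
  assumes d: "\<And>x. (h has_real_derivative h' x) (at x)" and h': "\<And>x. h' x \<ge> 0" and K: "\<And>x. h x \<ge> - K * exp x"
  shows "h x \<ge> 0"
proof (rule ccontr)
  assume "\<not> h x \<ge> 0"
  then have neg: "h x < 0" by simp
  have le: "h y \<le> h x" if "y \<le> x" for y
    using DERIV_nonneg_imp_nondecreasing[OF that, of h] d h' by blast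
  have "((\<lambda>y. - K * exp y) \<longlongrightarrow> - K * 0) at_bot"
    by (intro tendsto_intros exp_at_bot)
  then have "\<forall>\<^sub>F y in at_bot. - K * exp y > h x"
    using neg by (intro order_tendstoD(1)) auto
  then have "\<forall>\<^sub>F y in at_bot. - K * exp y > h x \<and> y \<le> x"
    by (intro eventually_conj eventually_le_at_bot)
  then obtain y where "- K * exp y > h x" "y \<le> x"
    by (metis (mono_tags, lifting) eventually_happens trivial_limit_at_bot_linorder)
  with le[of y] K[of y] show False by linarith
qed

lemma nonneg_if_nonincreasing_to_top:
  fixes h :: "real \<Rightarrow> real"
  assumes d: "\<And>y. y \<ge> x \<Longrightarrow> (h has_real_derivative h' y) (at y)" and h': "\<And>y. y \<ge> x \<Longrightarrow> h' y \<le> 0"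
    and K: "\<And>y. h y \<ge> - K * exp (- y)"
  shows "h x \<ge> 0"
proof (rule ccontr)
  assume "\<not> h x \<ge> 0"
  then have neg: "h x < 0" by simp
  have le: "h y \<le> h x" if "y \<ge> x" for y
    using DERIV_nonpos_imp_nonincreasing[OF that, of h] d h' by force
  have "((\<lambda>y. - K * exp (- y)) \<longlongrightarrow> - K * 0) at_top"
    by (intro tendsto_intros filterlim_compose[OF exp_at_bot] filterlim_uminus_at_bot_at_top)
  then have "\<forall>\<^sub>F y in at_top. - K * exp (- y) > h x"
    using neg by (intro order_tendstoD(1)) auto
  then have "\<forall>\<^sub>F y in at_top. - K * exp (- y) > h x \<and> y \<ge> x"
    by (intro eventually_conj eventually_ge_at_top)
  then obtain y where "- K * exp (- y) > h x" "y \<ge> x"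
    by (metis (mono_tags, lifting) eventually_happens trivial_limit_at_top_linorder)
  with le[of y] K[of y] show False by linarith
qed

lemma weight_growth_exp: "weight_growth c (\<lambda>x. exp (c * x))"
  unfolding weight_growth_def by (auto simp: exp_add[symmetric] algebra_simps)

lemma weight_growth_exp_minus: "weight_growth (- 1) (\<lambda>x. exp (- x))"
  using weight_growth_exp[of "- 1"] by simp

lemma weight_growth_1: "weight_growth 0 (\<lambda>x. 1)"
  by (simp add: weight_growth_def)

lemma Re_disc_root_le: assumes "\<nu> \<ge> 1" shows "Re (disc_root \<nu>) \<le> \<nu> / 2"
proof (cases "\<nu> = 1")
  case True
  have "sqrt (1 / 4) = sqrt ((1 / 2)\<^sup>2)" by (simp add: power2_eq_square)
  then show ?thesis using True by (simp add: disc_root_def del: real_sqrt_divide)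
next
  case False
  then show ?thesis using Re_disc_root_less[of \<nu>] assms by simp
qed

text \<open>\<open>W\<close> arises from the constant coefficient problem by conjugation with \<open>exp (\<nu> * x)\<close>.\<close>

definition W :: "real \<Rightarrow> (real \<Rightarrow> real) \<Rightarrow> real \<Rightarrow> real" where
  "W \<nu> F = response (3 * \<nu> / 2) (disc_root \<nu>) \<nu> F"

definition Wk :: "real \<Rightarrow> (real \<Rightarrow> real) \<Rightarrow> real \<Rightarrow> real" where
  "Wk \<nu> F = coresponse (3 * \<nu> / 2) (disc_root \<nu>) \<nu> F"

lemma damped_W:
  assumes "\<nu> \<ge> 1" "weight_growth b w" "b < 3 * \<nu> / 2 - Re (disc_root \<nu>)" "continuous_on UNIV F"
    and "\<And>x. \<bar>F x\<bar> \<le> C / w x"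
  shows "damped (3 * \<nu> / 2) (disc_root \<nu>) b C w F"
  by standard (use assms Re_disc_root_nonneg[of \<nu>] Im_disc_root_sq in auto)

lemma W_rate: "\<nu> \<ge> 1 \<Longrightarrow> \<nu> \<le> 3 * \<nu> / 2 - Re (disc_root \<nu>)"
  using Re_disc_root_le[of \<nu>] by simp

lemma norm_half_root: assumes "\<nu> \<ge> 1" shows "norm (of_real (3 * \<nu> / 2) + disc_root \<nu> - of_real \<nu>) \<le> 3 / 2 * \<nu>"
proof -
  have "of_real (3 * \<nu> / 2) + disc_root \<nu> - of_real \<nu> = of_real (\<nu> / 2) + disc_root \<nu>"
    by (simp add: complex_eq_iff)
  moreover have "norm (of_real (\<nu> / 2) + disc_root \<nu>) \<le> \<nu> / 2 + \<nu>"
    using norm_triangle_ineq[of "of_real (\<nu> / 2)" "disc_root \<nu>"] norm_disc_root_le[OF assms] assms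
    by (simp add: norm_divide)
  ultimately show ?thesis by simp
qed

text \<open>Combined with the factor \<open>1 / 4\<close> that the integration against the potential
  gains in the weight \<open>exp (4 * Phi)\<close>, the constant \<open>2 / \<nu>\<close> yields
  \<open>1 / (2 * \<nu>)\<close>, a contraction factor for all \<open>\<nu> \<ge> 1\<close>.\<close>

lemma W_const_le: assumes "\<nu> \<ge> 1"
  shows "response_const (3 * \<nu> / 2) (disc_root \<nu>) \<nu> 0 \<le> 2 / \<nu>"
    and "0 \<le> response_const (3 * \<nu> / 2) (disc_root \<nu>) \<nu> 0"
proof -
  have i: "inner_const (3 * \<nu> / 2) (disc_root \<nu>) \<nu> 0 \<le> (3 / 2 * \<nu>) / (3 / 2 * \<nu>)"
    unfolding inner_const_def
    using norm_half_root[OF assms] Re_disc_root_nonneg[of \<nu>] assms by (intro frac_le) auto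
  have i0: "inner_const (3 * \<nu> / 2) (disc_root \<nu>) \<nu> 0 \<ge> 0"
    unfolding inner_const_def using Re_disc_root_nonneg[of \<nu>] assms by (intro divide_nonneg_nonneg) auto
  show "response_const (3 * \<nu> / 2) (disc_root \<nu>) \<nu> 0 \<le> 2 / \<nu>"
    unfolding response_const_def using i i0 assms W_rate[OF assms] by (intro frac_le) auto
  show "0 \<le> response_const (3 * \<nu> / 2) (disc_root \<nu>) \<nu> 0"
    unfolding response_const_def using i0 assms W_rate[OF assms] by (intro divide_nonneg_nonneg) auto
qed

section \<open>The Volterra equation of the normalised Jost function\<close>

context soliton begin

text \<open>The integral of \<open>q * m\<close> from \<open>-\<infinity>\<close>, seen as a
  resolvent of rate \<open>0\<close>. This is legitimate because the potential provides the weight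
  \<open>exp (- x)\<close>, whose growth is \<open>- 1\<close>.\<close>

definition Jq :: "(real \<Rightarrow> real) \<Rightarrow> real \<Rightarrow> real" where "Jq m = fwd 0 (\<lambda>x. q x * m x)"

lemma Jq_dom:
  assumes "continuous_on UNIV m" "\<And>x. \<bar>m x\<bar> \<le> M"
  shows "fwd_dominated 0 (- 1) (real p * CQ * M) (\<lambda>x. exp (- x)) (\<lambda>x. q x * m x)"
proof
  show "\<bar>q x * m x\<bar> \<le> real p * CQ * M / exp (- x)" for x
  proof -
    have "\<bar>q x * m x\<bar> \<le> (real p * CQ * exp (- \<bar>x\<bar>)) * M"
      unfolding abs_mult using q_bound[of x] q_pos[of x] assms(2)[of x] by (intro mult_mono) auto
    also have "\<dots> \<le> (real p * CQ * exp x) * M"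
      using order_trans[OF abs_ge_zero assms(2)] by (intro mult_right_mono mult_left_mono) auto
    finally show ?thesis by (simp add: exp_minus field_simps)
  qed
qed (use assms weight_growth_exp_minus cont_q in \<open>auto intro!: continuous_intros\<close>)

lemma Jq_deriv:
  assumes "continuous_on UNIV m" "\<And>x. \<bar>m x\<bar> \<le> M"
  shows "(Jq m has_real_derivative q x * m x) (at x)"
  using fwd_dominated.fwd_deriv[OF Jq_dom[OF assms], of x] by (simp add: Jq_def)

lemma Jq_cont:
  assumes "continuous_on UNIV m" "\<And>x. \<bar>m x\<bar> \<le> M"
  shows "continuous_on UNIV (Jq m)"
  using fwd_dominated.fwd_cont[OF Jq_dom[OF assms]] by (simp add: Jq_def)

lemma Jq_le_exp:
  assumes "continuous_on UNIV m" "\<And>x. \<bar>m x\<bar> \<le> M"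
  shows "\<bar>Jq m x\<bar> \<le> real p * CQ * M * exp x"
  using fwd_dominated.abs_fwd_le[OF Jq_dom[OF assms], of x] by (simp add: Jq_def exp_minus divide_inverse)

text \<open>Both \<open>g - Jq m\<close> and \<open>g + Jq m\<close> are nondecreasing. At
  \<open>-\<infinity>\<close> the integral vanishes at an exponential rate while \<open>g\<close> is
  nonnegative, so neither can become negative.\<close>

lemma Jq_compare:
  assumes m: "continuous_on UNIV m" "\<And>x. \<bar>m x\<bar> \<le> M"
    and g: "\<And>x. (g has_real_derivative g' x) (at x)" "\<And>x. g x \<ge> 0" "\<And>x. q x * \<bar>m x\<bar> \<le> g' x"
  shows "\<bar>Jq m x\<bar> \<le> g x"
proof -
  have le: "\<bar>q x * m x\<bar> \<le> g' x" for x using g(3)[of x] q_pos[of x] by (simp add: abs_mult)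
  define K where "K = real p * CQ * M"
  have J: "Jq m x \<le> K * exp x" "- (K * exp x) \<le> Jq m x" for x
    using Jq_le_exp[OF m, of x] by (auto simp: K_def abs_le_iff)
  have "g x - Jq m x \<ge> 0"
  proof (rule nonneg_if_nondecreasing_from_bot[where h = "\<lambda>x. g x - Jq m x" and h' = "\<lambda>x. g' x - q x * m x" and K = K])
    show "((\<lambda>x. g x - Jq m x) has_real_derivative g' x - q x * m x) (at x)" for x
      by (intro derivative_intros g(1) Jq_deriv[OF m])
    show "0 \<le> g' x - q x * m x" for x using le[of x] by linarith
    show "- K * exp x \<le> g x - Jq m x" for x using J(1)[of x] g(2)[of x] by linarith
  qed
  moreover have "g x + Jq m x \<ge> 0"
  proof (rule nonneg_if_nondecreasing_from_bot[where h = "\<lambda>x. g x + Jq m x" and h' = "\<lambda>x. g' x + q x * m x" and K = K])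
    show "((\<lambda>x. g x + Jq m x) has_real_derivative g' x + q x * m x) (at x)" for x
      by (intro derivative_intros g(1) Jq_deriv[OF m])
    show "0 \<le> g' x + q x * m x" for x using le[of x] by linarith
    show "- K * exp x \<le> g x + Jq m x" for x using J(2)[of x] g(2)[of x] by linarith
  qed
  ultimately show ?thesis by linarith
qed

lemma Jq_le_Phi:
  assumes m: "continuous_on UNIV m" "\<And>x. \<bar>m x\<bar> \<le> M"
  shows "\<bar>Jq m x\<bar> \<le> M * Phi x"
proof -
  have "M \<ge> 0" using order_trans[OF abs_ge_zero m(2)] .
  then show ?thesis
    using m(2) q_pos Phi_bounds by (intro Jq_compare[OF m, of _ "\<lambda>x. M * q x"])
     (auto intro!: derivative_eq_intros Phi_deriv mult_mono simp: mult.commute less_imp_le)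
qed

text \<open>The derivative of \<open>S / 4 * exp (4 * Phi x)\<close> is
  \<open>q x * (S * exp (4 * Phi x))\<close>: in this weight, integration against the potential
  gains \<open>1 / 4\<close> however large the potential is.\<close>

lemma Jq_le_exp_Phi:
  assumes m: "continuous_on UNIV m" "\<And>x. \<bar>m x\<bar> \<le> S * exp (4 * Phi x)"
  shows "\<bar>Jq m x\<bar> \<le> S / 4 * exp (4 * Phi x)"
proof -
  have S: "S \<ge> 0" using order_trans[OF abs_ge_zero m(2)] by (simp add: zero_le_mult_iff)
  have "\<bar>m x\<bar> \<le> S * exp (4 * Phi_max)" for x
    by (rule order_trans[OF m(2)]) (use S Phi_bounds in \<open>auto intro!: mult_left_mono\<close>)
  then show ?thesis
    using m(2) q_pos S by (intro Jq_compare[OF m(1), of _ _ "\<lambda>x. q x * (S * exp (4 * Phi x))"])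
     (auto intro!: derivative_eq_intros Phi_deriv mult_left_mono simp: less_imp_le)
qed

lemma Jq_diff:
  assumes m: "continuous_on UNIV m" "\<And>x. \<bar>m x\<bar> \<le> M" and m': "continuous_on UNIV m'" "\<And>x. \<bar>m' x\<bar> \<le> M'"
  shows "Jq (\<lambda>x. m x - m' x) x = Jq m x - Jq m' x"
proof -
  have "continuous_on UNIV (\<lambda>x. - 1 * m' x)" "\<And>x. \<bar>- 1 * m' x\<bar> \<le> M'"
    using m' by (auto intro!: continuous_intros)
  from fwd_add[OF Jq_dom[OF m] Jq_dom[OF this], of x] show ?thesis
    using fwd_mult[of 0 "- 1" "\<lambda>x. q x * m' x" x] by (simp add: Jq_def algebra_simps)
qed

lemma Phi_mono: "x \<le> y \<Longrightarrow> Phi x \<le> Phi y"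
  by (rule DERIV_nonneg_imp_nondecreasing[of x y Phi]) (use Phi_deriv q_pos in \<open>auto intro: less_imp_le\<close>)

lemma weight_growth_Phi: "weight_growth 0 (\<lambda>x. exp (- (4 * Phi x)))"
  using Phi_mono by (simp add: weight_growth_def)

lemma W_Jq_le:
  assumes \<nu>: "\<nu> \<ge> 1" and m: "continuous_on UNIV m" "\<And>x. \<bar>m x\<bar> \<le> S * exp (4 * Phi x)"
  shows "\<bar>W \<nu> (Jq m) x\<bar> \<le> S / (2 * \<nu>) * exp (4 * Phi x)"
    and "damped (3 * \<nu> / 2) (disc_root \<nu>) 0 (S / 4) (\<lambda>x. exp (- (4 * Phi x))) (Jq m)"
proof -
  have S: "S \<ge> 0" using order_trans[OF abs_ge_zero m(2)] by (simp add: zero_le_mult_iff)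
  have M: "\<bar>m x\<bar> \<le> S * exp (4 * Phi_max)" for x
    by (rule order_trans[OF m(2)]) (use S Phi_bounds in \<open>auto intro!: mult_left_mono\<close>)
  show d: "damped (3 * \<nu> / 2) (disc_root \<nu>) 0 (S / 4) (\<lambda>x. exp (- (4 * Phi x))) (Jq m)"
  proof (rule damped_W[OF \<nu> weight_growth_Phi _ Jq_cont[OF m(1) M]])
    show "0 < 3 * \<nu> / 2 - Re (disc_root \<nu>)" using W_rate[OF \<nu>] \<nu> by linarith
    show "\<bar>Jq m x\<bar> \<le> S / 4 / exp (- (4 * Phi x))" for x
      using Jq_le_exp_Phi[OF m, of x] unfolding exp_minus divide_inverse inverse_inverse_eq .
  qed
  have "\<bar>W \<nu> (Jq m) x\<bar> \<le> S / 4 * response_const (3 * \<nu> / 2) (disc_root \<nu>) \<nu> 0 / exp (- (4 * Phi x))"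
    using damped.abs_response_le[OF d, of \<nu> x] by (simp add: W_def)
  also have "\<dots> \<le> S / 4 * (2 / \<nu>) / exp (- (4 * Phi x))"
    using S W_const_le[OF \<nu>] by (intro divide_right_mono mult_left_mono) auto
  also have "\<dots> = S / (2 * \<nu>) * exp (4 * Phi x)"
    unfolding exp_minus divide_inverse inverse_inverse_eq by simp
  finally show "\<bar>W \<nu> (Jq m) x\<bar> \<le> S / (2 * \<nu>) * exp (4 * Phi x)" .
qed

lemma W_cont: "damped (3 * \<nu> / 2) (disc_root \<nu>) b C w F \<Longrightarrow> continuous_on UNIV (W \<nu> F)"
  unfolding W_def by (rule damped.isCont_response)

abbreviation "M0 \<equiv> 2 * exp (4 * Phi_max)"

text \<open>A bounded continuous \<open>u\<close> stands for the candidate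
  \<open>exp (4 * Phi) * u\<close>, which makes the Volterra map a contraction with factor
  \<open>1 / 2\<close>. The fixed point has \<open>norm u \<le> 2\<close>, whence the bound
  \<open>M0\<close>.\<close>

lemma volterra_exists:
  assumes \<nu>: "\<nu> \<ge> 1"
  shows "\<exists>m. continuous_on UNIV m \<and> (\<forall>x. \<bar>m x\<bar> \<le> M0) \<and> (\<forall>x. m x = 1 - W \<nu> (Jq m) x)"
proof -
  define G where "G u x = exp (4 * Phi x) * apply_bcontfun u x" for u :: "real \<Rightarrow>\<^sub>C real" and x
  have Gc: "continuous_on UNIV (G u)" for u unfolding G_def by (intro continuous_intros cont_Phi continuous_on_apply_bcontfun)
  have Gb: "\<bar>G u x\<bar> \<le> norm u * exp (4 * Phi x)" for u x
    using norm_bounded[of u x] by (simp add: G_def abs_mult)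
  have GM: "\<bar>G u x\<bar> \<le> norm u * exp (4 * Phi_max)" for u x
    by (rule order_trans[OF Gb]) (use Phi_bounds in \<open>auto intro!: mult_left_mono\<close>)
  define T where "T u x = exp (- (4 * Phi x)) * (1 - W \<nu> (Jq (G u)) x)" for u x
  have Tb: "\<bar>T u x\<bar> \<le> 1 + norm u / 2" for u x
  proof -
    have "\<bar>W \<nu> (Jq (G u)) x\<bar> \<le> norm u / (2 * \<nu>) * exp (4 * Phi x)" by (rule W_Jq_le[OF \<nu> Gc Gb])
    also have "\<dots> \<le> norm u / 2 * exp (4 * Phi x)"
      using \<nu> by (intro mult_right_mono divide_left_mono) auto
    finally have "\<bar>W \<nu> (Jq (G u)) x\<bar> \<le> norm u / 2 * exp (4 * Phi x)" .
    moreover have "1 \<le> exp (4 * Phi x)" using Phi_bounds(1)[of x] by simp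
    moreover have "\<bar>1 - W \<nu> (Jq (G u)) x\<bar> \<le> 1 + \<bar>W \<nu> (Jq (G u)) x\<bar>" by simp
    ultimately have "\<bar>1 - W \<nu> (Jq (G u)) x\<bar> \<le> exp (4 * Phi x) * (1 + norm u / 2)"
      unfolding distrib_left mult_1_right mult.commute[of "exp (4 * Phi x)"] by linarith
    then have "exp (- (4 * Phi x)) * \<bar>1 - W \<nu> (Jq (G u)) x\<bar> \<le> exp (- (4 * Phi x)) * (exp (4 * Phi x) * (1 + norm u / 2))"
      by (intro mult_left_mono) auto
    also have "\<dots> = 1 + norm u / 2" unfolding mult.assoc[symmetric] exp_add[symmetric] by simp
    finally show ?thesis by (simp add: T_def abs_mult)
  qed
  have Tc: "T u \<in> bcontfun" for u
  proof (rule bcontfun_normI)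
    show "continuous_on UNIV (T u)"
      unfolding T_def using W_cont[OF W_Jq_le(2)[OF \<nu> Gc Gb]] by (intro continuous_intros cont_Phi)
  qed (use Tb in simp)
  then have Ta: "apply_bcontfun (Bcontfun (T u)) x = T u x" for u x by (simp add: Bcontfun_inverse)
  have "\<exists>!u. Bcontfun (T u) = u"
  proof (rule banach_fix_type[of "1/2"])
    show "\<forall>u v. dist (Bcontfun (T u)) (Bcontfun (T v)) \<le> 1 / 2 * dist u v"
    proof (intro allI)
      fix u v
      have Gd: "G (u - v) = (\<lambda>x. G u x - G v x)" by (simp add: G_def algebra_simps fun_eq_iff)
      have Jd: "Jq (G (u - v)) = (\<lambda>x. Jq (G u) x - Jq (G v) x)"
        unfolding Gd by (rule ext) (rule Jq_diff[OF Gc GM Gc GM])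
      have Wd: "W \<nu> (Jq (G (u - v))) x = W \<nu> (Jq (G u)) x - W \<nu> (Jq (G v)) x" for x
        unfolding Jd W_def by (rule response_diff[OF W_Jq_le(2)[OF \<nu> Gc Gb] W_Jq_le(2)[OF \<nu> Gc Gb]])
      show "dist (Bcontfun (T u)) (Bcontfun (T v)) \<le> 1 / 2 * dist u v"
        unfolding dist_norm
      proof (rule norm_bound)
        fix x
        have "T v x - T u x = exp (- (4 * Phi x)) * W \<nu> (Jq (G (u - v))) x"
          by (simp add: T_def Wd algebra_simps)
        then have "\<bar>T u x - T v x\<bar> = exp (- (4 * Phi x)) * \<bar>W \<nu> (Jq (G (u - v))) x\<bar>"
          by (simp add: abs_minus_commute[of "T u x"] abs_mult)
        also have "\<dots> \<le> exp (- (4 * Phi x)) * (norm (u - v) / (2 * \<nu>) * exp (4 * Phi x))"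
          by (intro mult_left_mono W_Jq_le[OF \<nu> Gc Gb]) auto
        also have "\<dots> = norm (u - v) / (2 * \<nu>)"
          by (simp add: exp_minus)
        also have "\<dots> \<le> norm (u - v) / 2" using \<nu> by (intro divide_left_mono) auto
        finally show "norm (apply_bcontfun (Bcontfun (T u) - Bcontfun (T v)) x) \<le> 1 / 2 * norm (u - v)"
          by (simp add: Ta)
      qed
    qed
  qed auto
  then obtain u where u: "Bcontfun (T u) = u" by blast
  then have Tu: "T u x = apply_bcontfun u x" for x using Ta[of u x] by simp
  have "norm u \<le> 1 + norm u / 2"
    by (rule norm_bound) (use Tb[of u] Tu in auto)
  then have u2: "norm u \<le> 2" by simp
  show ?thesis
  proof (intro exI[of _ "G u"] conjI allI Gc)
    show "\<bar>G u x\<bar> \<le> M0" for x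
      by (rule order_trans[OF GM]) (use mult_right_mono[OF u2, of "exp (4 * Phi_max)"] in simp)
    show "G u x = 1 - W \<nu> (Jq (G u)) x" for x
      using Tu[of x] by (simp add: G_def[of u x] T_def exp_minus field_simps)
  qed
qed

text \<open>The weighted supremum \<open>S\<close> of the difference satisfies
  \<open>S \<le> \<delta> + S / 2\<close>. With \<open>\<delta> = 0\<close> this is uniqueness; with
  the solution for another parameter in the role of \<open>m'\<close> it is continuous
  dependence.\<close>

lemma volterra_stable:
  assumes \<nu>: "\<nu> \<ge> 1" and m: "continuous_on UNIV m" "\<And>x. \<bar>m x\<bar> \<le> M" "\<And>x. m x = 1 - W \<nu> (Jq m) x"
    and m': "continuous_on UNIV m'" "\<And>x. \<bar>m' x\<bar> \<le> M'" "\<And>x. \<bar>m' x - (1 - W \<nu> (Jq m') x)\<bar> \<le> \<delta>"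
  shows "\<bar>m x - m' x\<bar> \<le> M0 * \<delta>"
proof -
  define d where "d x = m x - m' x" for x
  have dc: "continuous_on UNIV d" unfolding d_def by (intro continuous_intros m m')
  define S where "S = (SUP x. exp (- (4 * Phi x)) * \<bar>d x\<bar>)"
  have bdd: "bdd_above (range (\<lambda>x. exp (- (4 * Phi x)) * \<bar>d x\<bar>))"
  proof (rule bdd_aboveI2)
    fix x
    have "exp (- (4 * Phi x)) * \<bar>d x\<bar> \<le> 1 * (M + M')"
      using m(2)[of x] m'(2)[of x] Phi_bounds(1)[of x] by (intro mult_mono) (auto simp: d_def)
    then show "exp (- (4 * Phi x)) * \<bar>d x\<bar> \<le> M + M'" by simp
  qed
  have dS: "\<bar>d x\<bar> \<le> S * exp (4 * Phi x)" for x
  proof -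
    have "exp (- (4 * Phi x)) * \<bar>d x\<bar> \<le> S" unfolding S_def by (rule cSUP_upper[OF _ bdd]) simp
    then show ?thesis by (simp add: exp_minus field_simps)
  qed
  have e1: "1 \<le> exp (4 * Phi x)" for x using Phi_bounds(1)[of x] by simp
  have m1: "\<bar>m x\<bar> \<le> M * exp (4 * Phi x)" for x
    using m(2)[of x] order_trans[OF abs_ge_zero m(2)[of x]] mult_left_mono[OF e1[of x], of M] by simp
  have m2: "\<bar>m' x\<bar> \<le> M' * exp (4 * Phi x)" for x
    using m'(2)[of x] order_trans[OF abs_ge_zero m'(2)[of x]] mult_left_mono[OF e1[of x], of M'] by simp
  have Jd: "Jq d = (\<lambda>x. Jq m x - Jq m' x)"
    unfolding d_def by (rule ext) (rule Jq_diff[OF m(1,2) m'(1,2)])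
  have Wd: "W \<nu> (Jq d) x = W \<nu> (Jq m) x - W \<nu> (Jq m') x" for x
    unfolding Jd W_def by (rule response_diff[OF W_Jq_le(2)[OF \<nu> m(1) m1] W_Jq_le(2)[OF \<nu> m'(1) m2]])
  have S0: "S \<ge> 0" using order_trans[OF abs_ge_zero dS[of 0]] by (simp add: zero_le_mult_iff)
  have \<delta>0: "\<delta> \<ge> 0" using order_trans[OF abs_ge_zero m'(3)] .
  have "S \<le> \<delta> + S / 2"
    unfolding S_def
  proof (rule cSUP_least)
    fix x
    have "\<bar>d x\<bar> \<le> \<bar>W \<nu> (Jq d) x\<bar> + \<delta>"
      using m'(3)[of x] m(3)[of x] by (simp add: Wd d_def)
    also have "\<dots> \<le> S / (2 * \<nu>) * exp (4 * Phi x) + \<delta>"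
      using W_Jq_le(1)[OF \<nu> dc dS, of x] by simp
    also have "\<dots> \<le> S / 2 * exp (4 * Phi x) + \<delta> * exp (4 * Phi x)"
      using \<nu> S0 mult_left_mono[OF e1[of x] \<delta>0] by (intro add_mono mult_right_mono divide_left_mono) auto
    finally have "\<bar>d x\<bar> \<le> (\<delta> + S / 2) * exp (4 * Phi x)" by (simp add: algebra_simps)
    then have "exp (- (4 * Phi x)) * \<bar>d x\<bar> \<le> \<delta> + S / 2" by (simp add: exp_minus field_simps)
    then show "exp (- (4 * Phi x)) * \<bar>d x\<bar> \<le> \<delta> + (SUP x. exp (- (4 * Phi x)) * \<bar>d x\<bar>) / 2"
      by (simp add: S_def)
  qed simp
  then have "S \<le> 2 * \<delta>" by simp
  have "\<bar>d x\<bar> \<le> S * exp (4 * Phi x)" by (rule dS)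
  also have "\<dots> \<le> 2 * \<delta> * exp (4 * Phi_max)"
    using \<open>S \<le> 2 * \<delta>\<close> S0 Phi_bounds(2)[of x] by (intro mult_mono) auto
  finally show ?thesis by (simp add: d_def mult_ac)
qed

end

section \<open>The Jost function and the Evans function\<close>

context soliton begin

text \<open>\<open>exp (\<nu> * x) * jost_m \<nu> x\<close> is the solution of the eigenvalue equation that decays at \<open>-\<infinity>\<close>.\<close>

definition "jost_m \<nu> = (SOME m. continuous_on UNIV m \<and> (\<forall>x. \<bar>m x\<bar> \<le> M0) \<and> (\<forall>x. m x = 1 - W \<nu> (Jq m) x))"
definition "FF \<nu> = Jq (jost_m \<nu>)"
definition "kk \<nu> = Wk \<nu> (FF \<nu>)"
text \<open>The integral of \<open>q * jost_m \<nu>\<close> over the half-line beyond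
  \<open>x\<close>, reduced to \<open>Jq\<close> by reflection because \<open>q\<close> is
  even.\<close>

definition "Fp \<nu> x = Jq (\<lambda>t. jost_m \<nu> (- t)) (- x)"
definition "Finf \<nu> = FF \<nu> 0 + Fp \<nu> 0"
text \<open>The coefficient \<open>\<nu> / (3 * \<nu>^2 - 1)\<close> is the value at frequency zero
  of the multiplier \<open>(D + \<nu>) / (D^2 + 3 * \<nu> * D + 3 * \<nu>^2 - 1)\<close> of
  \<open>W \<nu>\<close>, that is, the factor by which it acts on the constant
  \<open>Finf \<nu>\<close>.\<close>

definition "evans \<nu> = 1 - \<nu> / (3 * \<nu>\<^sup>2 - 1) * Finf \<nu>"
text \<open>Multiplied by \<open>exp (\<nu> * x)\<close> this becomes the antiderivative of the
  unnormalised Jost solution that vanishes at \<open>-\<infinity>\<close>.\<close>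

definition "nn \<nu> = fwd \<nu> (jost_m \<nu>)"
abbreviation "CF \<equiv> real p * CQ * M0"

end

locale jost = soliton +
  fixes \<nu> :: real
  assumes nu1: "\<nu> \<ge> 1"
begin

lemma jost_m: "continuous_on UNIV (jost_m \<nu>) \<and> (\<forall>x. \<bar>jost_m \<nu> x\<bar> \<le> M0) \<and> (\<forall>x. jost_m \<nu> x = 1 - W \<nu> (Jq (jost_m \<nu>)) x)"
  unfolding jost_m_def by (rule someI_ex[OF volterra_exists[OF nu1]])

lemma m_cont: "continuous_on UNIV (jost_m \<nu>)" and m_le: "\<bar>jost_m \<nu> x\<bar> \<le> M0" and m_eq: "jost_m \<nu> x = 1 - W \<nu> (FF \<nu>) x"
  using jost_m by (auto simp: FF_def)

lemma m_cont': "continuous_on UNIV (\<lambda>t. jost_m \<nu> (- t))"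
  by (intro continuous_on_compose2[OF m_cont] continuous_intros) auto

lemma F_deriv: "(FF \<nu> has_real_derivative q x * jost_m \<nu> x) (at x)"
  unfolding FF_def by (rule Jq_deriv[OF m_cont m_le])

lemma F_cont: "continuous_on UNIV (FF \<nu>)"
  unfolding FF_def by (rule Jq_cont[OF m_cont m_le])

lemma F_le: "\<bar>FF \<nu> x\<bar> \<le> M0 * Phi_max"
  unfolding FF_def by (rule order_trans[OF Jq_le_Phi[OF m_cont m_le]]) (use Phi_bounds in simp)

lemma F_le_exp: "\<bar>FF \<nu> x\<bar> \<le> CF * exp x"
  unfolding FF_def by (rule Jq_le_exp[OF m_cont m_le])

lemma dampedF: "damped (3 * \<nu> / 2) (disc_root \<nu>) 0 (M0 * Phi_max) (\<lambda>x. 1) (FF \<nu>)"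
  using W_rate[OF nu1] nu1 F_le by (intro damped_W[OF nu1 weight_growth_1 _ F_cont]) auto

lemma dampedF': "damped (3 * \<nu> / 2) (disc_root \<nu>) (- 1) CF (\<lambda>x. exp (- x)) (FF \<nu>)"
proof (rule damped_W[OF nu1 weight_growth_exp_minus _ F_cont])
  show "\<bar>FF \<nu> x\<bar> \<le> CF / exp (- x)" for x
    using F_le_exp[of x] unfolding exp_minus divide_inverse inverse_inverse_eq .
qed (use W_rate[OF nu1] nu1 in auto)

lemma AB: "2 * (3 * \<nu> / 2) - \<nu> = 2 * \<nu>" "2 * (3 * \<nu> / 2) = 3 * \<nu>"
  "(3 * \<nu> / 2)\<^sup>2 - Re ((disc_root \<nu>)\<^sup>2) = 3 * \<nu>\<^sup>2 - 1"
  by (simp_all add: Re_disc_root_sq power_divide power_mult_distrib)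

lemma W_deriv:
  assumes "damped (3 * \<nu> / 2) (disc_root \<nu>) b C w F"
  shows "(W \<nu> F has_real_derivative F x - Wk \<nu> F x) (at x)"
    and "(Wk \<nu> F has_real_derivative 2 * \<nu> * F x - 3 * \<nu> * Wk \<nu> F x + (3 * \<nu>\<^sup>2 - 1) * W \<nu> F x) (at x)"
  using damped.response_deriv[OF assms, of \<nu> x] damped.coresponse_deriv[OF assms, of \<nu> x]
  unfolding AB W_def Wk_def by auto

lemma m_deriv: "(jost_m \<nu> has_real_derivative kk \<nu> x - FF \<nu> x) (at x)"
proof -
  have "((\<lambda>x. 1 - W \<nu> (FF \<nu>) x) has_real_derivative 0 - (FF \<nu> x - Wk \<nu> (FF \<nu>) x)) (at x)"
    by (intro derivative_intros W_deriv[OF dampedF])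
  then show ?thesis by (simp add: m_eq[abs_def, symmetric] kk_def)
qed

lemma k_deriv: "(kk \<nu> has_real_derivative 2 * \<nu> * FF \<nu> x - 3 * \<nu> * kk \<nu> x + (3 * \<nu>\<^sup>2 - 1) * (1 - jost_m \<nu> x)) (at x)"
  using W_deriv(2)[OF dampedF, of x] by (simp add: kk_def m_eq)

lemma u_le_exp: "\<exists>C. \<forall>x. \<bar>1 - jost_m \<nu> x\<bar> \<le> C * exp x \<and> \<bar>kk \<nu> x\<bar> \<le> C * exp x"
proof -
  obtain C1 C2 where C: "\<bar>W \<nu> (FF \<nu>) x\<bar> \<le> C1 / exp (- x)" "\<bar>Wk \<nu> (FF \<nu>) x\<bar> \<le> C2 / exp (- x)" for x
    using damped.abs_response_le[OF dampedF', of \<nu>] damped.abs_coresponse_le[OF dampedF', of \<nu>]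
    unfolding W_def Wk_def by meson
  have "\<bar>1 - jost_m \<nu> x\<bar> \<le> max C1 C2 * exp x \<and> \<bar>kk \<nu> x\<bar> \<le> max C1 C2 * exp x" for x
  proof -
    have "C1 * exp x \<le> max C1 C2 * exp x" "C2 * exp x \<le> max C1 C2 * exp x" by (auto intro!: mult_right_mono)
    moreover have "\<bar>1 - jost_m \<nu> x\<bar> \<le> C1 * exp x" "\<bar>kk \<nu> x\<bar> \<le> C2 * exp x"
      using C[of x] by (simp_all add: m_eq kk_def exp_minus divide_inverse)
    ultimately show ?thesis by linarith
  qed
  then show ?thesis by blast
qed

lemma k_le: "\<exists>C. \<forall>x. \<bar>kk \<nu> x\<bar> \<le> C"
  using damped.abs_coresponse_le[OF dampedF, of \<nu>] unfolding kk_def Wk_def by (meson order.refl)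

lemma Fp_deriv: "(Fp \<nu> has_real_derivative - q x * jost_m \<nu> x) (at x)"
  unfolding Fp_def[abs_def]
  by (rule DERIV_cong[OF DERIV_chain2[OF Jq_deriv[OF m_cont' m_le]]])
    (auto intro!: derivative_eq_intros simp: q_even)

lemma Fp_cont: "continuous_on UNIV (Fp \<nu>)"
  using Fp_deriv by (auto simp: continuous_on_eq_continuous_at intro: DERIV_isCont)

lemma Fp_le: "\<bar>Fp \<nu> x\<bar> \<le> M0 * Phi_max"
  unfolding Fp_def by (rule order_trans[OF Jq_le_Phi[OF m_cont' m_le]]) (use Phi_bounds in simp)

lemma Fp_le_exp: "\<bar>Fp \<nu> x\<bar> \<le> CF * exp (- x)"
  unfolding Fp_def using Jq_le_exp[OF m_cont' m_le, of "- x"] by simp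

lemma F_plus_Fp: "FF \<nu> x + Fp \<nu> x = Finf \<nu>"
proof -
  have "((\<lambda>x. FF \<nu> x + Fp \<nu> x) has_real_derivative 0) (at x)" for x
    by (rule DERIV_cong[OF DERIV_add[OF F_deriv Fp_deriv]]) simp
  then show ?thesis
    unfolding Finf_def using DERIV_isconst_all[of "\<lambda>x. FF \<nu> x + Fp \<nu> x" x 0] by blast
qed

lemma Finf_le: "\<bar>Finf \<nu>\<bar> \<le> 2 * M0 * Phi_max"
  using F_le[of 0] Fp_le[of 0] unfolding Finf_def by linarith

lemma dampedFp: "damped (3 * \<nu> / 2) (disc_root \<nu>) 0 (M0 * Phi_max) (\<lambda>x. 1) (Fp \<nu>)"
  using W_rate[OF nu1] nu1 Fp_le by (intro damped_W[OF nu1 weight_growth_1 _ Fp_cont]) auto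

lemma W_unique:
  assumes d: "damped (3 * \<nu> / 2) (disc_root \<nu>) b C w F"
    and u: "\<And>x. (u has_real_derivative F x - k x) (at x)"
    and k: "\<And>x. (k has_real_derivative 2 * \<nu> * F x - 3 * \<nu> * k x + (3 * \<nu>\<^sup>2 - 1) * u x) (at x)"
    and Mu: "\<And>x. \<bar>u x\<bar> \<le> M / w x" and Mk: "\<And>x. \<bar>k x\<bar> \<le> M / w x"
  shows "u x = W \<nu> F x"
  unfolding W_def
proof (rule damped.response_unique[OF d _ u _ Mu Mk])
  show "of_real (3 * \<nu> / 2) + disc_root \<nu> \<noteq> of_real \<nu>"
    using nu1 Re_disc_root_nonneg[of \<nu>] by (auto simp: complex_eq_iff)
  show "(k has_real_derivative (2 * (3 * \<nu> / 2) - \<nu>) * F x - 2 * (3 * \<nu> / 2) * k x +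
      ((3 * \<nu> / 2)\<^sup>2 - Re ((disc_root \<nu>)\<^sup>2)) * u x) (at x)" for x
    by (rule DERIV_cong[OF k]) (unfold AB, simp)
qed

lemma den_pos: "3 * \<nu>\<^sup>2 - 1 > 0"
  using power_mono[OF nu1, of 2] by simp

text \<open>At \<open>+\<infinity>\<close> the normalised Jost function tends to the Evans function \<open>evans \<nu>\<close>.\<close>

lemma m_at_top: "jost_m \<nu> x = evans \<nu> + W \<nu> (Fp \<nu>) x" and k_at_top: "kk \<nu> x = Finf \<nu> - Wk \<nu> (Fp \<nu>) x"
proof -
  define c where "c = \<nu> / (3 * \<nu>\<^sup>2 - 1) * Finf \<nu>"
  have c: "(3 * \<nu>\<^sup>2 - 1) * c = \<nu> * Finf \<nu>" using den_pos by (simp add: c_def)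
  obtain C1 C2 where C: "\<bar>W \<nu> (Fp \<nu>) x\<bar> \<le> C1 / 1" "\<bar>Wk \<nu> (Fp \<nu>) x\<bar> \<le> C2 / 1" for x
    using damped.abs_response_le[OF dampedFp, of \<nu>] damped.abs_coresponse_le[OF dampedFp, of \<nu>]
    unfolding W_def Wk_def by meson
  \<comment> \<open>\<open>FF \<nu>\<close> is the constant \<open>Finf \<nu>\<close> minus the tail
    \<open>Fp \<nu>\<close>. The uniqueness of bounded solutions of the system identifies
    \<open>W \<nu>\<close> of this sum.\<close>
  have eq: "c - W \<nu> (Fp \<nu>) x = W \<nu> (FF \<nu>) x" for x
  proof (rule W_unique[OF dampedF, where k = "\<lambda>x. Finf \<nu> - Wk \<nu> (Fp \<nu>) x" and M = "\<bar>c\<bar> + \<bar>Finf \<nu>\<bar> + C1 + C2"])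
    fix x
    show "((\<lambda>x. c - W \<nu> (Fp \<nu>) x) has_real_derivative FF \<nu> x - (Finf \<nu> - Wk \<nu> (Fp \<nu>) x)) (at x)"
      by (rule DERIV_cong[OF DERIV_diff[OF DERIV_const W_deriv(1)[OF dampedFp]]])
        (simp add: F_plus_Fp[symmetric, of x])
    have "- (2 * \<nu> * Fp \<nu> x - 3 * \<nu> * Wk \<nu> (Fp \<nu>) x + (3 * \<nu>\<^sup>2 - 1) * W \<nu> (Fp \<nu>) x)
       = 2 * \<nu> * FF \<nu> x - 3 * \<nu> * (Finf \<nu> - Wk \<nu> (Fp \<nu>) x) + (3 * \<nu>\<^sup>2 - 1) * (c - W \<nu> (Fp \<nu>) x)"
      unfolding right_diff_distrib[of "3 * \<nu>\<^sup>2 - 1"] c unfolding F_plus_Fp[symmetric, of x]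
      by (simp add: algebra_simps)
    then show "((\<lambda>x. Finf \<nu> - Wk \<nu> (Fp \<nu>) x) has_real_derivative
       2 * \<nu> * FF \<nu> x - 3 * \<nu> * (Finf \<nu> - Wk \<nu> (Fp \<nu>) x) + (3 * \<nu>\<^sup>2 - 1) * (c - W \<nu> (Fp \<nu>) x)) (at x)"
      using DERIV_diff[OF DERIV_const W_deriv(2)[OF dampedFp], of "Finf \<nu>" x] by simp
    show "\<bar>c - W \<nu> (Fp \<nu>) x\<bar> \<le> (\<bar>c\<bar> + \<bar>Finf \<nu>\<bar> + C1 + C2) / 1"
      using C[of x] unfolding div_by_1 by linarith
    show "\<bar>Finf \<nu> - Wk \<nu> (Fp \<nu>) x\<bar> \<le> (\<bar>c\<bar> + \<bar>Finf \<nu>\<bar> + C1 + C2) / 1"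
      using C[of x] unfolding div_by_1 by linarith
  qed
  show "jost_m \<nu> x = evans \<nu> + W \<nu> (Fp \<nu>) x"
    using eq[of x] m_eq[of x] by (simp add: evans_def c_def)
  have "(W \<nu> (FF \<nu>) has_real_derivative FF \<nu> x - kk \<nu> x) (at x)"
    using W_deriv(1)[OF dampedF, of x] by (simp add: kk_def)
  moreover have "(W \<nu> (FF \<nu>) has_real_derivative 0 - (Fp \<nu> x - Wk \<nu> (Fp \<nu>) x)) (at x)"
    using DERIV_diff[OF DERIV_const W_deriv(1)[OF dampedFp], of c x] unfolding eq .
  ultimately have "FF \<nu> x - kk \<nu> x = 0 - (Fp \<nu> x - Wk \<nu> (Fp \<nu>) x)" by (rule DERIV_unique)
  then show "kk \<nu> x = Finf \<nu> - Wk \<nu> (Fp \<nu>) x" using F_plus_Fp[of x] by simp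
qed

text \<open>The weight \<open>exp x\<close> has growth \<open>1\<close>. The rate
  \<open>3 * \<nu> / 2 - Re (disc_root \<nu>)\<close>, which is at least \<open>\<nu>\<close>,
  exceeds this once \<open>\<nu> > 1\<close>.\<close>

lemma plus_le_exp: assumes "\<nu> > 1"
  shows "\<exists>C. \<forall>x. \<bar>W \<nu> (Fp \<nu>) x\<bar> \<le> C * exp (- x) \<and> \<bar>Wk \<nu> (Fp \<nu>) x\<bar> \<le> C * exp (- x)"
proof -
  have d: "damped (3 * \<nu> / 2) (disc_root \<nu>) 1 CF (\<lambda>x. exp (1 * x)) (Fp \<nu>)"
  proof (rule damped_W[OF nu1 weight_growth_exp _ Fp_cont])
    show "\<bar>Fp \<nu> x\<bar> \<le> CF / exp (1 * x)" for x
      using Fp_le_exp[of x] unfolding exp_minus divide_inverse by simp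
  qed (use W_rate[OF nu1] assms in auto)
  obtain C1 C2 where C: "\<bar>W \<nu> (Fp \<nu>) x\<bar> \<le> C1 / exp (1 * x)" "\<bar>Wk \<nu> (Fp \<nu>) x\<bar> \<le> C2 / exp (1 * x)" for x
    using damped.abs_response_le[OF d, of \<nu>] damped.abs_coresponse_le[OF d, of \<nu>]
    unfolding W_def Wk_def by meson
  have "\<bar>W \<nu> (Fp \<nu>) x\<bar> \<le> max C1 C2 * exp (- x) \<and> \<bar>Wk \<nu> (Fp \<nu>) x\<bar> \<le> max C1 C2 * exp (- x)" for x
  proof -
    have "C1 * exp (- x) \<le> max C1 C2 * exp (- x)" "C2 * exp (- x) \<le> max C1 C2 * exp (- x)" by (auto intro!: mult_right_mono)
    moreover have "\<bar>W \<nu> (Fp \<nu>) x\<bar> \<le> C1 * exp (- x)" "\<bar>Wk \<nu> (Fp \<nu>) x\<bar> \<le> C2 * exp (- x)"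
      using C[of x] by (simp_all add: exp_minus divide_inverse)
    ultimately show ?thesis by linarith
  qed
  then show ?thesis by blast
qed

lemma nn_dom: "fwd_dominated \<nu> 0 M0 (\<lambda>x. 1) (jost_m \<nu>)"
  by standard (use weight_growth_1 nu1 m_cont m_le in auto)

lemma n_deriv: "(nn \<nu> has_real_derivative jost_m \<nu> x - \<nu> * nn \<nu> x) (at x)"
  unfolding nn_def by (rule fwd_dominated.fwd_deriv[OF nn_dom])

lemma n_le: "\<bar>nn \<nu> x\<bar> \<le> M0"
proof -
  have "\<bar>nn \<nu> x\<bar> \<le> M0 / (\<nu> * 1)"
    using fwd_dominated.abs_fwd_le[OF nn_dom, of x] by (simp add: nn_def)
  also have "\<dots> \<le> M0" using nu1 by (simp add: pos_divide_le_eq)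
  finally show ?thesis .
qed

text \<open>After multiplication by \<open>exp (\<nu> * x)\<close> this is the eigenvalue equation
  integrated once. The difference \<open>X\<close> of the two sides satisfies
  \<open>X' = - \<nu> * X\<close> and is bounded on the whole line, hence zero: no constant of
  integration survives.\<close>

lemma dichotomy_relation:
  "\<nu>\<^sup>2 * jost_m \<nu> x - \<nu> * kk \<nu> x + (3 * \<nu>\<^sup>2 - 1) * (1 - jost_m \<nu> x) - jost_m \<nu> x = (\<nu> ^ 3 - \<nu>) * nn \<nu> x"
proof -
  define X where "X x = \<nu>\<^sup>2 * jost_m \<nu> x - \<nu> * kk \<nu> x + (3 * \<nu>\<^sup>2 - 1) * (1 - jost_m \<nu> x) - jost_m \<nu> x - (\<nu> ^ 3 - \<nu>) * nn \<nu> x" for x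
  have dX: "(X has_real_derivative - \<nu> * X x) (at x)" for x
    unfolding X_def[abs_def]
    by (rule derivative_eq_intros m_deriv k_deriv n_deriv refl)+
      (simp add: X_def algebra_simps power2_eq_square power3_eq_cube)
  obtain Ck where Ck: "\<And>x. \<bar>kk \<nu> x\<bar> \<le> Ck" using k_le by blast
  define B where "B = \<nu>\<^sup>2 * M0 + \<nu> * Ck + (3 * \<nu>\<^sup>2 - 1) * (1 + M0) + M0 + (\<nu> ^ 3 - \<nu>) * M0"
  have n3: "\<nu> ^ 3 - \<nu> \<ge> 0" using nu1 self_le_power[of \<nu> 3] by simp
  have X_le: "\<bar>X x\<bar> \<le> B / 1" for x
  proof -
    have "\<bar>\<nu>\<^sup>2 * jost_m \<nu> x\<bar> \<le> \<nu>\<^sup>2 * M0" "\<bar>\<nu> * kk \<nu> x\<bar> \<le> \<nu> * Ck"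
      "\<bar>(3 * \<nu>\<^sup>2 - 1) * (1 - jost_m \<nu> x)\<bar> \<le> (3 * \<nu>\<^sup>2 - 1) * (1 + M0)" "\<bar>(\<nu> ^ 3 - \<nu>) * nn \<nu> x\<bar> \<le> (\<nu> ^ 3 - \<nu>) * M0"
      unfolding abs_mult using nu1 m_le[of x] Ck[of x] den_pos n3 n_le[of x]
      by (auto intro!: mult_mono simp: abs_le_iff)
    then show ?thesis using m_le[of x] unfolding X_def B_def div_by_1 by linarith
  qed
  interpret z: fwd_dominated \<nu> 0 0 "\<lambda>x. 1" "\<lambda>x. 0"
    by standard (use weight_growth_1 nu1 in auto)
  have "X x = fwd \<nu> (\<lambda>x. 0) x"
    by (rule z.fwd_unique[OF _ X_le]) (use dX in simp)
  also have "\<dots> = 0" using z.abs_fwd_le[of x] by simp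
  finally show ?thesis by (simp add: X_def)
qed

end

context soliton begin

text \<open>The Jost function at \<open>\<nu>'\<close> solves the Volterra equation at
  \<open>\<nu>\<close> up to the defect \<open>W \<nu> (FF \<nu>') - W \<nu>' (FF \<nu>')\<close>,
  which the parameter estimate for \<open>response\<close> controls.\<close>

lemma jost_m_diff:
  assumes "\<nu> \<ge> 1" "\<nu>' \<ge> 1" and L: "3 / 2 * \<nu> \<le> L" "3 / 2 * \<nu>' \<le> L"
  shows "\<bar>jost_m \<nu> x - jost_m \<nu>' x\<bar> \<le> M0 * (M0 * Phi_max * (2 * (1 + L) * (5 / 2 * \<bar>\<nu> - \<nu>'\<bar> + norm (disc_root \<nu> - disc_root \<nu>'))))"
proof -
  interpret a: jost p \<nu> by standard fact
  interpret b: jost p \<nu>' by standard fact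
  have d: "damped (3 * \<nu> / 2) (disc_root \<nu>) 0 (M0 * Phi_max) (\<lambda>x. 1) (FF \<nu>')"
    using W_rate[OF a.nu1] a.nu1 b.F_le by (intro damped_W[OF a.nu1 weight_growth_1 _ b.F_cont]) auto
  show ?thesis
  proof (rule volterra_stable[OF a.nu1 a.m_cont a.m_le _ b.m_cont b.m_le])
    show "jost_m \<nu> x = 1 - W \<nu> (Jq (jost_m \<nu>)) x" for x using a.m_eq[of x] by (simp add: FF_def)
    fix x
    have "\<bar>jost_m \<nu>' x - (1 - W \<nu> (Jq (jost_m \<nu>')) x)\<bar> = \<bar>W \<nu> (FF \<nu>') x - W \<nu>' (FF \<nu>') x\<bar>"
      using b.m_eq[of x] by (simp add: FF_def)
    also have "\<dots> \<le> (M0 * Phi_max) * (2 * (1 + L / 1) / 1\<^sup>2 *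
        (\<bar>3 * \<nu> / 2 - 3 * \<nu>' / 2\<bar> + norm (disc_root \<nu> - disc_root \<nu>') + \<bar>\<nu> - \<nu>'\<bar>)) / 1"
      unfolding W_def
      using W_rate[OF a.nu1] W_rate[OF b.nu1] a.nu1 b.nu1 Re_disc_root_nonneg[of \<nu>] Re_disc_root_nonneg[of \<nu>']
        order_trans[OF norm_half_root[OF a.nu1] L(1)] order_trans[OF norm_half_root[OF b.nu1] L(2)]
      by (intro response_param_diff[OF d b.dampedF]) auto
    also have "\<dots> = M0 * Phi_max * (2 * (1 + L) * (5 / 2 * \<bar>\<nu> - \<nu>'\<bar> + norm (disc_root \<nu> - disc_root \<nu>')))"
    proof -
      have "\<bar>3 * \<nu> / 2 - 3 * \<nu>' / 2\<bar> = 3 / 2 * \<bar>\<nu> - \<nu>'\<bar>" by (simp add: abs_if)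
      then show ?thesis by (simp add: algebra_simps)
    qed
    finally show "\<bar>jost_m \<nu>' x - (1 - W \<nu> (Jq (jost_m \<nu>')) x)\<bar> \<le> \<dots>" .
  qed
qed

lemma Finf_diff:
  assumes "\<nu> \<ge> 1" "\<nu>' \<ge> 1" and L: "3 / 2 * \<nu> \<le> L" "3 / 2 * \<nu>' \<le> L"
  shows "\<bar>Finf \<nu> - Finf \<nu>'\<bar> \<le> 2 * Phi_max * (M0 * (M0 * Phi_max * (2 * (1 + L) * (5 / 2 * \<bar>\<nu> - \<nu>'\<bar> + norm (disc_root \<nu> - disc_root \<nu>')))))"
    (is "_ \<le> 2 * Phi_max * ?d")
proof -
  interpret a: jost p \<nu> by standard fact
  interpret b: jost p \<nu>' by standard fact
  have d: "\<bar>jost_m \<nu> x - jost_m \<nu>' x\<bar> \<le> ?d" for x by (rule jost_m_diff[OF assms])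
  have d0: "?d \<ge> 0" using order_trans[OF abs_ge_zero d] .
  have "\<bar>Jq (\<lambda>x. jost_m \<nu> x - jost_m \<nu>' x) 0\<bar> \<le> ?d * Phi 0"
    by (rule Jq_le_Phi) (use d a.m_cont b.m_cont in \<open>auto intro!: continuous_intros\<close>)
  also have "\<dots> \<le> ?d * Phi_max" by (intro mult_left_mono Phi_bounds d0)
  finally have 1: "\<bar>FF \<nu> 0 - FF \<nu>' 0\<bar> \<le> ?d * Phi_max"
    unfolding FF_def Jq_diff[OF a.m_cont a.m_le b.m_cont b.m_le] .
  have "\<bar>Jq (\<lambda>x. jost_m \<nu> (- x) - jost_m \<nu>' (- x)) 0\<bar> \<le> ?d * Phi 0"
    by (rule Jq_le_Phi) (use d a.m_cont' b.m_cont' in \<open>auto intro!: continuous_intros\<close>)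
  also have "\<dots> \<le> ?d * Phi_max" by (intro mult_left_mono Phi_bounds d0)
  finally have 2: "\<bar>Fp \<nu> 0 - Fp \<nu>' 0\<bar> \<le> ?d * Phi_max"
    unfolding Fp_def Jq_diff[OF a.m_cont' a.m_le b.m_cont' b.m_le] by simp
  have "\<bar>Finf \<nu> - Finf \<nu>'\<bar> \<le> ?d * Phi_max + ?d * Phi_max"
    using 1 2 unfolding Finf_def by linarith
  then show ?thesis by (simp only: mult_2 distrib_right mult.commute)
qed

lemma evans_cont: "continuous_on {1..B} evans"
proof -
  have "continuous_on {1..B} Finf"
    unfolding continuous_on_def
  proof
    fix \<nu>' assume v: "\<nu>' \<in> {1..B}"
    define L where "L = 3 / 2 * B"
    define K where "K = 2 * Phi_max * (M0 * (M0 * Phi_max * (2 * (1 + L))))"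
    have "((\<lambda>\<nu>. Finf \<nu> - Finf \<nu>') \<longlongrightarrow> 0) (at \<nu>' within {1..B})"
    proof (rule Lim_null_comparison)
      show "\<forall>\<^sub>F \<nu> in at \<nu>' within {1..B}. norm (Finf \<nu> - Finf \<nu>') \<le>
          K * (5 / 2 * \<bar>\<nu> - \<nu>'\<bar> + norm (disc_root \<nu> - disc_root \<nu>'))"
        using v Finf_diff[of _ \<nu>' L]
        by (auto simp: eventually_at_filter L_def K_def mult.assoc intro!: always_eventually)
      have "((\<lambda>\<nu>. K * (5 / 2 * \<bar>\<nu> - \<nu>'\<bar> + norm (disc_root \<nu> - disc_root \<nu>'))) \<longlongrightarrow>
          K * (5 / 2 * \<bar>\<nu>' - \<nu>'\<bar> + norm (disc_root \<nu>' - disc_root \<nu>'))) (at \<nu>' within {1..B})"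
        using continuous_on_disc_root[of "{1..B}"] v
        by (intro tendsto_intros) (auto simp: continuous_on_def)
      then show "((\<lambda>\<nu>. K * (5 / 2 * \<bar>\<nu> - \<nu>'\<bar> + norm (disc_root \<nu> - disc_root \<nu>'))) \<longlongrightarrow> 0) (at \<nu>' within {1..B})"
        by simp
    qed
    then show "(Finf \<longlongrightarrow> Finf \<nu>') (at \<nu>' within {1..B})" by (rule LIM_zero_cancel)
  qed
  moreover have "3 * \<nu>\<^sup>2 - 1 \<noteq> 0" if "\<nu> \<ge> 1" for \<nu> :: real
    using power_mono[OF that, of 2] by simp
  ultimately show ?thesis
    unfolding evans_def[abs_def] by (intro continuous_intros) auto
qed

text \<open>\<open>Finf \<nu>\<close> is bounded uniformly in \<open>\<nu>\<close>, whereas its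
  coefficient in \<open>evans\<close> is at most \<open>1 / (2 * \<nu>)\<close>.\<close>

lemma evans_pos: assumes "\<nu> > M0 * Phi_max" "\<nu> \<ge> 1" shows "evans \<nu> > 0"
proof -
  interpret jost p \<nu> by standard fact
  have "\<nu>\<^sup>2 \<ge> 1" using power_mono[OF assms(2), of 2] by simp
  then have "\<nu> / (3 * \<nu>\<^sup>2 - 1) \<le> \<nu> / (2 * \<nu>\<^sup>2)"
    using assms \<open>\<nu>\<^sup>2 \<ge> 1\<close> den_pos by (intro divide_left_mono mult_pos_pos) auto
  also have "\<dots> = 1 / (2 * \<nu>)" using assms by (simp add: power2_eq_square)
  finally have le: "\<nu> / (3 * \<nu>\<^sup>2 - 1) \<le> 1 / (2 * \<nu>)" .
  have "\<nu> / (3 * \<nu>\<^sup>2 - 1) * Finf \<nu> \<le> \<nu> / (3 * \<nu>\<^sup>2 - 1) * (2 * M0 * Phi_max)"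
    using Finf_le den_pos assms by (intro mult_left_mono) auto
  also have "\<dots> \<le> 1 / (2 * \<nu>) * (2 * M0 * Phi_max)"
    using le Phi_max_pos by (intro mult_right_mono) auto
  also have "\<dots> < 1" using assms by (simp add: field_simps)
  finally show ?thesis by (simp add: evans_def)
qed

end

text \<open>The half-line form of the comparison principle, with rate \<open>1 / 2\<close> because
  the linear factor in the speed derivative of the soliton consumes a part of the decay.\<close>

lemma nonneg_at_0_if_nondecreasing_from_bot:
  fixes h :: "real \<Rightarrow> real"
  assumes d: "\<And>x. x \<le> 0 \<Longrightarrow> (h has_real_derivative h' x) (at x)" and h': "\<And>x. x \<le> 0 \<Longrightarrow> h' x \<ge> 0"
    and K: "\<And>x. x \<le> 0 \<Longrightarrow> h x \<ge> - K * exp (x / 2)"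
  shows "h 0 \<ge> 0"
proof (rule ccontr)
  assume "\<not> h 0 \<ge> 0"
  then have neg: "h 0 < 0" by simp
  have le: "h y \<le> h 0" if "y \<le> 0" for y
    using DERIV_nonneg_imp_nondecreasing[OF that, of h] d h' by force
  have "((\<lambda>y. - K * exp (y / 2)) \<longlongrightarrow> - K * 0) at_bot"
    by (intro tendsto_intros filterlim_compose[OF exp_at_bot]
        filterlim_tendsto_pos_mult_at_bot[OF tendsto_const[of "1/2"] _ filterlim_ident, simplified])
  then have "\<forall>\<^sub>F y in at_bot. - K * exp (y / 2) > h 0"
    using neg by (intro order_tendstoD(1)) auto
  then have "\<forall>\<^sub>F y in at_bot. - K * exp (y / 2) > h 0 \<and> y \<le> 0"
    by (intro eventually_conj eventually_le_at_bot)
  then obtain y where "- K * exp (y / 2) > h 0" "y \<le> 0"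
    by (metis (mono_tags, lifting) eventually_happens trivial_limit_at_bot_linorder)
  with le[of y] K[of y] show False by linarith
qed

section \<open>The Evans function in terms of values at the origin\<close>

context jost begin

definition "lam = \<nu> ^ 3 - \<nu>"
text \<open>\<open>Y1\<close> is the Jost solution, \<open>Y2\<close> its derivative and
  \<open>Y0\<close> its antiderivative. In the unknown \<open>Y0\<close> the equation reads
  \<open>Y0''' = (1 - q) * Y0' + lam * Y0\<close>, in which the potential is not
  differentiated.\<close>

definition "Y0 x = exp (\<nu> * x) * nn \<nu> x"
definition "Y1 x = exp (\<nu> * x) * jost_m \<nu> x"
definition "Y2 x = exp (\<nu> * x) * (\<nu> * jost_m \<nu> x + kk \<nu> x - FF \<nu> x)"

lemma exp_deriv: "((\<lambda>x. exp (\<nu> * x)) has_real_derivative \<nu> * exp (\<nu> * x)) (at x)"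
  by (auto intro!: derivative_eq_intros)

lemma Y0_deriv: "(Y0 has_real_derivative Y1 x) (at x)"
  unfolding Y0_def[abs_def] Y1_def
  by (rule DERIV_cong[OF DERIV_mult[OF exp_deriv n_deriv]]) (simp add: algebra_simps)

lemma Y1_deriv: "(Y1 has_real_derivative Y2 x) (at x)"
  unfolding Y1_def[abs_def] Y2_def
  by (rule DERIV_cong[OF DERIV_mult[OF exp_deriv m_deriv]]) (simp add: algebra_simps)

lemma Y2_deriv: "(Y2 has_real_derivative (1 - q x) * Y1 x + lam * Y0 x) (at x)"
proof -
  have "((\<lambda>x. \<nu> * jost_m \<nu> x + kk \<nu> x - FF \<nu> x) has_real_derivative \<nu> * (kk \<nu> x - FF \<nu> x) +
      (2 * \<nu> * FF \<nu> x - 3 * \<nu> * kk \<nu> x + (3 * \<nu>\<^sup>2 - 1) * (1 - jost_m \<nu> x)) - q x * jost_m \<nu> x) (at x)"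
    by (intro derivative_intros DERIV_cmult m_deriv k_deriv F_deriv)
  note D = DERIV_mult[OF exp_deriv[of x] this]
  have "\<nu> * exp (\<nu> * x) * (\<nu> * jost_m \<nu> x + kk \<nu> x - FF \<nu> x) + (\<nu> * (kk \<nu> x - FF \<nu> x) +
      (2 * \<nu> * FF \<nu> x - 3 * \<nu> * kk \<nu> x + (3 * \<nu>\<^sup>2 - 1) * (1 - jost_m \<nu> x)) - q x * jost_m \<nu> x) * exp (\<nu> * x)
    = exp (\<nu> * x) * ((\<nu>\<^sup>2 * jost_m \<nu> x - \<nu> * kk \<nu> x + (3 * \<nu>\<^sup>2 - 1) * (1 - jost_m \<nu> x) - jost_m \<nu> x) + (1 - q x) * jost_m \<nu> x)"
    by (simp add: algebra_simps power2_eq_square)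
  also have "\<dots> = (1 - q x) * Y1 x + lam * Y0 x"
    unfolding dichotomy_relation by (simp add: Y1_def Y0_def lam_def algebra_simps)
  finally show ?thesis unfolding Y2_def[abs_def] using DERIV_cong[OF D] by blast
qed

lemma reflect_deriv: "(f has_real_derivative f' (- x)) (at (- x)) \<Longrightarrow> ((\<lambda>x. f (- x)) has_real_derivative - f' (- x)) (at x)"
  by (rule DERIV_cong[OF DERIV_chain2[of f _ "\<lambda>x. - x"]]) (auto intro!: derivative_eq_intros)

text \<open>The reflected \<open>Y0\<close> solves the adjoint of the equation for \<open>Y1\<close>, so the bilinear concomitant of
  the two is constant; comparing its value at \<open>0\<close> with its limit at \<open>+\<infinity>\<close> expresses \<open>evans \<nu>\<close> by the
  values at the origin.\<close>

lemma Evans_at_0: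
  assumes nu: "\<nu> > 1"
  shows "lam * (Y0 0)\<^sup>2 + 2 * Y1 0 * Y2 0 = evans \<nu> * (3 * \<nu>\<^sup>2 - 1) / \<nu>"
proof -
  define B where "B x = lam * (Y0 x * Y0 (- x)) + Y2 x * Y1 (- x) + Y1 x * Y2 (- x)" for x
  note r = reflect_deriv[where f' = Y1, OF Y0_deriv] reflect_deriv[where f' = Y2, OF Y1_deriv]
    reflect_deriv[where f' = "\<lambda>x. (1 - q x) * Y1 x + lam * Y0 x", OF Y2_deriv]
  have "(B has_real_derivative 0) (at x)" for x
    unfolding B_def[abs_def]
    by (rule derivative_eq_intros Y0_deriv Y1_deriv Y2_deriv r refl)+
      (simp add: q_even algebra_simps)
  then have "B x = B 0" for x using DERIV_isconst_all by blast
  then obtain c where B: "B = (\<lambda>_. c)" by blast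
  have lam: "lam = \<nu> * (\<nu>\<^sup>2 - 1)" by (simp add: lam_def power2_eq_square power3_eq_cube algebra_simps)
  have n2: "\<nu>\<^sup>2 - 1 > 0" using nu by (simp add: power2_eq_square less_1_mult)
  have lam0: "lam > 0" using nu n2 by (simp add: lam)
  \<comment> \<open>Limits at both ends are available for \<open>jost_m\<close>, \<open>kk\<close>
    and \<open>FF\<close>, so \<open>nn\<close> is eliminated by the dichotomy relation before
    passing to the limit.\<close>
  define z where "z x = (\<nu>\<^sup>2 * jost_m \<nu> x - \<nu> * kk \<nu> x + (3 * \<nu>\<^sup>2 - 1) * (1 - jost_m \<nu> x) - jost_m \<nu> x)" for x
  have nz: "nn \<nu> x = z x / lam" for x
    using dichotomy_relation[of x] lam0 by (simp add: z_def lam_def)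
  have Bx: "B x = z x * z (- x) / lam + (\<nu> * jost_m \<nu> x + kk \<nu> x - FF \<nu> x) * jost_m \<nu> (- x)
      + jost_m \<nu> x * (\<nu> * jost_m \<nu> (- x) + kk \<nu> (- x) - FF \<nu> (- x))" for x
  proof -
    have e: "exp (\<nu> * x) * a * (exp (\<nu> * (- x)) * b) = a * b" for a b
    proof -
      have "exp (\<nu> * x) * exp (\<nu> * (- x)) = 1" unfolding exp_add[symmetric] by simp
      then show ?thesis by (simp add: mult_ac)
    qed
    have "Y0 x * Y0 (- x) = nn \<nu> x * nn \<nu> (- x)" unfolding Y0_def by (rule e)
    moreover have "Y2 x * Y1 (- x) = (\<nu> * jost_m \<nu> x + kk \<nu> x - FF \<nu> x) * jost_m \<nu> (- x)"
      unfolding Y1_def Y2_def by (rule e)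
    moreover have "Y1 x * Y2 (- x) = jost_m \<nu> x * (\<nu> * jost_m \<nu> (- x) + kk \<nu> (- x) - FF \<nu> (- x))"
      unfolding Y1_def Y2_def by (rule e)
    ultimately show ?thesis using lam0 by (simp add: B_def nz)
  qed
  have E: "((\<lambda>x::real. exp (- x)) \<longlongrightarrow> 0) at_top"
    by (intro filterlim_compose[OF exp_at_bot] filterlim_uminus_at_bot_at_top)
  have lim: "(f \<longlongrightarrow> c) at_top" if "\<And>x. \<bar>f x - c\<bar> \<le> C * exp (- x)" for f :: "real \<Rightarrow> real" and c C
  proof (rule LIM_zero_cancel, rule Lim_null_comparison)
    show "\<forall>\<^sub>F x in at_top. norm (f x - c) \<le> C * exp (- x)" using that by simp
    show "((\<lambda>x. C * exp (- x)) \<longlongrightarrow> 0) at_top" using tendsto_mult_right_zero[OF E] by simp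
  qed
  obtain C where C: "\<And>x. \<bar>1 - jost_m \<nu> x\<bar> \<le> C * exp x" "\<And>x. \<bar>kk \<nu> x\<bar> \<le> C * exp x" using u_le_exp by blast
  obtain C' where C': "\<And>x. \<bar>W \<nu> (Fp \<nu>) x\<bar> \<le> C' * exp (- x)" "\<And>x. \<bar>Wk \<nu> (Fp \<nu>) x\<bar> \<le> C' * exp (- x)"
    using plus_le_exp[OF nu] by blast
  have m1: "((\<lambda>x. jost_m \<nu> (- x)) \<longlongrightarrow> 1) at_top" by (rule lim[of _ _ C]) (use C(1)[of "- x" for x] in \<open>simp add: abs_minus_commute\<close>)
  have k1: "((\<lambda>x. kk \<nu> (- x)) \<longlongrightarrow> 0) at_top" by (rule lim[of _ _ C]) (use C(2)[of "- x" for x] in simp)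
  have F1: "((\<lambda>x. FF \<nu> (- x)) \<longlongrightarrow> 0) at_top" by (rule lim[of _ _ CF]) (use F_le_exp[of "- x" for x] in simp)
  have m2: "(jost_m \<nu> \<longlongrightarrow> evans \<nu>) at_top" by (rule lim[of _ _ C']) (use C'(1) in \<open>simp add: m_at_top\<close>)
  have k2: "(kk \<nu> \<longlongrightarrow> Finf \<nu>) at_top" by (rule lim[of _ _ C']) (use C'(2) in \<open>simp add: k_at_top\<close>)
  have F2: "(FF \<nu> \<longlongrightarrow> Finf \<nu>) at_top"
  proof (rule lim)
    fix x
    have "FF \<nu> x - Finf \<nu> = - Fp \<nu> x" using F_plus_Fp[of x] by linarith
    then show "\<bar>FF \<nu> x - Finf \<nu>\<bar> \<le> CF * exp (- x)" using Fp_le_exp[of x] by simp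
  qed
  have "(B \<longlongrightarrow> (\<nu>\<^sup>2 * evans \<nu> - \<nu> * Finf \<nu> + (3 * \<nu>\<^sup>2 - 1) * (1 - evans \<nu>) - evans \<nu>) *
      (\<nu>\<^sup>2 * 1 - \<nu> * 0 + (3 * \<nu>\<^sup>2 - 1) * (1 - 1) - 1) / lam + (\<nu> * evans \<nu> + Finf \<nu> - Finf \<nu>) * 1
      + evans \<nu> * (\<nu> * 1 + 0 - 0)) at_top"
    unfolding Bx[abs_def] z_def by (intro tendsto_intros m1 k1 F1 m2 k2 F2) (use lam0 in simp)
  then have "B 0 = (\<nu>\<^sup>2 * evans \<nu> - \<nu> * Finf \<nu> + (3 * \<nu>\<^sup>2 - 1) * (1 - evans \<nu>) - evans \<nu>) *
      (\<nu>\<^sup>2 * 1 - \<nu> * 0 + (3 * \<nu>\<^sup>2 - 1) * (1 - 1) - 1) / lam + (\<nu> * evans \<nu> + Finf \<nu> - Finf \<nu>) * 1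
      + evans \<nu> * (\<nu> * 1 + 0 - 0)"
    unfolding B by (rule tendsto_unique[OF trivial_limit_at_top_linorder tendsto_const])
  moreover have "(3 * \<nu>\<^sup>2 - 1) * (1 - evans \<nu>) = \<nu> * Finf \<nu>"
    using den_pos by (simp add: evans_def)
  then have "\<nu>\<^sup>2 * evans \<nu> - \<nu> * Finf \<nu> + (3 * \<nu>\<^sup>2 - 1) * (1 - evans \<nu>) - evans \<nu> = (\<nu>\<^sup>2 - 1) * evans \<nu>"
    by (simp add: left_diff_distrib)
  ultimately have "B 0 = (\<nu>\<^sup>2 - 1) * evans \<nu> * (\<nu>\<^sup>2 - 1) / lam + 2 * \<nu> * evans \<nu>"
    by simp
  also have "(\<nu>\<^sup>2 - 1) * evans \<nu> * (\<nu>\<^sup>2 - 1) / lam = (\<nu>\<^sup>2 - 1) * evans \<nu> / \<nu>"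
    using n2 nu by (simp add: lam)
  also have "(\<nu>\<^sup>2 - 1) * evans \<nu> / \<nu> + 2 * \<nu> * evans \<nu> = evans \<nu> * (3 * \<nu>\<^sup>2 - 1) / \<nu>"
    using nu by (simp add: field_simps power2_eq_square)
  finally show ?thesis by (simp add: B_def power2_eq_square)
qed

end

section \<open>The Jost solution at and near \<nu> = 1\<close>

context soliton begin

text \<open>This is \<open>exp (- x) * Q' x / cQ\<close>. At \<open>\<nu> = 1\<close> the spectral
  parameter is \<open>0\<close>, and the equation is solved by the translation mode
  \<open>Q'\<close>.\<close>

definition "mh x = - th x * ell x"

lemma ell_deriv: "(ell has_real_derivative mh x - ell x) (at x)"
proof -
  have "((\<lambda>x. exp (- x) * Q p x / cQ) has_real_derivative (- exp (- x) * Q p x + Q1 x * exp (- x)) / cQ) (at x)"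
    by (intro DERIV_cdivide DERIV_mult Q_deriv) (auto intro!: derivative_eq_intros)
  then show ?thesis
    unfolding ell_def[abs_def]
    by (rule DERIV_cong) (use cQ_pos in \<open>simp add: mh_def Q1_def ell_def field_simps\<close>)
qed

lemma mh_le: "\<bar>mh x\<bar> \<le> 1"
proof -
  have "\<bar>th x\<bar> * \<bar>ell x\<bar> \<le> 1 * 1"
    using th_bound[of x] ell_bounds[of x] by (intro mult_mono) auto
  then show ?thesis by (simp add: mh_def abs_mult)
qed

lemma left_bounds: "1 - ell x \<le> exp x" "1 + th x \<le> 2 * exp x"
proof -
  consider "x \<le> 0" | "x > 0" by linarith
  then have "1 - ell x \<le> exp x \<and> 1 + th x \<le> 2 * exp x"
  proof cases
    case 1
    then show ?thesis using ell_bounds(3)[of x] th_lower[of x] exp_n_le[of x] by linarith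
  next
    case 2
    then have "exp x \<ge> 1" by simp
    then show ?thesis using ell_bounds(1)[of x] th_bound[of x] by linarith
  qed
  then show "1 - ell x \<le> exp x" "1 + th x \<le> 2 * exp x" by auto
qed

lemma u_hat_le: "\<bar>1 - mh x\<bar> \<le> 3 * exp x"
proof -
  have eq: "1 - mh x = (1 - ell x) + (1 + th x) * ell x" by (simp add: mh_def algebra_simps)
  have "(1 + th x) * ell x \<le> (2 * exp x) * 1"
    using left_bounds(2)[of x] ell_bounds[of x] by (intro mult_mono) auto
  moreover have "(1 + th x) * ell x \<ge> 0" using th_bound[of x] ell_bounds(1)[of x] by auto
  ultimately show ?thesis unfolding eq using left_bounds(1)[of x] ell_bounds(2)[of x] by linarith
qed

lemma cont_th: "continuous_on A th"
  using th_deriv DERIV_isCont by (blast intro: continuous_at_imp_continuous_on)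

lemma cont_ell: "continuous_on A ell"
  using ell_deriv DERIV_isCont by (blast intro: continuous_at_imp_continuous_on)

lemma mh_cont: "continuous_on UNIV mh"
  unfolding mh_def[abs_def] by (intro continuous_intros cont_th cont_ell)

lemma mh_eq: "mh x = exp (- x) * Q1 x / cQ"
  using cQ_pos by (simp add: mh_def Q1_def ell_def)

lemma mh_deriv: "(mh has_real_derivative exp (- x) * (Q2 x - Q1 x) / cQ) (at x)"
proof -
  have "((\<lambda>x. exp (- x) * Q1 x / cQ) has_real_derivative (- exp (- x) * Q1 x + Q2 x * exp (- x)) / cQ) (at x)"
    by (intro DERIV_cdivide DERIV_mult Q1_deriv) (auto intro!: derivative_eq_intros)
  then show ?thesis unfolding mh_eq[abs_def] by (simp add: algebra_simps)
qed

text \<open>An antiderivative of \<open>q * mh\<close> found from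
  \<open>Q''' = (1 - q) * Q'\<close>. The constant \<open>2\<close> makes it vanish at
  \<open>-\<infinity>\<close>, where \<open>Q'\<close> and \<open>Q''\<close> both behave like
  \<open>cQ * exp x\<close>.\<close>

definition "Fh x = 2 - exp (- x) * (Q2 x + Q1 x) / cQ"

lemma Jq_mh: "Jq mh x = Fh x"
proof -
  have "((\<lambda>x. 2 - exp (- x) * (Q2 x + Q1 x) / cQ) has_real_derivative
     0 - (- exp (- x) * (Q2 x + Q1 x) + ((1 - q x) * Q1 x + Q2 x) * exp (- x)) / cQ) (at x)" for x
    by (intro derivative_intros DERIV_cdivide DERIV_mult DERIV_add Q1_deriv Q2_deriv) (auto intro!: derivative_eq_intros)
  moreover have "0 - (- exp (- x) * (Q2 x + Q1 x) + ((1 - q x) * Q1 x + Q2 x) * exp (- x)) / cQ = q x * mh x" for x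
    unfolding mh_eq using cQ_pos by (simp add: field_simps)
  ultimately have d: "(Fh has_real_derivative q x * mh x - 0 * Fh x) (at x)" for x
    by (simp add: Fh_def[abs_def])
  have b: "\<bar>Fh x\<bar> \<le> (4 + CQ) / exp (- x)" for x
  proof -
    have "exp (- x) * (Q2 x + Q1 x) / cQ = ell x * ((1 - q x / real p) - th x)"
      unfolding Q2_eq Q1_def ell_def using cQ_pos p5 by (simp add: field_simps)
    then have eq: "Fh x = 2 * (1 - ell x) + (1 + th x) * ell x + ell x * (q x / real p)"
      by (simp add: Fh_def algebra_simps)
    have "(1 + th x) * ell x \<le> (2 * exp x) * 1"
      using left_bounds(2)[of x] ell_bounds[of x] by (intro mult_mono) auto
    moreover have "(1 + th x) * ell x \<ge> 0" using th_bound[of x] ell_bounds(1)[of x] by auto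
    moreover have "ell x * (q x / real p) \<ge> 0" using q_pos[of x] ell_bounds(1)[of x] by auto
    moreover have "ell x * (q x / real p) \<le> 1 * (CQ * exp x)"
    proof (intro mult_mono)
      have "q x / real p \<le> CQ * exp (- \<bar>x\<bar>)" using q_bound[of x] p5 by (simp add: field_simps)
      also have "\<dots> \<le> CQ * exp x" by (intro mult_left_mono) auto
      finally show "q x / real p \<le> CQ * exp x" .
    qed (use ell_bounds q_pos[of x] in auto)
    moreover have "\<bar>2 * a + b + c\<bar> \<le> 2 * e + 2 * e + f"
      if "b \<le> 2 * e * 1" "b \<ge> 0" "c \<ge> 0" "c \<le> 1 * f" "a \<le> e" "a \<ge> 0" for a b c e f :: real
      using that by linarith
    ultimately have "\<bar>Fh x\<bar> \<le> 2 * exp x + 2 * exp x + CQ * exp x"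
      unfolding eq using left_bounds(1)[of x] ell_bounds(2)[of x] by (simp only: diff_ge_0_iff_ge)
    also have "\<dots> = (4 + CQ) / exp (- x)" by (simp add: exp_minus divide_inverse distrib_right)
    finally show ?thesis .
  qed
  show ?thesis
    unfolding Jq_def
    by (rule fwd_dominated.fwd_unique[OF Jq_dom[OF mh_cont mh_le], symmetric]) (use d b in auto)
qed

text \<open>The pair \<open>1 - mh\<close>, \<open>2 * (1 - mh)\<close> solves the system that
  characterises \<open>W 1 (Jq mh)\<close>. Hence \<open>mh\<close> satisfies the Volterra equation
  exactly, and stability with defect zero identifies it.\<close>

lemma jost_m_1: "jost_m 1 x = mh x"
proof -
  interpret j: jost p 1 by standard simp
  have Jc: "continuous_on UNIV (Jq mh)" by (rule Jq_cont[OF mh_cont mh_le])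
  have d: "damped (3 * 1 / 2) (disc_root 1) (- 1) (real p * CQ * 1) (\<lambda>x. exp (- x)) (Jq mh)"
  proof (rule damped_W[OF order_refl weight_growth_exp_minus _ Jc])
    show "\<bar>Jq mh x\<bar> \<le> real p * CQ * 1 / exp (- x)" for x
      using Jq_le_exp[OF mh_cont mh_le, of x] unfolding exp_minus divide_inverse inverse_inverse_eq .
    show "- 1 < 3 * 1 / 2 - Re (disc_root 1)" using W_rate[of 1] by simp
  qed
  have u: "1 - mh x = W 1 (Jq mh) x" for x
  proof (rule j.W_unique[OF d, where k = "\<lambda>x. 2 * (1 - mh x)" and M = 6])
    fix x
    have dm: "((\<lambda>x. 1 - mh x) has_real_derivative 0 - exp (- x) * (Q2 x - Q1 x) / cQ) (at x)"
      by (intro DERIV_diff mh_deriv DERIV_const)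
    have e: "0 - exp (- x) * (Q2 x - Q1 x) / cQ = Jq mh x - 2 * (1 - mh x)"
      unfolding Jq_mh Fh_def mh_eq using cQ_pos by (simp add: field_simps)
    show "((\<lambda>x. 1 - mh x) has_real_derivative Jq mh x - 2 * (1 - mh x)) (at x)"
      using dm unfolding e .
    show "((\<lambda>x. 2 * (1 - mh x)) has_real_derivative
      2 * 1 * Jq mh x - 3 * 1 * (2 * (1 - mh x)) + (3 * 1\<^sup>2 - 1) * (1 - mh x)) (at x)"
      by (rule DERIV_cong[OF DERIV_cmult[OF dm[unfolded e]]]) simp
    show "\<bar>1 - mh x\<bar> \<le> 6 / exp (- x)" "\<bar>2 * (1 - mh x)\<bar> \<le> 6 / exp (- x)"
      using u_hat_le[of x] by (auto simp: exp_minus divide_inverse abs_mult)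
  qed
  have "\<bar>jost_m 1 x - mh x\<bar> \<le> M0 * 0"
  proof (rule volterra_stable[OF _ j.m_cont j.m_le _ mh_cont mh_le])
    show "jost_m 1 x = 1 - W 1 (Jq (jost_m 1)) x" for x using j.m_eq[of x] by (simp add: FF_def)
    show "\<bar>mh x - (1 - W 1 (Jq mh) x)\<bar> \<le> 0" for x using u[of x] by simp
  qed simp
  then show ?thesis by simp
qed

lemma nn_1: "nn 1 x = ell x"
proof -
  interpret j: jost p 1 by standard simp
  show ?thesis
    unfolding nn_def
    by (rule fwd_dominated.fwd_unique[OF j.nn_dom, symmetric, where M = 1])
      (use ell_deriv ell_bounds jost_m_1 in \<open>auto simp: abs_le_iff less_imp_le intro: order_trans[of _ 0]\<close>)
qed

text \<open>Up to \<open>11 / 10\<close> the discriminant remains positive, before the branch point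
  at \<open>\<nu>^2 = 4 / 3\<close>, so here the square root is Lipschitz.\<close>

lemma disc_root_near_1:
  assumes "1 \<le> \<nu>" "\<nu> \<le> 11 / 10"
  shows "norm (disc_root \<nu> - disc_root 1) \<le> 4 * (\<nu> - 1)"
proof -
  have "\<nu>\<^sup>2 \<le> (11 / 10)\<^sup>2" "\<nu>\<^sup>2 \<ge> 1\<^sup>2" using assms by (intro power_mono; simp)+
  then have n2: "\<nu>\<^sup>2 \<le> 121 / 100" "\<nu>\<^sup>2 \<ge> 1" by (simp_all add: power2_eq_square)
  define d where "d = 1 - 3 * \<nu>\<^sup>2 / 4"
  have d: "d > 0" "d \<le> 1 / 4" using n2 by (simp_all add: d_def)
  have r: "disc_root \<nu> = of_real (sqrt d)" using n2 by (simp add: disc_root_def d_def complex_eq_iff max_def)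
  have r1: "disc_root 1 = of_real (1 / 2)"
    by (simp add: disc_root_def complex_eq_iff real_sqrt_divide)
  have n: "norm (disc_root \<nu> - disc_root 1) = \<bar>sqrt d - 1 / 2\<bar>"
    unfolding r r1 by (metis norm_of_real of_real_diff)
  have "(sqrt d - 1 / 2) * (sqrt d + 1 / 2) = d - 1 / 4"
    using d by (simp add: algebra_simps)
  then have "\<bar>sqrt d - 1 / 2\<bar> * (sqrt d + 1 / 2) = 1 / 4 - d"
    using d abs_mult[of "sqrt d - 1 / 2" "sqrt d + 1 / 2"] by (simp del: real_sqrt_abs2)
  moreover have "\<bar>sqrt d - 1 / 2\<bar> * (sqrt d + 1 / 2) \<ge> \<bar>sqrt d - 1 / 2\<bar> * (1 / 2)"
    using d by (intro mult_left_mono) auto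
  ultimately have "\<bar>sqrt d - 1 / 2\<bar> * (1 / 2) \<le> 1 / 4 - d" by (simp only:)
  moreover have "a \<le> 2 * y" if "a * (1 / 2) \<le> y" for a y :: real using that by linarith
  ultimately have "\<bar>sqrt d - 1 / 2\<bar> \<le> 2 * (1 / 4 - d)" by blast
  also have "\<dots> = 3 / 2 * (\<nu> + 1) * (\<nu> - 1)" by (simp add: d_def power2_eq_square field_simps)
  also have "\<dots> \<le> 4 * (\<nu> - 1)" using assms by (intro mult_right_mono) auto
  finally show ?thesis unfolding n .
qed

text \<open>The constant of \<open>jost_m_diff\<close> for \<open>L = 33 / 20\<close>, which is
  \<open>3 / 2 * (11 / 10)\<close>. The factor \<open>13 / 2\<close> is \<open>5 / 2 + 4\<close>,
  with \<open>4\<close> the Lipschitz constant of \<open>disc_root\<close> near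
  \<open>1\<close>.\<close>

definition "K1 = M0 * (M0 * Phi_max * (2 * (1 + 33 / 20) * (13 / 2)))"

lemma jost_m_near_1:
  assumes "1 \<le> \<nu>" "\<nu> \<le> 11 / 10"
  shows "\<bar>jost_m \<nu> x - mh x\<bar> \<le> K1 * (\<nu> - 1)"
proof -
  have "\<bar>jost_m \<nu> x - jost_m 1 x\<bar> \<le> M0 * (M0 * Phi_max * (2 * (1 + 33 / 20) * (5 / 2 * \<bar>\<nu> - 1\<bar> + norm (disc_root \<nu> - disc_root 1))))"
    using assms by (intro jost_m_diff) auto
  also have "\<dots> \<le> M0 * (M0 * Phi_max * (2 * (1 + 33 / 20) * (13 / 2 * (\<nu> - 1))))"
  proof -
    have "5 / 2 * \<bar>\<nu> - 1\<bar> + norm (disc_root \<nu> - disc_root 1) \<le> 13 / 2 * (\<nu> - 1)"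
      using disc_root_near_1[OF assms] assms abs_of_nonneg[of "\<nu> - 1"] by linarith
    then show ?thesis using Phi_max_pos by (intro mult_left_mono) auto
  qed
  finally show ?thesis unfolding jost_m_1 K1_def by (simp only: mult.assoc)
qed

lemma K1_nonneg: "K1 \<ge> 0" using Phi_max_pos by (simp add: K1_def)

text \<open>The three summands belong to three effects of moving \<open>\<nu>\<close> away from
  \<open>1\<close>: on the rate of the resolvent, on the Jost function, and on the factor
  \<open>exp (\<nu> * x)\<close>, in this order.\<close>

definition "K2 = M0 + K1 + 1"

lemma Y0_near_1:
  assumes nu: "1 \<le> \<nu>" "\<nu> \<le> 11 / 10" and x: "x \<le> 0"
  shows "\<bar>exp (\<nu> * x) * nn \<nu> x - Q p x / cQ\<bar> \<le> K2 * (\<nu> - 1)"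
proof -
  interpret j: jost p \<nu> by standard fact
  interpret j1: jost p 1 by standard simp
  have a: "\<bar>fwd \<nu> (jost_m \<nu>) x - fwd 1 (jost_m \<nu>) x\<bar> \<le> \<bar>\<nu> - 1\<bar> * (M0 / 1\<^sup>2) / 1"
    using nu by (intro fwd_param_diff[OF j.nn_dom]) auto
  interpret dd: fwd_dominated 1 0 "K1 * (\<nu> - 1)" "\<lambda>x. 1" "\<lambda>x. jost_m \<nu> x - jost_m 1 x"
    by standard (use weight_growth_1 j.m_cont j1.m_cont jost_m_near_1[OF nu] in \<open>auto intro!: continuous_intros simp: jost_m_1\<close>)
  have "fwd_dominated 1 0 M0 (\<lambda>x. 1) (\<lambda>x. - 1 * jost_m 1 x)"
    by standard (use weight_growth_1 j1.m_cont j1.m_le in \<open>auto intro!: continuous_intros\<close>)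
  moreover have "fwd_dominated 1 0 M0 (\<lambda>x. 1) (jost_m \<nu>)"
    by standard (use weight_growth_1 j.m_cont j.m_le in auto)
  ultimately have "fwd 1 (\<lambda>x. jost_m \<nu> x + - 1 * jost_m 1 x) x = fwd 1 (jost_m \<nu>) x + fwd 1 (\<lambda>x. - 1 * jost_m 1 x) x"
    by (intro fwd_add)
  then have "fwd 1 (\<lambda>x. jost_m \<nu> x - jost_m 1 x) x = fwd 1 (jost_m \<nu>) x - fwd 1 (jost_m 1) x"
    unfolding fwd_mult by simp
  with dd.abs_fwd_le[of x] have b: "\<bar>fwd 1 (jost_m \<nu>) x - fwd 1 (jost_m 1) x\<bar> \<le> K1 * (\<nu> - 1)" by simp
  have c: "\<bar>nn \<nu> x - ell x\<bar> \<le> (M0 + K1) * (\<nu> - 1)"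
  proof -
    have "\<bar>\<nu> - 1\<bar> * (M0 / 1\<^sup>2) / 1 = M0 * (\<nu> - 1)" using nu by simp
    then have "\<bar>fwd \<nu> (jost_m \<nu>) x - fwd 1 (jost_m 1) x\<bar> \<le> M0 * (\<nu> - 1) + K1 * (\<nu> - 1)"
      using a b by linarith
    then show ?thesis using nn_1[of x] unfolding nn_def distrib_right by simp
  qed
  have e1: "exp (\<nu> * x) \<le> 1" using nu x by (simp add: mult_nonneg_nonpos)
  have "Q p x / cQ = exp x * ell x" by (simp add: ell_def exp_minus)
  then have eq: "exp (\<nu> * x) * nn \<nu> x - Q p x / cQ = exp (\<nu> * x) * (nn \<nu> x - ell x) - (exp x - exp (\<nu> * x)) * ell x"
    by (simp add: algebra_simps)
  have "exp (\<nu> * x) = exp x * exp ((\<nu> - 1) * x)" by (simp add: exp_add[symmetric] algebra_simps)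
  then have "exp x - exp (\<nu> * x) = exp x * (1 - exp ((\<nu> - 1) * x))" by (simp add: algebra_simps)
  also have "\<dots> \<le> exp x * (- ((\<nu> - 1) * x))"
    by (rule mult_left_mono) (use exp_ge_add_one_self[of "(\<nu> - 1) * x"] in linarith, simp)
  also have "\<dots> = (\<nu> - 1) * (exp x * (- x))" by simp
  also have "\<dots> \<le> (\<nu> - 1) * (exp x * exp (- x))"
    using nu exp_ge_add_one_self[of "- x"] by (intro mult_left_mono) auto
  also have "\<dots> = \<nu> - 1" by (simp add: exp_add[symmetric])
  finally have f: "exp x - exp (\<nu> * x) \<le> \<nu> - 1" .
  have f0: "exp x - exp (\<nu> * x) \<ge> 0" using mult_right_mono_neg[of 1 \<nu> x] nu x by simp
  have "\<bar>exp (\<nu> * x) * (nn \<nu> x - ell x)\<bar> \<le> 1 * ((M0 + K1) * (\<nu> - 1))"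
    unfolding abs_mult using c e1 by (intro mult_mono) auto
  moreover have "\<bar>(exp x - exp (\<nu> * x)) * ell x\<bar> \<le> (\<nu> - 1) * 1"
    unfolding abs_mult using f f0 ell_bounds[of x] nu by (intro mult_mono) auto
  ultimately show ?thesis unfolding eq K2_def by (simp add: distrib_right)
qed

lemma K2_pos: "K2 > 0" using K1_nonneg by (simp add: K2_def add_pos_nonneg)

end

section \<open>The sign of the Evans function just beyond \<nu> = 1\<close>

context soliton begin

text \<open>The derivative of the rescaled solitons with respect to the speed.\<close>

definition "S x = Q p x / n + x * Q1 x / 2"
definition "S1 x = Q1 x / n + Q1 x / 2 + x * Q2 x / 2"

lemma S_deriv: "(S has_real_derivative S1 x) (at x)"
  unfolding S_def[abs_def] S1_def
  by (rule DERIV_cong[OF DERIV_add[OF DERIV_cdivide[OF Q_deriv] DERIV_cdivide[OF DERIV_mult[OF DERIV_ident Q1_deriv]]]])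
    (simp add: add_divide_distrib mult.commute)

text \<open>The equation \<open>Q_c'' + Q_c ^ p = c * Q_c\<close> differentiated in \<open>c\<close>
  at \<open>c = 1\<close>.\<close>

lemma S1_deriv: "(S1 has_real_derivative (1 - q x) * S x + Q p x) (at x)"
proof -
  have "(S1 has_real_derivative Q2 x / n + Q2 x / 2 + (Q2 x / 2 + x * ((1 - q x) * Q1 x) / 2)) (at x)"
    unfolding S1_def[abs_def]
    by (rule DERIV_cong[OF DERIV_add[OF DERIV_add[OF DERIV_cdivide[OF Q1_deriv] DERIV_cdivide[OF Q1_deriv]]
          DERIV_cdivide[OF DERIV_mult[OF DERIV_ident Q2_deriv]]]])
      (simp add: add_divide_distrib mult_ac)
  moreover have "Q2 x / n + Q2 x / 2 + (Q2 x / 2 + x * ((1 - q x) * Q1 x) / 2) = (1 - q x) * S x + Q p x"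
  proof -
    have "Q2 x / n + Q2 x = (1 - q x) * (Q p x / n) + Q p x"
      unfolding Q2_eq using n5 p5 by (simp add: field_simps)
    then show ?thesis by (simp add: S_def algebra_simps)
  qed
  ultimately show ?thesis by simp
qed

lemma Q1_0: "Q1 0 = 0" and S1_0: "S1 0 = 0" and S_0: "S 0 = Q p 0 / n"
  by (simp_all add: Q1_def S1_def S_def th_def)

lemma Q2_0: "Q2 0 = - (n / 2) * Q p 0"
proof -
  have "q 0 = real p * (real p + 1) / 2" by (simp add: q_th th_def)
  then show ?thesis unfolding Q2_eq using p5 by (simp add: field_simps)
qed

lemma Q0_ge_1: "Q p 0 \<ge> 1" using Q_lower[of 0] by simp

lemma S_le: assumes "x \<le> 0" shows "\<bar>S x\<bar> \<le> CQ * exp (x / 2)"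
proof -
  have "\<bar>S x\<bar> \<le> Q p x / n + \<bar>x\<bar> * \<bar>Q1 x\<bar> / 2"
    unfolding S_def using Q_pos[of x] n5 by (intro order_trans[OF abs_triangle_ineq]) (simp add: abs_mult)
  also have "\<dots> \<le> Q p x / 1 + \<bar>x\<bar> * Q p x / 2"
    using Q_pos[of x] n5 Q1_bound[of x] by (intro add_mono divide_left_mono divide_right_mono mult_left_mono) auto
  also have "\<dots> = Q p x * (1 + - x / 2)" using assms by (simp add: algebra_simps)
  also have "\<dots> \<le> (CQ * exp x) * exp (- x / 2)"
    using Q_upper[of x] assms exp_ge_add_one_self[of "- x / 2"] by (intro mult_mono) auto
  also have "\<dots> = CQ * exp (x / 2)"
    by (simp add: mult.assoc exp_add[symmetric])
  finally show ?thesis .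
qed

lemma Q2_le: "\<bar>Q2 x\<bar> \<le> CQ * CQ"
  by (rule order_trans[OF Q2_bound mult_left_mono[OF Q_le]]) simp

text \<open>By scaling, the integral of the square of \<open>Q_c\<close> is proportional to
  \<open>c\<close> to the power \<open>2 / n - 1 / 2\<close>, which is \<open>- 2 * kappa\<close>.
  Positivity of \<open>kappa\<close> means that the mass decreases as the speed grows.\<close>

definition "kappa = 1 / 4 - 1 / n"

text \<open>This is where supercriticality \<open>p > 5\<close> enters.\<close>

lemma kappa_pos: "kappa > 0"
  using p5 by (simp add: kappa_def field_simps)

end

context jost begin

lemma lam_nonneg: "lam \<ge> 2 * (\<nu> - 1)"
proof -
  have "lam - 2 * (\<nu> - 1) = (\<nu> - 1) * (\<nu>\<^sup>2 + \<nu> - 2)"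
    by (simp add: lam_def algebra_simps power2_eq_square power3_eq_cube)
  moreover have "\<nu>\<^sup>2 + \<nu> - 2 \<ge> 0" using one_le_power[OF nu1, of 2] nu1 by linarith
  ultimately show ?thesis using nu1 mult_nonneg_nonneg[of "\<nu> - 1" "\<nu>\<^sup>2 + \<nu> - 2"] by linarith
qed

lemma Y_le: "\<exists>K. \<forall>x\<le>0. \<bar>Y0 x\<bar> \<le> K * exp x \<and> \<bar>Y1 x\<bar> \<le> K * exp x \<and> \<bar>Y2 x\<bar> \<le> K * exp x"
proof -
  obtain Ck where Ck: "\<And>x. \<bar>kk \<nu> x\<bar> \<le> Ck" using k_le by blast
  define K where "K = M0 + \<nu> * M0 + Ck + M0 * Phi_max"
  have e: "exp (\<nu> * x) \<le> exp x" if "x \<le> 0" for x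
    using mult_right_mono_neg[of 1 \<nu> x] that nu1 by simp
  have Ck0: "Ck \<ge> 0" using order_trans[OF abs_ge_zero Ck[of 0]] .
  have b: "\<bar>exp (\<nu> * x) * z\<bar> \<le> K * exp x" if "x \<le> 0" "\<bar>z\<bar> \<le> K" for x z
    unfolding abs_mult using e[OF that(1)] that mult_mono[of "exp (\<nu> * x)" "exp x" "\<bar>z\<bar>" K] by (simp add: mult.commute)
  have "\<nu> * M0 \<ge> 0" "M0 * Phi_max \<ge> 0" using nu1 Phi_max_pos by auto
  then have K: "\<bar>nn \<nu> x\<bar> \<le> K" "\<bar>jost_m \<nu> x\<bar> \<le> K" for x
    using n_le[of x] m_le[of x] Ck0 unfolding K_def by linarith+
  have "\<bar>\<nu> * jost_m \<nu> x\<bar> \<le> \<nu> * M0" for x unfolding abs_mult using nu1 m_le[of x] by (auto intro!: mult_mono)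
  then have K2: "\<bar>\<nu> * jost_m \<nu> x + kk \<nu> x - FF \<nu> x\<bar> \<le> K" for x
    unfolding K_def using Ck[of x] F_le[of x] exp_gt_zero[of "4 * Phi_max"]
    by (smt (verit))
  show ?thesis
    unfolding Y0_def Y1_def Y2_def using b K K2 by blast
qed

text \<open>A Wronskian identity: \<open>Q1 * Y2 - Q2 * Y1\<close> has derivative
  \<open>lam * Q1 * Y0\<close>. Integrated over the left half-line with \<open>Y0\<close> replaced
  by its value \<open>Q / cQ\<close> at \<open>\<nu> = 1\<close> it gives the main term, and since
  \<open>Q1 0 = 0\<close> only \<open>Y1 0\<close> is left on the other side.\<close>

lemma E2_estimate:
  assumes nu: "\<nu> \<le> 11 / 10"
  shows "\<bar>n / 2 * Q p 0 * Y1 0 - lam * (Q p 0)\<^sup>2 / (2 * cQ)\<bar> \<le> lam * (K2 * (\<nu> - 1) * CQ)"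
proof -
  define \<Theta> where "\<Theta> x = Q1 x * Y2 x - Q2 x * Y1 x - lam / cQ * (Q p x)\<^sup>2 / 2" for x
  define L where "L = lam * (K2 * (\<nu> - 1) * CQ)"
  have lam0: "lam \<ge> 0" using lam_nonneg nu1 by simp
  have d\<Theta>: "(\<Theta> has_real_derivative lam * Q1 x * (Y0 x - Q p x / cQ)) (at x)" for x
    unfolding \<Theta>_def[abs_def]
    by (rule DERIV_cong[OF DERIV_diff[OF DERIV_diff[OF DERIV_mult[OF Q1_deriv Y2_deriv] DERIV_mult[OF Q2_deriv Y1_deriv]]
          DERIV_cdivide[OF DERIV_cmult[OF DERIV_power[OF Q_deriv, where n = 2]]]]])
      (simp add: algebra_simps)
  have b: "\<bar>lam * Q1 x * (Y0 x - Q p x / cQ)\<bar> \<le> L * exp x" if "x \<le> 0" for x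
  proof -
    have "\<bar>Q1 x\<bar> \<le> CQ * exp x" using Q1_bound[of x] Q_upper[of x] that by simp
    moreover have "\<bar>Y0 x - Q p x / cQ\<bar> \<le> K2 * (\<nu> - 1)"
      using Y0_near_1[OF nu1 nu that] by (simp add: Y0_def)
    ultimately have "\<bar>Q1 x\<bar> * \<bar>Y0 x - Q p x / cQ\<bar> \<le> (CQ * exp x) * (K2 * (\<nu> - 1))"
      by (intro mult_mono) auto
    then have "lam * (\<bar>Q1 x\<bar> * \<bar>Y0 x - Q p x / cQ\<bar>) \<le> lam * ((CQ * exp x) * (K2 * (\<nu> - 1)))"
      using lam0 by (rule mult_left_mono)
    then show ?thesis unfolding L_def abs_mult using lam0 by (simp add: mult_ac)
  qed
  obtain K where K: "\<And>x. x \<le> 0 \<Longrightarrow> \<bar>Y1 x\<bar> \<le> K * exp x" "\<And>x. x \<le> 0 \<Longrightarrow> \<bar>Y2 x\<bar> \<le> K * exp x"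
    using Y_le by blast
  have K0: "K \<ge> 0" using order_trans[OF abs_ge_zero K(1)[of 0]] by simp
  have L0: "L \<ge> 0" unfolding L_def using lam0 K2_pos nu1 by (intro mult_nonneg_nonneg) auto
  \<comment> \<open>Its size is irrelevant for the result; it merely certifies that
    \<open>\<Theta>\<close> vanishes at \<open>-\<infinity>\<close>.\<close>
  define K' where "K' = L + CQ * K + CQ * CQ * K + lam / cQ * (CQ * CQ) / 2"
  have bd: "\<bar>\<Theta> x\<bar> \<le> (K' - L) * exp (x / 2)" if "x \<le> 0" for x
  proof -
    have Q: "Q p x \<le> CQ * exp x" using Q_upper[of x] that by simp
    have "\<bar>Q1 x * Y2 x\<bar> \<le> CQ * (K * exp x)"
      unfolding abs_mult using K(2)[OF that] Q1_bound[of x] Q_le[of x] by (intro mult_mono) auto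
    moreover have "\<bar>Q2 x * Y1 x\<bar> \<le> (CQ * CQ) * (K * exp x)"
      unfolding abs_mult using K(1)[OF that] by (intro mult_mono Q2_le) auto
    moreover have "\<bar>lam / cQ * (Q p x)\<^sup>2 / 2\<bar> \<le> lam / cQ * (CQ * (CQ * exp x)) / 2"
    proof -
      have "Q p x * Q p x \<le> CQ * (CQ * exp x)"
        using Q_le[of x] Q Q_pos[of x] by (intro mult_mono) auto
      then have "lam / cQ * (Q p x * Q p x) \<le> lam / cQ * (CQ * (CQ * exp x))"
        using lam0 cQ_pos by (intro mult_left_mono) auto
      moreover have "0 \<le> lam / cQ * (Q p x * Q p x) / 2" using lam0 cQ_pos by simp
      ultimately show ?thesis unfolding power2_eq_square
        by (simp only: abs_of_nonneg divide_right_mono zero_le_numeral)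
    qed
    ultimately have "\<bar>\<Theta> x\<bar> \<le> CQ * (K * exp x) + (CQ * CQ) * (K * exp x) + lam / cQ * (CQ * (CQ * exp x)) / 2"
      unfolding \<Theta>_def by linarith
    also have "\<dots> = (K' - L) * exp x" by (simp add: K'_def algebra_simps)
    also have "\<dots> \<le> (K' - L) * exp (x / 2)"
      using K0 lam0 cQ_pos that by (intro mult_left_mono) (auto simp: K'_def intro!: add_nonneg_nonneg mult_nonneg_nonneg)
    finally show ?thesis .
  qed
  have e: "L * exp x \<le> L * exp (x / 2)" "0 \<le> L * exp x" if "x \<le> 0" for x
    using that L0 by (auto intro!: mult_left_mono)
  have "L * exp 0 - \<Theta> 0 \<ge> 0"
  proof (rule nonneg_at_0_if_nondecreasing_from_bot[where h = "\<lambda>x. L * exp x - \<Theta> x"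
        and h' = "\<lambda>x. L * exp x - lam * Q1 x * (Y0 x - Q p x / cQ)" and K = K'])
    fix x :: real assume x: "x \<le> 0"
    show "((\<lambda>x. L * exp x - \<Theta> x) has_real_derivative L * exp x - lam * Q1 x * (Y0 x - Q p x / cQ)) (at x)"
      by (intro DERIV_diff d\<Theta> DERIV_cmult DERIV_exp)
    show "0 \<le> L * exp x - lam * Q1 x * (Y0 x - Q p x / cQ)" using b[OF x] by linarith
    show "- K' * exp (x / 2) \<le> L * exp x - \<Theta> x"
      using bd[OF x] e[OF x] L0 mult_nonneg_nonneg[OF L0 exp_ge_zero[of "x / 2"]] unfolding left_diff_distrib by linarith
  qed
  moreover have "L * exp 0 + \<Theta> 0 \<ge> 0"
  proof (rule nonneg_at_0_if_nondecreasing_from_bot[where h = "\<lambda>x. L * exp x + \<Theta> x"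
        and h' = "\<lambda>x. L * exp x + lam * Q1 x * (Y0 x - Q p x / cQ)" and K = K'])
    fix x :: real assume x: "x \<le> 0"
    show "((\<lambda>x. L * exp x + \<Theta> x) has_real_derivative L * exp x + lam * Q1 x * (Y0 x - Q p x / cQ)) (at x)"
      by (intro DERIV_add d\<Theta> DERIV_cmult DERIV_exp)
    show "0 \<le> L * exp x + lam * Q1 x * (Y0 x - Q p x / cQ)" using b[OF x] by linarith
    show "- K' * exp (x / 2) \<le> L * exp x + \<Theta> x"
      using bd[OF x] e[OF x] L0 mult_nonneg_nonneg[OF L0 exp_ge_zero[of "x / 2"]] unfolding left_diff_distrib by linarith
  qed
  ultimately have "\<bar>\<Theta> 0\<bar> \<le> L" by simp
  moreover have "\<Theta> 0 = n / 2 * Q p 0 * Y1 0 - lam * (Q p 0)\<^sup>2 / (2 * cQ)"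
    by (simp add: \<Theta>_def Q1_0 Q2_0)
  ultimately show ?thesis unfolding L_def by simp
qed

text \<open>\<open>Q1 - lam * S\<close> solves the adjoint of the equation for \<open>Y0\<close> up
  to \<open>lam^2 * S\<close>, so the bilinear concomitant \<open>B\<close> of the two satisfies
  \<open>B' = lam^2 * S * Y0\<close>. To leading order \<open>Y0\<close> is \<open>Q / cQ\<close>,
  and over the left half-line the integral of \<open>S * Q\<close> equals \<open>- kappa\<close>
  times that of \<open>Q^2\<close>: this is the negative term. The bound
  \<open>exp x \<le> Q\<close> makes the integral of \<open>Q^2\<close> at least
  \<open>1 / 2\<close>.\<close>

lemma E1_estimate:
  assumes nu: "\<nu> \<le> 11 / 10"
  shows "Q2 0 * Y1 0 + lam * S 0 * Y2 0 + lam * Q p 0 * Y0 0 \<le> lam\<^sup>2 * (2 * CQ * K2 * (\<nu> - 1) - kappa / (2 * cQ))"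
proof -
  define B where "B x = (Q2 x - lam * S1 x) * Y1 x + (lam * S x - Q1 x) * Y2 x + lam * Q p x * Y0 x" for x
  define G where "G x = B x - lam\<^sup>2 / cQ * (x * (Q p x)\<^sup>2 / 4)" for x
  have lam0: "lam \<ge> 0" using lam_nonneg nu1 by simp
  have dB: "(B has_real_derivative lam\<^sup>2 * S x * Y0 x) (at x)" for x
    unfolding B_def[abs_def]
    by (rule derivative_eq_intros Q_deriv Q1_deriv Q2_deriv S_deriv S1_deriv Y0_deriv Y1_deriv Y2_deriv refl)+
      (simp add: algebra_simps power2_eq_square)
  \<comment> \<open>The derivative of \<open>x * Q^2 / 4\<close>. This function vanishes at both
    ends of the half-line, which gives the integral of \<open>S * Q\<close> without computing that
    of \<open>Q^2\<close>.\<close>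
  have SQ: "(Q p x)\<^sup>2 / 4 + x * (Q p x * Q1 x) / 2 = S x * Q p x + kappa * (Q p x)\<^sup>2" for x
    by (simp add: S_def kappa_def algebra_simps power2_eq_square)
  have dG: "(G has_real_derivative lam\<^sup>2 * (S x * (Y0 x - Q p x / cQ) - kappa / cQ * (Q p x)\<^sup>2)) (at x)" for x
  proof -
    have "((\<lambda>x. x * (Q p x)\<^sup>2 / 4) has_real_derivative (Q p x)\<^sup>2 / 4 + x * (Q p x * Q1 x) / 2) (at x)"
      by (rule DERIV_cong[OF DERIV_cdivide[OF DERIV_mult[OF DERIV_ident DERIV_power[OF Q_deriv, where n = 2]]]])
        (simp add: add_divide_distrib mult_ac)
    then have "(G has_real_derivative lam\<^sup>2 * S x * Y0 x - lam\<^sup>2 / cQ * (S x * Q p x + kappa * (Q p x)\<^sup>2)) (at x)"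
      unfolding G_def[abs_def] SQ by (intro DERIV_diff dB DERIV_cmult)
    then show ?thesis by (simp add: algebra_simps)
  qed
  define c1 where "c1 = CQ * K2 * (\<nu> - 1)"
  define c2 where "c2 = kappa / cQ"
  have c1: "c1 \<ge> 0" and c2: "c2 \<ge> 0"
    using K2_pos nu1 kappa_pos cQ_pos by (auto simp: c1_def c2_def)
  \<comment> \<open>The integrated form of the bound on the derivative of \<open>G\<close>: the
    coefficients \<open>2 * c1\<close> and \<open>c2 / 2\<close> arise by integrating
    \<open>c1 * exp (x / 2)\<close> and \<open>c2 * exp (2 * x)\<close>.\<close>
  define H where "H x = lam\<^sup>2 * (2 * c1 * exp (x / 2) - c2 / 2 * exp (2 * x)) - G x" for x
  obtain K where K: "\<And>x. x \<le> 0 \<Longrightarrow> \<bar>Y0 x\<bar> \<le> K * exp x" "\<And>x. x \<le> 0 \<Longrightarrow> \<bar>Y1 x\<bar> \<le> K * exp x" "\<And>x. x \<le> 0 \<Longrightarrow> \<bar>Y2 x\<bar> \<le> K * exp x"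
    using Y_le by blast
  have K0: "K \<ge> 0" using order_trans[OF abs_ge_zero K(1)[of 0]] by simp
  define K' where "K' = (CQ * CQ + lam * (2 * CQ + CQ * CQ)) * K + (lam * CQ + CQ) * K + lam * CQ * K + lam\<^sup>2 / cQ * CQ\<^sup>2 + lam\<^sup>2 * c2"
  have "H 0 \<ge> 0"
  proof (rule nonneg_at_0_if_nondecreasing_from_bot[where K = K'])
    fix x :: real assume x: "x \<le> 0"
    show "(H has_real_derivative lam\<^sup>2 * (c1 * exp (x / 2) - c2 * exp (2 * x)) -
        lam\<^sup>2 * (S x * (Y0 x - Q p x / cQ) - kappa / cQ * (Q p x)\<^sup>2)) (at x)"
    proof -
      have e1: "((\<lambda>x. exp (x / 2)) has_real_derivative exp (x / 2) / 2) (at x)"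
        by (rule DERIV_cong[OF DERIV_chain2[OF DERIV_exp DERIV_cdivide[OF DERIV_ident]]]) simp
      have e2: "((\<lambda>x. exp (2 * x)) has_real_derivative 2 * exp (2 * x)) (at x)"
        by (rule DERIV_cong[OF DERIV_chain2[OF DERIV_exp DERIV_cmult[OF DERIV_ident]]]) simp
      show ?thesis
        unfolding H_def[abs_def]
        by (rule DERIV_cong[OF DERIV_diff[OF DERIV_cmult[OF DERIV_diff[OF DERIV_cmult[OF e1] DERIV_cmult[OF e2]]] dG]]) simp
    qed
    have "\<bar>S x * (Y0 x - Q p x / cQ)\<bar> \<le> (CQ * exp (x / 2)) * (K2 * (\<nu> - 1))"
      unfolding abs_mult using S_le[OF x] Y0_near_1[OF nu1 nu x] by (intro mult_mono) (auto simp: Y0_def)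
    then have a: "S x * (Y0 x - Q p x / cQ) \<le> c1 * exp (x / 2)" by (simp add: c1_def mult_ac abs_le_iff)
    have "exp x ^ 2 \<le> (Q p x)\<^sup>2" using Q_lower[of x] x by (intro power_mono) auto
    then have "exp (2 * x) \<le> (Q p x)\<^sup>2" by (simp add: power2_eq_square exp_add[symmetric])
    then have "c2 * exp (2 * x) \<le> c2 * (Q p x)\<^sup>2" using c2 by (rule mult_left_mono)
    with a have "0 \<le> lam\<^sup>2 * ((c1 * exp (x / 2) - c2 * exp (2 * x)) - (S x * (Y0 x - Q p x / cQ) - c2 * (Q p x)\<^sup>2))"
      by (intro mult_nonneg_nonneg) auto
    then show "0 \<le> lam\<^sup>2 * (c1 * exp (x / 2) - c2 * exp (2 * x)) - lam\<^sup>2 * (S x * (Y0 x - Q p x / cQ) - kappa / cQ * (Q p x)\<^sup>2)"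
      by (simp add: c2_def right_diff_distrib)
    have Q: "Q p x \<le> CQ * exp x" using Q_upper[of x] x by simp
    have xe: "\<bar>x\<bar> * exp x \<le> 1"
      using exp_ge_add_one_self[of "- x"] x mult_right_mono[of "- x" "exp (- x)" "exp x"]
      by (simp add: exp_add[symmetric])
    have xQ: "\<bar>x\<bar> * Q p x \<le> CQ"
    proof -
      have "\<bar>x\<bar> * Q p x \<le> \<bar>x\<bar> * (CQ * exp x)" by (rule mult_left_mono[OF Q]) simp
      also have "\<dots> = CQ * (\<bar>x\<bar> * exp x)" by (simp only: mult_ac)
      also have "\<dots> \<le> CQ * 1" by (rule mult_left_mono[OF xe]) simp
      finally show ?thesis by simp
    qed
    have Q2b: "\<bar>Q2 x\<bar> \<le> CQ * CQ" by (rule Q2_le)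
    have "\<bar>S1 x\<bar> \<le> \<bar>Q1 x\<bar> / n + \<bar>Q1 x\<bar> / 2 + \<bar>x\<bar> * \<bar>Q2 x\<bar> / 2"
      unfolding S1_def using n5 by (intro order_trans[OF abs_triangle_ineq] add_mono) (auto simp: abs_mult intro!: order_trans[OF abs_triangle_ineq])
    also have "\<dots> \<le> \<bar>Q1 x\<bar> / 1 + \<bar>Q1 x\<bar> + \<bar>x\<bar> * (CQ * Q p x)"
    proof -
      have "\<bar>Q1 x\<bar> / n \<le> \<bar>Q1 x\<bar> / 1" using n5 by (intro divide_left_mono) auto
      moreover have "\<bar>x\<bar> * \<bar>Q2 x\<bar> \<le> \<bar>x\<bar> * (CQ * Q p x)" using Q2_bound[of x] by (intro mult_left_mono) auto
      moreover have "\<bar>x\<bar> * \<bar>Q2 x\<bar> \<ge> 0" by simp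
      ultimately show ?thesis by linarith
    qed
    also have "\<dots> \<le> 2 * CQ + CQ * CQ"
    proof -
      have "\<bar>x\<bar> * (CQ * Q p x) = CQ * (\<bar>x\<bar> * Q p x)" by (simp only: mult_ac)
      also have "\<dots> \<le> CQ * CQ" by (rule mult_left_mono[OF xQ]) simp
      finally show ?thesis using Q1_bound[of x] Q_le[of x] by linarith
    qed
    finally have S1b: "\<bar>S1 x\<bar> \<le> 2 * CQ + CQ * CQ" .
    have Sb: "\<bar>S x\<bar> \<le> CQ" 
      by (rule order_trans[OF S_le[OF x] mult_right_le_one_le]) (use x in auto)
    have "\<bar>(Q2 x - lam * S1 x) * Y1 x\<bar> \<le> (CQ * CQ + lam * (2 * CQ + CQ * CQ)) * (K * exp x)"
    proof -
      have "\<bar>lam * S1 x\<bar> \<le> lam * (2 * CQ + CQ * CQ)" unfolding abs_mult using S1b lam0 by (intro mult_mono) auto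
      then have "\<bar>Q2 x - lam * S1 x\<bar> \<le> CQ * CQ + lam * (2 * CQ + CQ * CQ)" using Q2b by linarith
      then show ?thesis unfolding abs_mult using K(2)[OF x] by (intro mult_mono) auto
    qed
    moreover have "\<bar>(lam * S x - Q1 x) * Y2 x\<bar> \<le> (lam * CQ + CQ) * (K * exp x)"
    proof -
      have "\<bar>lam * S x\<bar> \<le> lam * CQ" unfolding abs_mult using Sb lam0 by (intro mult_mono) auto
      then have "\<bar>lam * S x - Q1 x\<bar> \<le> lam * CQ + CQ" using Q1_bound[of x] Q_le[of x] by linarith
      then show ?thesis unfolding abs_mult using K(3)[OF x] by (intro mult_mono) auto
    qed
    moreover have "\<bar>lam * Q p x * Y0 x\<bar> \<le> (lam * CQ) * (K * exp x)"
      unfolding abs_mult using K(1)[OF x] lam0 Q_le[of x] Q_pos[of x] by (intro mult_mono) auto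
    moreover have "\<bar>lam\<^sup>2 / cQ * (x * (Q p x)\<^sup>2 / 4)\<bar> \<le> lam\<^sup>2 / cQ * CQ\<^sup>2 * exp x"
    proof -
      have "(\<bar>x\<bar> * Q p x) * Q p x \<le> CQ * (CQ * exp x)" by (rule mult_mono[OF xQ Q]) (use Q_pos[of x] in auto)
      moreover have "0 \<le> (\<bar>x\<bar> * Q p x) * Q p x" using Q_pos[of x] by auto
      moreover have "\<bar>x * (Q p x)\<^sup>2 / 4\<bar> = (\<bar>x\<bar> * Q p x) * Q p x / 4"
        by (simp add: abs_mult power2_eq_square)
      moreover have "CQ * (CQ * exp x) = CQ\<^sup>2 * exp x" by (simp only: power2_eq_square mult.assoc)
      ultimately have "\<bar>x * (Q p x)\<^sup>2 / 4\<bar> \<le> CQ\<^sup>2 * exp x" by linarith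
      then have "lam\<^sup>2 / cQ * \<bar>x * (Q p x)\<^sup>2 / 4\<bar> \<le> lam\<^sup>2 / cQ * (CQ\<^sup>2 * exp x)"
        by (rule mult_left_mono) (use cQ_pos in simp)
      moreover have "\<bar>lam\<^sup>2 / cQ\<bar> = lam\<^sup>2 / cQ" using cQ_pos by simp
      ultimately show ?thesis unfolding abs_mult[of "lam\<^sup>2 / cQ"] by (simp only: mult.assoc)
    qed
    moreover have "lam\<^sup>2 * (2 * c1 * exp (x / 2)) \<ge> 0" using c1 by simp
    moreover have "lam\<^sup>2 * (c2 / 2 * exp (2 * x)) \<le> lam\<^sup>2 * c2 * exp x"
    proof -
      have "c2 * exp (2 * x) \<le> c2 * (2 * exp x)" using c2 x exp_gt_zero[of x] by (intro mult_left_mono) (auto intro: order_trans[of _ "exp x"])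
      then have "c2 / 2 * exp (2 * x) \<le> c2 * exp x" by simp
      then show ?thesis by (simp add: mult.assoc mult_left_mono)
    qed
    moreover have "H x = lam\<^sup>2 * (2 * c1 * exp (x / 2)) - lam\<^sup>2 * (c2 / 2 * exp (2 * x)) - ((Q2 x - lam * S1 x) * Y1 x + (lam * S x - Q1 x) * Y2 x + lam * Q p x * Y0 x)
       + lam\<^sup>2 / cQ * (x * (Q p x)\<^sup>2 / 4)"
      unfolding H_def G_def B_def right_diff_distrib by simp
    ultimately have "H x \<ge> - ((CQ * CQ + lam * (2 * CQ + CQ * CQ)) * (K * exp x) + (lam * CQ + CQ) * (K * exp x)
        + (lam * CQ) * (K * exp x) + lam\<^sup>2 / cQ * CQ\<^sup>2 * exp x + lam\<^sup>2 * c2 * exp x)" by linarith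
    also have "(CQ * CQ + lam * (2 * CQ + CQ * CQ)) * (K * exp x) + (lam * CQ + CQ) * (K * exp x)
        + (lam * CQ) * (K * exp x) + lam\<^sup>2 / cQ * CQ\<^sup>2 * exp x + lam\<^sup>2 * c2 * exp x = K' * exp x"
      unfolding K'_def by (simp only: distrib_right mult.assoc)
    finally have "- (K' * exp x) \<le> H x" .
    moreover have "K' \<ge> 0" unfolding K'_def using K0 lam0 cQ_pos c2
      by (intro add_nonneg_nonneg mult_nonneg_nonneg) auto
    then have "K' * exp x \<le> K' * exp (x / 2)" using x by (intro mult_left_mono) auto
    ultimately show "- K' * exp (x / 2) \<le> H x" by simp
  qed
  then have "B 0 \<le> lam\<^sup>2 * (2 * c1 - c2 / 2)" by (simp add: H_def G_def)
  moreover have "2 * c1 - c2 / 2 = 2 * CQ * K2 * (\<nu> - 1) - kappa / (2 * cQ)"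
    by (simp only: c1_def c2_def mult.assoc divide_divide_eq_left mult.commute[of cQ])
  ultimately have "B 0 \<le> lam\<^sup>2 * (2 * CQ * K2 * (\<nu> - 1) - kappa / (2 * cQ))" by (simp only:)
  then show ?thesis by (simp only: B_def Q1_0 S1_0 mult_zero_right diff_zero)
qed

end

text \<open>The two estimates at the origin are solved for \<open>Y1 0\<close> and
  \<open>Y2 0\<close> in terms of normalised quantities \<open>J\<close> and \<open>I\<close>. The
  concomitant then equals \<open>lam\<close> times the sum of a square and
  \<open>4 * lam * J * I / q0^2\<close>. The square is of second order in \<open>\<nu> - 1\<close>,
  whereas the other term is negative of first order, since \<open>J > 0 > I\<close> and
  \<open>lam \<ge> 2 * (\<nu> - 1)\<close>.\<close>

lemma (in soliton) evans_neg: "\<exists>\<nu>>1. evans \<nu> < 0"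
proof -
  define K3 where "K3 = K2 * (1 + 2 * CQ)"
  define c where "c = 1 / cQ"
  have c0: "c > 0" using cQ_pos by (simp add: c_def)
  have K20: "K2 > 0" by (rule K2_pos)
  have K30: "K3 > 0" unfolding K3_def using K20 by (intro mult_pos_pos) auto
  have CQ0: "CQ > 0" by simp
  \<comment> \<open>The entries keep \<open>\<nu>\<close> within the range of the estimates, keep
    \<open>J\<close> above half of its leading term, keep \<open>I\<close> below half of its leading
    term, and make the square at most half of the bound for the negative term.\<close>
  define d where "d = Min {1 / 10, c / (4 * (K2 * CQ)), c * kappa / (8 * (CQ * K2)), c\<^sup>2 * kappa / (4 * K3\<^sup>2)}"
  have d0: "d > 0" unfolding d_def using c0 K20 K30 kappa_pos by (auto simp: zero_less_mult_iff)
  have d_le: "d \<le> 1 / 10" "d \<le> c / (4 * (K2 * CQ))" "d \<le> c * kappa / (8 * (CQ * K2))" "d \<le> c\<^sup>2 * kappa / (4 * K3\<^sup>2)"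
    unfolding d_def by (auto intro!: Min_le)
  have KC: "K2 * CQ > 0" using K20 by (intro mult_pos_pos) auto
  have scale: "k * d \<le> z" if "d \<le> y / (m * k)" "k > 0" "m > 0" "y / m = z" for k m y z :: real
  proof -
    have "d * (m * k) \<le> y" using that by (simp only: pos_le_divide_eq mult_pos_pos)
    then show ?thesis using that by (simp add: field_simps)
  qed
  have d2: "K2 * CQ * d \<le> c / 4" by (rule scale[OF d_le(2) KC]) auto
  have "(CQ * K2) * d \<le> c * kappa / 8" by (rule scale[OF d_le(3)]) (use KC in \<open>auto simp: mult.commute\<close>)
  then have d3: "2 * CQ * K2 * d \<le> c * kappa / 4" by (simp only: mult.assoc)
  have d4: "K3\<^sup>2 * d \<le> c\<^sup>2 * kappa / 4" by (rule scale[OF d_le(4)]) (use K30 in auto)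
  define \<nu> where "\<nu> = 1 + d"
  interpret jost p \<nu> by standard (use d0 in \<open>simp add: \<nu>_def\<close>)
  have nu: "\<nu> \<le> 11 / 10" "\<nu> > 1" "\<nu> - 1 = d" using d_le(1) d0 by (auto simp: \<nu>_def)
  have lam: "lam \<ge> 2 * d" using lam_nonneg nu by simp
  then have lam0: "lam > 0" using d0 by simp
  define q0 where "q0 = Q p 0"
  have q0: "q0 \<ge> 1" using Q0_ge_1 by (simp add: q0_def)
  define J where "J = n / 2 * q0 * Y1 0 / lam"
  define I where "I = (Q2 0 * Y1 0 + lam * S 0 * Y2 0 + lam * q0 * Y0 0) / lam\<^sup>2"
  have J: "\<bar>J - c * q0\<^sup>2 / 2\<bar> \<le> K2 * d * CQ"
  proof -
    have "lam * \<bar>J - c * q0\<^sup>2 / 2\<bar> = \<bar>n / 2 * q0 * Y1 0 - lam * q0\<^sup>2 / (2 * cQ)\<bar>"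
    proof -
      have "n / 2 * q0 * Y1 0 - lam * q0\<^sup>2 / (2 * cQ) = lam * (J - c * q0\<^sup>2 / 2)"
        using lam0 by (simp add: J_def c_def right_diff_distrib)
      then show ?thesis using lam0 by (simp add: abs_mult)
    qed
    also have "\<dots> \<le> lam * (K2 * d * CQ)" using E2_estimate[OF nu(1)] nu(3) by (simp add: q0_def)
    finally show ?thesis using lam0 by simp
  qed
  have I: "I \<le> - (c * kappa / 4)"
  proof -
    have "I \<le> 2 * CQ * K2 * d - kappa / (2 * cQ)"
      using E1_estimate[OF nu(1)] lam0 nu(3) by (simp add: I_def q0_def pos_divide_le_eq mult.commute)
    also have "\<dots> \<le> c * kappa / 4 - c * kappa / 2" using d3 by (simp add: c_def)
    finally show ?thesis by simp
  qed
  have J_ge: "J \<ge> c * q0\<^sup>2 / 4"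
  proof -
    have "K2 * d * CQ = K2 * CQ * d" by simp
    then have "J \<ge> c * q0\<^sup>2 / 2 - c / 4" using J d2 by linarith
    moreover have "c / 4 * 1 \<le> c / 4 * q0\<^sup>2" using q0 c0 by (intro mult_left_mono) auto
    ultimately show ?thesis by simp
  qed
  have Y1: "Y1 0 = 2 * lam * J / (n * q0)" using lam0 q0 n5 by (simp add: J_def)
  have Y2: "Y2 0 = n / q0 * (lam * I + J - q0 * Y0 0)"
  proof -
    have Q2Y: "Q2 0 * Y1 0 = - (lam * J)" using lam0 by (simp add: J_def Q2_0 q0_def)
    have "lam\<^sup>2 * I = Q2 0 * Y1 0 + lam * S 0 * Y2 0 + lam * q0 * Y0 0" using lam0 by (simp add: I_def)
    then have "lam * (q0 / n * Y2 0) = lam * (lam * I + J - q0 * Y0 0)"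
      unfolding Q2Y S_0 q0_def[symmetric] by (simp add: algebra_simps power2_eq_square)
    then have "q0 / n * Y2 0 = lam * I + J - q0 * Y0 0"
      using lam0 mult_left_cancel[of lam] by (metis less_irrefl)
    then have "n / q0 * (q0 / n * Y2 0) = n / q0 * (lam * I + J - q0 * Y0 0)" by simp
    then show ?thesis using q0 n5 by simp
  qed
  \<comment> \<open>Substitution of \<open>Y1 0\<close> and \<open>Y2 0\<close>, followed by
    completing the square in \<open>Y0 0\<close>.\<close>
  have E: "lam * (Y0 0)\<^sup>2 + 2 * Y1 0 * Y2 0 = lam * ((Y0 0 - 2 * J / q0)\<^sup>2 + 4 * lam * J * I / q0\<^sup>2)"
  proof -
    have "2 * Y1 0 * Y2 0 = 4 * lam * J / q0\<^sup>2 * (lam * I + J - q0 * Y0 0)"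
      unfolding Y1 Y2 using q0 n5 by (simp add: power2_eq_square)
    also have "\<dots> = lam * (4 * J\<^sup>2 / q0\<^sup>2 - 4 * J * Y0 0 / q0 + 4 * lam * J * I / q0\<^sup>2)"
      using q0 by (simp add: field_simps power2_eq_square)
    finally show ?thesis using q0 by (simp add: field_simps power2_eq_square)
  qed
  have "\<bar>Y0 0 - 2 * J / q0\<bar> \<le> K3 * d"
  proof -
    have a: "\<bar>Y0 0 - c * q0\<bar> \<le> K2 * d"
      using Y0_near_1[OF nu1 nu(1), of 0] nu(3) by (simp add: Y0_def c_def q0_def)
    have "2 * J / q0 - c * q0 = 2 * (J - c * q0\<^sup>2 / 2) / q0" using q0 by (simp add: field_simps power2_eq_square)
    then have "\<bar>2 * J / q0 - c * q0\<bar> = 2 * \<bar>J - c * q0\<^sup>2 / 2\<bar> / q0"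
      using q0 by (simp only: abs_mult abs_divide abs_numeral abs_of_nonneg)
    also have "\<dots> \<le> 2 * (K2 * d * CQ) / 1" using J q0 by (intro frac_le) auto
    finally have "\<bar>Y0 0 - 2 * J / q0\<bar> \<le> K2 * d + 2 * (K2 * d * CQ)" using a by linarith
    then show ?thesis by (simp add: K3_def algebra_simps)
  qed
  then have "\<bar>Y0 0 - 2 * J / q0\<bar>\<^sup>2 \<le> (K3 * d)\<^sup>2" by (intro power_mono) auto
  also have "\<dots> = (K3\<^sup>2 * d) * d" by (simp add: power2_eq_square)
  also have "\<dots> \<le> c\<^sup>2 * kappa / 4 * d" using d4 d0 by (intro mult_right_mono) auto
  finally have s1: "(Y0 0 - 2 * J / q0)\<^sup>2 \<le> c\<^sup>2 * kappa / 4 * d" by simp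
  have "4 * lam * J * (- I) / q0\<^sup>2 \<ge> 4 * lam * (c * q0\<^sup>2 / 4) * (c * kappa / 4) / q0\<^sup>2"
  proof (intro divide_right_mono mult_mono mult_left_mono)
    have "0 \<le> c * q0\<^sup>2 / 4" using c0 by simp
    then have "J \<ge> 0" using J_ge by linarith
    then show "0 \<le> 4 * lam * J" using lam0 by simp
  qed (use J_ge I lam0 c0 kappa_pos in auto)
  also have "4 * lam * (c * q0\<^sup>2 / 4) * (c * kappa / 4) / q0\<^sup>2 = lam * (c\<^sup>2 * kappa / 4)"
    using q0 by (simp add: power2_eq_square)
  finally have "4 * lam * J * I / q0\<^sup>2 \<le> - (lam * (c\<^sup>2 * kappa / 4))" by simp
  also have "\<dots> \<le> - (2 * d * (c\<^sup>2 * kappa / 4))"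
    using lam c0 kappa_pos by (simp add: mult_right_mono)
  finally have "(Y0 0 - 2 * J / q0)\<^sup>2 + 4 * lam * J * I / q0\<^sup>2 \<le> - (d * (c\<^sup>2 * kappa / 4))"
    using s1 by (simp add: mult_ac)
  also have "\<dots> < 0" using d0 c0 kappa_pos by simp
  finally have "lam * (Y0 0)\<^sup>2 + 2 * Y1 0 * Y2 0 < 0" unfolding E using lam0 by (simp add: mult_less_0_iff)
  then have "evans \<nu> * (3 * \<nu>\<^sup>2 - 1) / \<nu> < 0" unfolding Evans_at_0[OF nu(2)] .
  then have "evans \<nu> < 0" using den_pos nu(2) by (simp add: divide_less_0_iff mult_less_0_iff)
  then show ?thesis using nu(2) by blast
qed

lemma (in soliton) evans_zero: "\<exists>\<nu>>1. evans \<nu> = 0"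
proof -
  obtain \<nu>1 where v1: "\<nu>1 > 1" "evans \<nu>1 < 0" using evans_neg by blast
  define \<nu>2 where "\<nu>2 = max \<nu>1 (M0 * Phi_max + 1)"
  have "evans \<nu>2 > 0" by (rule evans_pos) (use v1 in \<open>auto simp: \<nu>2_def\<close>)
  moreover have "continuous_on {\<nu>1..\<nu>2} evans"
    by (rule continuous_on_subset[OF evans_cont[of \<nu>2]]) (use v1 in auto)
  moreover have "\<nu>1 \<le> \<nu>2" by (simp add: \<nu>2_def)
  ultimately obtain \<nu> where "\<nu>1 \<le> \<nu>" "\<nu> \<le> \<nu>2" "evans \<nu> = 0"
    using IVT'[of evans \<nu>1 0 \<nu>2] v1 by auto
  then show ?thesis using v1 by (intro exI[of _ \<nu>]) auto
qed

section \<open>From a zero of the Evans function to an eigenfunction\<close>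

lemma weight_growth_cutoff:
  fixes c R :: real assumes "c \<ge> 0" "R \<ge> 1"
  shows "weight_growth c (\<lambda>x. min (max 1 (exp (c * x))) R)"
  unfolding weight_growth_def
proof (intro conjI allI impI)
  show "min (max 1 (exp (c * x))) R > 0" for x using assms by simp
  fix x t :: real assume tx: "t \<le> x"
  have E: "exp (c * (x - t)) \<ge> 1" using assms tx by simp
  have "exp (c * x) = exp (c * (x - t)) * exp (c * t)" by (simp add: exp_add[symmetric] algebra_simps)
  also have "\<dots> \<le> exp (c * (x - t)) * max 1 (exp (c * t))" by (intro mult_left_mono) auto
  finally have "max 1 (exp (c * x)) \<le> exp (c * (x - t)) * max 1 (exp (c * t))"
    using mult_mono[OF E, of 1 "max 1 (exp (c * t))"] E by simp
  moreover have "R \<le> exp (c * (x - t)) * R" using mult_right_mono[OF E, of R] assms by simp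
  ultimately show "min (max 1 (exp (c * x))) R \<le> exp (c * (x - t)) * min (max 1 (exp (c * t))) R"
    by (auto simp: min_def)
qed

context jost begin

text \<open>If the Evans function vanishes, then \<open>jost_m \<nu> = W \<nu> (Fp \<nu>)\<close> and \<open>Fp \<nu>\<close> is small compared with \<open>jost_m \<nu>\<close>
  near \<open>+\<infinity>\<close>. The weights are truncated at height \<open>R\<close> so that the supremum absorbed in the
  estimate is known to be finite.\<close>

lemma decay_if_evans_zero:
  assumes nu: "\<nu> > 1" and D: "evans \<nu> = 0" and a: "a \<ge> 0" "a < gap \<nu>"
  shows "\<exists>K. \<forall>x\<ge>0. \<bar>jost_m \<nu> x\<bar> \<le> K * exp (- ((\<nu> + a) * x)) \<and> \<bar>Fp \<nu> x\<bar> \<le> K * exp (- ((\<nu> + a) * x))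
    \<and> \<bar>Wk \<nu> (Fp \<nu>) x\<bar> \<le> K * exp (- ((\<nu> + a) * x))"
proof -
  define c where "c = \<nu> + a"
  have c: "c \<ge> 0" "c < 3 * \<nu> / 2 - Re (disc_root \<nu>)" using a nu1 by (auto simp: c_def gap_def)
  define w where "w R x = min (max 1 (exp (c * x))) R" for R x
  have w1: "w R x \<ge> 1" if "R \<ge> 1" for R x using that by (simp add: w_def)
  have wR: "w R x \<le> R" for R x by (simp add: w_def)
  have wmono: "w R x \<le> w R y" if "x \<le> y" for R x y
  proof -
    have "c * x \<le> c * y" using that c(1) by (rule mult_left_mono)
    then have "exp (c * x) \<le> exp (c * y)" by simp
    then show ?thesis unfolding w_def by linarith
  qed
  have wgr: "weight_growth c (w R)" if "R \<ge> 1" for R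
    unfolding w_def[abs_def] by (rule weight_growth_cutoff[OF c(1) that])
  define rc where "rc = response_const (3 * \<nu> / 2) (disc_root \<nu>) \<nu> c"
  define kc where "kc = inner_const (3 * \<nu> / 2) (disc_root \<nu>) \<nu> c + norm (of_real (3 * \<nu> / 2) - disc_root \<nu>) * rc"
  have ic0: "inner_const (3 * \<nu> / 2) (disc_root \<nu>) \<nu> c \<ge> 0"
    unfolding inner_const_def using c Re_disc_root_nonneg[of \<nu>] by (intro divide_nonneg_nonneg) auto
  then have rc0: "rc \<ge> 0" unfolding rc_def response_const_def using c by (intro divide_nonneg_nonneg) auto
  have kc0: "kc \<ge> 0" unfolding kc_def using ic0 rc0 by simp
  have mW: "jost_m \<nu> x = W \<nu> (Fp \<nu>) x" for x using m_at_top[of x] D by simp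
  have damped: "damped (3 * \<nu> / 2) (disc_root \<nu>) c C (w R) (Fp \<nu>)" if "R \<ge> 1" "\<And>x. \<bar>Fp \<nu> x\<bar> \<le> C / w R x" for C R
    by (rule damped_W[OF nu1 wgr[OF that(1)] c(2) Fp_cont that(2)])
  have Wle: "\<bar>jost_m \<nu> x\<bar> \<le> C * rc / w R x" if "R \<ge> 1" "\<And>x. \<bar>Fp \<nu> x\<bar> \<le> C / w R x" for C R x
    using damped.abs_response_le[OF damped[OF that], of \<nu> x] unfolding mW W_def rc_def .
  have Wkle: "\<bar>Wk \<nu> (Fp \<nu>) x\<bar> \<le> C * kc / w R x" if "R \<ge> 1" "\<And>x. \<bar>Fp \<nu> x\<bar> \<le> C / w R x" for C R x
    using damped.abs_coresponse_le[OF damped[OF that], of \<nu> x] unfolding Wk_def kc_def rc_def .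
  \<comment> \<open>Beyond \<open>x\<close> the weight is at least \<open>w R x\<close>, so
    \<open>Fp\<close> is bounded by the weighted size of \<open>jost_m\<close> times the mass of the
    potential that remains, and this mass tends to zero.\<close>
  have tail: "\<bar>Fp \<nu> x\<bar> \<le> s / w R x * (Phi_max - Phi x)" if R: "R \<ge> 1" and s: "\<And>y. \<bar>jost_m \<nu> y\<bar> \<le> s / w R y" for s R x
  proof -
    define z where "z = s / w R x"
    have s0: "s \<ge> 0" using order_trans[OF abs_ge_zero s[of 0]] w1[OF R, of 0] by (simp add: zero_le_divide_iff)
    have z0: "z \<ge> 0" using s0 w1[OF R, of x] by (simp add: z_def)
    have mz: "\<bar>jost_m \<nu> y\<bar> \<le> z" if "y \<ge> x" for y
      unfolding z_def using s0 wmono[OF that, of R] w1[OF R, of x]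
      by (intro order_trans[OF s] divide_left_mono) (auto intro!: mult_pos_pos simp: less_le_trans[OF zero_less_one w1[OF R]])
    have qm: "\<bar>q y * jost_m \<nu> y\<bar> \<le> z * q y" if "y \<ge> x" for y
      unfolding abs_mult using mz[OF that] q_pos[of y] by (simp add: mult.commute mult_left_mono)
    have FpE: "- CF * exp (- y) \<le> - Fp \<nu> y" "- CF * exp (- y) \<le> Fp \<nu> y" for y
      using Fp_le_exp[of y] unfolding mult_minus_left abs_le_iff by linarith+
    have zP: "z * (Phi_max - Phi y) \<ge> 0" for y using z0 Phi_bounds[of y] by simp
    have dP: "((\<lambda>y. z * (Phi_max - Phi y)) has_real_derivative z * (0 - q y)) (at y)" for y
      by (intro DERIV_cmult DERIV_diff DERIV_const Phi_deriv)
    have "z * (Phi_max - Phi x) - Fp \<nu> x \<ge> 0"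
    proof (rule nonneg_if_nonincreasing_to_top[where h = "\<lambda>y. z * (Phi_max - Phi y) - Fp \<nu> y"
          and h' = "\<lambda>y. z * (0 - q y) - - q y * jost_m \<nu> y" and K = CF])
      show "((\<lambda>y. z * (Phi_max - Phi y) - Fp \<nu> y) has_real_derivative z * (0 - q y) - - q y * jost_m \<nu> y) (at y)" for y
        by (intro DERIV_diff dP Fp_deriv)
      show "z * (0 - q y) - - q y * jost_m \<nu> y \<le> 0" if "y \<ge> x" for y using qm[OF that] by (simp add: abs_le_iff)
      show "- CF * exp (- y) \<le> z * (Phi_max - Phi y) - Fp \<nu> y" for y
        using FpE[of y] zP[of y] by linarith
    qed
    moreover have "z * (Phi_max - Phi x) + Fp \<nu> x \<ge> 0"
    proof (rule nonneg_if_nonincreasing_to_top[where h = "\<lambda>y. z * (Phi_max - Phi y) + Fp \<nu> y"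
          and h' = "\<lambda>y. z * (0 - q y) + - q y * jost_m \<nu> y" and K = CF])
      show "((\<lambda>y. z * (Phi_max - Phi y) + Fp \<nu> y) has_real_derivative z * (0 - q y) + - q y * jost_m \<nu> y) (at y)" for y
        by (intro DERIV_add dP Fp_deriv)
      show "z * (0 - q y) + - q y * jost_m \<nu> y \<le> 0" if "y \<ge> x" for y using qm[OF that] by (simp add: abs_le_iff)
      show "- CF * exp (- y) \<le> z * (Phi_max - Phi y) + Fp \<nu> y" for y
        using FpE[of y] zP[of y] by linarith
    qed
    ultimately show ?thesis unfolding z_def by linarith
  qed
  \<comment> \<open>Chosen so that \<open>\<epsilon> * rc \<le> 1 / 2\<close>, which allows the
    weighted supremum \<open>s\<close> to be absorbed.\<close>
  define \<epsilon> where "\<epsilon> = 1 / (2 * (rc + 1))"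
  have \<epsilon>0: "\<epsilon> > 0" using rc0 by (simp add: \<epsilon>_def)
  have "\<forall>\<^sub>F x in at_top. Phi x > Phi_max - \<epsilon>"
    by (rule order_tendstoD(1)[OF Phi_tendsto]) (use \<epsilon>0 in simp)
  then have "\<forall>\<^sub>F x in at_top. Phi x > Phi_max - \<epsilon> \<and> x \<ge> 0"
    by (intro eventually_conj eventually_ge_at_top)
  then obtain X where X: "Phi X > Phi_max - \<epsilon>" "X \<ge> 0"
    by (metis (mono_tags, lifting) eventually_happens trivial_limit_at_top_linorder)
  define C1 where "C1 = M0 * Phi_max * exp (c * X)"
  have C10: "C1 \<ge> 0" using Phi_max_pos by (simp add: C1_def)
  define K where "K = 2 * rc * C1"
  have bound: "\<bar>jost_m \<nu> x\<bar> \<le> K / w R x" if R: "R \<ge> 1" for R x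
  proof -
    define s where "s = (SUP x. w R x * \<bar>jost_m \<nu> x\<bar>)"
    have bdd: "bdd_above (range (\<lambda>x. w R x * \<bar>jost_m \<nu> x\<bar>))"
      by (rule bdd_aboveI2[of _ _ "R * M0"]) (use R w1[OF R] wR m_le in \<open>auto intro!: mult_mono intro: order_trans[OF zero_le_one]\<close>)
    have s: "\<bar>jost_m \<nu> x\<bar> \<le> s / w R x" for x
    proof -
      have "w R x * \<bar>jost_m \<nu> x\<bar> \<le> s" unfolding s_def by (rule cSUP_upper[OF _ bdd]) simp
      then show ?thesis using w1[OF R, of x] by (simp add: pos_le_divide_eq mult.commute)
    qed
    have s0: "s \<ge> 0" using order_trans[OF abs_ge_zero s[of 0]] w1[OF R, of 0] by (simp add: zero_le_divide_iff)
    have F: "\<bar>Fp \<nu> x\<bar> \<le> (\<epsilon> * s + C1) / w R x" for x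
    proof (cases "x \<ge> X")
      case True
      have "Phi X \<le> Phi x" using True by (rule Phi_mono)
      then have "Phi_max - Phi x \<le> \<epsilon>" using X by simp
      then have "\<bar>Fp \<nu> x\<bar> \<le> s / w R x * \<epsilon>"
        using s0 w1[OF R, of x] by (intro order_trans[OF tail[OF R s]] mult_left_mono) auto
      also have "\<dots> \<le> (\<epsilon> * s + C1) / w R x"
        using C10 w1[OF R, of x] by (simp add: mult.commute divide_right_mono)
      finally show ?thesis .
    next
      case False
      have "w R x \<le> w R X" using False by (intro wmono) simp
      also have "w R X \<le> exp (c * X)" using c X by (auto simp: w_def min_def)
      finally have "w R x \<le> exp (c * X)" .
      then have "M0 * Phi_max * w R x \<le> C1" unfolding C1_def using Phi_max_pos by (intro mult_left_mono) auto
      then have "M0 * Phi_max \<le> C1 / w R x" using w1[OF R, of x] by (simp add: pos_le_divide_eq)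
      also have "\<dots> \<le> (\<epsilon> * s + C1) / w R x" using \<epsilon>0 s0 w1[OF R, of x] by (intro divide_right_mono) auto
      finally show ?thesis using Fp_le[of x] by linarith
    qed
    have "s \<le> (\<epsilon> * s + C1) * rc"
      unfolding s_def
    proof (rule cSUP_least)
      fix x
      have "\<bar>jost_m \<nu> x\<bar> \<le> (\<epsilon> * s + C1) * rc / w R x" by (rule Wle[OF R F])
      then show "w R x * \<bar>jost_m \<nu> x\<bar> \<le> (\<epsilon> * (SUP x. w R x * \<bar>jost_m \<nu> x\<bar>) + C1) * rc"
        using w1[OF R, of x] by (simp add: s_def pos_le_divide_eq mult.commute)
    qed simp
    moreover have "\<epsilon> * rc \<le> 1 / 2" using rc0 by (simp add: \<epsilon>_def field_simps)
    then have "(\<epsilon> * rc) * s \<le> (1 / 2) * s" using s0 by (rule mult_right_mono)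
    ultimately have "s \<le> K" by (simp add: K_def algebra_simps)
    then show ?thesis using s[of x] w1[OF R, of x] divide_right_mono[of s K "w R x"] by linarith
  qed
  have Fb: "\<bar>Fp \<nu> x\<bar> \<le> (K * Phi_max) / w R x" if R: "R \<ge> 1" for R x
  proof -
    have K0: "K \<ge> 0" using rc0 C10 by (simp add: K_def)
    have "\<bar>Fp \<nu> x\<bar> \<le> K / w R x * (Phi_max - Phi x)" by (rule tail[OF R bound[OF R]])
    also have "\<dots> \<le> K / w R x * Phi_max"
      using K0 w1[OF R, of x] Phi_bounds[of x] by (intro mult_left_mono) auto
    finally show ?thesis by simp
  qed
  \<comment> \<open>Since \<open>K\<close> does not depend on \<open>R\<close>, the truncation
    height may be taken as \<open>exp (c * x)\<close> separately at each point \<open>x\<close>, and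
    the truncation disappears.\<close>
  have wexp: "1 / w (exp (c * x)) x = exp (- (c * x))" "exp (c * x) \<ge> 1" if "x \<ge> 0" for x
  proof -
    have "c * x \<ge> 0" using that c(1) by (intro mult_nonneg_nonneg)
    then show "exp (c * x) \<ge> 1" by simp
    then have "w (exp (c * x)) x = exp (c * x)" unfolding w_def by linarith
    then show "1 / w (exp (c * x)) x = exp (- (c * x))" by (simp only: exp_minus inverse_eq_divide)
  qed
  define K' where "K' = max K (max (K * Phi_max) (K * Phi_max * kc))"
  have up: "z \<le> K' * exp (- (c * x))" if "x \<ge> 0" "z \<le> k / w (exp (c * x)) x" "k \<le> K'" for x z k
  proof -
    have "z \<le> k * exp (- (c * x))" using that(2) wexp(1)[OF that(1)] by (simp add: divide_inverse)
    also have "\<dots> \<le> K' * exp (- (c * x))" using that(3) by (intro mult_right_mono) auto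
    finally show ?thesis .
  qed
  show ?thesis
    unfolding c_def[symmetric]
  proof (intro exI[of _ K'] allI impI conjI)
    fix x :: real assume x: "0 \<le> x"
    show "\<bar>jost_m \<nu> x\<bar> \<le> K' * exp (- (c * x))" by (rule up[OF x bound[OF wexp(2)[OF x]]]) (simp add: K'_def)
    show "\<bar>Fp \<nu> x\<bar> \<le> K' * exp (- (c * x))" by (rule up[OF x Fb[OF wexp(2)[OF x]]]) (simp add: K'_def)
    show "\<bar>Wk \<nu> (Fp \<nu>) x\<bar> \<le> K' * exp (- (c * x))"
      by (rule up[OF x Wkle[OF wexp(2)[OF x] Fb[OF wexp(2)[OF x]]]]) (simp add: K'_def)
  qed
qed

text \<open>On the left the decay comes from \<open>exp (\<nu> * x)\<close>; on the right the rate
  \<open>\<nu> + a\<close> of \<open>jost_m\<close> outweighs this factor. The functions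
  \<open>u\<close> and \<open>\<kappa>\<close> complete \<open>Y1\<close> to the first-order system
  with the same decay, so that uniqueness yields the integral equation. \<open>Y1\<close> is not
  zero because \<open>jost_m\<close> tends to \<open>1\<close> at
  \<open>-\<infinity>\<close>.\<close>

lemma eigenfunction_if_evans_zero:
  assumes nu: "\<nu> > 1" and D: "evans \<nu> = 0" and a: "a \<ge> 0" "a < gap \<nu>"
  shows "\<exists>C. \<forall>x. \<bar>Y1 x\<bar> \<le> C * exp (- (a * \<bar>x\<bar>))"
    and "Y1 x = linT \<nu> (\<lambda>x. q x * Y1 x) x" and "Y1 \<noteq> (\<lambda>_. 0)"
proof -
  obtain K where K: "\<And>x. x \<ge> 0 \<Longrightarrow> \<bar>jost_m \<nu> x\<bar> \<le> K * exp (- ((\<nu> + a) * x))" "\<And>x. x \<ge> 0 \<Longrightarrow> \<bar>Fp \<nu> x\<bar> \<le> K * exp (- ((\<nu> + a) * x))"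
    "\<And>x. x \<ge> 0 \<Longrightarrow> \<bar>Wk \<nu> (Fp \<nu>) x\<bar> \<le> K * exp (- ((\<nu> + a) * x))"
    using decay_if_evans_zero[OF assms] by blast
  obtain Ck where Ck: "\<And>x. \<bar>kk \<nu> x\<bar> \<le> Ck" using k_le by blast
  define k where "k = Wk \<nu> (Fp \<nu>)"
  have kb: "\<bar>k x\<bar> \<le> Ck + \<bar>Finf \<nu>\<bar>" for x using Ck[of x] k_at_top[of x] unfolding k_def by linarith
  define u where "u x = exp (\<nu> * x) * (k x - Fp \<nu> x)" for x
  define \<kappa> where "\<kappa> x = exp (\<nu> * x) * (- \<nu> * Fp \<nu> x + 2 * \<nu> * k x - (3 * \<nu>\<^sup>2 - 1) * jost_m \<nu> x)" for x
  define B where "B = M0 + M0 * Phi_max + Ck + \<bar>Finf \<nu>\<bar> + \<bar>K\<bar>"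
  have B0: "B \<ge> 0" using Ck[of 0] Phi_max_pos by (simp add: B_def add_nonneg_nonneg order_trans[OF abs_ge_zero])
  have a_nu: "a \<le> \<nu>" using a gap_le[of \<nu>] nu by simp
  have est: "\<bar>exp (\<nu> * x) * f x\<bar> \<le> B * exp (- (a * \<bar>x\<bar>))"
    if b1: "\<And>x. \<bar>f x\<bar> \<le> B" and b2: "\<And>x. x \<ge> 0 \<Longrightarrow> \<bar>f x\<bar> \<le> K * exp (- ((\<nu> + a) * x))" for f :: "real \<Rightarrow> real" and x
  proof (cases "x \<ge> 0")
    case True
    have "\<bar>exp (\<nu> * x) * f x\<bar> \<le> exp (\<nu> * x) * (K * exp (- ((\<nu> + a) * x)))"
      unfolding abs_mult using b2[OF True] by (simp add: mult_left_mono)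
    also have "\<dots> = K * (exp (\<nu> * x) * exp (- ((\<nu> + a) * x)))" by simp
    also have "exp (\<nu> * x) * exp (- ((\<nu> + a) * x)) = exp (- (a * x))"
      unfolding exp_add[symmetric] by (simp add: algebra_simps)
    also have "K * exp (- (a * x)) \<le> B * exp (- (a * x))"
    proof (intro mult_right_mono)
      have "M0 * Phi_max \<ge> 0" using Phi_max_pos by simp
      moreover have "Ck \<ge> 0" using order_trans[OF abs_ge_zero Ck[of 0]] .
      ultimately show "K \<le> B" unfolding B_def using exp_gt_zero[of "4 * Phi_max"] by linarith
    qed simp
    finally show ?thesis using True by simp
  next
    case False
    have "exp (\<nu> * x) \<le> exp (a * x)" using False a_nu by (simp add: mult_right_mono_neg)
    then have "\<bar>exp (\<nu> * x) * f x\<bar> \<le> exp (a * x) * B"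
      unfolding abs_mult using b1[of x] by (intro mult_mono) auto
    then show ?thesis using False by (simp add: mult.commute)
  qed
  have ME: "M0 \<ge> 0" "M0 * Phi_max \<ge> 0" "Ck \<ge> 0" using Phi_max_pos order_trans[OF abs_ge_zero Ck[of 0]] by auto
  have mB: "\<bar>jost_m \<nu> x\<bar> \<le> B" for x using m_le[of x] ME unfolding B_def by linarith
  have FB: "\<bar>Fp \<nu> x\<bar> \<le> B" for x using Fp_le[of x] ME unfolding B_def by linarith
  have kB: "\<bar>k x\<bar> \<le> B" for x using kb[of x] ME unfolding B_def by linarith
  have em: "\<bar>exp (\<nu> * x) * jost_m \<nu> x\<bar> \<le> B * exp (- (a * \<bar>x\<bar>))" for x by (rule est[OF mB K(1)])
  have eF: "\<bar>exp (\<nu> * x) * Fp \<nu> x\<bar> \<le> B * exp (- (a * \<bar>x\<bar>))" for x by (rule est[OF FB K(2)])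
  have ek: "\<bar>exp (\<nu> * x) * k x\<bar> \<le> B * exp (- (a * \<bar>x\<bar>))" for x by (rule est[OF kB]) (use K(3) in \<open>simp add: k_def\<close>)
  show Yb: "\<exists>C. \<forall>x. \<bar>Y1 x\<bar> \<le> C * exp (- (a * \<bar>x\<bar>))"
    using em by (auto simp: Y1_def)
  have Y1b: "\<bar>Y1 x\<bar> \<le> B * exp (- (a * \<bar>x\<bar>))" for x using em by (simp add: Y1_def)
  have Y1c: "continuous_on UNIV Y1" unfolding Y1_def[abs_def] by (intro continuous_intros m_cont)
  interpret lp: lin_problem \<nu> a "real p * CQ * B" "\<lambda>x. q x * Y1 x"
  proof
    show "\<bar>q x * Y1 x\<bar> \<le> real p * CQ * B / exp (a * \<bar>x\<bar>)" for x
    proof -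
      have "\<bar>q x\<bar> * \<bar>Y1 x\<bar> \<le> (real p * CQ) * (B * exp (- (a * \<bar>x\<bar>)))"
        using q_le[of x] q_pos[of x] Y1b[of x] by (intro mult_mono) auto
      then show ?thesis by (simp add: abs_mult exp_minus divide_inverse mult.assoc)
    qed
    show "continuous_on UNIV (\<lambda>x. q x * Y1 x)" by (intro continuous_intros cont_q Y1c)
  qed (use a nu in auto)
  define M where "M = (3 * \<nu> + (3 * \<nu>\<^sup>2 - 1) + 2) * B"
  have mW: "jost_m \<nu> x = W \<nu> (Fp \<nu>) x" for x using m_at_top[of x] D by simp
  have dm: "(jost_m \<nu> has_real_derivative Fp \<nu> x - k x) (at x)" for x
    using W_deriv(1)[OF dampedFp, of x] unfolding mW[abs_def, symmetric] k_def by simp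
  have dk: "(k has_real_derivative 2 * \<nu> * Fp \<nu> x - 3 * \<nu> * k x + (3 * \<nu>\<^sup>2 - 1) * jost_m \<nu> x) (at x)" for x
    using W_deriv(2)[OF dampedFp, of x] unfolding mW[symmetric] k_def by simp
  have fin: "z \<le> M / exp (a * \<bar>x\<bar>)" if "z \<le> y * (B * exp (- (a * \<bar>x\<bar>)))" "y \<le> 3 * \<nu> + (3 * \<nu>\<^sup>2 - 1) + 2" for x y z
  proof -
    have "y * (B * exp (- (a * \<bar>x\<bar>))) \<le> (3 * \<nu> + (3 * \<nu>\<^sup>2 - 1) + 2) * (B * exp (- (a * \<bar>x\<bar>)))"
      using that(2) B0 by (intro mult_right_mono) auto
    then show ?thesis using that(1) by (simp add: M_def exp_minus divide_inverse mult.assoc)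
  qed
  show "Y1 x = linT \<nu> (\<lambda>x. q x * Y1 x) x"
  proof (rule lp.linT_unique[where u = u and q = \<kappa> and M = M])
    fix x
    show "(Y1 has_real_derivative \<nu> * Y1 x - u x) (at x)"
      unfolding Y1_def[abs_def] u_def
      by (rule DERIV_cong[OF DERIV_mult[OF exp_deriv dm]]) (simp add: algebra_simps)
    show "(u has_real_derivative q x * Y1 x - \<kappa> x) (at x)"
      unfolding Y1_def u_def[abs_def] \<kappa>_def
      by (rule DERIV_cong[OF DERIV_mult[OF exp_deriv DERIV_diff[OF dk Fp_deriv]]]) (simp add: algebra_simps)
    have d: "((\<lambda>x. - \<nu> * Fp \<nu> x + 2 * \<nu> * k x - (3 * \<nu>\<^sup>2 - 1) * jost_m \<nu> x) has_real_derivative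
       - \<nu> * (- q x * jost_m \<nu> x) + 2 * \<nu> * (2 * \<nu> * Fp \<nu> x - 3 * \<nu> * k x + (3 * \<nu>\<^sup>2 - 1) * jost_m \<nu> x)
       - (3 * \<nu>\<^sup>2 - 1) * (Fp \<nu> x - k x)) (at x)"
      by (intro DERIV_diff DERIV_add DERIV_cmult Fp_deriv dk dm)
    show "(\<kappa> has_real_derivative \<nu> * (q x * Y1 x) - \<nu> * \<kappa> x + (\<nu>\<^sup>2 - 1) * u x) (at x)"
      unfolding Y1_def u_def \<kappa>_def[abs_def]
      by (rule DERIV_cong[OF DERIV_mult[OF exp_deriv d]]) (simp add: algebra_simps power2_eq_square)
    show "\<bar>Y1 x\<bar> \<le> M / exp (a * \<bar>x\<bar>)"
      by (rule fin[of _ 1]) (use Y1b[of x] nu den_pos in auto)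
    show "\<bar>u x\<bar> \<le> M / exp (a * \<bar>x\<bar>)"
    proof (rule fin[of _ 2])
      show "\<bar>u x\<bar> \<le> 2 * (B * exp (- (a * \<bar>x\<bar>)))" unfolding u_def right_diff_distrib using eF[of x] ek[of x] by linarith
    qed (use nu den_pos in auto)
    show "\<bar>\<kappa> x\<bar> \<le> M / exp (a * \<bar>x\<bar>)"
    proof (rule fin[of _ "\<nu> + 2 * \<nu> + (3 * \<nu>\<^sup>2 - 1)"])
      have "\<kappa> x = - (\<nu> * (exp (\<nu> * x) * Fp \<nu> x)) + 2 * \<nu> * (exp (\<nu> * x) * k x) - (3 * \<nu>\<^sup>2 - 1) * (exp (\<nu> * x) * jost_m \<nu> x)"
        by (simp add: \<kappa>_def algebra_simps)
      moreover have "\<bar>\<nu> * (exp (\<nu> * x) * Fp \<nu> x)\<bar> \<le> \<nu> * (B * exp (- (a * \<bar>x\<bar>)))"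
        unfolding abs_mult[of \<nu>] using eF[of x] nu by (intro mult_mono) auto
      moreover have "\<bar>2 * \<nu> * (exp (\<nu> * x) * k x)\<bar> \<le> 2 * \<nu> * (B * exp (- (a * \<bar>x\<bar>)))"
        unfolding abs_mult[of "2 * \<nu>"] using ek[of x] nu by (intro mult_mono) auto
      moreover have "\<bar>(3 * \<nu>\<^sup>2 - 1) * (exp (\<nu> * x) * jost_m \<nu> x)\<bar> \<le> (3 * \<nu>\<^sup>2 - 1) * (B * exp (- (a * \<bar>x\<bar>)))"
        unfolding abs_mult[of "3 * \<nu>\<^sup>2 - 1"] using em[of x] den_pos by (intro mult_mono) auto
      ultimately show "\<bar>\<kappa> x\<bar> \<le> (\<nu> + 2 * \<nu> + (3 * \<nu>\<^sup>2 - 1)) * (B * exp (- (a * \<bar>x\<bar>)))"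
        unfolding distrib_right by linarith
    qed auto
  qed
  obtain C where C: "\<And>x. \<bar>1 - jost_m \<nu> x\<bar> \<le> C * exp x" using u_le_exp by blast
  show "Y1 \<noteq> (\<lambda>_. 0)"
  proof
    assume "Y1 = (\<lambda>_. 0)"
    then have m0: "jost_m \<nu> x = 0" for x by (metis Y1_def exp_not_eq_zero mult_eq_0_iff)
    have "((\<lambda>x. C * exp x) \<longlongrightarrow> C * 0) at_bot" by (intro tendsto_intros exp_at_bot)
    then have "\<forall>\<^sub>F x in at_bot. C * exp x < 1" by (intro order_tendstoD(2)) auto
    then obtain x where "C * exp x < 1" by (metis (mono_tags, lifting) eventually_happens trivial_limit_at_bot_linorder)
    then show False using C[of x] m0[of x] by simp
  qed
qed

end

text \<open>The bound from below makes any right inverse \<open>R\<close> of \<open>I - K\<close>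
  Lipschitz with constant \<open>C\<close>. The perturbed equation becomes the fixed-point equation
  \<open>u = R (f + (K' u - K u))\<close> with contraction factor \<open>1 / 2\<close>.\<close>

lemma perturbed_invertible:
  fixes K K' :: "'a::{real_normed_vector, complete_space} \<Rightarrow> 'a"
  assumes K: "linear K" and K': "linear K'" and C: "C > 0"
    and below: "\<And>u. norm u \<le> C * norm (u - K u)" and surj: "\<And>f. \<exists>u. u - K u = f"
    and close: "\<And>u. norm (K' u - K u) \<le> 1 / (2 * C) * norm u"
  shows "norm u \<le> 2 * C * norm (u - K' u)" and "\<exists>u. u - K' u = f"
proof -
  have "norm u \<le> C * norm (u - K u)" by (rule below)
  also have "\<dots> \<le> C * (norm (u - K' u) + 1 / (2 * C) * norm u)"
  proof (rule mult_left_mono)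
    have "u - K u = (u - K' u) + (K' u - K u)" by simp
    then have "norm (u - K u) \<le> norm (u - K' u) + norm (K' u - K u)" by (metis norm_triangle_ineq)
    then show "norm (u - K u) \<le> norm (u - K' u) + 1 / (2 * C) * norm u" using close[of u] by linarith
  qed (use C in simp)
  also have "\<dots> = C * norm (u - K' u) + norm u / 2" using C by (simp add: distrib_left)
  finally show "norm u \<le> 2 * C * norm (u - K' u)" by simp
  obtain R where R: "\<And>f. R f - K (R f) = f" using surj by metis
  have Rd: "norm (R f - R g) \<le> C * norm (f - g)" for f g
  proof -
    have "(R f - R g) - K (R f - R g) = (R f - K (R f)) - (R g - K (R g))" by (simp add: linear_diff[OF K])
    then have "(R f - R g) - K (R f - R g) = f - g" unfolding R .
    then show ?thesis using below[of "R f - R g"] by simp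
  qed
  have "\<exists>!u. R (f + (K' u - K u)) = u"
  proof (rule banach_fix_type[of "1/2"])
    show "\<forall>u v. dist (R (f + (K' u - K u))) (R (f + (K' v - K v))) \<le> 1 / 2 * dist u v"
    proof (intro allI)
      fix u v
      have "norm (R (f + (K' u - K u)) - R (f + (K' v - K v))) \<le> C * norm ((f + (K' u - K u)) - (f + (K' v - K v)))"
        by (rule Rd)
      also have "(f + (K' u - K u)) - (f + (K' v - K v)) = K' (u - v) - K (u - v)"
        by (simp add: linear_diff[OF K] linear_diff[OF K'])
      also have "C * norm (K' (u - v) - K (u - v)) \<le> C * (1 / (2 * C) * norm (u - v))"
        using C by (intro mult_left_mono close) auto
      finally show "dist (R (f + (K' u - K u))) (R (f + (K' v - K v))) \<le> 1 / 2 * dist u v"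
        using C by (simp add: dist_norm)
    qed
  qed auto
  then obtain u where "R (f + (K' u - K u)) = u" by blast
  then have "u - K u = f + (K' u - K u)" using R[of "f + (K' u - K u)"] by simp
  then have "u - K' u = f" by (simp add: algebra_simps)
  then show "\<exists>u. u - K' u = f" by blast
qed

section \<open>The largest eigenvalue\<close>

text \<open>The method of continuity replaces the Fredholm alternative: to the right of its last singular
  parameter the family \<open>I - K \<nu>\<close> is invertible.\<close>

lemma last_singular_parameter:
  fixes K :: "real \<Rightarrow> 'a::{real_normed_vector, complete_space} \<Rightarrow> 'a"
  assumes lin: "\<And>\<nu>. \<nu> \<ge> \<nu>1 \<Longrightarrow> linear (K \<nu>)" and bdd: "\<And>\<nu>. \<nu> \<ge> \<nu>1 \<Longrightarrow> \<exists>B. \<forall>u. norm (K \<nu> u) \<le> B * norm u"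
    and cont: "\<And>\<nu> e. \<nu> \<ge> \<nu>1 \<Longrightarrow> e > 0 \<Longrightarrow> \<exists>d>0. \<forall>\<nu>'\<ge>\<nu>1. \<bar>\<nu>' - \<nu>\<bar> < d \<longrightarrow> (\<forall>u. norm (K \<nu>' u - K \<nu> u) \<le> e * norm u)"
    and small: "\<And>\<nu> u. \<nu> \<ge> \<Lambda> \<Longrightarrow> \<nu> \<ge> \<nu>1 \<Longrightarrow> norm (K \<nu> u) \<le> 1 / 2 * norm u"
    and comp: "\<And>\<nu> v. \<nu> \<ge> \<nu>1 \<Longrightarrow> (\<And>n. norm (v n) \<le> 1) \<Longrightarrow> (\<lambda>n. v n - K \<nu> (v n)) \<longlonglongrightarrow> 0 \<Longrightarrow>
        \<exists>l r. strict_mono (r :: nat \<Rightarrow> nat) \<and> (\<lambda>n. v (r n)) \<longlonglongrightarrow> l"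
    and bad: "u1 \<noteq> 0" "K \<nu>1 u1 = u1"
  shows "\<exists>\<nu>0\<ge>\<nu>1. (\<exists>u. u \<noteq> 0 \<and> K \<nu>0 u = u) \<and> (\<forall>\<nu>>\<nu>0. \<exists>C>0. \<forall>f. \<exists>u. u - K \<nu> u = f \<and> norm u \<le> C * norm f)"
    and "\<nu> \<ge> \<Lambda> \<Longrightarrow> \<nu> \<ge> \<nu>1 \<Longrightarrow> \<exists>u. u - K \<nu> u = f \<and> norm u \<le> 2 * norm f"
proof -
  define below where "below \<nu> C \<longleftrightarrow> (\<forall>u. norm u \<le> C * norm (u - K \<nu> u))" for \<nu> C
  define surj where "surj \<nu> \<longleftrightarrow> (\<forall>f. \<exists>u. u - K \<nu> u = f)" for \<nu>
  define good where "good \<nu> \<longleftrightarrow> (\<exists>C>0. below \<nu> C) \<and> surj \<nu>" for \<nu>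
  have pert: "below \<nu>' (2 * C) \<and> surj \<nu>'"
    if "below \<nu> C" "surj \<nu>" "C > 0" "\<nu> \<ge> \<nu>1" "\<nu>' \<ge> \<nu>1" "\<And>u. norm (K \<nu>' u - K \<nu> u) \<le> 1 / (2 * C) * norm u" for \<nu> \<nu>' C
    using perturbed_invertible[OF lin[OF that(4)] lin[OF that(5)] that(3) _ _ that(6)] that(1,2)
    unfolding below_def surj_def by blast
  have large: "below \<nu> 2 \<and> surj \<nu>" if "\<nu> \<ge> \<Lambda>" "\<nu> \<ge> \<nu>1" for \<nu>
    using perturbed_invertible[of "\<lambda>_. 0" "K \<nu>" 1, OF _ lin[OF that(2)]] small[OF that]
    unfolding below_def surj_def by (auto simp: linear_zero)
  then show "\<nu> \<ge> \<Lambda> \<Longrightarrow> \<nu> \<ge> \<nu>1 \<Longrightarrow> \<exists>u. u - K \<nu> u = f \<and> norm u \<le> 2 * norm f"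
    unfolding below_def surj_def by metis
  define A where "A = {\<nu>. \<nu> \<ge> \<nu>1 \<and> \<not> good \<nu>}"
  have "\<not> good \<nu>1"
  proof
    assume "good \<nu>1"
    then obtain C where "norm u1 \<le> C * norm (u1 - K \<nu>1 u1)" unfolding good_def below_def by blast
    then show False using bad by simp
  qed
  then have A1: "\<nu>1 \<in> A" by (simp add: A_def)
  have Abdd: "bdd_above A"
  proof (rule bdd_aboveI)
    fix x assume "x \<in> A"
    then have "\<nu>1 \<le> x" "\<not> good x" by (auto simp: A_def)
    then show "x \<le> max \<Lambda> \<nu>1" using large[of x] unfolding good_def by (meson linorder_le_cases max.coboundedI1 zero_less_numeral)
  qed
  define \<nu>0 where "\<nu>0 = Sup A"
  have v01: "\<nu>1 \<le> \<nu>0" unfolding \<nu>0_def by (rule cSup_upper[OF A1 Abdd])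
  have good_above: "good \<nu>" if "\<nu> > \<nu>0" for \<nu>
  proof (rule ccontr)
    assume "\<not> good \<nu>"
    then have "\<nu> \<in> A" using that v01 by (simp add: A_def)
    then have "\<nu> \<le> \<nu>0" unfolding \<nu>0_def by (rule cSup_upper[OF _ Abdd])
    then show False using that by simp
  qed
  \<comment> \<open>Invertibility is stable under small perturbations, so it would extend to members
    of \<open>A\<close> close to the supremum.\<close>
  have bad0: "\<not> good \<nu>0"
  proof
    assume "good \<nu>0"
    then obtain C where C: "C > 0" "below \<nu>0 C" "surj \<nu>0" unfolding good_def by blast
    obtain d where d: "d > 0" "\<And>\<nu>' u. \<nu>' \<ge> \<nu>1 \<Longrightarrow> \<bar>\<nu>' - \<nu>0\<bar> < d \<Longrightarrow> norm (K \<nu>' u - K \<nu>0 u) \<le> 1 / (2 * C) * norm u"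
      using cont[OF v01, of "1 / (2 * C)"] C(1) by auto
    obtain x where x: "x \<in> A" "\<nu>0 - d < x"
      using less_cSup_iff[of A "\<nu>0 - d"] A1 Abdd d(1) unfolding \<nu>0_def[symmetric] by auto
    have "x \<le> \<nu>0" unfolding \<nu>0_def by (rule cSup_upper[OF x(1) Abdd])
    then have "below x (2 * C) \<and> surj x"
      using x d v01 by (intro pert[OF C(2,3,1) v01]) (auto simp: A_def)
    then have "good x" unfolding good_def using C(1) by (intro conjI exI[of _ "2 * C"]) auto
    then show False using x(1) by (simp add: A_def)
  qed
  have "\<exists>u. u \<noteq> 0 \<and> K \<nu>0 u = u"
  proof (rule ccontr)
    assume no: "\<not> (\<exists>u. u \<noteq> 0 \<and> K \<nu>0 u = u)"
    interpret lin0: linear "K \<nu>0" by (rule lin[OF v01])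
    obtain B where B: "\<And>u. norm (K \<nu>0 u) \<le> B * norm u" using bdd[OF v01] by blast
    have bl: "bounded_linear (K \<nu>0)"
      by (intro bounded_linear.intro lin0.linear_axioms bounded_linear_axioms.intro exI[of _ B])
        (use B in \<open>simp add: mult.commute\<close>)
    \<comment> \<open>Otherwise there are unit vectors that \<open>K \<nu>0\<close> almost fixes;
      the compactness hypothesis extracts a limit, which is a fixed unit vector.\<close>
    have "\<exists>C>0. below \<nu>0 C"
    proof (rule ccontr)
      assume "\<not> (\<exists>C>0. below \<nu>0 C)"
      then have "\<exists>u. norm u > real (Suc n) * norm (u - K \<nu>0 u)" for n
        unfolding below_def by (metis not_le of_nat_0_less_iff zero_less_Suc)
      then obtain u where u: "\<And>n. norm (u n) > real (Suc n) * norm (u n - K \<nu>0 (u n))" by metis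
      have un: "norm (u n) > 0" for n using u[of n] by (smt (verit) mult_nonneg_nonneg norm_ge_zero of_nat_0_le_iff)
      define v where "v n = u n /\<^sub>R norm (u n)" for n
      have nv: "norm (v n) = 1" for n using un[of n] by (simp add: v_def)
      have vn: "norm (v n - K \<nu>0 (v n)) \<le> 1 / real (Suc n)" for n
      proof -
        have "v n - K \<nu>0 (v n) = (u n - K \<nu>0 (u n)) /\<^sub>R norm (u n)"
          by (simp add: v_def lin0.scale scaleR_diff_right)
        then have "norm (v n - K \<nu>0 (v n)) = norm (u n - K \<nu>0 (u n)) / norm (u n)" by (simp add: divide_inverse mult.commute)
        also have "\<dots> \<le> 1 / real (Suc n)" using u[of n] un[of n] by (simp add: field_simps)
        finally show ?thesis .
      qed
      have v0: "(\<lambda>n. v n - K \<nu>0 (v n)) \<longlonglongrightarrow> 0"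
        by (rule Lim_null_comparison[OF _ LIMSEQ_Suc[OF lim_1_over_n]]) (use vn in \<open>simp add: eventually_sequentially\<close>)
      obtain l r where r: "strict_mono r" "(\<lambda>n. v (r n)) \<longlonglongrightarrow> l"
        using comp[OF v01 _ v0] nv by (metis order_refl)
      have "(\<lambda>n. v (r n) - K \<nu>0 (v (r n))) \<longlonglongrightarrow> 0" using LIMSEQ_subseq_LIMSEQ[OF v0 r(1)] by (simp add: o_def)
      moreover have "(\<lambda>n. v (r n) - K \<nu>0 (v (r n))) \<longlonglongrightarrow> l - K \<nu>0 l"
        by (intro tendsto_diff r bounded_linear.tendsto[OF bl])
      ultimately have "K \<nu>0 l = l" using LIMSEQ_unique by force
      moreover have "norm l = 1" using tendsto_norm[OF r(2)] by (simp add: nv LIMSEQ_const_iff)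
      ultimately show False using no by force
    qed
    then obtain C where C: "C > 0" "below \<nu>0 C" by blast
    obtain d where d: "d > 0" "\<And>\<nu>' u. \<nu>' \<ge> \<nu>1 \<Longrightarrow> \<bar>\<nu>' - \<nu>0\<bar> < d \<Longrightarrow> norm (K \<nu>' u - K \<nu>0 u) \<le> 1 / (2 * (2 * C)) * norm u"
      using cont[OF v01, of "1 / (2 * (2 * C))"] C(1) by auto
    \<comment> \<open>The lower bound at \<open>\<nu>'\<close> is inherited from
      \<open>\<nu>0\<close> with constant \<open>2 * C\<close>, so a possible blow-up of the
      constants to the right of \<open>\<nu>0\<close> does no harm. Surjectivity holds at
      \<open>\<nu>'\<close> and is carried back to \<open>\<nu>0\<close>.\<close>
    define \<nu>' where "\<nu>' = \<nu>0 + d / 2"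
    have v': "\<nu>' \<ge> \<nu>1" "\<nu>' > \<nu>0" "\<bar>\<nu>' - \<nu>0\<bar> < d" using d(1) v01 by (auto simp: \<nu>'_def)
    have cl: "norm (K \<nu>' u - K \<nu>0 u) \<le> 1 / (2 * (2 * C)) * norm u" for u by (rule d(2)[OF v'(1,3)])
    have surj': "surj \<nu>'" using good_above[OF v'(2)] by (simp add: good_def)
    have "below \<nu>' (2 * C)"
      unfolding below_def
    proof
      fix u
      have "norm u \<le> C * norm (u - K \<nu>0 u)" using C(2) by (simp add: below_def)
      also have "\<dots> \<le> C * (norm (u - K \<nu>' u) + 1 / (2 * (2 * C)) * norm u)"
      proof (rule mult_left_mono)
        have "u - K \<nu>0 u = (u - K \<nu>' u) + (K \<nu>' u - K \<nu>0 u)" by simp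
        then have "norm (u - K \<nu>0 u) \<le> norm (u - K \<nu>' u) + norm (K \<nu>' u - K \<nu>0 u)" by (metis norm_triangle_ineq)
        then show "norm (u - K \<nu>0 u) \<le> norm (u - K \<nu>' u) + 1 / (2 * (2 * C)) * norm u" using cl[of u] by linarith
      qed (use C in simp)
      also have "\<dots> = C * norm (u - K \<nu>' u) + norm u / 4" using C by (simp add: distrib_left)
      finally have "norm u \<le> 4 / 3 * (C * norm (u - K \<nu>' u))" by simp
      also have "\<dots> \<le> 2 * (C * norm (u - K \<nu>' u))" using C by (intro mult_right_mono) auto
      finally show "norm u \<le> 2 * C * norm (u - K \<nu>' u)" by simp
    qed
    then have "below \<nu>0 (2 * (2 * C)) \<and> surj \<nu>0"
      using cl C(1) by (intro pert[OF _ surj' _ v'(1) v01]) (auto simp: norm_minus_commute)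
    then have "good \<nu>0" unfolding good_def using C(1) by (intro conjI exI[of _ "2 * (2 * C)"]) auto
    with bad0 show False by simp
  qed
  moreover have "\<exists>C>0. \<forall>f. \<exists>u. u - K \<nu> u = f \<and> norm u \<le> C * norm f" if "\<nu> > \<nu>0" for \<nu>
    using good_above[OF that] unfolding good_def below_def surj_def by metis
  ultimately show "\<exists>\<nu>0\<ge>\<nu>1. (\<exists>u. u \<noteq> 0 \<and> K \<nu>0 u = u) \<and> (\<forall>\<nu>>\<nu>0. \<exists>C>0. \<forall>f. \<exists>u. u - K \<nu> u = f \<and> norm u \<le> C * norm f)"
    using v01 by blast
qed

section \<open>The integral operator on exponentially decaying functions\<close>

lemma exp_weight_le: "\<bar>y\<bar> \<le> B / exp t \<Longrightarrow> \<bar>exp t * y\<bar> \<le> B" for y B t :: real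
  by (simp add: abs_mult pos_le_divide_eq mult.commute)

text \<open>The rate \<open>a\<close> is at most half the gap at \<open>\<nu>1\<close>, hence
  admissible for all larger parameters, with room for the rate \<open>3 / 2 * a\<close> that gives
  compactness. The bound \<open>1 / 2\<close> keeps the soliton and its derivatives in the weighted
  space.\<close>

locale spectral = soliton +
  fixes \<nu>1 a :: real
  assumes nu1: "\<nu>1 > 1" and evans0: "evans \<nu>1 = 0" and a_def: "a = min (gap \<nu>1 / 2) (1 / 2)"
begin

lemma a_pos: "a > 0" using gap_pos[OF nu1] by (simp add: a_def)

lemma a_le: "a \<le> 1 / 2" by (simp add: a_def)

lemma gap_ge: "\<nu> \<ge> \<nu>1 \<Longrightarrow> gap \<nu> \<ge> 2 * a"
  using gap_mono[of \<nu>1 \<nu>] nu1 by (simp add: a_def)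

lemma a_le_nu: "\<nu> \<ge> \<nu>1 \<Longrightarrow> a \<le> \<nu> / 4"
  using gap_ge[of \<nu>] gap_le[of \<nu>] by simp

text \<open>The bound has to be independent of \<open>\<nu>\<close>, because the series involves
  infinitely many spectral parameters tending to infinity.\<close>

lemma inner_const_le:
  assumes "\<nu> \<ge> \<nu>1" "b \<le> \<nu> / 4"
  shows "inner_const (\<nu> / 2) (disc_root \<nu>) 0 b \<le> 6" "0 \<le> inner_const (\<nu> / 2) (disc_root \<nu>) 0 b"
proof -
  have n: "norm (of_real (\<nu> / 2) + disc_root \<nu>) \<le> 3 / 2 * \<nu>"
    using norm_triangle_ineq[of "of_real (\<nu> / 2)" "disc_root \<nu>"] norm_disc_root_le[of \<nu>] assms nu1
    by (simp add: norm_divide)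
  have "inner_const (\<nu> / 2) (disc_root \<nu>) 0 b \<le> (3 / 2 * \<nu>) / (\<nu> / 4)"
    unfolding inner_const_def using n Re_disc_root_nonneg[of \<nu>] assms nu1 by (intro frac_le) auto
  then show "inner_const (\<nu> / 2) (disc_root \<nu>) 0 b \<le> 6" using assms nu1 by simp
  show "0 \<le> inner_const (\<nu> / 2) (disc_root \<nu>) 0 b"
    unfolding inner_const_def using Re_disc_root_nonneg[of \<nu>] assms nu1 by (intro divide_nonneg_nonneg) auto
qed

lemma response_const_le:
  assumes "\<nu> \<ge> \<nu>1" "b \<le> \<nu> / 4" "e > 0" "e \<le> gap \<nu> - b"
  shows "response_const (\<nu> / 2) (disc_root \<nu>) 0 b \<le> 7 / e" "0 \<le> response_const (\<nu> / 2) (disc_root \<nu>) 0 b"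
  unfolding response_const_def
  using inner_const_le[OF assms(1,2)] assms by (auto intro!: frac_le divide_nonneg_nonneg simp: gap_def)

lemma linT_le:
  assumes p: "lin_problem \<nu> b C f" and "\<nu> \<ge> \<nu>1" "b \<le> \<nu> / 4" "e > 0" "e \<le> gap \<nu> - b" "e' > 0" "e' \<le> \<nu> - b"
  shows "\<bar>linT \<nu> f x\<bar> \<le> C * (7 / e / e') / exp (b * \<bar>x\<bar>)"
proof -
  interpret lin_problem \<nu> b C f by fact
  have "rc / (\<nu> - b) \<le> 7 / e / e'"
    using response_const_le[OF assms(2-5)] assms by (intro frac_le) auto
  then have "C * (rc / (\<nu> - b)) \<le> C * (7 / e / e')" by (rule mult_left_mono) (rule outer.C_nonneg)
  then show ?thesis using abs_linT_le[of x] by (meson divide_right_mono exp_ge_zero order_trans)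
qed

lemma linT'_le:
  assumes p: "lin_problem \<nu> b C f" and "\<nu> \<ge> \<nu>1" "b \<le> \<nu> / 4" "e > 0" "e \<le> gap \<nu> - b" "e' > 0" "e' \<le> \<nu> - b"
  shows "\<bar>linT' \<nu> f x\<bar> \<le> C * (\<nu> * (7 / e / e') + 7 / e) / exp (b * \<bar>x\<bar>)"
proof -
  interpret lin_problem \<nu> b C f by fact
  have "rc / (\<nu> - b) \<le> 7 / e / e'"
    using response_const_le[OF assms(2-5)] assms by (intro frac_le) auto
  then have "C * (\<nu> * (rc / (\<nu> - b)) + rc) \<le> C * (\<nu> * (7 / e / e') + 7 / e)"
    using nu response_const_le[OF assms(2-5)] by (intro mult_left_mono add_mono outer.C_nonneg) auto
  then show ?thesis using abs_linT'_le[of x] by (meson divide_right_mono exp_ge_zero order_trans)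
qed

text \<open>Bounded continuous functions serve as an isometric model of the weighted space, so that
  completeness of the former can be used.\<close>

definition emb :: "(real \<Rightarrow>\<^sub>C real) \<Rightarrow> real \<Rightarrow> real" where
  "emb u x = exp (- (a * \<bar>x\<bar>)) * apply_bcontfun u x"

definition weighted_linT :: "real \<Rightarrow> (real \<Rightarrow>\<^sub>C real) \<Rightarrow> (real \<Rightarrow>\<^sub>C real)" where
  "weighted_linT \<nu> u = Bcontfun (\<lambda>x. exp (a * \<bar>x\<bar>) * linT \<nu> (\<lambda>t. q t * emb u t) x)"

lemma emb_cont: "continuous_on UNIV (emb u)"
  unfolding emb_def[abs_def] by (intro continuous_intros continuous_on_apply_bcontfun)

lemma emb_le: "\<bar>emb u x\<bar> \<le> norm u / exp (a * \<bar>x\<bar>)"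
  using norm_bounded[of u x] by (simp add: emb_def abs_mult exp_minus divide_inverse mult.commute mult_right_mono)

text \<open>Multiplication by the potential improves the decay rate by up to \<open>1\<close>. This
  gain is the source of compactness.\<close>

lemma lin_problem_q:
  assumes \<nu>: "\<nu> \<ge> \<nu>1" and b: "0 \<le> b" "b < gap \<nu>" "b \<le> a + 1" and f: "continuous_on UNIV f" "\<And>x. \<bar>f x\<bar> \<le> M / exp (a * \<bar>x\<bar>)"
  shows "lin_problem \<nu> b (real p * CQ * M) (\<lambda>t. q t * f t)"
proof
  have M0: "M \<ge> 0" using order_trans[OF abs_ge_zero f(2)[of 0]] by simp
  show "\<bar>q x * f x\<bar> \<le> real p * CQ * M / exp (b * \<bar>x\<bar>)" for x
  proof -
    have "\<bar>q x * f x\<bar> \<le> (real p * CQ * exp (- \<bar>x\<bar>)) * (M / exp (a * \<bar>x\<bar>))"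
      unfolding abs_mult using q_bound[of x] q_pos[of x] f(2)[of x] by (intro mult_mono) auto
    also have "\<dots> = real p * CQ * M * (exp (- \<bar>x\<bar>) * exp (- (a * \<bar>x\<bar>)))"
      by (simp only: exp_minus divide_inverse mult_ac)
    also have "exp (- \<bar>x\<bar>) * exp (- (a * \<bar>x\<bar>)) = exp (- ((a + 1) * \<bar>x\<bar>))"
      unfolding exp_add[symmetric] by (simp add: algebra_simps)
    also have "real p * CQ * M * exp (- ((a + 1) * \<bar>x\<bar>)) \<le> real p * CQ * M * exp (- (b * \<bar>x\<bar>))"
      using M0 b(3) by (intro mult_left_mono) (auto intro!: mult_right_mono)
    finally show ?thesis by (simp only: exp_minus divide_inverse)
  qed
qed (use \<nu> nu1 b f cont_q in \<open>auto intro!: continuous_intros\<close>)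

lemma lin_problem_emb: "\<nu> \<ge> \<nu>1 \<Longrightarrow> lin_problem \<nu> a (real p * CQ * norm u) (\<lambda>t. q t * emb u t)"
  using gap_ge[of \<nu>] a_pos by (intro lin_problem_q emb_cont emb_le) auto

lemma linT_cont: "lin_problem \<nu> b C f \<Longrightarrow> continuous_on UNIV (linT \<nu> f)"
  unfolding continuous_on_eq_continuous_at[OF open_UNIV] by (blast intro: DERIV_isCont[OF lin_problem.linT_deriv])

lemma weighted_linT_apply: assumes "\<nu> \<ge> \<nu>1" shows "apply_bcontfun (weighted_linT \<nu> u) x = exp (a * \<bar>x\<bar>) * linT \<nu> (\<lambda>t. q t * emb u t) x"
proof -
  note l = lin_problem_emb[OF assms, of u]
  have "(\<lambda>x. exp (a * \<bar>x\<bar>) * linT \<nu> (\<lambda>t. q t * emb u t) x) \<in> bcontfun"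
  proof (rule bcontfun_normI)
    show "continuous_on UNIV (\<lambda>x. exp (a * \<bar>x\<bar>) * linT \<nu> (\<lambda>t. q t * emb u t) x)"
      by (intro continuous_intros linT_cont[OF l])
    show "norm (exp (a * \<bar>x\<bar>) * linT \<nu> (\<lambda>t. q t * emb u t) x) \<le> real p * CQ * norm u * (7 / a / a)" for x
    proof -
      have "\<bar>linT \<nu> (\<lambda>t. q t * emb u t) x\<bar> \<le> real p * CQ * norm u * (7 / a / a) / exp (a * \<bar>x\<bar>)"
        using gap_ge[OF assms] a_le_nu[OF assms] a_pos by (intro linT_le[OF l assms]) auto
      then show ?thesis unfolding real_norm_def by (rule exp_weight_le)
    qed
  qed
  then show ?thesis by (simp add: weighted_linT_def Bcontfun_inverse)
qed

lemma weighted_linT_emb: assumes "\<nu> \<ge> \<nu>1" shows "emb (weighted_linT \<nu> u) x = linT \<nu> (\<lambda>t. q t * emb u t) x"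
  by (simp add: emb_def[of "weighted_linT \<nu> u"] weighted_linT_apply[OF assms] mult.assoc[symmetric] exp_add[symmetric])

lemma norm_weighted_linT_le:
  assumes "\<And>x. \<bar>linT \<nu> (\<lambda>t. q t * emb u t) x\<bar> \<le> B / exp (a * \<bar>x\<bar>)" "\<nu> \<ge> \<nu>1"
  shows "norm (weighted_linT \<nu> u) \<le> B"
proof (rule norm_bound)
  fix x show "norm (apply_bcontfun (weighted_linT \<nu> u) x) \<le> B"
    using exp_weight_le[OF assms(1)[of x]] by (simp add: weighted_linT_apply[OF assms(2)])
qed

lemma weighted_linT_linear: assumes "\<nu> \<ge> \<nu>1" shows "linear (weighted_linT \<nu>)"
proof
  show "weighted_linT \<nu> (u + v) = weighted_linT \<nu> u + weighted_linT \<nu> v" for u v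
  proof (rule bcontfun_eqI)
    fix x
    have "(\<lambda>t. q t * emb (u + v) t) = (\<lambda>t. q t * emb u t + q t * emb v t)"
      by (simp add: emb_def algebra_simps fun_eq_iff)
    then show "apply_bcontfun (weighted_linT \<nu> (u + v)) x = apply_bcontfun (weighted_linT \<nu> u + weighted_linT \<nu> v) x"
      by (simp add: weighted_linT_apply[OF assms] linT_add[OF lin_problem_emb[OF assms] lin_problem_emb[OF assms]] distrib_left)
  qed
  show "weighted_linT \<nu> (s *\<^sub>R u) = s *\<^sub>R weighted_linT \<nu> u" for s u
  proof (rule bcontfun_eqI)
    fix x
    have "(\<lambda>t. q t * emb (s *\<^sub>R u) t) = (\<lambda>t. s * (q t * emb u t))"
      by (simp add: emb_def fun_eq_iff)
    then show "apply_bcontfun (weighted_linT \<nu> (s *\<^sub>R u)) x = apply_bcontfun (s *\<^sub>R weighted_linT \<nu> u) x"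
      by (simp add: weighted_linT_apply[OF assms] linT_mult)
  qed
qed

lemma weighted_linT_bounded: assumes "\<nu> \<ge> \<nu>1" shows "norm (weighted_linT \<nu> u) \<le> real p * CQ * (7 / a / a) * norm u"
proof (rule norm_weighted_linT_le[OF _ assms])
  fix x
  show "\<bar>linT \<nu> (\<lambda>t. q t * emb u t) x\<bar> \<le> real p * CQ * (7 / a / a) * norm u / exp (a * \<bar>x\<bar>)"
    using linT_le[OF lin_problem_emb[OF assms] assms, of a a u x] gap_ge[OF assms] a_le_nu[OF assms] a_pos
    by (simp add: mult_ac)
qed

text \<open>From \<open>\<nu> = 2\<close> on, the gap is \<open>\<nu> / 2\<close> and the operator
  norm is of order \<open>\<nu>^-2\<close>. One power of \<open>\<nu>\<close> is spent on the
  numerical constants and the other, through the factor \<open>100\<close>, brings the norm below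
  \<open>1 / 2\<close>.\<close>

definition "Lam = max 2 (100 * real p * CQ)"

lemma weighted_linT_small: assumes "\<nu> \<ge> Lam" "\<nu> \<ge> \<nu>1" shows "norm (weighted_linT \<nu> u) \<le> 1 / 2 * norm u"
proof (rule norm_weighted_linT_le[OF _ assms(2)])
  fix x
  have \<nu>2: "\<nu> \<ge> 2" and \<nu>p: "\<nu> \<ge> 100 * real p * CQ" using assms(1) by (auto simp: Lam_def)
  have "\<bar>linT \<nu> (\<lambda>t. q t * emb u t) x\<bar> \<le> real p * CQ * norm u * (7 / (\<nu> / 4) / (3 / 4 * \<nu>)) / exp (a * \<bar>x\<bar>)"
    using gap_eq[OF \<nu>2] a_le_nu[OF assms(2)] \<nu>2
    by (intro linT_le[OF lin_problem_emb[OF assms(2)] assms(2)]) auto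
  also have "real p * CQ * norm u * (7 / (\<nu> / 4) / (3 / 4 * \<nu>)) \<le> 1 / 2 * norm u"
  proof -
    have "7 / (\<nu> / 4) / (3 / 4 * \<nu>) = (112 / 3 / \<nu>) / \<nu>" by simp
    also have "\<dots> \<le> 50 / \<nu>" using \<nu>2 by (intro divide_right_mono) (auto simp: field_simps)
    finally have "real p * CQ * (7 / (\<nu> / 4) / (3 / 4 * \<nu>)) \<le> real p * CQ * (50 / \<nu>)" by (intro mult_left_mono) auto
    also have "\<dots> \<le> 1 / 2" using \<nu>p \<nu>2 by (simp add: field_simps)
    finally have "real p * CQ * (7 / (\<nu> / 4) / (3 / 4 * \<nu>)) * norm u \<le> 1 / 2 * norm u" by (rule mult_right_mono) simp
    then show ?thesis by (simp only: mult_ac)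
  qed
  finally show "\<bar>linT \<nu> (\<lambda>t. q t * emb u t) x\<bar> \<le> 1 / 2 * norm u / exp (a * \<bar>x\<bar>)"
    by (simp add: divide_right_mono)
qed

lemma weighted_linT_cont:
  assumes \<nu>: "\<nu> \<ge> \<nu>1" and e: "e > 0"
  shows "\<exists>d>0. \<forall>\<nu>'\<ge>\<nu>1. \<bar>\<nu>' - \<nu>\<bar> < d \<longrightarrow> (\<forall>u. norm (weighted_linT \<nu>' u - weighted_linT \<nu> u) \<le> e * norm u)"
proof -
  define B where "B = real p * CQ * (3 * (1 + (2 * (\<nu> + 1)) / a) / a ^ 3)"
  have B: "B > 0" using a_pos \<nu> nu1 p5 unfolding B_def
    by (intro mult_pos_pos divide_pos_pos add_pos_pos) auto
  have "isCont disc_root \<nu>" using continuous_on_disc_root[of UNIV] by (simp add: continuous_on_eq_continuous_at)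
  then obtain d where d: "d > 0" "\<And>\<nu>'. \<bar>\<nu>' - \<nu>\<bar> < d \<Longrightarrow> norm (disc_root \<nu>' - disc_root \<nu>) < e / (2 * B)"
    unfolding continuous_at_eps_delta dist_norm real_norm_def
    by (metis B divide_pos_pos e mult_pos_pos zero_less_numeral)
  define d' where "d' = min (min d 1) (e / (2 * B))"
  have d'0: "d' > 0" using d B e by (simp add: d'_def)
  show ?thesis
  proof (intro exI[of _ d'] conjI allI impI d'0)
    fix \<nu>' u assume v: "\<nu>1 \<le> \<nu>'" "\<bar>\<nu>' - \<nu>\<bar> < d'"
    show "norm (weighted_linT \<nu>' u - weighted_linT \<nu> u) \<le> e * norm u"
    proof (rule norm_bound)
      fix x
      have "\<bar>linT \<nu>' (\<lambda>t. q t * emb u t) x - linT \<nu> (\<lambda>t. q t * emb u t) x\<bar> \<le> real p * CQ * norm u *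
          (3 * (1 + (2 * (\<nu> + 1)) / a) / a ^ 3 * (\<bar>\<nu>' - \<nu>\<bar> + norm (disc_root \<nu>' - disc_root \<nu>))) / exp (a * \<bar>x\<bar>)"
        using gap_ge[OF v(1)] gap_ge[OF \<nu>] a_pos v(2)
        by (intro linT_param_diff[OF lin_problem_emb[OF v(1)] lin_problem_emb[OF \<nu>]]) (auto simp: d'_def)
      also have "\<dots> = (B * (\<bar>\<nu>' - \<nu>\<bar> + norm (disc_root \<nu>' - disc_root \<nu>))) * norm u / exp (a * \<bar>x\<bar>)"
        by (simp add: B_def mult_ac)
      also have "\<dots> \<le> e * norm u / exp (a * \<bar>x\<bar>)"
      proof (intro divide_right_mono mult_right_mono)
        have "\<bar>\<nu>' - \<nu>\<bar> + norm (disc_root \<nu>' - disc_root \<nu>) \<le> e / (2 * B) + e / (2 * B)"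
          using v(2) d(2)[of \<nu>'] by (intro add_mono) (auto simp: d'_def)
        also have "\<dots> = e / B" by simp
        finally show "B * (\<bar>\<nu>' - \<nu>\<bar> + norm (disc_root \<nu>' - disc_root \<nu>)) \<le> e"
          using B by (simp add: pos_le_divide_eq mult.commute)
      qed auto
      finally have "\<bar>exp (a * \<bar>x\<bar>) * (linT \<nu>' (\<lambda>t. q t * emb u t) x - linT \<nu> (\<lambda>t. q t * emb u t) x)\<bar> \<le> e * norm u"
        by (rule exp_weight_le)
      then show "norm (apply_bcontfun (weighted_linT \<nu>' u - weighted_linT \<nu> u) x) \<le> e * norm u"
        by (simp add: weighted_linT_apply[OF v(1)] weighted_linT_apply[OF \<nu>] right_diff_distrib)
    qed
  qed
qed

text \<open>Because of the extra decay of the potential, \<open>weighted_linT \<nu> u\<close> is uniformly small at infinity, so that only the behaviour on a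
  fixed compact interval matters and Arzela--Ascoli applies there.\<close>

lemma weighted_linT_compact:
  assumes \<nu>: "\<nu> \<ge> \<nu>1" and v1: "\<And>n. norm (v n) \<le> 1" and v0: "(\<lambda>n. v n - weighted_linT \<nu> (v n)) \<longlonglongrightarrow> 0"
  shows "\<exists>l r. strict_mono (r :: nat \<Rightarrow> nat) \<and> (\<lambda>n. v (r n)) \<longlonglongrightarrow> l"
proof -
  \<comment> \<open>Less than the gap and therefore admissible, but larger than \<open>a\<close>:
    relative to the weight, the image of the operator decays like
    \<open>exp (- (a / 2 * \<bar>x\<bar>))\<close>.\<close>
  define b where "b = 3 / 2 * a"
  have b: "0 \<le> b" "b < gap \<nu>" "b \<le> a + 1" "a / 2 \<le> gap \<nu> - b" "b \<le> \<nu> / 4 + a / 2" using gap_ge[OF \<nu>] a_pos a_le a_le_nu[OF \<nu>] by (auto simp: b_def)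
  have lb: "lin_problem \<nu> b (real p * CQ * norm u) (\<lambda>t. q t * emb u t)" for u
    by (rule lin_problem_q[OF \<nu> b(1-3) emb_cont emb_le])
  have "\<exists>D\<ge>0. \<forall>u x. \<bar>linT \<nu> (\<lambda>t. q t * emb u t) x\<bar> \<le> norm u * D / exp (b * \<bar>x\<bar>)"
  proof (intro exI conjI allI)
    let ?D = "real p * CQ * \<bar>response_const (\<nu> / 2) (disc_root \<nu>) 0 b / (\<nu> - b)\<bar>"
    show "0 \<le> ?D" by simp
    fix u x
    have "\<bar>linT \<nu> (\<lambda>t. q t * emb u t) x\<bar> \<le> real p * CQ * norm u * (response_const (\<nu> / 2) (disc_root \<nu>) 0 b / (\<nu> - b)) / exp (b * \<bar>x\<bar>)"
      by (rule lin_problem.abs_linT_le[OF lb])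
    also have "\<dots> \<le> real p * CQ * norm u * \<bar>response_const (\<nu> / 2) (disc_root \<nu>) 0 b / (\<nu> - b)\<bar> / exp (b * \<bar>x\<bar>)"
      by (intro divide_right_mono mult_left_mono abs_ge_self) auto
    finally show "\<bar>linT \<nu> (\<lambda>t. q t * emb u t) x\<bar> \<le> norm u * ?D / exp (b * \<bar>x\<bar>)" by (simp only: mult_ac)
  qed
  then obtain D where D: "D \<ge> 0" "\<And>u x. \<bar>linT \<nu> (\<lambda>t. q t * emb u t) x\<bar> \<le> norm u * D / exp (b * \<bar>x\<bar>)" by blast
  have tail: "\<bar>apply_bcontfun (weighted_linT \<nu> u) x\<bar> \<le> norm u * D * exp (- (a / 2 * \<bar>x\<bar>))" for u x
  proof -
    have "\<bar>apply_bcontfun (weighted_linT \<nu> u) x\<bar> \<le> exp (a * \<bar>x\<bar>) * (norm u * D / exp (b * \<bar>x\<bar>))"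
      unfolding weighted_linT_apply[OF \<nu>] abs_mult using D(2)[of u x] by (intro mult_mono) auto
    also have "\<dots> = norm u * D * (exp (a * \<bar>x\<bar>) * exp (- (b * \<bar>x\<bar>)))" by (simp add: exp_minus divide_inverse)
    also have "exp (a * \<bar>x\<bar>) * exp (- (b * \<bar>x\<bar>)) = exp (- (a / 2 * \<bar>x\<bar>))"
      unfolding exp_add[symmetric] by (simp add: b_def algebra_simps)
    finally show ?thesis .
  qed
  have "((\<lambda>x. D * exp (- (a / 2 * x))) \<longlongrightarrow> D * 0) at_top"
    by (intro tendsto_intros filterlim_compose[OF exp_at_bot] filterlim_compose[OF filterlim_uminus_at_bot_at_top]
        filterlim_tendsto_pos_mult_at_top[OF tendsto_const _ filterlim_ident]) (use a_pos in auto)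
  then have "\<forall>\<^sub>F x in at_top. D * exp (- (a / 2 * x)) < 1 / 2" by (intro order_tendstoD(2)) auto
  then have "\<forall>\<^sub>F x in at_top. D * exp (- (a / 2 * x)) < 1 / 2 \<and> x \<ge> 0" by (intro eventually_conj eventually_ge_at_top)
  then obtain X where X: "D * exp (- (a / 2 * X)) < 1 / 2" "X \<ge> 0"
    by (metis (mono_tags, lifting) eventually_happens trivial_limit_at_top_linorder)
  define \<phi> where "\<phi> n x = linT \<nu> (\<lambda>t. q t * emb (v n) t) x" for n x
  define L where "L = real p * CQ * \<bar>\<nu> * (response_const (\<nu> / 2) (disc_root \<nu>) 0 a / (\<nu> - a)) + response_const (\<nu> / 2) (disc_root \<nu>) 0 a\<bar>"
  have d\<phi>: "(\<phi> n has_real_derivative linT' \<nu> (\<lambda>t. q t * emb (v n) t) x) (at x)" for n x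
    unfolding \<phi>_def by (rule lin_problem.linT_deriv[OF lin_problem_emb[OF \<nu>]])
  have L: "\<bar>linT' \<nu> (\<lambda>t. q t * emb (v n) t) x\<bar> \<le> L" for n x
  proof -
    have "\<bar>linT' \<nu> (\<lambda>t. q t * emb (v n) t) x\<bar> \<le> real p * CQ * norm (v n) * (\<nu> * (response_const (\<nu> / 2) (disc_root \<nu>) 0 a / (\<nu> - a)) + response_const (\<nu> / 2) (disc_root \<nu>) 0 a) / exp (a * \<bar>x\<bar>)"
      by (rule lin_problem.abs_linT'_le[OF lin_problem_emb[OF \<nu>]])
    also have "\<dots> \<le> real p * CQ * 1 * \<bar>\<nu> * (response_const (\<nu> / 2) (disc_root \<nu>) 0 a / (\<nu> - a)) + response_const (\<nu> / 2) (disc_root \<nu>) 0 a\<bar> / 1"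
    proof (intro frac_le mult_mono abs_ge_self)
      show "0 \<le> \<nu> * (response_const (\<nu> / 2) (disc_root \<nu>) 0 a / (\<nu> - a)) + response_const (\<nu> / 2) (disc_root \<nu>) 0 a"
        using response_const_le(2)[OF \<nu> a_le_nu[OF \<nu>] a_pos] gap_ge[OF \<nu>] a_le_nu[OF \<nu>] \<nu> nu1
        by (intro add_nonneg_nonneg mult_nonneg_nonneg divide_nonneg_nonneg) auto
    qed (use v1[of n] a_pos in auto)
    finally show ?thesis by (simp add: L_def)
  qed
  have L0: "L \<ge> 0" using order_trans[OF abs_ge_zero L] .
  have lip: "\<bar>\<phi> n x - \<phi> n y\<bar> \<le> L * \<bar>x - y\<bar>" for n x y
    using field_differentiable_bound[of UNIV "\<phi> n" "linT' \<nu> (\<lambda>t. q t * emb (v n) t)" L x y] d\<phi> L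
    by auto
  have \<phi>b: "\<bar>\<phi> n x\<bar> \<le> D" for n x
  proof -
    have "\<bar>\<phi> n x\<bar> \<le> norm (v n) * D / exp (b * \<bar>x\<bar>)" unfolding \<phi>_def by (rule D(2))
    also have "\<dots> \<le> 1 * D / 1" using v1[of n] D(1) b(1) by (intro frac_le mult_mono) auto
    finally show ?thesis by simp
  qed
  obtain g r where r: "strict_mono (r :: nat \<Rightarrow> nat)" and
    g: "\<And>e. 0 < e \<Longrightarrow> \<exists>N. \<forall>n x. n \<ge> N \<and> x \<in> {-X..X} \<longrightarrow> norm (\<phi> (r n) x - g x) < e"
  proof (rule Arzela_Ascoli[of "{-X..X}" \<phi> D])
    fix x e :: real assume "0 < e"
    show "\<exists>d>0. \<forall>n y. y \<in> {-X..X} \<and> norm (x - y) < d \<longrightarrow> norm (\<phi> n x - \<phi> n y) < e"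
    proof (intro exI[of _ "e / (L + 1)"] conjI allI impI)
      show "e / (L + 1) > 0" using \<open>0 < e\<close> L0 by simp
      fix n y assume "y \<in> {-X..X} \<and> norm (x - y) < e / (L + 1)"
      then have "(L + 1) * \<bar>x - y\<bar> < e" using L0 by (simp add: pos_less_divide_eq mult.commute)
      then show "norm (\<phi> n x - \<phi> n y) < e" using lip[of n x y] by (simp add: algebra_simps)
    qed
  qed (use \<phi>b in auto)
  have "Cauchy (\<lambda>n. v (r n))"
  proof (rule CauchyI)
    fix e :: real assume e: "e > 0"
    define e' where "e' = e / (16 * exp (a * X))"
    have e': "e' > 0" using e by (simp add: e'_def)
    obtain N1 where N1: "\<And>n x. n \<ge> N1 \<Longrightarrow> x \<in> {-X..X} \<Longrightarrow> \<bar>\<phi> (r n) x - g x\<bar> < e'" using g[OF e'] by auto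
    have "(\<lambda>n. v (r n) - weighted_linT \<nu> (v (r n))) \<longlonglongrightarrow> 0" using LIMSEQ_subseq_LIMSEQ[OF v0 r(1)] by (simp add: o_def)
    then obtain N2 where N2: "\<And>n. n \<ge> N2 \<Longrightarrow> norm (v (r n) - weighted_linT \<nu> (v (r n))) < e / 16"
      using e unfolding LIMSEQ_iff by (metis diff_zero divide_pos_pos zero_less_numeral)
    show "\<exists>M. \<forall>m\<ge>M. \<forall>n\<ge>M. norm (v (r m) - v (r n)) < e"
    proof (intro exI[of _ "max N1 N2"] allI impI)
      fix m n assume mn: "m \<ge> max N1 N2" "n \<ge> max N1 N2"
      define d where "d = v (r m) - v (r n)"
      interpret KL: linear "weighted_linT \<nu>" by (rule weighted_linT_linear[OF \<nu>])
      have Kd: "weighted_linT \<nu> d = weighted_linT \<nu> (v (r m)) - weighted_linT \<nu> (v (r n))" by (simp add: d_def KL.diff)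
      have "d - weighted_linT \<nu> d = (v (r m) - weighted_linT \<nu> (v (r m))) - (v (r n) - weighted_linT \<nu> (v (r n)))" by (simp add: Kd) (simp add: d_def)
      then have dK: "norm (d - weighted_linT \<nu> d) \<le> e / 8"
        using N2[of m] N2[of n] mn norm_triangle_ineq4[of "v (r m) - weighted_linT \<nu> (v (r m))" "v (r n) - weighted_linT \<nu> (v (r n))"] by simp
      \<comment> \<open>Inside \<open>{-X..X}\<close> the uniformly convergent subsequence
        contributes \<open>e / 8\<close>. Outside, the tail bound contributes
        \<open>norm d / 2\<close>, which is absorbed on the left.\<close>
      have "norm (weighted_linT \<nu> d) \<le> e / 8 + norm d / 2"
      proof (rule norm_bound)
        fix x
        show "norm (apply_bcontfun (weighted_linT \<nu> d) x) \<le> e / 8 + norm d / 2"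
        proof (cases "x \<in> {-X..X}")
          case True
          have "apply_bcontfun (weighted_linT \<nu> d) x = exp (a * \<bar>x\<bar>) * ((\<phi> (r m) x - g x) - (\<phi> (r n) x - g x))"
            by (simp add: Kd weighted_linT_apply[OF \<nu>] \<phi>_def algebra_simps)
          then have "\<bar>apply_bcontfun (weighted_linT \<nu> d) x\<bar> = exp (a * \<bar>x\<bar>) * \<bar>(\<phi> (r m) x - g x) - (\<phi> (r n) x - g x)\<bar>"
            by (simp add: abs_mult)
          also have "\<dots> \<le> exp (a * X) * (2 * e')"
          proof (intro mult_mono)
            show "exp (a * \<bar>x\<bar>) \<le> exp (a * X)" using True a_pos by (auto intro!: mult_left_mono)
            show "\<bar>(\<phi> (r m) x - g x) - (\<phi> (r n) x - g x)\<bar> \<le> 2 * e'" using N1[of m x] N1[of n x] mn True by auto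
          qed auto
          also have "\<dots> = e / 8" by (simp add: e'_def)
          finally show ?thesis using norm_ge_zero[of d] unfolding real_norm_def by linarith
        next
          case False
          then have "\<bar>x\<bar> \<ge> X" by auto
          then have "D * exp (- (a / 2 * \<bar>x\<bar>)) \<le> D * exp (- (a / 2 * X))"
            using D(1) a_pos by (intro mult_left_mono) auto
          then have "norm d * (D * exp (- (a / 2 * \<bar>x\<bar>))) \<le> norm d * (1 / 2)" using X(1) by (intro mult_left_mono) auto
          then show ?thesis using tail[of d x] e by (simp add: mult.assoc)
        qed
      qed
      moreover have "norm d \<le> norm (d - weighted_linT \<nu> d) + norm (weighted_linT \<nu> d)" by (metis diff_add_cancel norm_triangle_ineq)
      ultimately show "norm (v (r m) - v (r n)) < e" using dK e by (simp add: d_def[symmetric])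
    qed
  qed
  then obtain l where "(\<lambda>n. v (r n)) \<longlonglongrightarrow> l" using Cauchy_convergent convergent_def by blast
  then show ?thesis using r by blast
qed

lemma weighted_linT_singular: "\<exists>u. u \<noteq> 0 \<and> weighted_linT \<nu>1 u = u"
proof -
  note nu = nu1
  interpret jost p \<nu>1 by standard (use nu1 in simp)
  have "a \<ge> 0" "a < gap \<nu>1" using gap_ge[of \<nu>1] a_pos by auto
  note E = eigenfunction_if_evans_zero[OF nu evans0 this]
  obtain C where C: "\<And>x. \<bar>Y1 x\<bar> \<le> C * exp (- (a * \<bar>x\<bar>))" using E(1) by blast
  have Y1c: "continuous_on UNIV Y1" unfolding Y1_def[abs_def] by (intro continuous_intros m_cont)
  have "(\<lambda>x. exp (a * \<bar>x\<bar>) * Y1 x) \<in> bcontfun"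
  proof (rule bcontfun_normI)
    show "norm (exp (a * \<bar>x\<bar>) * Y1 x) \<le> C" for x
      using C[of x] by (simp add: abs_mult exp_minus divide_inverse[symmetric] pos_le_divide_eq mult.commute)
  qed (intro continuous_intros Y1c)
  then have ap: "apply_bcontfun (Bcontfun (\<lambda>x. exp (a * \<bar>x\<bar>) * Y1 x)) x = exp (a * \<bar>x\<bar>) * Y1 x" for x by (simp add: Bcontfun_inverse)
  define u where "u = Bcontfun (\<lambda>x. exp (a * \<bar>x\<bar>) * Y1 x)"
  have emb: "emb u = Y1" by (rule ext) (simp add: emb_def u_def ap mult.assoc[symmetric] exp_add[symmetric])
  have "weighted_linT \<nu>1 u = u"
  proof (rule bcontfun_eqI)
    fix x
    have "apply_bcontfun (weighted_linT \<nu>1 u) x = exp (a * \<bar>x\<bar>) * linT \<nu>1 (\<lambda>t. q t * Y1 t) x"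
      by (simp add: weighted_linT_apply emb)
    also have "linT \<nu>1 (\<lambda>t. q t * Y1 t) x = Y1 x" by (rule E(2)[symmetric])
    finally show "apply_bcontfun (weighted_linT \<nu>1 u) x = apply_bcontfun u x" by (simp add: u_def ap)
  qed
  moreover have "u \<noteq> 0"
  proof
    assume "u = 0"
    then have "Y1 x = 0" for x using emb by (auto simp: emb_def fun_eq_iff)
    then show False using E(3) by auto
  qed
  ultimately show ?thesis by blast
qed

definition eigenfunction :: "real \<Rightarrow> (real \<Rightarrow> real) \<Rightarrow> bool" where
  "eigenfunction \<nu> Z \<longleftrightarrow> continuous_on UNIV Z \<and> (\<exists>C. \<forall>x. \<bar>Z x\<bar> \<le> C / exp (a * \<bar>x\<bar>)) \<and> Z \<noteq> (\<lambda>_. 0) \<and> (\<forall>x. Z x = linT \<nu> (\<lambda>t. q t * Z t) x)"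

text \<open>The constant is a parameter, since one and the same \<open>C\<close> has to serve at
  every step of the recursion.\<close>

definition solvable :: "real \<Rightarrow> real \<Rightarrow> bool" where
  "solvable C \<nu> \<longleftrightarrow> (\<forall>f M. continuous_on UNIV f \<and> (\<forall>x. \<bar>f x\<bar> \<le> M / exp (a * \<bar>x\<bar>)) \<longrightarrow>
    (\<exists>Z. continuous_on UNIV Z \<and> (\<forall>x. \<bar>Z x\<bar> \<le> C * M / exp (a * \<bar>x\<bar>)) \<and> (\<forall>x. Z x = linT \<nu> (\<lambda>t. q t * Z t + f t) x)))"

text \<open>The inverse may blow up as the parameter approaches \<open>\<nu>0\<close>, so no
  constant is available for all larger parameters. From \<open>Lam\<close> on, the bound
  \<open>2\<close> for a small perturbation of the identity holds, and finitely many further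
  parameters can be added by taking a sum of constants.\<close>

lemma last_eigenvalue:
  "\<exists>\<nu>0\<ge>\<nu>1. (\<exists>Z. eigenfunction \<nu>0 Z) \<and>
    (\<forall>N. finite N \<longrightarrow> (\<exists>C>0. \<forall>\<nu>. \<nu> \<in> N \<and> \<nu> > \<nu>0 \<or> \<nu> \<ge> Lam \<and> \<nu> > \<nu>0 \<longrightarrow> solvable C \<nu>))"
proof -
  obtain u1 where u1: "u1 \<noteq> 0" "weighted_linT \<nu>1 u1 = u1" using weighted_linT_singular by blast
  have bd: "\<exists>B. \<forall>u. norm (weighted_linT \<nu> u) \<le> B * norm u" if "\<nu> \<ge> \<nu>1" for \<nu> using weighted_linT_bounded[OF that] by blast
  have "\<exists>\<nu>0\<ge>\<nu>1. (\<exists>u. u \<noteq> 0 \<and> weighted_linT \<nu>0 u = u) \<and> (\<forall>\<nu>>\<nu>0. \<exists>C>0. \<forall>f. \<exists>u. u - weighted_linT \<nu> u = f \<and> norm u \<le> C * norm f)"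
    by (rule last_singular_parameter(1)[where \<Lambda> = Lam]) (fact weighted_linT_linear bd weighted_linT_cont weighted_linT_small weighted_linT_compact u1)+
  then obtain \<nu>0 u where v0: "\<nu>0 \<ge> \<nu>1" and u: "u \<noteq> 0" "weighted_linT \<nu>0 u = u"
    and inv: "\<And>\<nu>. \<nu> > \<nu>0 \<Longrightarrow> \<exists>C>0. \<forall>f. \<exists>u. u - weighted_linT \<nu> u = f \<and> norm u \<le> C * norm f"
    by metis
  have inv2: "\<exists>u. u - weighted_linT \<nu> u = f \<and> norm u \<le> 2 * norm f" if "\<nu> \<ge> Lam" "\<nu> \<ge> \<nu>1" for \<nu> f
    by (rule last_singular_parameter(2)[where \<Lambda> = Lam]) (fact weighted_linT_linear bd weighted_linT_cont weighted_linT_small weighted_linT_compact u1 that)+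
  have solve: "\<exists>Z. continuous_on UNIV Z \<and> (\<forall>x. \<bar>Z x\<bar> \<le> C * (7 / a / a) * M / exp (a * \<bar>x\<bar>)) \<and> (\<forall>x. Z x = linT \<nu> (\<lambda>t. q t * Z t + f t) x)"
    if \<nu>: "\<nu> > \<nu>0" and C: "C > 0" "\<And>f. \<exists>u. u - weighted_linT \<nu> u = f \<and> norm u \<le> C * norm f"
      and f: "continuous_on UNIV f" "\<And>x. \<bar>f x\<bar> \<le> M / exp (a * \<bar>x\<bar>)" for \<nu> C f M
  proof -
    have \<nu>1: "\<nu> \<ge> \<nu>1" using \<nu> v0 by simp
    interpret lp: lin_problem \<nu> a M f
      by standard (use f a_pos gap_ge[OF \<nu>1] nu1 \<nu>1 in auto)
    have le: "\<bar>linT \<nu> f x\<bar> \<le> M * (7 / a / a) / exp (a * \<bar>x\<bar>)" for x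
      using gap_ge[OF \<nu>1] a_le_nu[OF \<nu>1] a_pos by (intro linT_le[OF lp.lin_problem_axioms \<nu>1]) auto
    have "(\<lambda>x. exp (a * \<bar>x\<bar>) * linT \<nu> f x) \<in> bcontfun"
    proof (rule bcontfun_normI)
      show "norm (exp (a * \<bar>x\<bar>) * linT \<nu> f x) \<le> M * (7 / a / a)" for x
        using exp_weight_le[OF le[of x]] by simp
    qed (intro continuous_intros linT_cont[OF lp.lin_problem_axioms])
    then have ap: "apply_bcontfun (Bcontfun (\<lambda>x. exp (a * \<bar>x\<bar>) * linT \<nu> f x)) x = exp (a * \<bar>x\<bar>) * linT \<nu> f x" for x
      by (simp add: Bcontfun_inverse)
    define g where "g = Bcontfun (\<lambda>x. exp (a * \<bar>x\<bar>) * linT \<nu> f x)"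
    have ng: "norm g \<le> M * (7 / a / a)"
      by (rule norm_bound) (use exp_weight_le[OF le] in \<open>simp add: g_def ap\<close>)
    obtain z where z: "z - weighted_linT \<nu> z = g" "norm z \<le> C * norm g" using C(2) by blast
    show ?thesis
    proof (intro exI[of _ "emb z"] conjI allI emb_cont)
      fix x
      have "norm z \<le> C * (7 / a / a) * M" using z(2) mult_left_mono[OF ng, of C] C(1) by (simp add: mult_ac)
      then show "\<bar>emb z x\<bar> \<le> C * (7 / a / a) * M / exp (a * \<bar>x\<bar>)"
        by (intro order_trans[OF emb_le divide_right_mono]) auto
      have "apply_bcontfun z x = apply_bcontfun (weighted_linT \<nu> z + g) x" using z(1) by (simp add: algebra_simps)
      then have "emb z x = linT \<nu> (\<lambda>t. q t * emb z t) x + linT \<nu> f x"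
        using weighted_linT_emb[OF \<nu>1, of z x] by (simp add: emb_def[of z x] emb_def[of "weighted_linT \<nu> z"] g_def ap distrib_left mult.assoc[symmetric] exp_add[symmetric])
      then show "emb z x = linT \<nu> (\<lambda>t. q t * emb z t + f t) x"
        by (simp add: linT_add[OF lin_problem_emb[OF \<nu>1] lp.lin_problem_axioms])
    qed
  qed
  show ?thesis
    unfolding eigenfunction_def solvable_def
  proof (rule exI[of _ \<nu>0], intro conjI v0 allI impI)
    show "\<exists>Z. continuous_on UNIV Z \<and> (\<exists>C. \<forall>x. \<bar>Z x\<bar> \<le> C / exp (a * \<bar>x\<bar>)) \<and> Z \<noteq> (\<lambda>_. 0) \<and> (\<forall>x. Z x = linT \<nu>0 (\<lambda>t. q t * Z t) x)"
    proof (intro exI[of _ "emb u"] conjI emb_cont exI[of _ "norm u"] allI emb_le)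
      show "emb u \<noteq> (\<lambda>_. 0)"
      proof
        assume "emb u = (\<lambda>_. 0)"
        then have "apply_bcontfun u x = 0" for x by (auto simp: emb_def fun_eq_iff)
        then have "u = 0" by (intro bcontfun_eqI) simp
        with u(1) show False by simp
      qed
      show "emb u x = linT \<nu>0 (\<lambda>t. q t * emb u t) x" for x using weighted_linT_emb[OF v0, of u x] u(2) by simp
    qed
    fix N :: "real set" assume N: "finite N"
    obtain Cf where Cf: "\<And>\<nu>. \<nu> > \<nu>0 \<Longrightarrow> Cf \<nu> > 0" "\<And>\<nu> f. \<nu> > \<nu>0 \<Longrightarrow> \<exists>u. u - weighted_linT \<nu> u = f \<and> norm u \<le> Cf \<nu> * norm f"
      using inv by metis
    define C where "C = 2 + (\<Sum>\<nu>\<in>N. \<bar>Cf \<nu>\<bar>)"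
    have C0: "C > 0" unfolding C_def by (rule add_pos_nonneg) (auto intro: sum_nonneg)
    have CN: "Cf \<nu> \<le> C" if "\<nu> \<in> N" for \<nu>
      using member_le_sum[OF that, of "\<lambda>\<nu>. \<bar>Cf \<nu>\<bar>"] N by (simp add: C_def)
    have C2: "2 \<le> C" by (simp add: C_def sum_nonneg)
    show "\<exists>C>0. \<forall>\<nu>. \<nu> \<in> N \<and> \<nu> > \<nu>0 \<or> \<nu> \<ge> Lam \<and> \<nu> > \<nu>0 \<longrightarrow>
        (\<forall>f M. continuous_on UNIV f \<and> (\<forall>x. \<bar>f x\<bar> \<le> M / exp (a * \<bar>x\<bar>)) \<longrightarrow>
          (\<exists>Z. continuous_on UNIV Z \<and> (\<forall>x. \<bar>Z x\<bar> \<le> C * M / exp (a * \<bar>x\<bar>)) \<and> (\<forall>x. Z x = linT \<nu> (\<lambda>t. q t * Z t + f t) x)))"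
    proof (intro exI[of _ "C * (7 / a / a)"] conjI allI impI)
      show "C * (7 / a / a) > 0" using C0 a_pos by simp
      fix \<nu> f M
      assume v: "\<nu> \<in> N \<and> \<nu> > \<nu>0 \<or> \<nu> \<ge> Lam \<and> \<nu> > \<nu>0"
        and f: "continuous_on UNIV f \<and> (\<forall>x. \<bar>f x\<bar> \<le> M / exp (a * \<bar>x\<bar>))"
      have "\<exists>u. u - weighted_linT \<nu> u = g \<and> norm u \<le> C * norm g" for g
      proof (cases "\<nu> \<in> N")
        case True
        then show ?thesis using Cf(2)[of \<nu> g] v mult_right_mono[OF CN[OF True], of "norm g"] by (meson norm_ge_zero order_trans)
      next
        case False
        then show ?thesis using inv2[of \<nu> g] v v0 mult_right_mono[OF C2, of "norm g"] by (meson less_imp_le norm_ge_zero order_trans)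
      qed
      then show "\<exists>Z. continuous_on UNIV Z \<and> (\<forall>x. \<bar>Z x\<bar> \<le> C * (7 / a / a) * M / exp (a * \<bar>x\<bar>)) \<and> (\<forall>x. Z x = linT \<nu> (\<lambda>t. q t * Z t + f t) x)"
        using v f by (intro solve[of \<nu> C f M] C0) auto
    qed
  qed
qed

end

section \<open>Weak derivatives\<close>

definition smooth :: "(real \<Rightarrow> real) \<Rightarrow> bool" where
  "smooth f \<longleftrightarrow> (\<forall>k x. ((deriv ^^ k) f) differentiable (at x))"

text \<open>Iterated derivatives need not be computed: it is enough to find a set of differentiable
  functions that contains \<open>f\<close> and is closed under \<open>deriv\<close>.\<close>

lemma smooth_coinduct:
  assumes f: "f \<in> S" and S: "\<And>g. g \<in> S \<Longrightarrow> (\<forall>x. g differentiable (at x)) \<and> deriv g \<in> S"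
  shows "smooth f"
proof -
  have "(deriv ^^ k) f \<in> S" for k by (induction k) (use f S in auto)
  then show ?thesis using S by (auto simp: smooth_def)
qed

lemma smooth_deriv: "smooth f \<Longrightarrow> smooth (deriv f)"
  unfolding smooth_def by (metis comp_apply funpow_Suc_right)

lemma smooth_DERIV: "smooth f \<Longrightarrow> (f has_real_derivative deriv f x) (at x)"
  unfolding smooth_def by (metis DERIV_deriv_iff_real_differentiable funpow_0)

lemma smooth_if_deriv:
  assumes "\<And>x. (f has_real_derivative g x) (at x)" "smooth g"
  shows "smooth f"
proof (rule smooth_coinduct[of f "insert f (Collect smooth)"])
  fix h assume h: "h \<in> insert f (Collect smooth)"
  have "deriv f = g" using DERIV_imp_deriv[OF assms(1)] by auto
  then show "(\<forall>x. h differentiable (at x)) \<and> deriv h \<in> insert f (Collect smooth)"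
    using h assms smooth_deriv smooth_DERIV real_differentiable_def by fastforce
qed simp

lemma smooth_affine: assumes "smooth f" shows "smooth (\<lambda>x. c * f (m * x + d))"
proof (rule smooth_coinduct[of _ "{\<lambda>x. c * f (m * x + d) |c f. smooth f}"])
  fix g assume "g \<in> {\<lambda>x. c * f (m * x + d) |c f. smooth f}"
  then obtain c f where g: "g = (\<lambda>x. c * f (m * x + d))" "smooth f" by blast
  have d: "(g has_real_derivative c * m * deriv f (m * x + d)) (at x)" for x
    unfolding g(1)
    by (rule DERIV_cong[OF DERIV_cmult[OF DERIV_chain2[OF smooth_DERIV[OF g(2)]]]]) (auto intro!: derivative_eq_intros)
  have "deriv g = (\<lambda>x. c * m * deriv f (m * x + d))" using DERIV_imp_deriv[OF d] by auto
  then show "(\<forall>x. g differentiable (at x)) \<and> deriv g \<in> {\<lambda>x. c * f (m * x + d) |c f. smooth f}"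
    using d smooth_deriv[OF g(2)] real_differentiable_def by blast
qed (use assms in blast)

lemma smooth_diff: assumes "smooth f" "smooth g" shows "smooth (\<lambda>x. f x - g x)"
proof (rule smooth_coinduct[of _ "{\<lambda>x. f x - g x |f g. smooth f \<and> smooth g}"])
  fix h assume "h \<in> {\<lambda>x. f x - g x |f g. smooth f \<and> smooth g}"
  then obtain f g where h: "h = (\<lambda>x. f x - g x)" "smooth f" "smooth g" by blast
  have d: "(h has_real_derivative deriv f x - deriv g x) (at x)" for x
    unfolding h(1) by (intro DERIV_diff smooth_DERIV h)
  have "deriv h = (\<lambda>x. deriv f x - deriv g x)" using DERIV_imp_deriv[OF d] by auto
  then show "(\<forall>x. h differentiable (at x)) \<and> deriv h \<in> {\<lambda>x. f x - g x |f g. smooth f \<and> smooth g}"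
    using d smooth_deriv[OF h(2)] smooth_deriv[OF h(3)] real_differentiable_def by blast
qed (use assms in blast)

text \<open>The functions built from \<open>flat\<close> contain the standard bump functions and are closed under differentiation.\<close>

definition flat :: "real poly \<Rightarrow> real \<Rightarrow> real" where
  "flat P x = (if x > 0 then poly P (1 / x) * exp (- 1 / x) else 0)"

lemma flat_minus: "flat (- P) x = - flat P x"
  by (simp add: flat_def)

lemma poly_times_exp_tendsto_0: "((\<lambda>y. y ^ k * poly P y * exp (- y)) \<longlongrightarrow> (0::real)) at_top"
proof (induction P arbitrary: k)
  case 0 then show ?case by simp
next
  case (pCons a P)
  have "((\<lambda>y. y ^ k / exp y) \<longlongrightarrow> (0::real)) at_top" by (rule tendsto_power_div_exp_0)
  then have "((\<lambda>y. a * (y ^ k / exp y) + y ^ Suc k * poly P y * exp (- y)) \<longlongrightarrow> a * 0 + 0) at_top"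
    by (intro tendsto_intros pCons.IH)
  moreover have "(\<lambda>y. a * (y ^ k / exp y) + y ^ Suc k * poly P y * exp (- y)) = (\<lambda>y. y ^ k * poly (pCons a P) y * exp (- y))"
    by (rule ext) (simp add: exp_minus field_simps)
  ultimately show ?case by simp
qed

text \<open>In the variable \<open>y = 1 / x\<close> the derivative of
  \<open>P y * exp (- y)\<close> is \<open>y^2 * (P y - P' y) * exp (- y)\<close>, again of the same
  kind. At the origin the difference quotient tends to zero because the exponential beats every
  polynomial in \<open>y\<close>.\<close>

lemma flat_deriv: "(flat P has_real_derivative flat ([:0, 0, 1:] * (P - pderiv P)) x) (at x)"
proof (cases x "0 :: real" rule: linorder_cases)
  case less
  have "((\<lambda>_. 0) has_real_derivative 0) (at x)" by simp
  then have "(flat P has_real_derivative 0) (at x)"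
    by (rule has_field_derivative_transform_within_open[of _ _ _ "{..<0}"]) (use less in \<open>auto simp: flat_def\<close>)
  then show ?thesis using less by (simp add: flat_def)
next
  case greater
  have "((\<lambda>x. poly P (1 / x) * exp (- 1 / x)) has_real_derivative
     poly (pderiv P) (1 / x) * (- 1 / x\<^sup>2) * exp (- 1 / x) + exp (- 1 / x) * (1 / x\<^sup>2) * poly P (1 / x)) (at x)"
  proof (rule DERIV_mult)
    have i: "((\<lambda>x. 1 / x) has_real_derivative - 1 / x\<^sup>2) (at x)"
      using greater by (auto intro!: derivative_eq_intros simp: power2_eq_square)
    show "((\<lambda>x. poly P (1 / x)) has_real_derivative poly (pderiv P) (1 / x) * (- 1 / x\<^sup>2)) (at x)"
      by (rule DERIV_chain2[OF poly_DERIV i])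
    show "((\<lambda>x. exp (- 1 / x)) has_real_derivative exp (- 1 / x) * (1 / x\<^sup>2)) (at x)"
      using greater by (auto intro!: derivative_eq_intros simp: power2_eq_square)
  qed
  then have "(flat P has_real_derivative
     poly (pderiv P) (1 / x) * (- 1 / x\<^sup>2) * exp (- 1 / x) + exp (- 1 / x) * (1 / x\<^sup>2) * poly P (1 / x)) (at x)"
    by (rule has_field_derivative_transform_within_open[of _ _ _ "{0<..}"]) (use greater in \<open>auto simp: flat_def\<close>)
  then show ?thesis
    using greater by (rule_tac DERIV_cong) (auto simp: flat_def algebra_simps power2_eq_square)
next
  case equal
  have "((\<lambda>h. (flat P (0 + h) - flat P 0) / h) \<longlongrightarrow> 0) (at 0)"
    unfolding filterlim_at_split
  proof
    show "((\<lambda>h. (flat P (0 + h) - flat P 0) / h) \<longlongrightarrow> 0) (at_left 0)"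
      by (rule tendsto_eventually) (auto simp: flat_def eventually_at_filter intro!: always_eventually)
    have "((\<lambda>h. (1 / h) ^ 1 * poly P (1 / h) * exp (- (1 / h))) \<longlongrightarrow> 0) (at_right 0)"
      by (rule filterlim_compose[OF poly_times_exp_tendsto_0])
        (use filterlim_inverse_at_top_right in \<open>simp add: inverse_eq_divide\<close>)
    then show "((\<lambda>h. (flat P (0 + h) - flat P 0) / h) \<longlongrightarrow> 0) (at_right 0)"
      by (rule Lim_transform_eventually) (auto simp: flat_def eventually_at_filter intro!: always_eventually)
  qed
  then show ?thesis using equal by (simp add: DERIV_def flat_def)
qed

definition bump_comb :: "(real poly \<times> real poly) list \<Rightarrow> real \<Rightarrow> real" where
  "bump_comb L x = (\<Sum>(P, R)\<leftarrow>L. flat P x * flat R (1 - x))"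

lemma bump_comb_deriv: "\<exists>L'. \<forall>x. (bump_comb L has_real_derivative bump_comb L' x) (at x)"
proof (induction L)
  case Nil
  then show ?case by (intro exI[of _ "[]"]) (simp add: bump_comb_def[abs_def])
next
  case (Cons a L)
  obtain P R where a: "a = (P, R)" by (cases a)
  obtain L' where L': "\<And>x. (bump_comb L has_real_derivative bump_comb L' x) (at x)" using Cons.IH by blast
  let ?D = "\<lambda>P. [:0, 0, 1:] * (P - pderiv P) :: real poly"
  have R: "((\<lambda>x. flat R (1 - x)) has_real_derivative flat (?D R) (1 - x) * (- 1)) (at x)" for x
    by (rule DERIV_chain2[OF flat_deriv]) (auto intro!: derivative_eq_intros)
  have m: "flat (- ?D R) y = - flat (?D R) y" for y by (rule flat_minus)
  have "(bump_comb (a # L) has_real_derivative bump_comb ((?D P, R) # (P, - ?D R) # L') x) (at x)" for x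
  proof -
    have "((\<lambda>x. flat P x * flat R (1 - x) + bump_comb L x) has_real_derivative
      (flat (?D P) x * flat R (1 - x) + flat (?D R) (1 - x) * (- 1) * flat P x) + bump_comb L' x) (at x)"
      by (intro DERIV_add DERIV_mult flat_deriv R L')
    moreover have "bump_comb (a # L) = (\<lambda>x. flat P x * flat R (1 - x) + bump_comb L x)"
      by (simp add: bump_comb_def a fun_eq_iff)
    moreover have "bump_comb ((?D P, R) # (P, - ?D R) # L') x = (flat (?D P) x * flat R (1 - x) + flat (?D R) (1 - x) * (- 1) * flat P x) + bump_comb L' x"
      unfolding bump_comb_def by (simp del: mult_pCons_left mult_pCons_right add: m)
    ultimately show ?thesis by simp
  qed
  then show ?case by blast
qed

lemma smooth_bump_comb: "smooth (bump_comb L)"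
proof (rule smooth_coinduct[of _ "range bump_comb"])
  fix g assume "g \<in> range bump_comb"
  then obtain L where g: "g = bump_comb L" by blast
  obtain L' where L': "\<And>x. (bump_comb L has_real_derivative bump_comb L' x) (at x)" using bump_comb_deriv by blast
  then have "deriv g = bump_comb L'" unfolding g using DERIV_imp_deriv by blast
  then show "(\<forall>x. g differentiable (at x)) \<and> deriv g \<in> range bump_comb"
    using L' g real_differentiable_def by blast
qed simp

text \<open>The normalised antiderivative of the bump \<open>flat 1 x * flat 1 (1 - x)\<close>,
  which is positive exactly on the open unit interval.\<close>

lemma ex_smooth_step:
  "\<exists>\<theta>. smooth \<theta> \<and> (\<forall>x\<le>0. \<theta> x = 0) \<and> (\<forall>x\<ge>1. \<theta> x = 1) \<and> (\<forall>x. 0 \<le> \<theta> x \<and> \<theta> x \<le> 1)"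
proof -
  define b where "b x = flat 1 x * flat 1 (1 - x)" for x
  have b: "b = bump_comb [(1, 1)]" by (simp add: b_def bump_comb_def fun_eq_iff)
  have bs: "smooth b" unfolding b by (rule smooth_bump_comb)
  have b0: "b x \<ge> 0" "x \<le> 0 \<or> x \<ge> 1 \<Longrightarrow> b x = 0" "0 < x \<Longrightarrow> x < 1 \<Longrightarrow> b x > 0" for x
    by (auto simp: b_def flat_def)
  have bc: "continuous_on A b" for A
    using smooth_DERIV[OF bs] DERIV_isCont by (blast intro: continuous_at_imp_continuous_on)
  define G where "G x = integral {- 1..x} b" for x
  have Gneg: "G x = 0" if "x \<le> 0" for x
  proof -
    have "integral {- 1..x} b = integral {- 1..x} (\<lambda>_. 0)" by (rule integral_cong) (use that b0(2) in auto)
    then show ?thesis by (simp add: G_def)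
  qed
  have dG: "(G has_real_derivative b x) (at x)" for x
  proof (cases "x < 0")
    case True
    have "(G has_real_derivative 0) (at x)"
      by (rule has_field_derivative_transform_within_open[of "\<lambda>_. 0" _ _ "{..<0}"]) (use True Gneg in auto)
    then show ?thesis using True b0(2)[of x] by simp
  next
    case False
    have "((\<lambda>x. integral {- 1..x} b) has_real_derivative b x) (at x within {- 1..x + 1})"
      by (rule integral_has_real_derivative[OF bc]) (use False in auto)
    then show ?thesis using False by (simp add: G_def[abs_def] at_within_Icc_at)
  qed
  have mono: "G x \<le> G y" if "x \<le> y" for x y
    by (rule DERIV_nonneg_imp_nondecreasing[OF that]) (use dG b0 in blast)
  have G1: "G 1 > 0"
  proof -
    have "G 0 < G 1"
      by (rule DERIV_pos_imp_increasing_open[of 0 1 G])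
        (use dG b0(3) in \<open>auto intro!: continuous_at_imp_continuous_on DERIV_isCont[OF dG]\<close>)
    then show ?thesis using Gneg[of 0] by simp
  qed
  have Gpos: "G x = G 1" if "x \<ge> 1" for x
  proof (rule antisym)
    show "G x \<le> G 1"
      by (rule DERIV_nonpos_imp_nonincreasing[OF that]) (use dG b0(2) in \<open>metis order_refl\<close>)
    show "G 1 \<le> G x" using that by (rule mono)
  qed
  define \<theta> where "\<theta> x = G x / G 1" for x
  have "smooth \<theta>"
  proof (rule smooth_if_deriv)
    show "(\<theta> has_real_derivative (1 / G 1) * b (1 * x + 0)) (at x)" for x
      unfolding \<theta>_def[abs_def] using DERIV_cdivide[OF dG[of x], of "G 1"] by simp
    show "smooth (\<lambda>x. (1 / G 1) * b (1 * x + 0))" by (rule smooth_affine[OF bs])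
  qed
  moreover have "0 \<le> \<theta> x \<and> \<theta> x \<le> 1" for x
  proof -
    have "0 \<le> G x" using Gneg[of x] mono[of 0 x] Gneg[of 0] by (cases "x \<le> 0") auto
    moreover have "G x \<le> G 1" using Gpos[of x] mono[of x 1] by (cases "x \<ge> 1") auto
    ultimately show ?thesis using G1 by (simp add: \<theta>_def)
  qed
  moreover have "\<forall>x\<le>0. \<theta> x = 0" by (simp add: \<theta>_def Gneg)
  moreover have "\<theta> x = 1" if "x \<ge> 1" for x unfolding \<theta>_def Gpos[OF that] using G1 by simp
  ultimately show ?thesis by blast
qed

section \<open>Test functions and uniqueness of weak derivatives\<close>

lemma test_function_smooth: "test_function \<phi> \<longleftrightarrow> smooth \<phi> \<and> (\<exists>R. \<forall>x. \<bar>x\<bar> > R \<longrightarrow> \<phi> x = 0)"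
  by (simp add: test_function_def smooth_def)

lemma test_function_deriv:
  assumes "test_function \<phi>" shows "test_function (deriv \<phi>)"
proof -
  obtain R where R: "\<And>x. \<bar>x\<bar> > R \<Longrightarrow> \<phi> x = 0" and s: "smooth \<phi>" using assms by (auto simp: test_function_smooth)
  have "deriv \<phi> x = 0" if "\<bar>x\<bar> > R" for x
  proof -
    have "(\<phi> has_real_derivative 0) (at x)"
      by (rule has_field_derivative_transform_within_open[of "\<lambda>_. 0" _ _ "{x. \<bar>x\<bar> > R}"])
        (use that R in \<open>auto intro!: open_Collect_less continuous_intros\<close>)
    then show ?thesis by (rule DERIV_imp_deriv)
  qed
  then show ?thesis using smooth_deriv[OF s] by (auto simp: test_function_smooth)
qed

lemma test_function_DERIV: "test_function \<phi> \<Longrightarrow> (\<phi> has_real_derivative deriv \<phi> x) (at x)"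
  by (simp add: test_function_smooth smooth_DERIV)

lemma test_function_cont: "test_function \<phi> \<Longrightarrow> continuous_on A \<phi>"
  by (intro continuous_at_imp_continuous_on ballI DERIV_isCont[OF test_function_DERIV])

text \<open>The positive and negative parts of \<open>f\<close> are densities of finite measures
  that agree on all half-lines, and hence on all Borel sets.\<close>

lemma AE_zero_if_half_line_integrals_zero:
  fixes f :: "real \<Rightarrow> real"
  assumes f: "integrable lborel f" and z: "\<And>a. (LINT x:{a<..}|lborel. f x) = 0"
  shows "AE x in lborel. f x = 0"
proof -
  define M N where "M = density lborel (\<lambda>x. ennreal (f x))" and "N = density lborel (\<lambda>x. ennreal (- f x))"
  have fm[measurable]: "f \<in> borel_measurable borel" using f by simp
  have e: "emeasure M A = (\<integral>\<^sup>+x. ennreal (indicator A x * f x) \<partial>lborel)"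
    "emeasure N A = (\<integral>\<^sup>+x. ennreal (- (indicator A x * f x)) \<partial>lborel)" if "A \<in> sets borel" for A
    using that unfolding M_def N_def
    by (auto simp: emeasure_density intro!: nn_integral_cong split: split_indicator)
  have fin: "integrable lborel (\<lambda>x. indicator A x * f x)" if "A \<in> sets borel" for A
    using integrable_mult_indicator[OF _ f, of A] that by simp
  have int: "(LINT x:A|lborel. f x) = enn2real (emeasure M A) - enn2real (emeasure N A)" 
    and lt: "emeasure M A < \<infinity>" "emeasure N A < \<infinity>" if A: "A \<in> sets borel" for A
    using real_lebesgue_integral_def[OF fin[OF A]] fin[OF A] unfolding e[OF A] real_integrable_def
    by (auto simp: set_lebesgue_integral_def less_top[symmetric])
  have "M = N"
  proof (rule measure_eqI_lessThan)
    show "sets M = sets borel" "sets N = sets borel" by (auto simp: M_def N_def)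
    fix x show "emeasure M {x<..} < \<infinity>" by (rule lt) simp
    have "enn2real (emeasure M {x<..}) = enn2real (emeasure N {x<..})" using int[of "{x<..}"] z[of x] by simp
    then show "emeasure M {x<..} = emeasure N {x<..}"
      using ennreal_enn2real[OF lt(1)[of "{x<..}", unfolded infinity_ennreal_def]]
        ennreal_enn2real[OF lt(2)[of "{x<..}", unfolded infinity_ennreal_def]] by (metis borel_open open_greaterThan)
  qed
  show ?thesis
  proof (rule sigma_finite_measure.density_zero[OF sigma_finite_lborel f])
    fix A :: "real set" assume "A \<in> sets lborel"
    then show "(LINT x:A|lborel. f x) = 0" using int[of A] \<open>M = N\<close> by simp
  qed
qed

text \<open>Differences of steepening smooth steps are test functions bounded by \<open>1\<close>
  with support in \<open>{a..b + 1}\<close>, and they converge pointwise to the indicator of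
  \<open>{a<..b}\<close>. The interval is open on the left because the step vanishes at
  \<open>0\<close>.\<close>

lemma AE_zero_if_test_integrals_zero:
  assumes g: "locally_integrable g" and z: "\<And>\<phi>. test_function \<phi> \<Longrightarrow> (LINT x|lborel. g x * \<phi> x) = 0"
  shows "AE x in lborel. g x = 0"
proof -
  obtain \<theta> where \<theta>: "smooth \<theta>" "\<And>x. x \<le> 0 \<Longrightarrow> \<theta> x = 0" "\<And>x. x \<ge> 1 \<Longrightarrow> \<theta> x = 1" "\<And>x. 0 \<le> \<theta> x \<and> \<theta> x \<le> 1"
    using ex_smooth_step by metis
  have \<theta>c: "continuous_on UNIV \<theta>" using smooth_DERIV[OF \<theta>(1)] DERIV_isCont by (blast intro: continuous_at_imp_continuous_on)
  have gI: "set_integrable lborel {a..b} g" for a b using g by (simp add: locally_integrable_def)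
  have ab: "(LINT x:{a<..b}|lborel. g x) = 0" if "a \<le> b" for a b
  proof -
    define \<phi> where "\<phi> n x = \<theta> (real (Suc n) * (x - a)) - \<theta> (real (Suc n) * (x - b))" for n x
    have out: "\<phi> n x = 0" if "x \<notin> {a..b + 1}" for n x
    proof (cases "x < a")
      case True
      then show ?thesis using \<open>a \<le> b\<close> \<theta>(2) by (simp add: \<phi>_def mult_nonneg_nonpos)
    next
      case False
      then have "x > b + 1" using that by auto
      then have "1 * 1 \<le> real (Suc n) * (x - b)" "1 * 1 \<le> real (Suc n) * (x - a)"
        using \<open>a \<le> b\<close> by (intro mult_mono; simp)+
      then show ?thesis using \<theta>(3) by (simp add: \<phi>_def)
    qed
    have tf: "test_function (\<phi> n)" for n
    proof -
      have "smooth (\<lambda>x. 1 * \<theta> (real (Suc n) * x + (- real (Suc n) * a)) - 1 * \<theta> (real (Suc n) * x + (- real (Suc n) * b)))"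
        by (intro smooth_diff smooth_affine \<theta>)
      moreover have "(\<lambda>x. 1 * \<theta> (real (Suc n) * x + (- real (Suc n) * a)) - 1 * \<theta> (real (Suc n) * x + (- real (Suc n) * b))) = \<phi> n"
        by (simp add: \<phi>_def fun_eq_iff algebra_simps)
      ultimately have "smooth (\<phi> n)" by simp
      moreover have "\<phi> n x = 0" if "\<bar>x\<bar> > \<bar>a\<bar> + \<bar>b\<bar> + 1" for x using that by (intro out) auto
      ultimately show ?thesis unfolding test_function_smooth by blast
    qed
    have lim: "(\<lambda>n. \<phi> n x) \<longlonglongrightarrow> indicator {a<..b} x" for x
    proof -
      have pos: "\<forall>\<^sub>F n in sequentially. \<theta> (real (Suc n) * (x - c)) = 1" if "x > c" for c
      proof -
        obtain N :: nat where N: "real N > 1 / (x - c)" using reals_Archimedean2 by blast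
        have "real (Suc n) * (x - c) \<ge> 1" if "n \<ge> N" for n
        proof -
          have "real (Suc n) \<ge> 1 / (x - c)" using N that by simp
          then show ?thesis using \<open>x > c\<close> by (simp add: pos_divide_le_eq)
        qed
        then show ?thesis using \<theta>(3) unfolding eventually_sequentially by blast
      qed
      have neg: "\<theta> (real (Suc n) * (x - c)) = 0" if "x \<le> c" for n c
        using that by (intro \<theta>) (simp add: mult_nonneg_nonpos)
      consider "x \<le> a" | "a < x" "x \<le> b" | "x > b" using that by linarith
      then show ?thesis
      proof cases
        case 1
        then show ?thesis using \<open>a \<le> b\<close> neg[of a] neg[of b] by (simp add: \<phi>_def)
      next
        case 2
        have "\<forall>\<^sub>F n in sequentially. \<phi> n x = 1" using pos[OF 2(1)] by eventually_elim (use neg[OF 2(2)] in \<open>simp add: \<phi>_def\<close>)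
        then show ?thesis using 2 by (simp add: tendsto_eventually)
      next
        case 3
        have "\<forall>\<^sub>F n in sequentially. \<theta> (real (Suc n) * (x - a)) = 1" using 3 \<open>a \<le> b\<close> by (intro pos) simp
        moreover have "\<forall>\<^sub>F n in sequentially. \<theta> (real (Suc n) * (x - b)) = 1" by (rule pos[OF 3])
        ultimately have "\<forall>\<^sub>F n in sequentially. \<phi> n x = 0" by eventually_elim (simp add: \<phi>_def)
        then show ?thesis using 3 by (simp add: tendsto_eventually)
      qed
    qed
    have gm: "(\<lambda>x. indicator {a..b + 1} x * g x) \<in> borel_measurable lborel"
      using gI[of a "b + 1"] by (auto simp: set_integrable_def)
    have gi: "integrable lborel (\<lambda>x. indicator {a..b + 1} x * g x)" using gI[of a "b + 1"] by (simp add: set_integrable_def)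
    have "(\<lambda>n. LINT x|lborel. indicator {a..b + 1} x * g x * \<phi> n x) \<longlonglongrightarrow> (LINT x|lborel. indicator {a..b + 1} x * g x * indicator {a<..b} x)"
    proof (rule integral_dominated_convergence)
      show "integrable lborel (\<lambda>x. \<bar>indicator {a..b + 1} x * g x\<bar>)" using gi by simp
      show "AE x in lborel. (\<lambda>n. indicator {a..b + 1} x * g x * \<phi> n x) \<longlonglongrightarrow> indicator {a..b + 1} x * g x * indicator {a<..b} x"
        by (intro AE_I2 tendsto_intros lim)
      have "\<bar>\<phi> n x\<bar> \<le> 1" for n x using \<theta>(4)[of "real (Suc n) * (x - a)"] \<theta>(4)[of "real (Suc n) * (x - b)"] by (auto simp: \<phi>_def)
      then show "AE x in lborel. norm (indicator {a..b + 1} x * g x * \<phi> n x) \<le> \<bar>indicator {a..b + 1} x * g x\<bar>" for n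
        by (intro AE_I2) (simp add: abs_mult mult_left_le)
      have pm: "\<phi> n \<in> borel_measurable lborel" for n using test_function_cont[OF tf, of UNIV] by (simp add: borel_measurable_continuous_onI)
      show "(\<lambda>x. indicator {a..b + 1} x * g x * \<phi> n x) \<in> borel_measurable lborel" for n
        by (intro borel_measurable_times gm pm)
      show "(\<lambda>x. indicator {a..b + 1} x * g x * indicator {a<..b} x) \<in> borel_measurable lborel"
        by (intro borel_measurable_times gm) simp
    qed
    moreover have "(LINT x|lborel. indicator {a..b + 1} x * g x * \<phi> n x) = 0" for n
    proof -
      have "(\<lambda>x. indicator {a..b + 1} x * g x * \<phi> n x) = (\<lambda>x. g x * \<phi> n x)"
        using out by (auto simp: fun_eq_iff split: split_indicator)
      then show ?thesis using z[OF tf[of n]] by simp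
    qed
    ultimately have "(LINT x|lborel. indicator {a..b + 1} x * g x * indicator {a<..b} x) = 0"
      by (simp add: LIMSEQ_const_iff)
    moreover have "(\<lambda>x. indicator {a..b + 1} x * g x * indicator {a<..b} x) = (\<lambda>x. indicator {a<..b} x *\<^sub>R g x)"
      by (auto simp: fun_eq_iff split: split_indicator)
    ultimately show ?thesis by (simp add: set_lebesgue_integral_def)
  qed
  have "AE x in lborel. indicator {- real n<..real n} x * g x = 0" for n :: nat
  proof (rule AE_zero_if_half_line_integrals_zero)
    have "set_integrable lborel {- real n<..real n} g"
      by (rule set_integrable_subset[OF gI[of "- real n" "real n"]]) auto
    then show "integrable lborel (\<lambda>x. indicator {- real n<..real n} x * g x)" by (simp add: set_integrable_def)
    fix c
    have "(LINT x:{c<..}|lborel. indicator {- real n<..real n} x * g x) = (LINT x:{max c (- real n)<..real n}|lborel. g x)"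
      unfolding set_lebesgue_integral_def by (rule Bochner_Integration.integral_cong) (auto split: split_indicator)
    also have "\<dots> = 0" using ab[of "max c (- real n)" "real n"] by (cases "max c (- real n) \<le> real n") (auto simp: set_lebesgue_integral_def)
    finally show "(LINT x:{c<..}|lborel. indicator {- real n<..real n} x * g x) = 0" .
  qed
  then have "AE x in lborel. \<forall>n. indicator {- real n<..real n} x * g x = 0" unfolding AE_all_countable by blast
  then show ?thesis
  proof eventually_elim
    case (elim x)
    obtain n :: nat where "real n > \<bar>x\<bar>" using reals_Archimedean2 by blast
    then have "x \<in> {- real n<..real n}" by auto
    then show ?case using elim[rule_format, of n] by simp
  qed
qed

lemma locally_integrable_continuous: "continuous_on UNIV f \<Longrightarrow> locally_integrable f"
  unfolding locally_integrable_def
  by (auto intro: borel_integrable_atLeastAtMost' continuous_on_subset)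

lemma locally_integrable_measurable: 
  assumes "locally_integrable g" shows "g \<in> borel_measurable borel"
proof (rule borel_measurable_LIMSEQ_real)
  show "(\<lambda>x. indicator {- real n..real n} x * g x) \<in> borel_measurable borel" for n
  proof -
    have "set_integrable lborel {- real n..real n} g" using assms by (simp add: locally_integrable_def)
    then show ?thesis by (auto simp: set_integrable_def dest: borel_measurable_integrable)
  qed
  fix x :: real
  obtain N :: nat where N: "real N > \<bar>x\<bar>" using reals_Archimedean2 by blast
  have "indicator {- real n..real n} x * g x = g x" if "n \<ge> N" for n
  proof -
    have "real n \<ge> real N" using that by simp
    then show ?thesis using N by (auto simp: indicator_def)
  qed
  then show "(\<lambda>n. indicator {- real n..real n} x * g x) \<longlonglongrightarrow> g x"
    by (intro tendsto_eventually) (auto simp: eventually_sequentially)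
qed

lemma compact_support_integral:
  fixes f :: "real \<Rightarrow> real"
  assumes f: "continuous_on UNIV f" and z: "\<And>x. x \<notin> {- R..R} \<Longrightarrow> f x = 0"
  shows "integrable lborel f" "(LINT x|lborel. f x) = integral {- R..R} f"
proof -
  have i: "set_integrable lborel {- R..R} f"
    using locally_integrable_continuous[OF f] by (simp add: locally_integrable_def)
  have eq: "(\<lambda>x. indicator {- R..R} x *\<^sub>R f x) = f" using z by (auto simp: fun_eq_iff indicator_def)
  show "integrable lborel f" using i unfolding set_integrable_def eq .
  show "(LINT x|lborel. f x) = integral {- R..R} f"
    using set_borel_integral_eq_integral(2)[OF i] unfolding set_lebesgue_integral_def eq .
qed

lemma test_function_support:
  assumes "test_function \<phi>" shows "\<exists>R>0. \<forall>k. \<forall>x. x \<notin> {- R..R} \<longrightarrow> (deriv ^^ k) \<phi> x = 0"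
proof -
  obtain R where R: "\<And>x. \<bar>x\<bar> > R \<Longrightarrow> \<phi> x = 0" using assms by (auto simp: test_function_smooth)
  have *: "\<forall>x. \<bar>x\<bar> > R \<longrightarrow> (deriv ^^ k) \<phi> x = 0" for k
  proof (induction k)
    case (Suc k)
    show ?case
    proof (intro allI impI)
      fix x assume x: "\<bar>x\<bar> > R"
      have "((deriv ^^ k) \<phi> has_real_derivative 0) (at x)"
        by (rule has_field_derivative_transform_within_open[of "\<lambda>_. 0" _ _ "{x. \<bar>x\<bar> > R}"])
          (use Suc.IH x in \<open>auto intro!: open_Collect_less continuous_intros\<close>)
      then show "(deriv ^^ Suc k) \<phi> x = 0" using DERIV_imp_deriv by auto
    qed
  qed (use R in auto)
  show ?thesis
  proof (intro exI[of _ "\<bar>R\<bar> + 1"] conjI allI impI)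
    fix k x assume "x \<notin> {- (\<bar>R\<bar> + 1)..\<bar>R\<bar> + 1}"
    then have "\<bar>x\<bar> > R" by auto
    then show "(deriv ^^ k) \<phi> x = 0" using * by blast
  qed simp
qed

lemma integral_by_parts_test:
  fixes f g :: "real \<Rightarrow> real"
  assumes d: "\<And>x. (f has_real_derivative g x) (at x)" and g: "continuous_on UNIV g" and \<phi>: "test_function \<phi>"
  shows "(LINT x|lborel. f x * deriv \<phi> x) = - (LINT x|lborel. g x * \<phi> x)"
proof -
  obtain R where R: "R > 0" "\<And>k x. x \<notin> {- R..R} \<Longrightarrow> (deriv ^^ k) \<phi> x = 0" using test_function_support[OF \<phi>] by blast
  note z0 = R(2)[of _ 0, simplified] and z1 = R(2)[of _ 1, simplified]
  have fc: "continuous_on A f" for A by (intro continuous_at_imp_continuous_on ballI DERIV_isCont[OF d])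
  have c1: "continuous_on UNIV (\<lambda>x. f x * deriv \<phi> x)" by (intro continuous_intros fc test_function_cont test_function_deriv \<phi>)
  have c2: "continuous_on UNIV (\<lambda>x. g x * \<phi> x)" by (intro continuous_intros g test_function_cont \<phi>)
  have sum: "continuous_on UNIV (\<lambda>x. g x * \<phi> x + deriv \<phi> x * f x)"
    by (intro continuous_intros g fc test_function_cont test_function_deriv \<phi>)
  have z0': "\<phi> (- (R + 1)) = 0" "\<phi> (R + 1) = 0" using z0 R(1) by auto
  have "((\<lambda>x. g x * \<phi> x + deriv \<phi> x * f x) has_integral f (R + 1) * \<phi> (R + 1) - f (- (R + 1)) * \<phi> (- (R + 1))) {- (R + 1)..R + 1}"
  proof (rule fundamental_theorem_of_calculus)
    fix x
    have "((\<lambda>x. f x * \<phi> x) has_real_derivative g x * \<phi> x + deriv \<phi> x * f x) (at x)"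
      by (intro DERIV_mult d test_function_DERIV \<phi>)
    then show "((\<lambda>x. f x * \<phi> x) has_vector_derivative g x * \<phi> x + deriv \<phi> x * f x) (at x within {- (R + 1)..R + 1})"
      by (simp add: has_real_derivative_iff_has_vector_derivative has_vector_derivative_at_within)
  qed (use R in simp)
  from integral_unique[OF this] have "integral {- (R + 1)..R + 1} (\<lambda>x. g x * \<phi> x + deriv \<phi> x * f x) = 0"
    unfolding z0' by simp
  moreover have "(LINT x|lborel. g x * \<phi> x + deriv \<phi> x * f x) = integral {- (R + 1)..R + 1} (\<lambda>x. g x * \<phi> x + deriv \<phi> x * f x)"
    by (rule compact_support_integral(2)[OF sum]) (use z0 z1 in auto)
  moreover have "(LINT x|lborel. g x * \<phi> x + deriv \<phi> x * f x) = (LINT x|lborel. g x * \<phi> x) + (LINT x|lborel. f x * deriv \<phi> x)"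
    using compact_support_integral(1)[OF c1, of R] compact_support_integral(1)[OF c2, of R] z0 z1
    by (subst Bochner_Integration.integral_add[symmetric]) (auto simp: mult.commute)
  ultimately show ?thesis by simp
qed

lemma has_weak_deriv_C1:
  assumes d: "\<And>x. (f has_real_derivative g x) (at x)" and g: "continuous_on UNIV g"
  shows "has_weak_deriv f g"
  unfolding has_weak_deriv_def
  using integral_by_parts_test[OF assms] locally_integrable_continuous[OF g]
    locally_integrable_continuous[OF continuous_at_imp_continuous_on[OF ballI[OF DERIV_isCont[OF d]]]] by blast

lemma locally_integrable_mult_test:
  assumes g: "locally_integrable g" and \<phi>: "test_function \<phi>"
  shows "integrable lborel (\<lambda>x. g x * \<phi> x)"
proof -
  obtain R where R: "R > 0" "\<And>k x. x \<notin> {- R..R} \<Longrightarrow> (deriv ^^ k) \<phi> x = 0" using test_function_support[OF \<phi>] by blast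
  note z0 = R(2)[of _ 0, simplified]
  have "compact (\<phi> ` {- R..R})" by (intro compact_continuous_image test_function_cont \<phi>) simp
  then obtain B where "\<forall>y\<in>\<phi> ` {- R..R}. norm y \<le> B" using compact_imp_bounded bounded_iff by metis
  then have B: "\<bar>\<phi> x\<bar> \<le> B" if "x \<in> {- R..R}" for x using that by auto
  have gi: "integrable lborel (\<lambda>x. indicator {- R..R} x * g x)" using g by (auto simp: locally_integrable_def set_integrable_def)
  show ?thesis
  proof (rule Bochner_Integration.integrable_bound)
    show "integrable lborel (\<lambda>x. B * (indicator {- R..R} x * g x))" using gi by simp
    show "(\<lambda>x. g x * \<phi> x) \<in> borel_measurable lborel"
      using locally_integrable_measurable[OF g] borel_measurable_continuous_onI[OF test_function_cont[OF \<phi>, of UNIV]] by simp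
    show "AE x in lborel. norm (g x * \<phi> x) \<le> norm (B * (indicator {- R..R} x * g x))"
    proof (rule AE_I2)
      fix x
      have "\<bar>g x\<bar> * \<bar>\<phi> x\<bar> \<le> \<bar>g x\<bar> * \<bar>B\<bar>" if "x \<in> {- R..R}" using B[OF that] by (intro mult_left_mono) auto
      then show "norm (g x * \<phi> x) \<le> norm (B * (indicator {- R..R} x * g x))"
        using z0[of x] by (cases "x \<in> {- R..R}") (auto simp: abs_mult mult.commute)
    qed
  qed
qed

lemma weak_deriv_AE:
  assumes "has_weak_deriv f g"
  shows "has_weak_deriv f (weak_deriv f)" "AE x in lborel. weak_deriv f x = g x"
proof -
  show w: "has_weak_deriv f (weak_deriv f)" unfolding weak_deriv_def by (rule someI[of "has_weak_deriv f", OF assms])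
  have l: "locally_integrable (weak_deriv f)" "locally_integrable g" using w assms by (auto simp: has_weak_deriv_def)
  have "AE x in lborel. weak_deriv f x - g x = 0"
  proof (rule AE_zero_if_test_integrals_zero)
    show "locally_integrable (\<lambda>x. weak_deriv f x - g x)"
      using l unfolding locally_integrable_def by (auto intro: set_integral_diff(1))
    fix \<phi> assume \<phi>: "test_function \<phi>"
    have "(LINT x|lborel. weak_deriv f x * \<phi> x) = (LINT x|lborel. g x * \<phi> x)"
      using w assms \<phi> unfolding has_weak_deriv_def by fastforce
    then show "(LINT x|lborel. (weak_deriv f x - g x) * \<phi> x) = 0"
      using locally_integrable_mult_test[OF l(1) \<phi>] locally_integrable_mult_test[OF l(2) \<phi>]
      by (simp add: left_diff_distrib Bochner_Integration.integral_diff)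
  qed
  then show "AE x in lborel. weak_deriv f x = g x" by eventually_elim simp
qed

text \<open>\<open>weak_deriv\<close> is a chosen representative that agrees with the classical
  derivative only almost everywhere; this transfers second weak derivatives to it.\<close>

lemma has_weak_deriv_AE_cong:
  assumes "has_weak_deriv f g" "AE x in lborel. f' x = f x" "locally_integrable f'"
  shows "has_weak_deriv f' g"
  unfolding has_weak_deriv_def
proof (intro conjI allI impI assms)
  show "locally_integrable g" using assms(1) by (simp add: has_weak_deriv_def)
  fix \<phi> assume \<phi>: "test_function \<phi>"
  have f: "locally_integrable f" using assms(1) by (simp add: has_weak_deriv_def)
  note m = locally_integrable_mult_test[OF _ test_function_deriv[OF \<phi>], THEN borel_measurable_integrable]
  have "(LINT x|lborel. f' x * deriv \<phi> x) = (LINT x|lborel. f x * deriv \<phi> x)"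
    by (rule integral_cong_AE[OF m[OF assms(3)] m[OF f]]) (use assms(2) in eventually_elim, simp)
  then show "(LINT x|lborel. f' x * deriv \<phi> x) = - (LINT x|lborel. g x * \<phi> x)"
    using assms(1) \<phi> by (simp add: has_weak_deriv_def)
qed

text \<open>One square-integrable profile \<open>h\<close> dominates the function and its
  derivative. As the norm bound is linear in \<open>B\<close>, convergence in the Sobolev norm
  reduces to a pointwise estimate with \<open>B\<close> tending to zero.\<close>

lemma C1_H1:
  assumes d: "\<And>x. (f has_real_derivative g x) (at x)" and g: "continuous_on UNIV g"
    and h: "integrable lborel (\<lambda>x. (h x)\<^sup>2)" and B: "B \<ge> 0"
    and fb: "\<And>x. \<bar>f x\<bar> \<le> B * h x" and gb: "\<And>x. \<bar>g x\<bar> \<le> B * h x"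
  shows "H1 f" "H1_norm f \<le> B * sqrt (2 * (LINT x|lborel. (h x)\<^sup>2))"
proof -
  note w = weak_deriv_AE[OF has_weak_deriv_C1[OF d g]]
  have fc: "continuous_on UNIV f" by (intro continuous_at_imp_continuous_on ballI DERIV_isCont[OF d])
  have sq: "u\<^sup>2 \<le> B\<^sup>2 * v\<^sup>2" if "\<bar>u\<bar> \<le> B * v" for u v :: real
    using power_mono[OF that, of 2] by (simp add: power_mult_distrib)
  have int: "integrable lborel (\<lambda>x. (u x)\<^sup>2)" "(LINT x|lborel. (u x)\<^sup>2) \<le> B\<^sup>2 * (LINT x|lborel. (h x)\<^sup>2)"
    if uc: "continuous_on UNIV u" and ub: "\<And>x. \<bar>u x\<bar> \<le> B * h x" for u
  proof -
    have hB: "integrable lborel (\<lambda>x. B\<^sup>2 * (h x)\<^sup>2)" using h by simp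
    have m: "(\<lambda>x. (u x)\<^sup>2) \<in> borel_measurable lborel"
      using borel_measurable_continuous_onI[OF uc] by simp
    show i: "integrable lborel (\<lambda>x. (u x)\<^sup>2)"
      by (rule Bochner_Integration.integrable_bound[OF hB m]) (use sq[OF ub] in \<open>auto intro!: AE_I2\<close>)
    have "(LINT x|lborel. (u x)\<^sup>2) \<le> (LINT x|lborel. B\<^sup>2 * (h x)\<^sup>2)"
      by (rule integral_mono[OF i hB]) (use sq[OF ub] in simp)
    then show "(LINT x|lborel. (u x)\<^sup>2) \<le> B\<^sup>2 * (LINT x|lborel. (h x)\<^sup>2)" by simp
  qed
  have L2: "L2 u" if "continuous_on UNIV u" "\<And>x. \<bar>u x\<bar> \<le> B * h x" for u
    using int(1)[OF that] borel_measurable_continuous_onI[OF that(1)] by (simp add: L2_def)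
  show "H1 f" unfolding H1_def using L2[OF fc fb] L2[OF g gb] has_weak_deriv_C1[OF d g] by blast
  have "(LINT x|lborel. (weak_deriv f x)\<^sup>2) = (LINT x|lborel. (g x)\<^sup>2)"
  proof (rule integral_cong_AE)
    show "(\<lambda>x. (weak_deriv f x)\<^sup>2) \<in> borel_measurable lborel"
      using locally_integrable_measurable[of "weak_deriv f"] w(1) by (simp add: has_weak_deriv_def)
    show "(\<lambda>x. (g x)\<^sup>2) \<in> borel_measurable lborel" using borel_measurable_continuous_onI[OF g] by simp
    show "AE x in lborel. (weak_deriv f x)\<^sup>2 = (g x)\<^sup>2" using w(2) by eventually_elim simp
  qed
  then have "H1_norm f \<le> sqrt (B\<^sup>2 * (2 * (LINT x|lborel. (h x)\<^sup>2)))"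
    unfolding H1_norm_def using int(2)[OF fc fb] int(2)[OF g gb] by (intro real_sqrt_le_mono) simp
  also have "\<dots> = B * sqrt (2 * (LINT x|lborel. (h x)\<^sup>2))" using B by (simp add: real_sqrt_mult)
  finally show "H1_norm f \<le> B * sqrt (2 * (LINT x|lborel. (h x)\<^sup>2))" .
qed

text \<open>Differentiation under the integral over the common support of the test function, and
  integrations by parts. The equation is phrased for \<open>wxx + w ^ p\<close> as a whole, the form
  in which the linear problems deliver it.\<close>

lemma satisfies_gKdV_classical:
  assumes dx: "\<And>t x. t \<ge> 0 \<Longrightarrow> (w t has_real_derivative wx t x) (at x)"
    and dxx: "\<And>t x. t \<ge> 0 \<Longrightarrow> (wx t has_real_derivative wxx t x) (at x)"
    and wxxc: "\<And>t. t \<ge> 0 \<Longrightarrow> continuous_on UNIV (wxx t)"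
    and eq: "\<And>t x. t \<ge> 0 \<Longrightarrow> ((\<lambda>x. wxx t x + w t x ^ p) has_real_derivative - wt t x) (at x)"
    and dt: "\<And>t x. t \<ge> 0 \<Longrightarrow> ((\<lambda>s. w s x) has_real_derivative wt t x) (at t within {0..})"
    and wtc: "continuous_on ({0..} \<times> UNIV) (\<lambda>(t, x). wt t x)"
  shows "satisfies_gKdV p w"
  unfolding satisfies_gKdV_def
proof (intro allI impI)
  fix \<phi> and t :: real assume \<phi>: "test_function \<phi>" and t: "t \<ge> 0"
  obtain R where R: "R > 0" "\<And>k x. x \<notin> {- R..R} \<Longrightarrow> (deriv ^^ k) \<phi> x = 0" using test_function_support[OF \<phi>] by blast
  note z0 = R(2)[of _ 0, simplified]
  have wc: "continuous_on A (w t)" if "t \<ge> 0" for t A by (intro continuous_at_imp_continuous_on ballI DERIV_isCont[OF dx[OF that]])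
  have wxc: "continuous_on A (wx t)" if "t \<ge> 0" for t A by (intro continuous_at_imp_continuous_on ballI DERIV_isCont[OF dxx[OF that]])
  note \<phi>c = test_function_cont[OF \<phi>]
  have wt1: "continuous_on UNIV (wt t)"
  proof -
    have "continuous_on UNIV (\<lambda>x. (\<lambda>(t, x). wt t x) (t, x))"
      by (rule continuous_on_compose2[OF wtc]) (use t in \<open>auto intro!: continuous_intros\<close>)
    then show ?thesis by simp
  qed
  have L: "((\<lambda>s. integral (cbox (- R) R) (\<lambda>x. w s x * \<phi> x)) has_real_derivative
      integral (cbox (- R) R) (\<lambda>x. wt t x * \<phi> x)) (at t within {0..})"
  proof (rule leibniz_rule_field_derivative)
    show "((\<lambda>s. w s x * \<phi> x) has_real_derivative wt s x * \<phi> x) (at s within {0..})" if "s \<in> {0..}" for s x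
      using DERIV_cmult_right[OF dt[of s x], of "\<phi> x"] that by simp
    show "(\<lambda>x. w s x * \<phi> x) integrable_on cbox (- R) R" if "s \<in> {0..}" for s
      using that by (intro integrable_continuous continuous_intros wc \<phi>c) auto
    have "continuous_on ({0..} \<times> cbox (- R) R) (\<lambda>z. (\<lambda>(t, x). wt t x) z * \<phi> (snd z))"
      by (intro continuous_intros continuous_on_subset[OF wtc] continuous_on_compose2[OF \<phi>c[of UNIV]]) auto
    then show "continuous_on ({0..} \<times> cbox (- R) R) (\<lambda>(s, x). wt s x * \<phi> x)" by (simp add: split_beta)
  qed (use t in auto)
  have wI: "(LINT x|lborel. w s x * \<phi> x) = integral (cbox (- R) R) (\<lambda>x. w s x * \<phi> x)" if "s \<ge> 0" for s
    using compact_support_integral(2)[of "\<lambda>x. w s x * \<phi> x" R] z0 that wc[OF that] \<phi>c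
    by (auto intro!: continuous_intros)
  have wtI: "(LINT x|lborel. wt t x * \<phi> x) = integral (cbox (- R) R) (\<lambda>x. wt t x * \<phi> x)"
    using compact_support_integral(2)[of "\<lambda>x. wt t x * \<phi> x" R] z0 wt1 \<phi>c by (auto intro!: continuous_intros)
  have D: "((\<lambda>s. LINT x|lborel. w s x * \<phi> x) has_real_derivative (LINT x|lborel. wt t x * \<phi> x)) (at t within {0..})"
    unfolding wtI by (rule has_field_derivative_transform_within[OF L, of 1]) (use t wI in auto)
  have \<phi>1: "test_function (deriv \<phi>)" by (rule test_function_deriv[OF \<phi>])
  have \<phi>2: "test_function (deriv (deriv \<phi>))" by (rule test_function_deriv[OF \<phi>1])
  have "(LINT x|lborel. wt t x * \<phi> x) = (LINT x|lborel. (wxx t x + w t x ^ p) * deriv \<phi> x)"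
    using integral_by_parts_test[OF eq[OF t] continuous_on_minus[OF wt1] \<phi>] by simp
  also have "\<dots> = (LINT x|lborel. wxx t x * deriv \<phi> x) + (LINT x|lborel. w t x ^ p * deriv \<phi> x)"
  proof -
    have "integrable lborel (\<lambda>x. wxx t x * deriv \<phi> x)"
      by (intro locally_integrable_mult_test \<phi>1 locally_integrable_continuous wxxc t)
    moreover have "integrable lborel (\<lambda>x. w t x ^ p * deriv \<phi> x)"
      by (intro locally_integrable_mult_test \<phi>1 locally_integrable_continuous continuous_intros wc t)
    ultimately show ?thesis by (simp add: distrib_right)
  qed
  also have "(LINT x|lborel. wxx t x * deriv \<phi> x) = (LINT x|lborel. w t x * deriv (deriv (deriv \<phi>)) x)"
    using integral_by_parts_test[OF dxx[OF t] wxxc[OF t] \<phi>1] integral_by_parts_test[OF dx[OF t] wxc[OF t] \<phi>2] by simp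
  also have "(LINT x|lborel. w t x * deriv (deriv (deriv \<phi>)) x) + (LINT x|lborel. w t x ^ p * deriv \<phi> x)
      = (LINT x|lborel. w t x * (deriv ^^ 3) \<phi> x + w t x ^ p * deriv \<phi> x)"
  proof -
    have "integrable lborel (\<lambda>x. w t x * deriv (deriv (deriv \<phi>)) x)"
      by (intro locally_integrable_mult_test test_function_deriv[OF \<phi>2] locally_integrable_continuous wc t)
    moreover have "integrable lborel (\<lambda>x. w t x ^ p * deriv \<phi> x)"
      by (intro locally_integrable_mult_test \<phi>1 locally_integrable_continuous continuous_intros wc t)
    ultimately show ?thesis by (simp add: numeral_3_eq_3)
  qed
  finally show "((\<lambda>s. LINT x|lborel. w s x * \<phi> x) has_real_derivative
      (LINT x|lborel. w t x * (deriv ^^ 3) \<phi> x + w t x ^ p * deriv \<phi> x)) (at t within {0..})"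
    using D by simp
qed

section \<open>The series\<close>

unbundle no vec_syntax
unbundle fps_syntax

text \<open>The coefficient of order \<open>k\<close> of the base enters the same coefficient of the
  power only linearly, with factor \<open>m * (A $ 0) ^ (m - 1)\<close>. For constant term
  \<open>Q\<close> and exponent \<open>p\<close> this factor is the potential
  \<open>q\<close>.\<close>

lemma fps_power_nth_cong:
  fixes A B :: "real fps"
  assumes "\<And>j. j < k \<Longrightarrow> A $ j = B $ j" "k \<ge> 1"
  shows "(\<forall>j<k. (A ^ m) $ j = (B ^ m) $ j) \<and> (A ^ m) $ k = (B ^ m) $ k + of_nat m * (A $ 0) ^ (m - 1) * (A $ k - B $ k)"
proof (induction m)
  case 0 then show ?case by simp
next
  case (Suc m)
  have lt: "(A ^ Suc m) $ j = (B ^ Suc m) $ j" if "j < k" for j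
    unfolding power_Suc fps_mult_nth using that assms(1) Suc.IH by (intro sum.cong) auto
  have A0: "A $ 0 = B $ 0" using assms by auto
  have split: "(\<Sum>i=0..k. f i) = f 0 + f k + (\<Sum>i\<in>{0<..<k}. f i)" for f :: "nat \<Rightarrow> real"
  proof -
    have "{0..k} = insert 0 (insert k {0<..<k})" using assms(2) by auto
    moreover have "(0 :: nat) \<noteq> k" using assms(2) by simp
    ultimately show ?thesis by simp
  qed
  have mid: "(\<Sum>i\<in>{0<..<k}. A $ i * (A ^ m) $ (k - i)) = (\<Sum>i\<in>{0<..<k}. B $ i * (B ^ m) $ (k - i))"
    using assms(1) Suc.IH by (intro sum.cong) auto
  have "(A ^ Suc m) $ k = A $ 0 * (A ^ m) $ k + A $ k * (A $ 0) ^ m + (\<Sum>i\<in>{0<..<k}. A $ i * (A ^ m) $ (k - i))"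
    unfolding power_Suc fps_mult_nth split by (simp add: fps_power_zeroth)
  also have "\<dots> = (B ^ Suc m) $ k + of_nat (Suc m) * (A $ 0) ^ (Suc m - 1) * (A $ k - B $ k)"
  proof -
    have "(B ^ Suc m) $ k = B $ 0 * (B ^ m) $ k + B $ k * (B $ 0) ^ m + (\<Sum>i\<in>{0<..<k}. B $ i * (B ^ m) $ (k - i))"
      unfolding power_Suc fps_mult_nth split by (simp add: fps_power_zeroth)
    moreover have "A $ 0 * (real m * (A $ 0) ^ (m - 1)) = real m * (A $ 0) ^ m" by (cases m) auto
    then have "A $ 0 * (A ^ m) $ k = A $ 0 * (B ^ m) $ k + real m * (A $ 0) ^ m * (A $ k - B $ k)"
      using Suc.IH by (simp add: distrib_left mult.assoc[symmetric])
    ultimately show ?thesis unfolding mid using A0 by (simp add: algebra_simps)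
  qed
  finally show ?case using lt by blast
qed

lemma fps_power_nth_continuous:
  assumes "\<And>j. continuous_on S (\<lambda>t. a j t :: real)"
  shows "continuous_on S (\<lambda>t. ((Abs_fps (\<lambda>j. a j t)) ^ m) $ k)"
proof (induction m arbitrary: k)
  case (Suc m)
  then show ?case unfolding power_Suc fps_mult_nth by (auto intro!: continuous_intros assms)
qed simp

text \<open>Up to the constant \<open>8\<close> these weights are closed under convolution.\<close>

definition inv_sq :: "nat \<Rightarrow> real" where "inv_sq k = (if k = 0 then 0 else 1 / (real k)\<^sup>2)"

lemma inv_sq_nonneg: "inv_sq k \<ge> 0" and inv_sq_le_1: "inv_sq k \<le> 1"
  by (auto simp: inv_sq_def divide_le_eq_1 power2_eq_square intro: order_trans[OF _ mult_mono[of 1 _ 1]])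

text \<open>Telescoping with \<open>1 / (m + 1)^2 \<le> 1 / m - 1 / (m + 1)\<close>.\<close>

lemma sum_inv_sq_le: "(\<Sum>i\<le>m. inv_sq i) \<le> 2"
proof -
  have "(\<Sum>i\<le>m. inv_sq i) \<le> 2 - 1 / real m" if "m \<ge> 1" for m
    using that
  proof (induction m rule: dec_induct)
    case base then show ?case by (simp add: inv_sq_def atMost_Suc)
  next
    case (step m)
    have "1 / (real (Suc m))\<^sup>2 \<le> 1 / real m - 1 / real (Suc m)"
    proof -
      have "1 / real m - 1 / real (Suc m) = 1 / (real m * real (Suc m))" using step by (simp add: field_simps)
      moreover have "1 / (real (Suc m) * real (Suc m)) \<le> 1 / (real m * real (Suc m))"
        using step by (intro divide_left_mono mult_mono mult_pos_pos) auto
      ultimately show ?thesis by (simp add: power2_eq_square)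
    qed
    then show ?case using step.IH by (simp add: inv_sq_def)
  qed
  then show ?thesis by (cases "m \<ge> 1") (fastforce intro: order_trans, simp add: inv_sq_def)
qed

text \<open>For \<open>u + v = k\<close> one has \<open>1 / (u * v) = (1 / u + 1 / v) / k\<close>.
  Squaring bounds each product by \<open>2 / k^2 * (1 / u^2 + 1 / v^2)\<close>, and the two
  resulting sums are at most \<open>2\<close> each, which gives
  \<open>2 * (2 + 2) = 8\<close>.\<close>

lemma inv_sq_conv: "(\<Sum>i=0..k. inv_sq i * inv_sq (k - i)) \<le> 8 * inv_sq k"
proof (cases "k = 0")
  case True then show ?thesis by (simp add: inv_sq_def)
next
  case False
  have "inv_sq i * inv_sq (k - i) \<le> 2 * inv_sq k * (inv_sq i + inv_sq (k - i))" if "i \<in> {0..k}" for i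
  proof (cases "i = 0 \<or> i = k")
    case True then show ?thesis using inv_sq_nonneg by (auto simp: inv_sq_def)
  next
    case nz: False
    define u v where "u = real i" and "v = real (k - i)"
    have uv: "u > 0" "v > 0" "real k = u + v" using nz that by (auto simp: u_def v_def)
    have "1 / u + 1 / v = (u + v) / (u * v)" using uv by (simp add: field_simps)
    then have "1 / u\<^sup>2 * (1 / v\<^sup>2) = 1 / (u + v)\<^sup>2 * (1 / u + 1 / v)\<^sup>2"
      using uv by (simp add: power_divide power_mult_distrib)
    also have "\<dots> \<le> 1 / (u + v)\<^sup>2 * (2 * (1 / u\<^sup>2 + 1 / v\<^sup>2))"
    proof (rule mult_left_mono)
      have "0 \<le> (1 / u - 1 / v)\<^sup>2" by simp
      then show "(1 / u + 1 / v)\<^sup>2 \<le> 2 * (1 / u\<^sup>2 + 1 / v\<^sup>2)" by (simp add: power2_eq_square algebra_simps)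
    qed simp
    finally show ?thesis using nz False that by (simp add: inv_sq_def uv(3)[symmetric] u_def[symmetric] v_def[symmetric])
  qed
  then have "(\<Sum>i=0..k. inv_sq i * inv_sq (k - i)) \<le> (\<Sum>i=0..k. 2 * inv_sq k * (inv_sq i + inv_sq (k - i)))" by (rule sum_mono)
  also have "\<dots> = 2 * inv_sq k * ((\<Sum>i=0..k. inv_sq i) + (\<Sum>i=0..k. inv_sq (k - i)))"
    by (simp add: sum_distrib_left[symmetric] sum.distrib)
  also have "(\<Sum>i=0..k. inv_sq (k - i)) = (\<Sum>i=0..k. inv_sq i)"
    using sum.atLeastAtMost_rev[of inv_sq 0 k] by simp
  also have "2 * inv_sq k * ((\<Sum>i=0..k. inv_sq i) + (\<Sum>i=0..k. inv_sq i)) \<le> 2 * inv_sq k * (2 + 2)"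
    using sum_inv_sq_le[of k] inv_sq_nonneg[of k] by (intro mult_left_mono add_mono) (auto simp: atLeast0AtMost)
  finally show ?thesis by simp
qed

lemma fps_power_majorant:
  fixes V :: "real fps"
  assumes V: "\<And>j. \<bar>V $ j\<bar> \<le> s * inv_sq j" and s: "s \<ge> 0" and m: "m \<ge> 1"
  shows "\<bar>(V ^ m) $ k\<bar> \<le> s ^ m * 8 ^ (m - 1) * inv_sq k"
  using m
proof (induction m arbitrary: k rule: dec_induct)
  case base then show ?case using V by simp
next
  case (step m)
  have "\<bar>(V ^ Suc m) $ k\<bar> \<le> (\<Sum>i=0..k. \<bar>V $ i * (V ^ m) $ (k - i)\<bar>)"
    unfolding power_Suc fps_mult_nth by (rule sum_abs)
  also have "\<dots> \<le> (\<Sum>i=0..k. (s * inv_sq i) * (s ^ m * 8 ^ (m - 1) * inv_sq (k - i)))"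
    unfolding abs_mult by (intro sum_mono mult_mono V step.IH) (auto simp: s inv_sq_nonneg)
  also have "\<dots> = s ^ Suc m * 8 ^ (m - 1) * (\<Sum>i=0..k. inv_sq i * inv_sq (k - i))"
    by (simp add: sum_distrib_left mult_ac)
  also have "\<dots> \<le> s ^ Suc m * 8 ^ (m - 1) * (8 * inv_sq k)"
    using s by (intro mult_left_mono inv_sq_conv) auto
  also have "\<dots> = s ^ Suc m * 8 ^ (Suc m - 1) * inv_sq k" using step by (cases m) auto
  finally show ?case .
qed

text \<open>The gain is the factor \<open>s^2\<close>. In the binomial expansion the terms with
  \<open>V ^ 0\<close> and \<open>V ^ 1\<close> do not reach the coefficient \<open>k\<close>,
  because \<open>k \<ge> 1\<close> and \<open>V $ k = 0\<close>, so every contribution is at least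
  quadratic.\<close>

lemma fps_shifted_power_majorant:
  fixes V :: "real fps"
  assumes V: "\<And>j. \<bar>V $ j\<bar> \<le> s * inv_sq j" "V $ k = 0" and s: "0 \<le> s" "s \<le> 1" and k: "k \<ge> 1" and c: "\<bar>c\<bar> \<le> C"
  shows "\<bar>((fps_const c + V) ^ m) $ k\<bar> \<le> 8 ^ m * (C + 1) ^ m * s\<^sup>2 * inv_sq k"
proof -
  have C0: "C \<ge> 0" using c by simp
  have "(fps_const c + V) ^ m = (\<Sum>i\<le>m. of_nat (m choose i) * V ^ i * fps_const c ^ (m - i))"
    using binomial_ring[of V "fps_const c" m] by (simp add: add.commute)
  then have "((fps_const c + V) ^ m) $ k = (\<Sum>i\<le>m. real (m choose i) * c ^ (m - i) * (V ^ i) $ k)"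
    by (simp add: fps_sum_nth fps_of_nat[symmetric] fps_const_power mult_ac)
  then have "\<bar>((fps_const c + V) ^ m) $ k\<bar> \<le> (\<Sum>i\<le>m. \<bar>real (m choose i) * c ^ (m - i) * (V ^ i) $ k\<bar>)"
    by (simp add: sum_abs)
  also have "\<dots> \<le> (\<Sum>i\<le>m. (real (m choose i) * C ^ (m - i)) * (8 ^ m * s\<^sup>2 * inv_sq k))"
  proof (rule sum_mono)
    fix i assume i: "i \<in> {..m}"
    have "\<bar>(V ^ i) $ k\<bar> \<le> 8 ^ m * s\<^sup>2 * inv_sq k"
    proof (cases "i \<ge> 2")
      case True
      have "\<bar>(V ^ i) $ k\<bar> \<le> s ^ i * 8 ^ (i - 1) * inv_sq k" using True by (intro fps_power_majorant V s) auto
      also have "\<dots> \<le> s\<^sup>2 * 8 ^ m * inv_sq k"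
        using True i s inv_sq_nonneg[of k] by (intro mult_right_mono mult_mono power_decreasing power_increasing) auto
      finally show ?thesis by (simp add: mult_ac)
    next
      case False
      then have "i = 0 \<or> i = 1" by auto
      then have "(V ^ i) $ k = 0" using V(2) k by auto
      then show ?thesis using inv_sq_nonneg[of k] by simp
    qed
    moreover have "\<bar>c ^ (m - i)\<bar> \<le> C ^ (m - i)" unfolding power_abs using c by (intro power_mono) auto
    ultimately show "\<bar>real (m choose i) * c ^ (m - i) * (V ^ i) $ k\<bar> \<le> (real (m choose i) * C ^ (m - i)) * (8 ^ m * s\<^sup>2 * inv_sq k)"
      unfolding abs_mult using C0 by (intro mult_mono) auto
  qed
  also have "\<dots> = (\<Sum>i\<le>m. real (m choose i) * 1 ^ i * C ^ (m - i)) * (8 ^ m * s\<^sup>2 * inv_sq k)"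
    by (simp add: sum_distrib_right)
  also have "(\<Sum>i\<le>m. real (m choose i) * 1 ^ i * C ^ (m - i)) = (1 + C) ^ m" by (rule binomial_ring[symmetric])
  finally show ?thesis by (simp add: mult_ac add.commute)
qed

definition power_coeff :: "nat \<Rightarrow> (nat \<Rightarrow> real \<Rightarrow> real) \<Rightarrow> nat \<Rightarrow> real \<Rightarrow> real" where
  "power_coeff m Z k x = ((Abs_fps (\<lambda>j. Z j x)) ^ m) $ k"

text \<open>An interface between the recursion and the summation of the series. The growth
  \<open>(k + 1)^2\<close> comes from the second derivative: each derivative may cost a factor of
  the frequency, which is at most linear in \<open>k\<close>. Geometric factors make this
  harmless.\<close>

locale unstable_series = soliton +
  fixes a e0 K :: real and Z Z' Z'' :: "nat \<Rightarrow> real \<Rightarrow> real"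
  assumes a_pos: "a > 0" and e0_pos: "e0 > 0" and K_nonneg: "K \<ge> 0"
    and Z_0: "Z 0 = Q p" and Z_1: "\<exists>x. Z 1 x \<noteq> 0"
    and Z_deriv: "(Z k has_real_derivative Z' k x) (at x)"
    and Z'_deriv: "(Z' k has_real_derivative Z'' k x) (at x)"
    and Z_eq: "((\<lambda>x. Z'' k x + power_coeff p Z k x) has_real_derivative Z' k x + real k * e0 * Z k x) (at x)"
    and Z_le: "\<bar>Z k x\<bar> \<le> K * (real k + 1)\<^sup>2 / exp (a * \<bar>x\<bar>)"
    and Z'_le: "\<bar>Z' k x\<bar> \<le> K * (real k + 1)\<^sup>2 / exp (a * \<bar>x\<bar>)"
    and Z''_le: "\<bar>Z'' k x\<bar> \<le> K * (real k + 1)\<^sup>2 / exp (a * \<bar>x\<bar>)"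
    and power_coeff_le: "\<bar>power_coeff p Z k x\<bar> \<le> K * (real k + 1)\<^sup>2 / exp (a * \<bar>x\<bar>)"

text \<open>Truncation below \<open>k\<close> removes the unknown \<open>f k\<close>, so that the
  expression can be used as forcing term in the linear equation that determines it.\<close>

definition lower_power_coeff :: "nat \<Rightarrow> (nat \<Rightarrow> real \<Rightarrow> real) \<Rightarrow> nat \<Rightarrow> real \<Rightarrow> real" where
  "lower_power_coeff m f k x = ((Abs_fps (\<lambda>j. if j < k then f j x else 0)) ^ m) $ k"

lemma lower_power_coeff_cong:
  assumes "\<And>j. j < k \<Longrightarrow> f j = g j" shows "lower_power_coeff m f k = lower_power_coeff m g k"
proof
  fix x
  have "(\<lambda>j. if j < k then f j x else 0) = (\<lambda>j. if j < k then g j x else 0)" using assms by auto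
  then show "lower_power_coeff m f k x = lower_power_coeff m g k x" unfolding lower_power_coeff_def by (rule arg_cong)
qed

lemma power_coeff_split:
  assumes "k \<ge> 1"
  shows "power_coeff m f k x = real m * f 0 x ^ (m - 1) * f k x + lower_power_coeff m f k x"
  using fps_power_nth_cong[of k "Abs_fps (\<lambda>j. f j x)" "Abs_fps (\<lambda>j. if j < k then f j x else 0)" m] assms
  by (simp add: power_coeff_def lower_power_coeff_def)

lemma lower_power_coeff_1: "lower_power_coeff m f 1 x = 0"
proof -
  have "Abs_fps (\<lambda>j. if j < 1 then f j x else 0) = fps_const (f 0 x)" by (auto simp: fps_eq_iff)
  then show ?thesis by (simp add: lower_power_coeff_def fps_const_power)
qed

lemma lower_power_coeff_cont:
  assumes "\<And>j. j < k \<Longrightarrow> continuous_on S (f j)" shows "continuous_on S (lower_power_coeff m f k)"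
  unfolding lower_power_coeff_def[abs_def]
proof (rule fps_power_nth_continuous)
  show "continuous_on S (\<lambda>t. if j < k then f j t else 0)" for j using assms by (cases "j < k") auto
qed

lemma lower_power_coeff_le:
  assumes "\<And>j. 1 \<le> j \<Longrightarrow> j < k \<Longrightarrow> \<bar>f j x\<bar> \<le> s * inv_sq j" "0 \<le> s" "s \<le> 1" "k \<ge> 1" "\<bar>f 0 x\<bar> \<le> C"
  shows "\<bar>lower_power_coeff m f k x\<bar> \<le> 8 ^ m * (C + 1) ^ m * s\<^sup>2 * inv_sq k"
proof -
  define V where "V = Abs_fps (\<lambda>j. if 1 \<le> j \<and> j < k then f j x else 0)"
  have "Abs_fps (\<lambda>j. if j < k then f j x else 0) = fps_const (f 0 x) + V"
    using assms(4) by (auto simp: fps_eq_iff V_def Suc_le_eq)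
  moreover have "\<bar>((fps_const (f 0 x) + V) ^ m) $ k\<bar> \<le> 8 ^ m * (C + 1) ^ m * s\<^sup>2 * inv_sq k"
    using assms inv_sq_nonneg by (intro fps_shifted_power_majorant) (auto simp: V_def)
  ultimately show ?thesis by (simp add: lower_power_coeff_def)
qed

lemma cubic_le_imp_le:
  fixes x y :: real
  assumes "x ^ 3 - x \<le> y ^ 3 - y" "x \<ge> 1" "y \<ge> 1" shows "x \<le> y"
proof (rule ccontr)
  assume "\<not> x \<le> y"
  moreover have "x\<^sup>2 \<ge> 1" "y\<^sup>2 \<ge> 1" "x * y \<ge> 1" using assms mult_mono[of 1 x 1 y] by (auto intro: one_le_power)
  then have "x\<^sup>2 + x * y + y\<^sup>2 - 1 > 0" by linarith
  ultimately have "(x - y) * (x\<^sup>2 + x * y + y\<^sup>2 - 1) > 0" by (intro mult_pos_pos) auto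
  then show False using assms(1) by (simp add: algebra_simps power2_eq_square power3_eq_cube)
qed

section \<open>Solution of the recursion\<close>

context spectral begin

text \<open>The upper bound is crude but linear in \<open>k\<close>, which keeps all later growth
  polynomial. The strict inequality for \<open>k \<ge> 2\<close> places these frequencies beyond the
  last singular parameter.\<close>

lemma frequency_exists:
  assumes "\<nu>0 > 1" "k \<ge> 1"
  shows "\<exists>\<nu>\<ge>\<nu>0. \<nu> ^ 3 - \<nu> = real k * (\<nu>0 ^ 3 - \<nu>0) \<and> \<nu> \<le> \<nu>0 + real k * (\<nu>0 ^ 3 - \<nu>0) \<and> (k = 1 \<longrightarrow> \<nu> = \<nu>0) \<and> (k \<ge> 2 \<longrightarrow> \<nu> > \<nu>0)"
proof -
  define e u where "e = \<nu>0 ^ 3 - \<nu>0" and "u = \<nu>0 + real k * e"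
  have "e = \<nu>0 * (\<nu>0\<^sup>2 - 1)" by (simp add: e_def algebra_simps power2_eq_square power3_eq_cube)
  then have e: "e > 0" using assms(1) by (simp add: one_less_power)
  have "u ^ 3 - u \<ge> real k * e"
  proof -
    have u1: "u > 1" using assms(1) e by (simp add: u_def add_pos_nonneg add_strict_increasing2 less_le_trans)
    have "u ^ 3 - u = (u - 1) * (u * (u + 1))" by (simp add: algebra_simps power3_eq_cube)
    also have "\<dots> \<ge> (u - 1) * 1" using u1 mult_mono[of 1 u 1 "u + 1"] by (intro mult_left_mono) auto
    finally show ?thesis using assms(1) by (simp add: u_def)
  qed
  moreover have "\<nu>0 ^ 3 - \<nu>0 \<le> real k * e" using e assms(2) mult_right_mono[of 1 "real k" e] by (simp add: e_def)
  moreover have "\<nu>0 \<le> u" using e by (simp add: u_def)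
  moreover have "continuous_on {\<nu>0..u} (\<lambda>v. v ^ 3 - v)" by (intro continuous_intros)
  ultimately obtain v where v: "\<nu>0 \<le> v" "v \<le> u" "v ^ 3 - v = real k * e"
    using IVT'[of "\<lambda>v. v ^ 3 - v" \<nu>0 "real k * e" u] by blast
  have "v > \<nu>0" if "k \<ge> 2"
  proof (rule ccontr)
    assume "\<not> v > \<nu>0"
    then have "e = real k * e" using v by (simp add: e_def)
    then show False using e that by simp
  qed
  moreover have "v = \<nu>0" if "k = 1"
    using cubic_le_imp_le[of v \<nu>0] v that assms(1) by (auto simp: e_def)
  ultimately show ?thesis using v unfolding e_def[symmetric] u_def[symmetric] by blast
qed

lemma inverse_weight_le_1: "1 / exp (a * \<bar>x\<bar>) \<le> 1"
  using a_pos by simp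

text \<open>The dependence on the frequency is kept explicit through \<open>L\<close>: the function,
  its first and its second derivative need at most the powers \<open>0\<close>, \<open>1\<close> and
  \<open>2\<close> of it.\<close>

lemma linT_bounds:
  assumes "lin_problem \<nu> a M f" "\<nu> \<ge> \<nu>1" "\<nu> \<le> L" "M \<ge> 0" "M \<le> B"
    and B: "B \<ge> M * (7 / a / a)" "B \<ge> M * (7 / a / a + 7 / a) * L" "B \<ge> M * ((7 / a / a + 7 / a) * L\<^sup>2 + 7 + 11 / a * L)"
  shows "\<bar>linT \<nu> f x\<bar> \<le> B / exp (a * \<bar>x\<bar>)" "\<bar>linT' \<nu> f x\<bar> \<le> B / exp (a * \<bar>x\<bar>)" "\<bar>linT'' \<nu> f x\<bar> \<le> B / exp (a * \<bar>x\<bar>)"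
proof -
  interpret lin_problem \<nu> a M f by fact
  note g = gap_ge[OF assms(2)] a_le_nu[OF assms(2)] a_pos
  have \<nu>: "\<nu> > 1" using nu1 assms(2) by simp
  have M0: "M \<ge> 0" by fact
  define A where "A = 7 / a / a + 7 / a"
  have A0: "A \<ge> 0" "7 / a \<ge> 0" "7 / a / a \<ge> 0" "A \<ge> 7 / a / a" using g by (auto simp: A_def)
  have 1: "\<bar>linT \<nu> f x\<bar> \<le> M * (7 / a / a) / exp (a * \<bar>x\<bar>)"
    using g by (intro linT_le[OF assms(1,2)]) auto
  show "\<bar>linT \<nu> f x\<bar> \<le> B / exp (a * \<bar>x\<bar>)" by (rule order_trans[OF 1 divide_right_mono]) (use B in auto)
  have "\<bar>linT' \<nu> f x\<bar> \<le> M * (\<nu> * (7 / a / a) + 7 / a) / exp (a * \<bar>x\<bar>)"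
    using g by (intro linT'_le[OF assms(1,2)]) auto
  also have "\<nu> * (7 / a / a) + 7 / a \<le> A * \<nu>" using mult_right_mono[of 1 \<nu> "7 / a"] \<nu> A0 by (simp add: A_def algebra_simps)
  finally have 2: "\<bar>linT' \<nu> f x\<bar> \<le> M * (A * \<nu>) / exp (a * \<bar>x\<bar>)" using M0 by (simp add: divide_right_mono mult_left_mono)
  have "M * (A * \<nu>) \<le> M * (A * L)" by (intro mult_left_mono assms(3) A0(1) M0)
  then show "\<bar>linT' \<nu> f x\<bar> \<le> B / exp (a * \<bar>x\<bar>)"
    using B(2) by (intro order_trans[OF 2 divide_right_mono]) (auto simp: A_def mult.assoc)
  have "\<bar>coresponse (\<nu> / 2) (disc_root \<nu>) 0 f x\<bar> \<le> M * (inner_const (\<nu> / 2) (disc_root \<nu>) 0 a + norm (of_real (\<nu> / 2) - disc_root \<nu>) * response_const (\<nu> / 2) (disc_root \<nu>) 0 a) / exp (a * \<bar>x\<bar>)"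
    by (rule abs_coresponse_le)
  also have "\<dots> \<le> M * (6 + 11 / a * L) / exp (a * \<bar>x\<bar>)"
  proof (intro divide_right_mono mult_left_mono add_mono)
    show "inner_const (\<nu> / 2) (disc_root \<nu>) 0 a \<le> 6" by (rule inner_const_le(1)[OF assms(2) g(2)])
    have "norm (of_real (\<nu> / 2) - disc_root \<nu>) \<le> 3 / 2 * \<nu>"
      using norm_triangle_ineq4[of "of_real (\<nu> / 2)" "disc_root \<nu>"] norm_disc_root_le[of \<nu>] \<nu>
      by (simp add: norm_divide)
    then have "norm (of_real (\<nu> / 2) - disc_root \<nu>) * response_const (\<nu> / 2) (disc_root \<nu>) 0 a \<le> (3 / 2 * \<nu>) * (7 / a)"
      using response_const_le[OF assms(2) g(2) g(3)] g \<nu> by (intro mult_mono) auto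
    also have "\<dots> = (21 / 2) * (\<nu> / a)" by simp
    also have "\<dots> \<le> 11 * (L / a)" using \<nu> assms(3) a_pos by (intro mult_mono divide_right_mono) auto
    finally show "norm (of_real (\<nu> / 2) - disc_root \<nu>) * response_const (\<nu> / 2) (disc_root \<nu>) 0 a \<le> 11 / a * L" by simp
  qed (use M0 in auto)
  finally have co: "\<bar>coresponse (\<nu> / 2) (disc_root \<nu>) 0 f x\<bar> \<le> M * (6 + 11 / a * L) / exp (a * \<bar>x\<bar>)" .
  have "\<nu> * \<bar>linT' \<nu> f x\<bar> \<le> \<nu> * (M * (A * \<nu>) / exp (a * \<bar>x\<bar>))" using 2 \<nu> by (intro mult_left_mono) auto
  also have "\<dots> = M * (A * \<nu>\<^sup>2) / exp (a * \<bar>x\<bar>)" by (simp add: power2_eq_square)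
  also have "\<dots> \<le> M * (A * L\<^sup>2) / exp (a * \<bar>x\<bar>)"
    using \<nu> by (intro divide_right_mono mult_left_mono power_mono A0(1) M0 assms(3)) auto
  finally have 3: "\<nu> * \<bar>linT' \<nu> f x\<bar> \<le> M * (A * L\<^sup>2) / exp (a * \<bar>x\<bar>)" .
  have "\<bar>linT'' \<nu> f x\<bar> \<le> \<nu> * \<bar>linT' \<nu> f x\<bar> + \<bar>f x\<bar> + \<bar>coresponse (\<nu> / 2) (disc_root \<nu>) 0 f x\<bar>"
    unfolding linT''_def using \<nu> abs_mult[of \<nu> "linT' \<nu> f x"] by simp
  also have "\<dots> \<le> M * (A * L\<^sup>2) / exp (a * \<bar>x\<bar>) + M / exp (a * \<bar>x\<bar>) + M * (6 + 11 / a * L) / exp (a * \<bar>x\<bar>)"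
    by (intro add_mono 3 co boundf)
  also have "\<dots> = M * (A * L\<^sup>2 + 7 + 11 / a * L) / exp (a * \<bar>x\<bar>)" by (simp add: add_divide_distrib[symmetric] algebra_simps)
  also have "\<dots> \<le> B / exp (a * \<bar>x\<bar>)" using B(3) by (intro divide_right_mono) (auto simp: A_def)
  finally show "\<bar>linT'' \<nu> f x\<bar> \<le> B / exp (a * \<bar>x\<bar>)" .
qed

text \<open>The forcing is quadratic in the earlier coefficients and thus of size
  \<open>\<delta>^2 * inv_sq k\<close>. Inversion costs the constant \<open>C\<close>, and the
  smallness condition on \<open>\<delta>\<close> brings the result back to
  \<open>\<delta> * inv_sq k\<close>, so the induction closes with the same majorant.\<close>

lemma recursion_exists:
  assumes nu: "\<And>k. k \<ge> 2 \<Longrightarrow> \<nu>1 \<le> nu k" and C: "C > 0" and \<delta>: "0 < \<delta>" "\<delta> \<le> 1" "C * (8 ^ p * (CQ + 1) ^ p) * \<delta> \<le> 1"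
    and Y: "continuous_on UNIV Y" "\<And>x. \<bar>Y x\<bar> \<le> \<delta> / exp (a * \<bar>x\<bar>)"
    and solve: "\<And>k. k \<ge> 2 \<Longrightarrow> solvable C (nu k)"
  shows "\<exists>Z. Z 0 = Q p \<and> Z 1 = Y \<and> (\<forall>k. continuous_on UNIV (Z k)) \<and>
    (\<forall>k\<ge>1. \<forall>x. \<bar>Z k x\<bar> \<le> \<delta> * inv_sq k / exp (a * \<bar>x\<bar>)) \<and>
    (\<forall>k\<ge>2. \<forall>x. Z k x = linT (nu k) (\<lambda>t. q t * Z k t + lower_power_coeff p Z k t) x)"
proof -
  define P where "P f k r \<longleftrightarrow> (if k = 0 then r = Q p else if k = 1 then r = Y else
      continuous_on UNIV r \<and> (\<forall>x. \<bar>r x\<bar> \<le> \<delta> * inv_sq k / exp (a * \<bar>x\<bar>)) \<and>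
      (\<forall>x. r x = linT (nu k) (\<lambda>t. q t * r t + lower_power_coeff p f k t) x))" for f k r
  have cont: "continuous_on UNIV r" if "P f k r" for f k r
    using that cont_Q[of UNIV] Y(1) unfolding P_def by (metis (no_types, lifting))
  have bd: "\<bar>r x\<bar> \<le> \<delta> * inv_sq k / exp (a * \<bar>x\<bar>)" if "P f k r" "k \<ge> 1" for f k r x
  proof (cases "k = 1")
    case True
    then show ?thesis using that Y(2) by (simp add: P_def inv_sq_def)
  next
    case False
    then have "\<forall>x. \<bar>r x\<bar> \<le> \<delta> * inv_sq k / exp (a * \<bar>x\<bar>)" using that unfolding P_def by (metis (no_types, lifting) not_one_le_zero)
    then show ?thesis by blast
  qed
  have "\<exists>Z. \<forall>k. P Z k (Z k)"
  \<comment> \<open>Each coefficient is only known to exist, so the sequence is obtained by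
    dependent choice. The property \<open>P\<close> sees the earlier members only through
    \<open>lower_power_coeff\<close>, which does not look at orders from \<open>k\<close>
    on.\<close>
  proof (rule dependent_wf_choice[of less_than])
    fix f g :: "nat \<Rightarrow> real \<Rightarrow> real" and k r assume "\<And>z. (z, k) \<in> less_than \<Longrightarrow> f z = g z"
    then have "lower_power_coeff p f k = lower_power_coeff p g k" by (intro lower_power_coeff_cong) simp
    then show "P f k r = P g k r" by (simp add: P_def)
  next
    fix k f assume "\<And>y. (y, k) \<in> less_than \<Longrightarrow> P f y (f y)"
    then have IH: "P f j (f j)" if "j < k" for j using that by simp
    show "\<exists>r. P f k r"
    proof (cases "k \<ge> 2")
      case False
      then have "k = 0 \<or> k = 1" by auto
      then show ?thesis by (auto simp: P_def)
    next
      case k: True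
      let ?N = "lower_power_coeff p f k"
      have f0: "f 0 = Q p" using IH[of 0] k by (simp add: P_def)
      have "\<bar>?N x\<bar> \<le> 8 ^ p * (CQ + 1) ^ p * \<delta>\<^sup>2 * inv_sq k / exp (a * \<bar>x\<bar>)" for x
      proof -
        define w where "w = 1 / exp (a * \<bar>x\<bar>)"
        have w: "0 < w" "w \<le> 1" using inverse_weight_le_1[of x] by (auto simp: w_def)
        have "\<bar>?N x\<bar> \<le> 8 ^ p * (CQ + 1) ^ p * (\<delta> * w)\<^sup>2 * inv_sq k"
        proof (rule lower_power_coeff_le)
          show "\<bar>f j x\<bar> \<le> \<delta> * w * inv_sq j" if "1 \<le> j" "j < k" for j
            using bd[OF IH[OF that(2)] that(1), of x] by (simp add: w_def)
          show "\<bar>f 0 x\<bar> \<le> CQ" using Q_le[of x] Q_pos[of x] by (simp add: f0)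
        qed (use \<delta> w k mult_le_one[of \<delta> w] in auto)
        \<comment> \<open>The square of the weight is relaxed to one power of it, since the linear
          problems are solved in that weight.\<close>
        also have "(\<delta> * w)\<^sup>2 \<le> \<delta>\<^sup>2 * w"
          using w mult_left_mono[of "w * w" w "\<delta>\<^sup>2"] mult_right_mono[of w 1 w] by (simp add: power2_eq_square mult_ac)
        finally show ?thesis using inv_sq_nonneg[of k] by (simp add: w_def mult_left_mono mult_right_mono)
      qed
      moreover have "continuous_on UNIV ?N" by (intro lower_power_coeff_cont cont[OF IH])
      ultimately obtain r where r: "continuous_on UNIV r"
          "\<And>x. \<bar>r x\<bar> \<le> C * (8 ^ p * (CQ + 1) ^ p * \<delta>\<^sup>2 * inv_sq k) / exp (a * \<bar>x\<bar>)"
          "\<And>x. r x = linT (nu k) (\<lambda>t. q t * r t + ?N t) x"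
        using solve[OF k] unfolding solvable_def by blast
      have "C * (8 ^ p * (CQ + 1) ^ p * \<delta>\<^sup>2 * inv_sq k) = (C * (8 ^ p * (CQ + 1) ^ p) * \<delta>) * (\<delta> * inv_sq k)"
        by (simp add: power2_eq_square mult_ac)
      also have "\<dots> \<le> 1 * (\<delta> * inv_sq k)" using \<delta> inv_sq_nonneg[of k] by (intro mult_right_mono) auto
      finally have "\<bar>r x\<bar> \<le> \<delta> * inv_sq k / exp (a * \<bar>x\<bar>)" for x
        by (intro order_trans[OF r(2) divide_right_mono]) auto
      moreover have "k \<noteq> 0" "k \<noteq> 1" using k by auto
      ultimately show ?thesis unfolding P_def using r(1,3) by (metis (no_types, lifting))
    qed
  qed simp
  then obtain Z where Z: "\<And>k. P Z k (Z k)" by blast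
  show ?thesis
  proof (intro exI[of _ Z] conjI allI impI)
    show "Z 0 = Q p" "Z 1 = Y" using Z[of 0] Z[of 1] by (auto simp: P_def)
    show "Z k x = linT (nu k) (\<lambda>t. q t * Z k t + lower_power_coeff p Z k t) x" if "k \<ge> 2" for k x
    proof -
      have "k \<noteq> 0" "k \<noteq> 1" using that by auto
      then have "\<forall>x. Z k x = linT (nu k) (\<lambda>t. q t * Z k t + lower_power_coeff p Z k t) x"
        using Z[of k] unfolding P_def by (metis (no_types, lifting))
      then show ?thesis by blast
    qed
    show "continuous_on UNIV (Z k)" for k by (rule cont[OF Z])
    show "\<bar>Z k x\<bar> \<le> \<delta> * inv_sq k / exp (a * \<bar>x\<bar>)" if "1 \<le> k" for k x by (rule bd[OF Z that])
  qed
qed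

lemma unstable_series_exists: "\<exists>e0 K Z Z' Z''. unstable_series p a e0 K Z Z' Z''"
proof -
  obtain \<nu>0 Y0 where \<nu>0: "\<nu>0 \<ge> \<nu>1" and Y: "eigenfunction \<nu>0 Y0"
    and inv: "\<And>N. finite N \<Longrightarrow> \<exists>C>0. \<forall>\<nu>. \<nu> \<in> N \<and> \<nu> > \<nu>0 \<or> \<nu> \<ge> Lam \<and> \<nu> > \<nu>0 \<longrightarrow> solvable C \<nu>"
    using last_eigenvalue by blast
  obtain C0 where Y0: "continuous_on UNIV Y0" "\<And>x. \<bar>Y0 x\<bar> \<le> C0 / exp (a * \<bar>x\<bar>)" "Y0 \<noteq> (\<lambda>_. 0)"
    using Y unfolding eigenfunction_def by blast
  have Y0T: "Y0 x = linT \<nu>0 (\<lambda>t. q t * Y0 t) x" for x using Y unfolding eigenfunction_def by blast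
  have \<nu>0_1: "\<nu>0 > 1" using \<nu>0 nu1 by simp
  define e where "e = \<nu>0 ^ 3 - \<nu>0"
  have "e = \<nu>0 * (\<nu>0\<^sup>2 - 1)" by (simp add: e_def algebra_simps power2_eq_square power3_eq_cube)
  then have e: "e > 0" using \<nu>0_1 by (simp add: one_less_power)
  obtain nu where nu: "\<And>k. k \<ge> 1 \<Longrightarrow> nu k \<ge> \<nu>0" "\<And>k. k \<ge> 1 \<Longrightarrow> nu k ^ 3 - nu k = real k * e"
    "\<And>k. k \<ge> 1 \<Longrightarrow> nu k \<le> \<nu>0 + real k * e" "nu 1 = \<nu>0" "\<And>k. k \<ge> 2 \<Longrightarrow> nu k > \<nu>0"
  proof -
    from frequency_exists[OF \<nu>0_1] have "\<forall>k. \<exists>\<nu>. k \<ge> 1 \<longrightarrow> \<nu> \<ge> \<nu>0 \<and> \<nu> ^ 3 - \<nu> = real k * e \<and> \<nu> \<le> \<nu>0 + real k * e \<and> (k = 1 \<longrightarrow> \<nu> = \<nu>0) \<and> (k \<ge> 2 \<longrightarrow> \<nu> > \<nu>0)"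
      unfolding e_def by blast
    then obtain nu where "\<forall>k. k \<ge> 1 \<longrightarrow> nu k \<ge> \<nu>0 \<and> nu k ^ 3 - nu k = real k * e \<and> nu k \<le> \<nu>0 + real k * e \<and> (k = 1 \<longrightarrow> nu k = \<nu>0) \<and> (k \<ge> 2 \<longrightarrow> nu k > \<nu>0)"
      by metis
    then show ?thesis by (intro that[of nu]) fastforce+
  qed
  \<comment> \<open>The finitely many frequencies that may lie below \<open>Lam\<close>: if
    \<open>nu k < Lam\<close>, then \<open>k * e < Lam ^ 3\<close>.\<close>
  define N where "N = nu ` {k. real k * e < Lam ^ 3}"
  have "{k. real k * e < Lam ^ 3} \<subseteq> {..nat \<lceil>Lam ^ 3 / e\<rceil>}"
  proof
    fix k assume "k \<in> {k. real k * e < Lam ^ 3}"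
    then have "real k < Lam ^ 3 / e" using e by (simp add: pos_less_divide_eq)
    then have "k \<le> nat \<lceil>Lam ^ 3 / e\<rceil>" by linarith
    then show "k \<in> {..nat \<lceil>Lam ^ 3 / e\<rceil>}" by (rule atMost_iff[THEN iffD2])
  qed
  then have "finite N" unfolding N_def by (rule finite_imageI[OF finite_subset]) (rule finite_atMost)
  from inv[OF this] obtain C where C: "C > 0" "\<And>\<nu>. \<nu> \<in> N \<and> \<nu> > \<nu>0 \<or> \<nu> \<ge> Lam \<and> \<nu> > \<nu>0 \<Longrightarrow> solvable C \<nu>"
    by blast
  have nuN: "nu k \<in> N \<and> nu k > \<nu>0 \<or> nu k \<ge> Lam \<and> nu k > \<nu>0" if "k \<ge> 2" for k
  proof (cases "real k * e < Lam ^ 3")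
    case True
    then show ?thesis using nu(5)[OF that] unfolding N_def by blast
  next
    case False
    have Lam: "Lam \<ge> 2" by (simp add: Lam_def)
    have k1: "k \<ge> 1" using that by simp
    have "Lam ^ 3 - Lam \<le> nu k ^ 3 - nu k" using nu(2)[OF k1] False Lam by linarith
    moreover have "nu k \<ge> 1" using nu(1)[OF k1] \<nu>0_1 by linarith
    ultimately have "Lam \<le> nu k" using Lam cubic_le_imp_le[of Lam "nu k"] by linarith
    then show ?thesis using nu(5)[OF that] by simp
  qed
  define CN where "CN = (8 :: real) ^ p * (CQ + 1) ^ p"
  have CN: "CN > 0" by (auto simp: CN_def intro!: mult_pos_pos zero_less_power)
  define \<delta> where "\<delta> = min 1 (1 / (C * CN))"
  have \<delta>: "0 < \<delta>" "\<delta> \<le> 1" using C(1) CN by (auto simp: \<delta>_def)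
  have "\<delta> \<le> 1 / (C * CN)" by (simp add: \<delta>_def)
  then have \<delta>C: "C * (8 ^ p * (CQ + 1) ^ p) * \<delta> \<le> 1"
    unfolding CN_def[symmetric] using C(1) CN by (simp add: pos_le_divide_eq mult_ac)
  \<comment> \<open>The eigenfunction is rescaled so that it obeys the majorant at
    \<open>k = 1\<close>, where \<open>inv_sq\<close> equals \<open>1\<close>.\<close>
  define b where "b = \<delta> / (\<bar>C0\<bar> + 1)"
  have b: "b > 0" using \<delta> by (simp add: b_def add_nonneg_pos)
  define Y where "Y x = b * Y0 x" for x
  have Yc: "continuous_on UNIV Y" unfolding Y_def[abs_def] by (intro continuous_intros Y0)
  have Yb: "\<bar>Y x\<bar> \<le> \<delta> / exp (a * \<bar>x\<bar>)" for x
  proof -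
    have "\<bar>Y x\<bar> \<le> b * (C0 / exp (a * \<bar>x\<bar>))" unfolding Y_def abs_mult using b Y0(2)[of x] by (intro mult_mono) auto
    also have "\<dots> = b * C0 / exp (a * \<bar>x\<bar>)" by simp
    also have "b * C0 \<le> b * (\<bar>C0\<bar> + 1)" using b by (intro mult_left_mono) auto
    also have "b * (\<bar>C0\<bar> + 1) = \<delta>" using abs_ge_zero[of C0] by (simp add: b_def)
    finally show ?thesis by (simp add: divide_right_mono)
  qed
  have YT: "Y x = linT \<nu>0 (\<lambda>t. q t * Y t) x" for x
    using Y0T[of x] linT_mult[of \<nu>0 b "\<lambda>t. q t * Y0 t" x] by (simp add: Y_def mult_ac)
  have "\<exists>Z. Z 0 = Q p \<and> Z 1 = Y \<and> (\<forall>k. continuous_on UNIV (Z k)) \<and>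
    (\<forall>k\<ge>1. \<forall>x. \<bar>Z k x\<bar> \<le> \<delta> * inv_sq k / exp (a * \<bar>x\<bar>)) \<and>
    (\<forall>k\<ge>2. \<forall>x. Z k x = linT (nu k) (\<lambda>t. q t * Z k t + lower_power_coeff p Z k t) x)"
  proof (rule recursion_exists[OF _ C(1) \<delta> \<delta>C Yc Yb])
    show "\<nu>1 \<le> nu k" if "k \<ge> 2" for k using nu(1)[of k] that \<nu>0 by simp
    show "solvable C (nu k)" if "k \<ge> 2" for k by (rule C(2)[OF nuN[OF that]])
  qed
  then obtain Z where Z0: "Z 0 = Q p" and Z1: "Z 1 = Y" and Zc: "\<And>k. continuous_on UNIV (Z k)"
    and Zb: "\<And>k x. k \<ge> 1 \<Longrightarrow> \<bar>Z k x\<bar> \<le> \<delta> * inv_sq k / exp (a * \<bar>x\<bar>)"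
    and ZT: "\<And>k x. k \<ge> 2 \<Longrightarrow> Z k x = linT (nu k) (\<lambda>t. q t * Z k t + lower_power_coeff p Z k t) x"
    by blast
  define F where "F = power_coeff p Z"
  have F: "F k x = q x * Z k x + lower_power_coeff p Z k x" if "k \<ge> 1" for k x
    using power_coeff_split[OF that, of p Z x] by (simp add: F_def Z0 q_def)
  have Zlin: "Z k x = linT (nu k) (F k) x" if "k \<ge> 1" for k x
  proof (cases "k = 1")
    case True
    have F1: "F 1 = (\<lambda>t. q t * Y t)"
      by (rule ext) (simp only: F[OF order_refl] lower_power_coeff_1 Z1 add_0_right)
    show ?thesis unfolding True nu(4) Z1 F1 by (rule YT)
  next
    case False
    then have "F k = (\<lambda>t. q t * Z k t + lower_power_coeff p Z k t)" using F[OF that] by blast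
    then show ?thesis using ZT[of k x] that False by simp
  qed
  define M where "M = real p * CQ + CN"
  have M0: "M \<ge> 0" using CN by (simp add: M_def)
  have Fb: "\<bar>F k x\<bar> \<le> M / exp (a * \<bar>x\<bar>)" if "k \<ge> 1" for k x
  proof -
    define w where "w = 1 / exp (a * \<bar>x\<bar>)"
    have w: "0 < w" "w \<le> 1" using inverse_weight_le_1[of x] by (auto simp: w_def)
    have \<delta>w: "0 \<le> \<delta> * w" "\<delta> * w \<le> w" "\<delta> * w \<le> 1" using \<delta> w mult_le_one[of \<delta> w] mult_right_mono[of \<delta> 1 w] by auto
    have z: "\<bar>Z j x\<bar> \<le> \<delta> * w * inv_sq j" if "j \<ge> 1" for j using Zb[OF that, of x] by (simp add: w_def)
    have "\<bar>lower_power_coeff p Z k x\<bar> \<le> 8 ^ p * (CQ + 1) ^ p * (\<delta> * w)\<^sup>2 * inv_sq k"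
      using that z \<delta>w Q_le[of x] Q_pos[of x] by (intro lower_power_coeff_le) (auto simp: Z0)
    also have "\<dots> = CN * ((\<delta> * w)\<^sup>2 * inv_sq k)" by (simp add: CN_def)
    also have "\<dots> \<le> CN * (w * 1)"
    proof (intro mult_left_mono mult_mono)
      show "(\<delta> * w)\<^sup>2 \<le> w" using \<delta>w mult_mono[of "\<delta> * w" w "\<delta> * w" 1] by (simp add: power2_eq_square)
    qed (use CN inv_sq_nonneg inv_sq_le_1 w in auto)
    finally have l: "\<bar>lower_power_coeff p Z k x\<bar> \<le> CN * w" by simp
    have "\<bar>Z k x\<bar> \<le> w * 1" by (rule order_trans[OF z[OF that] mult_mono]) (use \<delta>w inv_sq_le_1 inv_sq_nonneg w in auto)
    then have "\<bar>q x * Z k x\<bar> \<le> (real p * CQ) * w" unfolding abs_mult using q_le[of x] q_pos[of x] by (intro mult_mono) auto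
    then have "\<bar>F k x\<bar> \<le> (real p * CQ) * w + CN * w" unfolding F[OF that] using l by linarith
    then show ?thesis by (simp add: M_def w_def add_divide_distrib)
  qed
  have Fc: "continuous_on UNIV (F k)" for k
    unfolding F_def power_coeff_def[abs_def] by (intro fps_power_nth_continuous Zc)
  have \<nu>k: "nu k > 1" "nu k \<ge> \<nu>1" if "k \<ge> 1" for k using nu(1)[OF that] \<nu>0 nu1 by auto
  have lp: "lin_problem (nu k) a M (F k)" if "k \<ge> 1" for k
    by standard (use Fb[OF that] Fc \<nu>k[OF that] a_pos gap_ge[OF \<nu>k(2)[OF that]] in auto)
  define Z' where "Z' k = (if k = 0 then Q1 else linT' (nu k) (F k))" for k
  define Z'' where "Z'' k = (if k = 0 then Q2 else linT'' (nu k) (F k))" for k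
  define L A where "L = \<nu>0 + e" and "A = 7 / a / a + 7 / a"
  \<comment> \<open>The terms in \<open>CQ\<close> cover the soliton at \<open>k = 0\<close>. The
    term with \<open>M\<close> covers \<open>k \<ge> 1\<close>, where \<open>nu k\<close> is at most
    \<open>L * (k + 1)\<close> and the factor \<open>(k + 1)^2\<close> is split off.\<close>
  define K where "K = CQ + CQ\<^sup>2 + M * (A * L\<^sup>2 + 7 + 11 / a * L)"
  have L: "L \<ge> 1" using \<nu>0_1 e by (simp add: L_def)
  have A: "A \<ge> 0" "7 / a / a \<le> A" "11 / a \<ge> 0" using a_pos by (auto simp: A_def)
  have KM: "0 \<le> M * (A * L\<^sup>2 + 7 + 11 / a * L)"
    using M0 A L by (intro mult_nonneg_nonneg add_nonneg_nonneg) auto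
  have K0: "K \<ge> CQ + CQ\<^sup>2" using KM by (simp add: K_def)
  have Knn: "K \<ge> 0" by (rule order_trans[OF _ K0]) simp
  have bounds: "\<bar>Z k x\<bar> \<le> K * (real k + 1)\<^sup>2 / exp (a * \<bar>x\<bar>) \<and> \<bar>Z' k x\<bar> \<le> K * (real k + 1)\<^sup>2 / exp (a * \<bar>x\<bar>) \<and>
    \<bar>Z'' k x\<bar> \<le> K * (real k + 1)\<^sup>2 / exp (a * \<bar>x\<bar>) \<and> \<bar>F k x\<bar> \<le> K * (real k + 1)\<^sup>2 / exp (a * \<bar>x\<bar>)" for k x
  proof (cases "k = 0")
    case True
    have "exp (- \<bar>x\<bar>) \<le> 1 / exp (a * \<bar>x\<bar>)"
      using a_le mult_right_mono[of a 1 "\<bar>x\<bar>"] by (simp add: exp_minus inverse_eq_divide divide_le_cancel frac_le)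
    then have "CQ * exp (- \<bar>x\<bar>) \<le> CQ * (1 / exp (a * \<bar>x\<bar>))" by (intro mult_left_mono) auto
    then have Q: "Q p x \<le> CQ * (1 / exp (a * \<bar>x\<bar>))" using Q_upper[of x] by simp
    have Q2: "\<bar>Q2 x\<bar> \<le> CQ\<^sup>2 * (1 / exp (a * \<bar>x\<bar>))"
      by (rule order_trans[OF Q2_bound]) (use mult_left_mono[OF Q, of CQ] in \<open>simp add: power2_eq_square\<close>)
    have "F 0 x = Q p x - Q2 x" by (simp add: F_def power_coeff_def Z0 Q2_def fps_power_zeroth)
    then have "\<bar>F 0 x\<bar> \<le> Q p x + \<bar>Q2 x\<bar>" using Q_pos[of x] by simp
    then have F0: "\<bar>F 0 x\<bar> \<le> (CQ + CQ\<^sup>2) * (1 / exp (a * \<bar>x\<bar>))" using Q Q2 unfolding distrib_right by linarith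
    have "(CQ + CQ\<^sup>2) * (1 / exp (a * \<bar>x\<bar>)) \<le> K * (1 / exp (a * \<bar>x\<bar>))" using K0 by (rule mult_right_mono) simp
    moreover have "CQ * (1 / exp (a * \<bar>x\<bar>)) \<le> (CQ + CQ\<^sup>2) * (1 / exp (a * \<bar>x\<bar>))"
      "CQ\<^sup>2 * (1 / exp (a * \<bar>x\<bar>)) \<le> (CQ + CQ\<^sup>2) * (1 / exp (a * \<bar>x\<bar>))" by (intro mult_right_mono; simp)+
    ultimately have "\<bar>Q p x\<bar> \<le> K / exp (a * \<bar>x\<bar>)" "\<bar>Q1 x\<bar> \<le> K / exp (a * \<bar>x\<bar>)" "\<bar>Q2 x\<bar> \<le> K / exp (a * \<bar>x\<bar>)" "\<bar>F 0 x\<bar> \<le> K / exp (a * \<bar>x\<bar>)"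
      using Q Q2 F0 Q_pos[of x] Q1_bound[of x] by auto
    then show ?thesis using True by (simp add: Z0 Z'_def Z''_def)
  next
    case False
    then have k: "k \<ge> 1" by simp
    define r where "r = real k + 1"
    have r: "r \<ge> 1" by (simp add: r_def)
    have r2: "r \<le> r\<^sup>2" "1 \<le> r\<^sup>2" using r self_le_power[of r 2] one_le_power[of r 2] by auto
    have L2: "L \<le> L\<^sup>2" "1 \<le> L\<^sup>2" using L self_le_power[of L 2] one_le_power[of L 2] by auto
    have "nu k \<le> \<nu>0 * 1 + real k * e" using nu(3)[OF k] by simp
    also have "\<dots> \<le> \<nu>0 * r + r * e" using \<nu>0_1 e by (intro add_mono mult_left_mono mult_right_mono) (auto simp: r_def)
    finally have nuL: "nu k \<le> L * r" by (simp add: L_def algebra_simps)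
    define B where "B = K * r\<^sup>2"
    have B3: "M * (A * (L * r)\<^sup>2 + 7 + 11 / a * (L * r)) \<le> B"
    proof -
      have "A * (L * r)\<^sup>2 + 7 + 11 / a * (L * r) \<le> (A * L\<^sup>2) * r\<^sup>2 + 7 * r\<^sup>2 + (11 / a * L) * r\<^sup>2"
        using r2 L A mult_left_mono[of r "r\<^sup>2" "11 / a * L"] by (simp add: power_mult_distrib mult_ac)
      then have "M * (A * (L * r)\<^sup>2 + 7 + 11 / a * (L * r)) \<le> M * ((A * L\<^sup>2 + 7 + 11 / a * L) * r\<^sup>2)"
        using M0 by (intro mult_left_mono) (simp_all add: distrib_right)
      also have "\<dots> \<le> K * r\<^sup>2" using r2 by (simp add: K_def distrib_right mult.assoc)
      finally show ?thesis by (simp add: B_def)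
    qed
    have Lr: "L * r \<ge> 1" using mult_mono[of 1 L 1 r] L r by simp
    have "A * (L * r) \<le> A * (L * r)\<^sup>2" using A Lr self_le_power[of "L * r" 2] by (intro mult_left_mono) auto
    moreover have pos: "0 \<le> 11 / a * (L * r)" by (rule mult_nonneg_nonneg[OF A(3)]) (use Lr in linarith)
    ultimately have "A * (L * r) \<le> A * (L * r)\<^sup>2 + 7 + 11 / a * (L * r)" by linarith
    then have B2: "M * (A * (L * r)) \<le> B" using M0 by (intro order_trans[OF mult_left_mono B3]) auto
    have "7 / a / a \<le> A * (L * r)" using A mult_left_mono[OF Lr, of A] by simp
    then have B1: "M * (7 / a / a) \<le> B" using M0 by (intro order_trans[OF mult_left_mono B2]) auto
    have "0 \<le> A * (L * r)\<^sup>2" using A by simp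
    then have "1 \<le> A * (L * r)\<^sup>2 + 7 + 11 / a * (L * r)" using pos by linarith
    then have MB: "M \<le> B" using mult_left_mono[of 1 _ M] M0 B3 by fastforce
    note T = linT_bounds[OF lp[OF k] \<nu>k(2)[OF k] nuL M0 MB B1, of x]
    have "\<bar>linT (nu k) (F k) x\<bar> \<le> B / exp (a * \<bar>x\<bar>)" "\<bar>linT' (nu k) (F k) x\<bar> \<le> B / exp (a * \<bar>x\<bar>)" "\<bar>linT'' (nu k) (F k) x\<bar> \<le> B / exp (a * \<bar>x\<bar>)"
      using B2 B3 by (auto intro!: T simp: A_def mult.assoc)
    moreover have "\<bar>F k x\<bar> \<le> B / exp (a * \<bar>x\<bar>)" by (rule order_trans[OF Fb[OF k] divide_right_mono]) (use MB in auto)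
    ultimately show ?thesis using False Zlin[OF k] by (simp add: Z'_def Z''_def B_def r_def)
  qed
  have Zf: "Z k = linT (nu k) (F k)" if "k \<ge> 1" for k using Zlin[OF that] by blast
  have F0: "F 0 = (\<lambda>x. Q p x ^ p)" by (rule ext) (simp add: F_def power_coeff_def Z0 fps_power_zeroth)
  have "unstable_series p a e K Z Z' Z''"
  proof (unfold_locales, goal_cases)
    case 1 show ?case by (rule a_pos)
  next
    case 2 show ?case by (rule e)
  next
    case 3 show ?case by (rule Knn)
  next
    case 4 show ?case by (rule Z0)
  next
    case 5
    obtain x where "Y0 x \<noteq> 0" using Y0(3) by (auto simp: fun_eq_iff)
    then have "Z 1 x \<noteq> 0" unfolding Z1 Y_def using b by simp
    then show ?case ..
  next
    case (6 k x)
    show ?case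
    proof (cases "k = 0")
      case True then show ?thesis using Q_deriv by (simp add: Z0 Z'_def)
    next
      case False then show ?thesis using lin_problem.linT_deriv[OF lp, of k x] by (simp add: Zf Z'_def)
    qed
  next
    case (7 k x)
    show ?case
    proof (cases "k = 0")
      case True then show ?thesis using Q1_deriv by (simp add: Z'_def Z''_def)
    next
      case False then show ?thesis using lin_problem.linT'_deriv[OF lp, of k x] by (simp add: Z'_def Z''_def)
    qed
  next
    case (8 k x)
    show ?case
    proof (cases "k = 0")
      case True
      have "(\<lambda>x. Q2 x + F 0 x) = Q p" by (rule ext) (simp add: F0 Q2_def)
      then show ?thesis using Q_deriv True by (simp add: F_def Z'_def Z''_def)
    next
      case False
      then have k: "k \<ge> 1" by simp
      show ?thesis using lin_problem.linT_ode[OF lp[OF k], of x] nu(2)[OF k] False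
        by (simp add: Z'_def Z''_def F_def[symmetric] Zlin[OF k])
    qed
  next
    case (9 k x) then show ?case using bounds by blast
  next
    case (10 k x) then show ?case using bounds by blast
  next
    case (11 k x) then show ?case using bounds by blast
  next
    case (12 k x) then show ?case using bounds unfolding F_def by blast
  qed
  then show ?thesis by blast
qed

end

lemma (in soliton) unstable_series_exists: "\<exists>a e0 K Z Z' Z''. unstable_series p a e0 K Z Z' Z''"
proof -
  obtain \<nu>1 where "\<nu>1 > 1" "evans \<nu>1 = 0" using evans_zero by blast
  then interpret spectral p \<nu>1 "min (gap \<nu>1 / 2) (1 / 2)" by unfold_locales auto
  show ?thesis using unstable_series_exists by blast
qed

lemma summable_power_times_geometric: "summable (\<lambda>k. (real k + 1) ^ m * (1 / 2) ^ k)"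
proof -
  have "(\<lambda>k. (1 + inverse (real (Suc k))) ^ m) \<longlonglongrightarrow> 1 ^ m"
    by (intro tendsto_power LIMSEQ_inverse_real_of_nat_add)
  then have "\<forall>\<^sub>F k in sequentially. (1 + inverse (real (Suc k))) ^ m < 3 / 2" by (intro order_tendstoD(2)) auto
  then obtain N where N: "\<And>k. k \<ge> N \<Longrightarrow> (1 + inverse (real (Suc k))) ^ m < 3 / 2" by (auto simp: eventually_sequentially)
  show ?thesis
  proof (rule summable_ratio_test[of "3 / 4" N])
    fix k assume "N \<le> k"
    have "real k + 2 = (1 + inverse (real (Suc k))) * (real k + 1)" by (simp add: field_simps)
    then have "(real k + 2) ^ m = (1 + inverse (real (Suc k))) ^ m * (real k + 1) ^ m" by (simp only: power_mult_distrib)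
    also have "\<dots> \<le> 3 / 2 * (real k + 1) ^ m" using N[OF \<open>N \<le> k\<close>] by (intro mult_right_mono) auto
    finally show "norm ((real (Suc k) + 1) ^ m * (1 / 2) ^ Suc k) \<le> 3 / 4 * norm ((real k + 1) ^ m * (1 / 2) ^ k)"
      by (simp add: abs_mult add.commute mult_right_mono)
  qed simp
qed

section \<open>Summation and termwise differentiation of the series\<close>

context unstable_series begin

text \<open>This class is stable under what differentiating the series in time produces, in
  particular under multiplication by \<open>k\<close>, while any polynomial factor disappears
  against \<open>(1 / 2) ^ k\<close>.\<close>

definition tame :: "(nat \<Rightarrow> real \<Rightarrow> real) \<Rightarrow> bool" where
  "tame c \<longleftrightarrow> (\<exists>B m. \<forall>k x. \<bar>c k x\<bar> \<le> B * (real k + 1) ^ m / exp (a * \<bar>x\<bar>))"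

lemma tameI: "(\<And>k x. \<bar>c k x\<bar> \<le> B * (real k + 1) ^ m / exp (a * \<bar>x\<bar>)) \<Longrightarrow> tame c"
  by (auto simp: tame_def)

lemma tameD:
  assumes "tame c" shows "\<exists>B m. B \<ge> 0 \<and> (\<forall>k x. \<bar>c k x\<bar> \<le> B * (real k + 1) ^ m / exp (a * \<bar>x\<bar>))"
proof -
  obtain B m where B: "\<And>k x. \<bar>c k x\<bar> \<le> B * (real k + 1) ^ m / exp (a * \<bar>x\<bar>)" using assms by (auto simp: tame_def)
  have "B \<ge> 0" using order_trans[OF abs_ge_zero B[of 0 0]] by simp
  then show ?thesis using B by blast
qed

lemma tame_add: assumes "tame c" "tame d" shows "tame (\<lambda>k x. c k x + d k x)"
proof -
  obtain B m where B: "B \<ge> 0" "\<And>k x. \<bar>c k x\<bar> \<le> B * (real k + 1) ^ m / exp (a * \<bar>x\<bar>)" using tameD[OF assms(1)] by blast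
  obtain B' m' where B': "B' \<ge> 0" "\<And>k x. \<bar>d k x\<bar> \<le> B' * (real k + 1) ^ m' / exp (a * \<bar>x\<bar>)" using tameD[OF assms(2)] by blast
  show ?thesis
  proof (rule tameI[of _ "B + B'" "m + m'"])
    fix k x
    have "\<bar>c k x + d k x\<bar> \<le> (B * (real k + 1) ^ m + B' * (real k + 1) ^ m') / exp (a * \<bar>x\<bar>)"
      using B(2)[of k x] B'(2)[of k x] abs_triangle_ineq[of "c k x" "d k x"] unfolding add_divide_distrib by linarith
    also have "\<dots> \<le> (B * (real k + 1) ^ (m + m') + B' * (real k + 1) ^ (m + m')) / exp (a * \<bar>x\<bar>)"
      using B(1) B'(1) by (intro divide_right_mono add_mono mult_left_mono power_increasing) auto
    finally show "\<bar>c k x + d k x\<bar> \<le> (B + B') * (real k + 1) ^ (m + m') / exp (a * \<bar>x\<bar>)" by (simp add: distrib_right)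
  qed
qed

lemma tame_mult: assumes "tame c" shows "tame (\<lambda>k x. s * real k * c k x)"
proof -
  obtain B m where B: "B \<ge> 0" "\<And>k x. \<bar>c k x\<bar> \<le> B * (real k + 1) ^ m / exp (a * \<bar>x\<bar>)" using tameD[OF assms(1)] by blast
  show ?thesis
  proof (rule tameI[of _ "\<bar>s\<bar> * B" "Suc m"])
    fix k x
    have "\<bar>s * real k * c k x\<bar> \<le> \<bar>s\<bar> * (real k + 1) * (B * (real k + 1) ^ m / exp (a * \<bar>x\<bar>))"
      unfolding abs_mult using B by (intro mult_mono) auto
    then show "\<bar>s * real k * c k x\<bar> \<le> \<bar>s\<bar> * B * (real k + 1) ^ Suc m / exp (a * \<bar>x\<bar>)" by (simp add: mult_ac)
  qed
qed

lemma tame_minus: "tame c \<Longrightarrow> tame (\<lambda>k x. - c k x)" by (simp add: tame_def)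

lemma tame_Z: "tame Z" and tame_Z': "tame Z'" and tame_Z'': "tame Z''" and tame_F: "tame (power_coeff p Z)"
  by (rule tameI; rule Z_le Z'_le Z''_le power_coeff_le)+

text \<open>Slightly negative times are included so that \<open>t = 0\<close> is an interior point
  for termwise differentiation. Down to this time the expansion parameter grows by at most the
  factor \<open>2\<close>, from \<open>1 / 4\<close> to \<open>1 / 2\<close>.\<close>

abbreviation "Tmin \<equiv> - (ln 2 / e0)"

definition sig :: "real \<Rightarrow> real \<Rightarrow> real" where "sig \<epsilon> t = \<epsilon> * exp (- (e0 * t))"

definition U :: "real \<Rightarrow> (nat \<Rightarrow> real \<Rightarrow> real) \<Rightarrow> real \<Rightarrow> real \<Rightarrow> real" where
  "U \<epsilon> c t x = (\<Sum>k. sig \<epsilon> t ^ k * c k (x - t))"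

lemma Tmin_neg: "Tmin < 0" using e0_pos by simp

lemma sig_bounds:
  assumes "0 < \<epsilon>" "\<epsilon> \<le> 1 / 4" "t \<ge> Tmin" shows "0 < sig \<epsilon> t" "sig \<epsilon> t \<le> 1 / 2"
proof -
  show "0 < sig \<epsilon> t" using assms by (simp add: sig_def)
  have "- (e0 * t) \<le> ln 2" using assms(3) e0_pos by (simp add: field_simps)
  then have "exp (- (e0 * t)) \<le> 2" by (metis exp_le_cancel_iff exp_ln zero_less_numeral)
  then have "\<epsilon> * exp (- (e0 * t)) \<le> 1 / 4 * 2" using assms by (intro mult_mono) auto
  then show "sig \<epsilon> t \<le> 1 / 2" by (simp add: sig_def)
qed

lemma term_le:
  assumes "\<And>k x. \<bar>c k x\<bar> \<le> B * (real k + 1) ^ m / exp (a * \<bar>x\<bar>)" "\<bar>s\<bar> \<le> 1 / 2"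
  shows "\<bar>s ^ k * c k y\<bar> \<le> B / exp (a * \<bar>y\<bar>) * ((real k + 1) ^ m * (1 / 2) ^ k)"
proof -
  have "\<bar>s ^ k * c k y\<bar> \<le> (1 / 2) ^ k * (B * (real k + 1) ^ m / exp (a * \<bar>y\<bar>))"
    unfolding abs_mult power_abs using assms by (intro mult_mono power_mono) auto
  then show ?thesis by (simp add: mult_ac)
qed

lemma term_le_uniform:
  assumes "\<And>k x. \<bar>c k x\<bar> \<le> B * (real k + 1) ^ m / exp (a * \<bar>x\<bar>)" "\<bar>s\<bar> \<le> 1 / 2" "B \<ge> 0"
  shows "norm (s ^ k * c k y) \<le> B * ((real k + 1) ^ m * (1 / 2) ^ k)"
proof -
  have "B / exp (a * \<bar>y\<bar>) \<le> B / 1" using assms(3) a_pos by (intro divide_left_mono) auto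
  then show ?thesis
    unfolding real_norm_def by (intro order_trans[OF term_le[OF assms(1,2)] mult_right_mono]) auto
qed

lemma tame_summable:
  assumes "tame c" "\<bar>s\<bar> \<le> 1 / 2" shows "summable (\<lambda>k. \<bar>s ^ k * c k y\<bar>)"
proof -
  obtain B m where B: "B \<ge> 0" "\<And>k x. \<bar>c k x\<bar> \<le> B * (real k + 1) ^ m / exp (a * \<bar>x\<bar>)" using tameD[OF assms(1)] by blast
  show ?thesis
    by (rule summable_comparison_test'[OF summable_mult[OF summable_power_times_geometric[of m], of "B / exp (a * \<bar>y\<bar>)"]])
      (use term_le[OF B(2) assms(2)] in simp)
qed

text \<open>The second estimate extracts a factor \<open>s\<close> from the tail, since
  \<open>s ^ k \<le> 2 * s * (1 / 2) ^ k\<close> for \<open>k \<ge> 1\<close>. It is responsible for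
  the convergence to the soliton as time grows.\<close>

lemma U_uniform:
  assumes "tame c"
  obtains C where "C \<ge> 0" "\<And>y s. \<bar>s\<bar> \<le> 1 / 2 \<Longrightarrow> \<bar>\<Sum>k. s ^ k * c k y\<bar> \<le> C / exp (a * \<bar>y\<bar>)"
    "\<And>y s. 0 < s \<Longrightarrow> s \<le> 1 / 2 \<Longrightarrow> \<bar>(\<Sum>k. s ^ k * c k y) - c 0 y\<bar> \<le> s * C / exp (a * \<bar>y\<bar>)"
proof -
  obtain B m where B: "B \<ge> 0" "\<And>k x. \<bar>c k x\<bar> \<le> B * (real k + 1) ^ m / exp (a * \<bar>x\<bar>)" using tameD[OF assms(1)] by blast
  define G where "G = (\<Sum>k. (real k + 1) ^ m * (1 / 2) ^ k)"
  have G0: "G \<ge> 0" unfolding G_def by (intro suminf_nonneg summable_power_times_geometric) auto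
  have sG: "summable (\<lambda>k. B / exp (a * \<bar>y\<bar>) * ((real k + 1) ^ m * (1 / 2) ^ k))" for y
    by (intro summable_mult summable_power_times_geometric)
  have eG: "(\<Sum>k. B / exp (a * \<bar>y\<bar>) * ((real k + 1) ^ m * (1 / 2) ^ k)) = B / exp (a * \<bar>y\<bar>) * G" for y
    unfolding G_def by (rule suminf_mult[OF summable_power_times_geometric])
  show ?thesis
  proof (rule that[of "2 * (B * G)"])
    show "0 \<le> 2 * (B * G)" using B G0 by simp
    show "\<bar>\<Sum>k. s ^ k * c k y\<bar> \<le> 2 * (B * G) / exp (a * \<bar>y\<bar>)" if "\<bar>s\<bar> \<le> 1 / 2" for y s
    proof -
      have "\<bar>\<Sum>k. s ^ k * c k y\<bar> \<le> (\<Sum>k. \<bar>s ^ k * c k y\<bar>)" by (intro summable_rabs tame_summable assms that)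
      also have "\<dots> \<le> B / exp (a * \<bar>y\<bar>) * G"
        unfolding eG[symmetric] by (intro suminf_le term_le[OF B(2) that] tame_summable assms that sG)
      also have "\<dots> \<le> 2 * (B * G) / exp (a * \<bar>y\<bar>)" using B(1) G0 by (simp add: divide_right_mono)
      finally show ?thesis .
    qed
    show "\<bar>(\<Sum>k. s ^ k * c k y) - c 0 y\<bar> \<le> s * (2 * (B * G)) / exp (a * \<bar>y\<bar>)" if s: "0 < s" "s \<le> 1 / 2" for y s
    proof -
      have s': "\<bar>s\<bar> \<le> 1 / 2" using s by simp
      have sm: "summable (\<lambda>k. s ^ k * c k y)" by (rule summable_rabs_cancel[OF tame_summable[OF assms s']])
      have le: "\<bar>s ^ Suc k * c (Suc k) y\<bar> \<le> 2 * s * (B / exp (a * \<bar>y\<bar>) * ((real (Suc k) + 1) ^ m * (1 / 2) ^ Suc k))" for k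
      proof -
        have "\<bar>s ^ Suc k * c (Suc k) y\<bar> \<le> (s * (1 / 2) ^ k) * (B * (real (Suc k) + 1) ^ m / exp (a * \<bar>y\<bar>))"
          unfolding abs_mult power_abs using s B(2)[of "Suc k" y]
          by (intro mult_mono) (auto intro!: mult_left_mono power_mono)
        then show ?thesis by (simp add: mult_ac)
      qed
      have sG': "summable (\<lambda>k. B / exp (a * \<bar>y\<bar>) * ((real (Suc k) + 1) ^ m * (1 / 2) ^ Suc k))"
        using sG[of y] by (subst (asm) summable_Suc_iff[symmetric]) simp
      have "(\<Sum>k. s ^ k * c k y) - c 0 y = (\<Sum>k. s ^ Suc k * c (Suc k) y)"
        using suminf_split_head[OF sm] by simp
      also have "\<bar>\<dots>\<bar> \<le> (\<Sum>k. \<bar>s ^ Suc k * c (Suc k) y\<bar>)"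
        using tame_summable[OF assms s', of y] by (intro summable_rabs) (subst (asm) summable_Suc_iff[symmetric], simp)
      also have "\<dots> \<le> (\<Sum>k. 2 * s * (B / exp (a * \<bar>y\<bar>) * ((real (Suc k) + 1) ^ m * (1 / 2) ^ Suc k)))"
        using tame_summable[OF assms s', of y]
        by (intro suminf_le le summable_mult sG') (subst (asm) summable_Suc_iff[symmetric], simp)
      also have "\<dots> = 2 * s * (\<Sum>k. B / exp (a * \<bar>y\<bar>) * ((real (Suc k) + 1) ^ m * (1 / 2) ^ Suc k))"
        by (rule suminf_mult[OF sG'])
      also have "(\<Sum>k. B / exp (a * \<bar>y\<bar>) * ((real (Suc k) + 1) ^ m * (1 / 2) ^ Suc k)) \<le> B / exp (a * \<bar>y\<bar>) * G"
        unfolding suminf_split_head[OF sG[of y]] eG using B(1) by simp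
      finally show ?thesis using s by (simp add: mult_ac)
    qed
  qed
qed

lemma U_deriv_x:
  assumes \<epsilon>: "0 < \<epsilon>" "\<epsilon> \<le> 1 / 4" and t: "t \<ge> Tmin" and c: "tame c" and c': "tame c'"
    and d: "\<And>k x. (c k has_real_derivative c' k x) (at x)"
  shows "(U \<epsilon> c t has_real_derivative U \<epsilon> c' t x) (at x)"
proof -
  note s = sig_bounds[OF \<epsilon> t]
  have s': "\<bar>sig \<epsilon> t\<bar> \<le> 1 / 2" using s by simp
  obtain B m where B: "B \<ge> 0" "\<And>k x. \<bar>c' k x\<bar> \<le> B * (real k + 1) ^ m / exp (a * \<bar>x\<bar>)" using tameD[OF c'] by blast
  have "((\<lambda>x. \<Sum>k. sig \<epsilon> t ^ k * c k (x - t)) has_real_derivative (\<Sum>k. sig \<epsilon> t ^ k * c' k (x - t))) (at x)"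
  proof (rule has_field_derivative_series'(2)[where S = UNIV and ?x0.0 = 0 and f = "\<lambda>k x. sig \<epsilon> t ^ k * c k (x - t)" and f' = "\<lambda>k x. sig \<epsilon> t ^ k * c' k (x - t)"])
    show "((\<lambda>x. sig \<epsilon> t ^ k * c k (x - t)) has_real_derivative sig \<epsilon> t ^ k * c' k (x - t)) (at x)" for k x
      by (rule derivative_eq_intros DERIV_chain2[OF d] refl)+ simp
    show "uniformly_convergent_on UNIV (\<lambda>n x. \<Sum>i<n. sig \<epsilon> t ^ i * c' i (x - t))"
    proof (rule Weierstrass_m_test'[where M = "\<lambda>k. B * ((real k + 1) ^ m * (1 / 2) ^ k)"])
      show "norm (sig \<epsilon> t ^ k * c' k (x - t)) \<le> B * ((real k + 1) ^ m * (1 / 2) ^ k)" for k x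
        by (rule term_le_uniform[OF B(2) s' B(1)])
    qed (intro summable_mult summable_power_times_geometric)
    show "summable (\<lambda>k. sig \<epsilon> t ^ k * c k (0 - t))" by (rule summable_rabs_cancel[OF tame_summable[OF c s']])
  qed simp_all
  then show ?thesis by (simp add: U_def[abs_def])
qed

lemma U_deriv_t:
  assumes \<epsilon>: "0 < \<epsilon>" "\<epsilon> \<le> 1 / 4" and t: "t \<ge> 0" and c: "tame c" and c': "tame c'"
    and d: "\<And>k x. (c k has_real_derivative c' k x) (at x)"
  shows "((\<lambda>t. U \<epsilon> c t x) has_real_derivative - U \<epsilon> (\<lambda>k x. c' k x + e0 * real k * c k x) t x) (at t)"
proof -
  define b where "b k y = - (c' k y + e0 * real k * c k y)" for k y
  have b: "tame b" unfolding b_def[abs_def] by (intro tame_minus tame_add tame_mult c c')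
  obtain B m where B: "B \<ge> 0" "\<And>k x. \<bar>b k x\<bar> \<le> B * (real k + 1) ^ m / exp (a * \<bar>x\<bar>)" using tameD[OF b] by blast
  have s': "\<bar>sig \<epsilon> t\<bar> \<le> 1 / 2" if "t \<ge> Tmin" for t using sig_bounds[OF \<epsilon> that] by simp
  have "((\<lambda>t. \<Sum>k. sig \<epsilon> t ^ k * c k (x - t)) has_real_derivative (\<Sum>k. sig \<epsilon> t ^ k * b k (x - t))) (at t)"
  proof (rule has_field_derivative_series'(2)[where S = "{Tmin..}" and ?x0.0 = 0 and f = "\<lambda>k t. sig \<epsilon> t ^ k * c k (x - t)" and f' = "\<lambda>k t. sig \<epsilon> t ^ k * b k (x - t)"])
    have "(sig \<epsilon> has_real_derivative - (e0 * sig \<epsilon> t)) (at t)" for t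
      unfolding sig_def[abs_def] by (rule derivative_eq_intros refl)+ simp
    then have ds: "((\<lambda>t. sig \<epsilon> t ^ k) has_real_derivative - (e0 * real k * sig \<epsilon> t ^ k)) (at t)" for k t
      using DERIV_power[of "sig \<epsilon>" "- (e0 * sig \<epsilon> t)" t UNIV k] by (cases k) (auto simp: mult_ac)
    have "((\<lambda>t. x - t) has_real_derivative - 1) (at t)" for t by (rule derivative_eq_intros refl)+ simp
    from DERIV_chain2[OF d this] have dc: "((\<lambda>t. c k (x - t)) has_real_derivative c' k (x - t) * - 1) (at t)" for k t .
    have "((\<lambda>t. sig \<epsilon> t ^ k * c k (x - t)) has_real_derivative sig \<epsilon> t ^ k * b k (x - t)) (at t)" for k t
      using DERIV_mult[OF ds[of k t] dc[of k t]] by (simp add: b_def algebra_simps)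
    then show "((\<lambda>t. sig \<epsilon> t ^ k * c k (x - t)) has_real_derivative sig \<epsilon> t ^ k * b k (x - t)) (at t within {Tmin..})" for k t
      by (rule has_field_derivative_at_within)
    show "uniformly_convergent_on {Tmin..} (\<lambda>n t. \<Sum>i<n. sig \<epsilon> t ^ i * b i (x - t))"
    proof (rule Weierstrass_m_test'[where M = "\<lambda>k. B * ((real k + 1) ^ m * (1 / 2) ^ k)"])
      show "norm (sig \<epsilon> t ^ k * b k (x - t)) \<le> B * ((real k + 1) ^ m * (1 / 2) ^ k)" if "t \<in> {Tmin..}" for k t
        using that by (intro term_le_uniform[OF B(2) s' B(1)]) simp
    qed (intro summable_mult summable_power_times_geometric)
    show "summable (\<lambda>k. sig \<epsilon> 0 ^ k * c k (x - 0))" using Tmin_neg by (intro summable_rabs_cancel[OF tame_summable[OF c s']]) simp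
    show "t \<in> interior {Tmin..}" using Tmin_neg t by (simp add: interior_real_atLeast)
  qed (use Tmin_neg in auto)
  moreover have "(\<Sum>k. sig \<epsilon> t ^ k * b k (x - t)) = - U \<epsilon> (\<lambda>k x. c' k x + e0 * real k * c k x) t x"
  proof -
    have "summable (\<lambda>k. sig \<epsilon> t ^ k * (c' k (x - t) + e0 * real k * c k (x - t)))"
      using t Tmin_neg by (intro summable_rabs_cancel[OF tame_summable[OF _ s']] tame_add tame_mult c c') simp
    from suminf_minus[OF this] show ?thesis unfolding U_def b_def mult_minus_right .
  qed
  ultimately show ?thesis unfolding U_def[of \<epsilon> c, abs_def] by simp
qed

lemma U_cont:
  assumes \<epsilon>: "0 < \<epsilon>" "\<epsilon> \<le> 1 / 4" and c: "tame c" and cont: "\<And>k. continuous_on UNIV (c k)"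
  shows "continuous_on ({0..} \<times> UNIV) (\<lambda>(t, x). U \<epsilon> c t x)"
proof -
  obtain B m where B: "B \<ge> 0" "\<And>k x. \<bar>c k x\<bar> \<le> B * (real k + 1) ^ m / exp (a * \<bar>x\<bar>)" using tameD[OF c] by blast
  have s': "\<bar>sig \<epsilon> t\<bar> \<le> 1 / 2" if "t \<ge> 0" for t using sig_bounds[OF \<epsilon>, of t] Tmin_neg that by simp
  have "continuous_on ({0..} \<times> UNIV) (\<lambda>z. \<Sum>k. sig \<epsilon> (fst z) ^ k * c k (snd z - fst z))"
  proof (rule uniform_limit_theorem)
    show "\<forall>\<^sub>F n in sequentially. continuous_on ({0..} \<times> UNIV) (\<lambda>z. \<Sum>k<n. sig \<epsilon> (fst z) ^ k * c k (snd z - fst z))"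
      unfolding sig_def by (intro always_eventually allI continuous_intros continuous_on_compose2[OF cont]) auto
    show "uniform_limit ({0..} \<times> UNIV) (\<lambda>n z. \<Sum>k<n. sig \<epsilon> (fst z) ^ k * c k (snd z - fst z)) (\<lambda>z. \<Sum>k. sig \<epsilon> (fst z) ^ k * c k (snd z - fst z)) sequentially"
    proof (rule Weierstrass_m_test[where M = "\<lambda>k. B * ((real k + 1) ^ m * (1 / 2) ^ k)"])
      show "norm (sig \<epsilon> (fst z) ^ k * c k (snd z - fst z)) \<le> B * ((real k + 1) ^ m * (1 / 2) ^ k)" if "z \<in> {0..} \<times> UNIV" for k z
        using that by (intro term_le_uniform[OF B(2) s' B(1)]) auto
    qed (intro summable_mult summable_power_times_geometric)
  qed auto
  then show ?thesis by (simp add: U_def split_beta)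
qed

lemma tame_conv_radius: assumes "tame c" shows "fps_conv_radius (Abs_fps (\<lambda>k. c k y)) \<ge> ereal (1 / 2)"
proof -
  have "summable (\<lambda>k. c k y * (1 / 2) ^ k)"
    using summable_rabs_cancel[OF tame_summable[OF assms, of "1 / 2" y]] by (simp add: mult.commute)
  from conv_radius_geI[OF this] show ?thesis by (simp add: fps_conv_radius_def)
qed

lemma eval_fps_power_real:
  fixes f :: "real fps"
  assumes "norm z < fps_conv_radius f" shows "eval_fps (f ^ m) z = eval_fps f z ^ m"
proof (induction m)
  case (Suc m)
  have "norm z < fps_conv_radius (f ^ m)" using assms fps_conv_radius_power[of f m] by (rule less_le_trans)
  then show ?case using Suc assms by (simp add: eval_fps_mult)
qed simp

lemma U_eval: "U \<epsilon> c t x = eval_fps (Abs_fps (\<lambda>k. c k (x - t))) (sig \<epsilon> t)"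
  by (simp add: U_def eval_fps_def mult.commute)

lemma sig_radius:
  assumes "0 < \<epsilon>" "\<epsilon> \<le> 1 / 4" "t \<ge> 0" "tame c"
  shows "norm (sig \<epsilon> t) < fps_conv_radius (Abs_fps (\<lambda>k. c k y))"
proof (rule less_le_trans[OF _ tame_conv_radius[OF assms(4)]])
  have "\<epsilon> * exp (- (e0 * t)) \<le> 1 / 4 * 1" using assms e0_pos by (intro mult_mono) auto
  then show "ereal (norm (sig \<epsilon> t)) < ereal (1 / 2)" using assms(1) by (simp add: sig_def)
qed

text \<open>Evaluation of formal power series is multiplicative inside the disc of convergence,
  which takes care of the Cauchy products hidden in \<open>power_coeff\<close>.\<close>

lemma U_power:
  assumes "0 < \<epsilon>" "\<epsilon> \<le> 1 / 4" "t \<ge> 0"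
  shows "U \<epsilon> Z t x ^ p = U \<epsilon> (power_coeff p Z) t x"
  using eval_fps_power_real[OF sig_radius[OF assms tame_Z, of "x - t"], of p]
  unfolding U_eval by (simp add: power_coeff_def fps_nth_inverse)

lemma U_add:
  assumes "0 < \<epsilon>" "\<epsilon> \<le> 1 / 4" "t \<ge> 0" "tame c" "tame d"
  shows "U \<epsilon> (\<lambda>k x. c k x + d k x) t x = U \<epsilon> c t x + U \<epsilon> d t x"
proof -
  have s: "\<bar>sig \<epsilon> t\<bar> \<le> 1 / 2" using sig_bounds[OF assms(1,2), of t] Tmin_neg assms(3) by simp
  show ?thesis unfolding U_def
    using suminf_add[OF summable_rabs_cancel[OF tame_summable[OF assms(4) s]] summable_rabs_cancel[OF tame_summable[OF assms(5) s]], of "x - t" "x - t"]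
    by (simp add: distrib_left)
qed

end

section \<open>The solution\<close>

lemma continuous_AE_zero:
  fixes f :: "real \<Rightarrow> real"
  assumes f: "continuous_on UNIV f" and ae: "AE x in lborel. f x = 0"
  shows "f x = 0"
proof (rule ccontr)
  assume "f x \<noteq> 0"
  have "open {x. f x \<noteq> 0}" by (intro open_Collect_neq f continuous_intros)
  then obtain e where e: "e > 0" "ball x e \<subseteq> {x. f x \<noteq> 0}" using \<open>f x \<noteq> 0\<close> by (auto simp: open_contains_ball)
  have "{x - e / 2..x + e / 2} \<subseteq> ball x e" using e(1) by (auto simp: ball_def dist_real_def)
  then have sub: "{x - e / 2..x + e / 2} \<subseteq> {x. f x \<noteq> 0}" using e(2) by blast
  have "{x. f x \<noteq> 0} \<in> null_sets lborel" using ae AE_iff_null[of lborel "\<lambda>x. f x = 0"]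
    borel_measurable_continuous_onI[OF f] by (auto simp: measurable_lborel1)
  then have "emeasure lborel {x - e / 2..x + e / 2} = 0"
    using sub emeasure_mono[OF sub, of lborel] by (auto simp: null_sets_def)
  then show False using e(1) by simp
qed

lemma integrable_exp_abs:
  fixes a :: real
  assumes "a > 0" shows "integrable lborel (\<lambda>x. (1 / exp (a * \<bar>x\<bar>))\<^sup>2)"
proof -
  have i: "integrable lborel (\<lambda>t. indicator {..0} t *\<^sub>R exp (- (2 * a) * (0 - t)))"
    using has_bochner_integral_exp_atMost[of "2 * a" 0] assms by (auto dest: integrable.intros)
  have "integrable lborel (\<lambda>t. indicator {..0} t *\<^sub>R exp (- (2 * a) * (0 - t)) + indicator {..0} (0 + (-1) * t) *\<^sub>R exp (- (2 * a) * (0 - (0 + (-1) * t))))"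
    by (intro Bochner_Integration.integrable_add i lborel_integrable_real_affine[OF i]) simp
  then show ?thesis
  proof (rule Bochner_Integration.integrable_bound)
    show "(\<lambda>x. (1 / exp (a * \<bar>x\<bar>))\<^sup>2) \<in> borel_measurable lborel" by measurable
    show "AE x in lborel. norm ((1 / exp (a * \<bar>x\<bar>))\<^sup>2) \<le> norm (indicator {..0} x *\<^sub>R exp (- (2 * a) * (0 - x)) + indicator {..0} (0 + (-1) * x) *\<^sub>R exp (- (2 * a) * (0 - (0 + (-1) * x))))"
    proof (intro AE_I2)
      fix x :: real
      have "(1 / exp (a * \<bar>x\<bar>))\<^sup>2 = exp (- (2 * a) * \<bar>x\<bar>)"
        by (simp add: power_divide exp_minus inverse_eq_divide exp_double[symmetric] mult_ac)
      also have "\<dots> \<le> norm (indicator {..0} x *\<^sub>R exp (- (2 * a) * (0 - x)) + indicator {..0} (0 + (-1) * x) *\<^sub>R exp (- (2 * a) * (0 - (0 + (-1) * x))) :: real)"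
        by (cases "x \<le> 0"; cases "x \<ge> 0") auto
      finally show "norm ((1 / exp (a * \<bar>x\<bar>))\<^sup>2) \<le> norm (indicator {..0} x *\<^sub>R exp (- (2 * a) * (0 - x)) + indicator {..0} (0 + (-1) * x) *\<^sub>R exp (- (2 * a) * (0 - (0 + (-1) * x))) :: real)"
        by simp
    qed
  qed
qed

context unstable_series begin

lemma U_le:
  assumes "0 < \<epsilon>" "\<epsilon> \<le> 1 / 4" "tame c"
  shows "\<exists>C\<ge>0. \<forall>t\<ge>0. \<forall>x. \<bar>U \<epsilon> c t x\<bar> \<le> C / exp (a * \<bar>x - t\<bar>) \<and> \<bar>U \<epsilon> c t x - c 0 (x - t)\<bar> \<le> sig \<epsilon> t * C / exp (a * \<bar>x - t\<bar>)"
proof -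
  have s: "0 < sig \<epsilon> t \<and> sig \<epsilon> t \<le> 1 / 2" if "t \<ge> 0" for t using sig_bounds[OF assms(1,2), of t] Tmin_neg that by simp
  from U_uniform[OF assms(3)] obtain C where C: "C \<ge> 0" "\<And>y s. \<bar>s\<bar> \<le> 1 / 2 \<Longrightarrow> \<bar>\<Sum>k. s ^ k * c k y\<bar> \<le> C / exp (a * \<bar>y\<bar>)"
    "\<And>y s. 0 < s \<Longrightarrow> s \<le> 1 / 2 \<Longrightarrow> \<bar>(\<Sum>k. s ^ k * c k y) - c 0 y\<bar> \<le> s * C / exp (a * \<bar>y\<bar>)" by blast
  show ?thesis
  proof (intro exI[of _ C] conjI allI impI C(1))
    fix t x :: real assume t: "t \<ge> 0"
    show "\<bar>U \<epsilon> c t x\<bar> \<le> C / exp (a * \<bar>x - t\<bar>)" unfolding U_def by (rule C(2)) (use s[OF t] in simp)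
    show "\<bar>U \<epsilon> c t x - c 0 (x - t)\<bar> \<le> sig \<epsilon> t * C / exp (a * \<bar>x - t\<bar>)" unfolding U_def by (rule C(3)) (use s[OF t] in auto)
  qed
qed

lemma weight_shift: assumes "0 \<le> t" "t \<le> T" shows "1 / exp (a * \<bar>x - t\<bar>) \<le> exp (a * T) * (1 / exp (a * \<bar>x\<bar>))"
proof -
  have "a * \<bar>x\<bar> \<le> a * (T + \<bar>x - t\<bar>)" using assms a_pos by (intro mult_left_mono) auto
  then have "exp (a * \<bar>x\<bar>) \<le> exp (a * T) * exp (a * \<bar>x - t\<bar>)" by (simp add: exp_add[symmetric] distrib_left)
  then show ?thesis by (simp add: divide_simps)
qed

lemma U_le_uniform:
  assumes "0 < \<epsilon>" "\<epsilon> \<le> 1 / 4" "tame c"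
  shows "\<exists>C\<ge>0. \<forall>t\<in>{0..T}. \<forall>x. \<bar>U \<epsilon> c t x\<bar> \<le> C * (1 / exp (a * \<bar>x\<bar>))"
proof -
  obtain C where C: "C \<ge> 0" "\<And>t x. t \<ge> 0 \<Longrightarrow> \<bar>U \<epsilon> c t x\<bar> \<le> C / exp (a * \<bar>x - t\<bar>)" using U_le[OF assms] by blast
  show ?thesis
  proof (intro exI[of _ "C * exp (a * T)"] conjI ballI allI)
    fix t x assume t: "t \<in> {0..T}"
    have "\<bar>U \<epsilon> c t x\<bar> \<le> C * (1 / exp (a * \<bar>x - t\<bar>))" using C(2)[of t x] t by simp
    also have "\<dots> \<le> C * (exp (a * T) * (1 / exp (a * \<bar>x\<bar>)))" using t by (intro mult_left_mono weight_shift C(1)) auto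
    finally show "\<bar>U \<epsilon> c t x\<bar> \<le> C * exp (a * T) * (1 / exp (a * \<bar>x\<bar>))" by simp
  qed (use C in simp)
qed

text \<open>The mean value inequality in time. On a bounded time interval the translated weights are
  dominated by one profile, so the estimate passes to the Sobolev norm.\<close>

lemma U_lipschitz:
  assumes \<epsilon>: "0 < \<epsilon>" "\<epsilon> \<le> 1 / 4" and c: "tame c" "tame c'" and d: "\<And>k x. (c k has_real_derivative c' k x) (at x)"
  shows "\<exists>C\<ge>0. \<forall>s\<in>{0..T}. \<forall>t\<in>{0..T}. \<forall>x. \<bar>U \<epsilon> c s x - U \<epsilon> c t x\<bar> \<le> C * \<bar>s - t\<bar> * (1 / exp (a * \<bar>x\<bar>))"
proof -
  have tm: "tame (\<lambda>k x. c' k x + e0 * real k * c k x)" by (intro tame_add tame_mult c)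
  obtain C where C: "C \<ge> 0" "\<And>t x. t \<in> {0..T} \<Longrightarrow> \<bar>U \<epsilon> (\<lambda>k x. c' k x + e0 * real k * c k x) t x\<bar> \<le> C * (1 / exp (a * \<bar>x\<bar>))"
    using U_le_uniform[OF \<epsilon> tm, of T] by blast
  show ?thesis
  proof (intro exI[of _ C] conjI ballI allI C(1))
    fix s t x assume st: "s \<in> {0..T}" "t \<in> {0..T}"
    have "norm (U \<epsilon> c s x - U \<epsilon> c t x) \<le> (C * (1 / exp (a * \<bar>x\<bar>))) * norm (s - t)"
    proof (rule field_differentiable_bound[where S = "{0..T}" and f' = "\<lambda>t. - U \<epsilon> (\<lambda>k x. c' k x + e0 * real k * c k x) t x"])
      show "((\<lambda>t. U \<epsilon> c t x) has_real_derivative - U \<epsilon> (\<lambda>k x. c' k x + e0 * real k * c k x) t x) (at t within {0..T})" if "t \<in> {0..T}" for t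
        using that by (intro has_field_derivative_at_within[OF U_deriv_t[OF \<epsilon> _ c d]]) simp
      show "norm (- U \<epsilon> (\<lambda>k x. c' k x + e0 * real k * c k x) t x) \<le> C * (1 / exp (a * \<bar>x\<bar>))" if "t \<in> {0..T}" for t
        using C(2)[OF that, of x] by simp
    qed (use st in auto)
    then show "\<bar>U \<epsilon> c s x - U \<epsilon> c t x\<bar> \<le> C * \<bar>s - t\<bar> * (1 / exp (a * \<bar>x\<bar>))" by (simp add: mult_ac)
  qed
qed

lemma U_cont_slice:
  assumes "0 < \<epsilon>" "\<epsilon> \<le> 1 / 4" "tame c" "\<And>k. continuous_on UNIV (c k)" "t \<ge> 0"
  shows "continuous_on UNIV (U \<epsilon> c t)"
proof -
  have "continuous_on UNIV (\<lambda>x. (\<lambda>(t, x). U \<epsilon> c t x) (t, x))"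
    by (rule continuous_on_compose2[OF U_cont[OF assms(1-4)]]) (use assms(5) in \<open>auto intro!: continuous_intros\<close>)
  then show ?thesis by simp
qed

lemma Z_cont: "continuous_on A (Z k)" and Z'_cont: "continuous_on A (Z' k)"
  by (intro continuous_at_imp_continuous_on ballI DERIV_isCont[OF Z_deriv] DERIV_isCont[OF Z'_deriv])+

lemma F_cont: "continuous_on A (power_coeff p Z k)"
  unfolding power_coeff_def[abs_def] by (intro fps_power_nth_continuous Z_cont)

text \<open>The recursion controls the derivative of this sum rather than that of \<open>Z''\<close>
  alone. Continuity of \<open>Z''\<close> is recovered from it by subtracting the continuous power
  coefficient.\<close>

definition "P k x = Z'' k x + power_coeff p Z k x"

lemma P_deriv: "(P k has_real_derivative Z' k x + e0 * real k * Z k x) (at x)"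
  using Z_eq[of k x] unfolding P_def[abs_def] by (simp add: mult_ac)

lemma P_cont: "continuous_on A (P k)"
  by (intro continuous_at_imp_continuous_on ballI DERIV_isCont[OF P_deriv])

lemma Z''_cont: "continuous_on A (Z'' k)"
proof -
  have "continuous_on A (\<lambda>x. P k x - power_coeff p Z k x)" by (intro continuous_intros P_cont F_cont)
  then show ?thesis by (simp add: P_def)
qed

lemma tame_P: "tame P" unfolding P_def[abs_def] by (intro tame_add tame_Z'' tame_F)

context
  fixes \<epsilon> :: real
  assumes \<epsilon>: "0 < \<epsilon>" "\<epsilon> \<le> 1 / 4"
begin

abbreviation "w \<equiv> U \<epsilon> Z"
abbreviation "h \<equiv> (\<lambda>x :: real. 1 / exp (a * \<bar>x\<bar>))"

lemma Tmin_le: "t \<ge> 0 \<Longrightarrow> t \<ge> Tmin" using Tmin_neg by simp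

lemma w_deriv: "t \<ge> 0 \<Longrightarrow> (w t has_real_derivative U \<epsilon> Z' t x) (at x)"
  by (intro U_deriv_x[OF \<epsilon> Tmin_le tame_Z tame_Z' Z_deriv])

lemma w'_deriv: "t \<ge> 0 \<Longrightarrow> (U \<epsilon> Z' t has_real_derivative U \<epsilon> Z'' t x) (at x)"
  by (intro U_deriv_x[OF \<epsilon> Tmin_le tame_Z' tame_Z'' Z'_deriv])

lemma w_P: "t \<ge> 0 \<Longrightarrow> U \<epsilon> Z'' t x + w t x ^ p = U \<epsilon> P t x"
  unfolding U_power[OF \<epsilon>] P_def[abs_def] by (rule U_add[OF \<epsilon> _ tame_Z'' tame_F, symmetric])

lemma w_satisfies: "satisfies_gKdV p w"
proof (rule satisfies_gKdV_classical[where wx = "U \<epsilon> Z'" and wxx = "U \<epsilon> Z''" and wt = "\<lambda>t x. - U \<epsilon> (\<lambda>k x. Z' k x + e0 * real k * Z k x) t x"])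
  have tm: "tame (\<lambda>k x. Z' k x + e0 * real k * Z k x)" by (intro tame_add tame_mult tame_Z tame_Z')
  show "continuous_on UNIV (U \<epsilon> Z'' t)" if "t \<ge> 0" for t by (intro U_cont_slice \<epsilon> tame_Z'' Z''_cont that)
  show "((\<lambda>x. U \<epsilon> Z'' t x + w t x ^ p) has_real_derivative - (- U \<epsilon> (\<lambda>k x. Z' k x + e0 * real k * Z k x) t x)) (at x)" if "t \<ge> 0" for t x
    using U_deriv_x[OF \<epsilon> Tmin_le[OF that] tame_P tm P_deriv] by (simp add: w_P[OF that])
  show "((\<lambda>s. w s x) has_real_derivative - U \<epsilon> (\<lambda>k x. Z' k x + e0 * real k * Z k x) t x) (at t within {0..})" if "t \<ge> 0" for t x
    by (intro has_field_derivative_at_within[OF U_deriv_t[OF \<epsilon> that tame_Z tame_Z' Z_deriv]])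
  have "continuous_on ({0..} \<times> UNIV) (\<lambda>z. - (\<lambda>(t, x). U \<epsilon> (\<lambda>k x. Z' k x + e0 * real k * Z k x) t x) z)"
    by (intro continuous_on_minus U_cont[OF \<epsilon> tm] continuous_intros Z_cont Z'_cont)
  then show "continuous_on ({0..} \<times> UNIV) (\<lambda>(t, x). - U \<epsilon> (\<lambda>k x. Z' k x + e0 * real k * Z k x) t x)" by (simp add: split_beta)
qed (use w_deriv w'_deriv in auto)

lemma h_int: "integrable lborel (\<lambda>x. (h x)\<^sup>2)" by (rule integrable_exp_abs[OF a_pos])

lemma w'_cont: "t \<ge> 0 \<Longrightarrow> continuous_on UNIV (U \<epsilon> Z' t)" by (intro U_cont_slice \<epsilon> tame_Z' Z'_cont)

lemma w_continuous_in_H1: "continuous_in_H1 w"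
  unfolding continuous_in_H1_def
proof (intro conjI allI impI)
  fix t :: real assume t: "t \<ge> 0"
  obtain C where C: "C \<ge> 0" "\<And>x. \<bar>w t x\<bar> \<le> C * h x" using U_le_uniform[OF \<epsilon> tame_Z, of t] t by auto
  obtain C' where C': "C' \<ge> 0" "\<And>x. \<bar>U \<epsilon> Z' t x\<bar> \<le> C' * h x" using U_le_uniform[OF \<epsilon> tame_Z', of t] t by auto
  have "C * h x \<le> (C + C') * h x" "C' * h x \<le> (C + C') * h x" for x
    using C(1) C'(1) by (auto intro!: mult_right_mono divide_right_mono)
  then show "H1 (w t)"
    using C(1) C'(1) order_trans[OF C(2)] order_trans[OF C'(2)]
    by (intro C1_H1(1)[OF w_deriv[OF t] w'_cont[OF t] h_int, of "C + C'"]) auto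
next
  fix t :: real assume t: "t \<ge> 0"
  obtain C where C: "C \<ge> 0" "\<And>s x. s \<in> {0..t + 1} \<Longrightarrow> \<bar>w s x - w t x\<bar> \<le> C * \<bar>s - t\<bar> * h x"
    using U_lipschitz[OF \<epsilon> tame_Z tame_Z' Z_deriv, of "t + 1"] t by auto
  obtain C' where C': "C' \<ge> 0" "\<And>s x. s \<in> {0..t + 1} \<Longrightarrow> \<bar>U \<epsilon> Z' s x - U \<epsilon> Z' t x\<bar> \<le> C' * \<bar>s - t\<bar> * h x"
    using U_lipschitz[OF \<epsilon> tame_Z' tame_Z'' Z'_deriv, of "t + 1"] t by auto
  define I where "I = sqrt (2 * (LINT x|lborel. (h x)\<^sup>2))"
  have le: "C * \<bar>s - t\<bar> * h x \<le> (C + C') * \<bar>s - t\<bar> * h x" "C' * \<bar>s - t\<bar> * h x \<le> (C + C') * \<bar>s - t\<bar> * h x" for s x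
    using C(1) C'(1) by (auto intro!: mult_right_mono divide_right_mono)
  have bd: "H1_norm (\<lambda>x. w s x - w t x) \<le> (C + C') * \<bar>s - t\<bar> * I" if "s \<in> {0..t + 1}" for s
    unfolding I_def
  proof (rule C1_H1(2))
    show "((\<lambda>x. w s x - w t x) has_real_derivative U \<epsilon> Z' s x - U \<epsilon> Z' t x) (at x)" for x
      using that t by (intro DERIV_diff w_deriv) auto
    show "continuous_on UNIV (\<lambda>x. U \<epsilon> Z' s x - U \<epsilon> Z' t x)" using that t by (intro continuous_intros w'_cont) auto
    show "\<bar>w s x - w t x\<bar> \<le> (C + C') * \<bar>s - t\<bar> * h x" for x by (rule order_trans[OF C(2)[OF that] le(1)])
    show "\<bar>U \<epsilon> Z' s x - U \<epsilon> Z' t x\<bar> \<le> (C + C') * \<bar>s - t\<bar> * h x" for x by (rule order_trans[OF C'(2)[OF that] le(2)])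
  qed (use C(1) C'(1) h_int in auto)
  show "((\<lambda>s. H1_norm (\<lambda>x. w s x - w t x)) \<longlongrightarrow> 0) (at t within {0..})"
  proof (rule tendsto_sandwich)
    show "\<forall>\<^sub>F s in at t within {0..}. 0 \<le> H1_norm (\<lambda>x. w s x - w t x)"
      by (simp add: H1_norm_def add_nonneg_nonneg)
    have "\<forall>\<^sub>F s in at t within {0..}. s < t + 1" by (rule order_tendstoD(2)[OF tendsto_ident_at]) simp
    moreover have "\<forall>\<^sub>F s in at t within {0..}. s \<in> {0..}" by (simp add: eventually_at_filter)
    ultimately show "\<forall>\<^sub>F s in at t within {0..}. H1_norm (\<lambda>x. w s x - w t x) \<le> (C + C') * \<bar>s - t\<bar> * I"
      by eventually_elim (auto intro: bd)
    have "((\<lambda>s. (C + C') * \<bar>s - t\<bar> * I) \<longlongrightarrow> (C + C') * \<bar>t - t\<bar> * I) (at t within {0..})" by (intro tendsto_intros)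
    then show "((\<lambda>s. (C + C') * \<bar>s - t\<bar> * I) \<longlongrightarrow> 0) (at t within {0..})" by simp
  qed simp
qed

text \<open>On \<open>{0..T}\<close> the solution and its first two derivatives are bounded by
  multiples of one exponentially decaying profile, which supplies the maximal function, the
  Strichartz and the smoothing majorants at once.\<close>

lemma w_KPV: assumes T: "T > 0" shows "KPV_class T w"
  unfolding KPV_class_def
proof (intro conjI)
  obtain C where C: "C \<ge> 0" "\<And>t x. t \<in> {0..T} \<Longrightarrow> \<bar>w t x\<bar> \<le> C * h x" using U_le_uniform[OF \<epsilon> tame_Z, of T] by auto
  obtain C' where C': "C' \<ge> 0" "\<And>t x. t \<in> {0..T} \<Longrightarrow> \<bar>U \<epsilon> Z' t x\<bar> \<le> C' * h x" using U_le_uniform[OF \<epsilon> tame_Z', of T] by auto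
  obtain C'' where C'': "C'' \<ge> 0" "\<And>t x. t \<in> {0..T} \<Longrightarrow> \<bar>U \<epsilon> Z'' t x\<bar> \<le> C'' * h x" using U_le_uniform[OF \<epsilon> tame_Z'', of T] by auto
  have h1: "h x \<le> 1" for x using a_pos by simp
  have wd: "has_weak_deriv (w t) (U \<epsilon> Z' t)" if "t \<ge> 0" for t
    by (rule has_weak_deriv_C1[OF w_deriv[OF that] w'_cont[OF that]])
  have wd': "has_weak_deriv (U \<epsilon> Z' t) (U \<epsilon> Z'' t)" if "t \<ge> 0" for t
    by (rule has_weak_deriv_C1[OF w'_deriv[OF that] U_cont_slice[OF \<epsilon> tame_Z'' Z''_cont that]])
  show "\<exists>M. L2 M \<and> (\<forall>t\<in>{0..T}. AE x in lborel. \<bar>w t x\<bar> \<le> M x)"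
  proof (intro exI[of _ "\<lambda>x. C * h x"] conjI ballI AE_I2 C(2))
    show "L2 (\<lambda>x. C * h x)" unfolding L2_def power_mult_distrib
      by (intro conjI integrable_mult_right h_int) measurable
  qed
  show "\<exists>m. set_integrable lborel {0..T} (\<lambda>t. (m t) ^ 4) \<and>
      (AE t in lborel. t \<in> {0..T} \<longrightarrow> (AE x in lborel. \<bar>weak_deriv (w t) x\<bar> \<le> m t))"
  proof (intro exI[of _ "\<lambda>_. C'"] conjI, goal_cases)
    case 1
    show ?case by (intro borel_integrable_atLeastAtMost' continuous_intros)
  next
    case 2
    have "AE x in lborel. \<bar>weak_deriv (w t) x\<bar> \<le> C'" if t: "t \<in> {0..T}" for t
    proof -
    have le: "\<bar>U \<epsilon> Z' t x\<bar> \<le> C'" for x using order_trans[OF C'(2)[OF t] mult_left_mono[OF h1 C'(1)]] by simp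
    have "AE x in lborel. weak_deriv (w t) x = U \<epsilon> Z' t x" using weak_deriv_AE(2)[OF wd[of t]] t by simp
    then show "AE x in lborel. \<bar>weak_deriv (w t) x\<bar> \<le> C'" by eventually_elim (simp add: le)
    qed
    then show ?case by - (rule AE_I2, rule impI, blast)
  qed
  show "\<exists>z C. (\<lambda>(t, x). z t x) \<in> borel_measurable (lborel \<Otimes>\<^sub>M lborel) \<and>
        (AE t in lborel. t \<in> {0..T} \<longrightarrow> has_weak_deriv (weak_deriv (w t)) (z t)) \<and>
        (AE x in lborel. set_integrable lborel {0..T} (\<lambda>t. (z t x)\<^sup>2) \<and>
           (LINT t:{0..T}|lborel. (z t x)\<^sup>2) \<le> C)"
  \<comment> \<open>\<open>max 0 t\<close> extends the second derivative continuously to negative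
    times, so joint measurability follows from continuity on the whole plane.\<close>
  proof (intro exI[of _ "\<lambda>t. U \<epsilon> Z'' (max 0 t)"] exI[of _ "T * C''\<^sup>2"] conjI AE_I2 impI)
    have cz: "continuous_on UNIV (\<lambda>z. (\<lambda>(t, x). U \<epsilon> Z'' t x) (max 0 (fst z), snd z))"
      by (rule continuous_on_compose2[OF U_cont[OF \<epsilon> tame_Z'' Z''_cont]]) (auto intro!: continuous_intros)
    have mz: "(\<lambda>(t, x). U \<epsilon> Z'' (max 0 t) x) \<in> borel_measurable borel"
      using borel_measurable_continuous_onI[OF cz] by (simp add: split_beta)
    have sz: "sets (lborel \<Otimes>\<^sub>M lborel :: (real \<times> real) measure) = sets borel"
      unfolding borel_prod[symmetric] by (rule sets_pair_measure_cong) simp_all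
    show "(\<lambda>(t, x). U \<epsilon> Z'' (max 0 t) x) \<in> borel_measurable (lborel \<Otimes>\<^sub>M lborel)"
      using mz unfolding measurable_cong_sets[OF sz refl] .
    show "has_weak_deriv (weak_deriv (w t)) (U \<epsilon> Z'' (max 0 t))" if "t \<in> {0..T}" for t
    proof -
      have t: "t \<ge> 0" using that by simp
      have "locally_integrable (weak_deriv (w t))" using weak_deriv_AE(1)[OF wd[OF t]] by (simp add: has_weak_deriv_def)
      from has_weak_deriv_AE_cong[OF wd'[OF t] weak_deriv_AE(2)[OF wd[OF t]] this] show ?thesis using t by simp
    qed
    fix x
    have ct: "continuous_on A (\<lambda>t. (U \<epsilon> Z'' (max 0 t) x)\<^sup>2)" for A
    proof -
      have "continuous_on UNIV (\<lambda>t. (\<lambda>z. (\<lambda>(t, x). U \<epsilon> Z'' t x) (max 0 (fst z), snd z)) (t, x))"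
        by (rule continuous_on_compose2[OF cz]) (auto intro!: continuous_intros)
      then show ?thesis by (auto intro!: continuous_intros intro: continuous_on_subset)
    qed
    show i: "set_integrable lborel {0..T} (\<lambda>t. (U \<epsilon> Z'' (max 0 t) x)\<^sup>2)"
      by (rule borel_integrable_atLeastAtMost'[OF ct])
    have "(LINT t:{0..T}|lborel. (U \<epsilon> Z'' (max 0 t) x)\<^sup>2) \<le> (LINT t:{0..T}|lborel. C''\<^sup>2)"
    proof (rule set_integral_mono[OF i])
      show "set_integrable lborel {0..T} (\<lambda>t. C''\<^sup>2)" by (intro borel_integrable_atLeastAtMost' continuous_intros)
      fix t assume t: "t \<in> {0..T}"
      have "\<bar>U \<epsilon> Z'' t x\<bar> \<le> C''" using order_trans[OF C''(2)[OF t] mult_left_mono[OF h1 C''(1)]] by simp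
      then show "(U \<epsilon> Z'' (max 0 t) x)\<^sup>2 \<le> C''\<^sup>2" using t C''(1) by (simp add: abs_le_square_iff[symmetric])
    qed
    also have "\<dots> = T * C''\<^sup>2" using T by (simp add: set_lebesgue_integral_def)
    finally show "(LINT t:{0..T}|lborel. (U \<epsilon> Z'' (max 0 t) x)\<^sup>2) \<le> T * C''\<^sup>2" .
  qed
qed

lemma w_global: "global_gKdV_solution p w"
  unfolding global_gKdV_solution_def using w_continuous_in_H1 w_satisfies w_KPV by blast

lemma Qc_1: "Qc p 1 = Q p" by (rule ext) (simp add: Qc_def)

lemma w_tendsto: "((\<lambda>t. H1_norm (\<lambda>x. w t x - Qc p 1 (x - t))) \<longlongrightarrow> 0) at_top"
proof -
  obtain C where C: "C \<ge> 0" "\<And>t x. t \<ge> 0 \<Longrightarrow> \<bar>w t x - Z 0 (x - t)\<bar> \<le> sig \<epsilon> t * C / exp (a * \<bar>x - t\<bar>)"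
    using U_le[OF \<epsilon> tame_Z] by blast
  obtain C' where C': "C' \<ge> 0" "\<And>t x. t \<ge> 0 \<Longrightarrow> \<bar>U \<epsilon> Z' t x - Z' 0 (x - t)\<bar> \<le> sig \<epsilon> t * C' / exp (a * \<bar>x - t\<bar>)"
    using U_le[OF \<epsilon> tame_Z'] by blast
  have s0: "sig \<epsilon> t \<ge> 0" for t using \<epsilon> by (simp add: sig_def)
  define I where "I = sqrt (2 * (LINT x|lborel. (h x)\<^sup>2))"
  have I: "(LINT x|lborel. (h (x - t))\<^sup>2) = (LINT x|lborel. (h x)\<^sup>2)" for t
    using lborel_integral_real_affine[of 1 "\<lambda>x. (h x)\<^sup>2" "- t"] by (simp add: add.commute)
  have hi: "integrable lborel (\<lambda>x. (h (x - t))\<^sup>2)" for t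
    using lborel_integrable_real_affine[OF h_int, of 1 "- t"] by (simp add: add.commute)
  have bd: "H1_norm (\<lambda>x. w t x - Qc p 1 (x - t)) \<le> sig \<epsilon> t * (C + C') * I" if t: "t \<ge> 0" for t
    unfolding I_def I[of t, symmetric]
  proof (rule C1_H1(2)[OF _ _ hi])
    have "((\<lambda>x. Z 0 (x - t)) has_real_derivative Z' 0 (x - t) * 1) (at x)" for x
      by (rule DERIV_chain2[OF Z_deriv]) (auto intro!: derivative_eq_intros)
    then have "((\<lambda>x. Z 0 (x - t)) has_real_derivative Z' 0 (x - t)) (at x)" for x by simp
    then show "((\<lambda>x. w t x - Qc p 1 (x - t)) has_real_derivative U \<epsilon> Z' t x - Z' 0 (x - t)) (at x)" for x
      unfolding Qc_1 Z_0[symmetric] by (intro DERIV_diff w_deriv t)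
    show "continuous_on UNIV (\<lambda>x. U \<epsilon> Z' t x - Z' 0 (x - t))"
      by (intro continuous_intros w'_cont t continuous_on_compose2[OF Z'_cont[of UNIV]]) auto
    have le: "sig \<epsilon> t * C / exp (a * \<bar>x - t\<bar>) \<le> sig \<epsilon> t * (C + C') * h (x - t)"
      "sig \<epsilon> t * C' / exp (a * \<bar>x - t\<bar>) \<le> sig \<epsilon> t * (C + C') * h (x - t)" for x
      using C(1) C'(1) s0[of t] by (auto intro!: divide_right_mono mult_left_mono)
    show "\<bar>w t x - Qc p 1 (x - t)\<bar> \<le> sig \<epsilon> t * (C + C') * h (x - t)" for x
      unfolding Qc_1 Z_0[symmetric] by (rule order_trans[OF C(2)[OF t] le(1)])
    show "\<bar>U \<epsilon> Z' t x - Z' 0 (x - t)\<bar> \<le> sig \<epsilon> t * (C + C') * h (x - t)" for x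
      by (rule order_trans[OF C'(2)[OF t] le(2)])
  qed (use C(1) C'(1) s0[of t] in auto)
  show ?thesis
  proof (rule tendsto_sandwich)
    show "\<forall>\<^sub>F t in at_top. 0 \<le> H1_norm (\<lambda>x. w t x - Qc p 1 (x - t))" by (simp add: H1_norm_def add_nonneg_nonneg)
    show "\<forall>\<^sub>F t in at_top. H1_norm (\<lambda>x. w t x - Qc p 1 (x - t)) \<le> sig \<epsilon> t * (C + C') * I"
      using eventually_ge_at_top[of 0] by eventually_elim (rule bd)
    have "((\<lambda>t. \<epsilon> * exp (- (e0 * t)) * (C + C') * I) \<longlongrightarrow> \<epsilon> * 0 * (C + C') * I) at_top"
      by (intro tendsto_intros filterlim_compose[OF exp_at_bot] filterlim_compose[OF filterlim_uminus_at_bot_at_top]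
        filterlim_tendsto_pos_mult_at_top[OF tendsto_const _ filterlim_ident]) (use e0_pos in auto)
    then show "((\<lambda>t. sig \<epsilon> t * (C + C') * I) \<longlongrightarrow> 0) at_top" by (simp add: sig_def)
  qed simp
qed

lemma Qc_second_deriv:
  fixes x0 :: real
  assumes "c > 0"
  defines "g \<equiv> \<lambda>x. c powr (1 / n) * (sqrt c * Q1 (sqrt c * (x + x0)))"
  shows "((\<lambda>x. Qc p c (x + x0)) has_real_derivative g x) (at x)"
    and "(g has_real_derivative c * Qc p c (x + x0) - Qc p c (x + x0) ^ p) (at x)"
proof -
  have l: "((\<lambda>x. sqrt c * (x + x0)) has_real_derivative sqrt c) (at x)" for x
    by (rule derivative_eq_intros refl)+ simp
  show "((\<lambda>x. Qc p c (x + x0)) has_real_derivative g x) (at x)"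
    unfolding Qc_def g_def by (rule DERIV_cmult) (use DERIV_chain2[OF Q_deriv l] in \<open>simp add: mult.commute\<close>)
  have "(g has_real_derivative c powr (1 / n) * (sqrt c * (Q2 (sqrt c * (x + x0)) * sqrt c))) (at x)"
    unfolding g_def by (intro DERIV_cmult DERIV_chain2[OF Q1_deriv l])
  also have "c powr (1 / n) * (sqrt c * (Q2 (sqrt c * (x + x0)) * sqrt c)) = c * Qc p c (x + x0) - Qc p c (x + x0) ^ p"
  proof -
    have "(c powr (1 / n)) ^ p = c powr (real p / n)"
      using assms(1) by (simp add: powr_realpow[symmetric] powr_powr)
    also have "real p / n = 1 + 1 / n" using n5 by (simp add: field_simps)
    finally have "(c powr (1 / n)) ^ p = c * c powr (1 / n)" using assms(1) by (simp add: powr_add)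
    then have "Qc p c (x + x0) ^ p = c * (c powr (1 / n) * Q p (sqrt c * (x + x0)) ^ p)"
      by (simp add: Qc_def power_mult_distrib)
    moreover have "c powr (1 / n) * (sqrt c * (Q2 (sqrt c * (x + x0)) * sqrt c)) = (sqrt c * sqrt c) * (c powr (1 / n) * Q2 (sqrt c * (x + x0)))"
      by (simp only: mult_ac)
    moreover have "sqrt c * sqrt c = c" using assms(1) by simp
    ultimately show ?thesis by (simp add: Qc_def Q2_def right_diff_distrib)
  qed
  finally show "(g has_real_derivative c * Qc p c (x + x0) - Qc p c (x + x0) ^ p) (at x)" .
qed

text \<open>By continuity, equality almost everywhere is equality everywhere and may be
  differentiated twice; the profile equation of \<open>Q_c\<close> then gives
  \<open>w'' + w ^ p = c * w\<close>.\<close>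

lemma soliton_data_proportional:
  assumes c: "c > 0" and AE: "AE x in lborel. w 0 x = Qc p c (x + x0)"
  shows "U \<epsilon> P 0 x = c * w 0 x"
proof -
  have d1: "(w 0 has_real_derivative U \<epsilon> Z' 0 x) (at x)" for x by (rule w_deriv) simp
  have d2: "(U \<epsilon> Z' 0 has_real_derivative U \<epsilon> Z'' 0 x) (at x)" for x by (rule w'_deriv) simp
  note Q = Qc_second_deriv[OF c, of x0]
  have "w 0 x - Qc p c (x + x0) = 0" for x
  proof (rule continuous_AE_zero[where f = "\<lambda>x. w 0 x - Qc p c (x + x0)"])
    show "continuous_on UNIV (\<lambda>x. w 0 x - Qc p c (x + x0))"
      by (intro continuous_intros continuous_at_imp_continuous_on ballI DERIV_isCont[OF d1] DERIV_isCont[OF Q(1)])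
    show "AE x in lborel. w 0 x - Qc p c (x + x0) = 0" using AE by eventually_elim simp
  qed
  then have eq: "w 0 = (\<lambda>x. Qc p c (x + x0))" by (auto simp: fun_eq_iff)
  have "U \<epsilon> Z' 0 x = c powr (1 / n) * (sqrt c * Q1 (sqrt c * (x + x0)))" for x
    using DERIV_unique[OF d1[of x]] Q(1)[of x] unfolding eq by blast
  then have "U \<epsilon> Z' 0 = (\<lambda>x. c powr (1 / n) * (sqrt c * Q1 (sqrt c * (x + x0))))" by blast
  then have "U \<epsilon> Z'' 0 x = c * Qc p c (x + x0) - Qc p c (x + x0) ^ p" 
    using DERIV_unique[OF d2[of x]] Q(2)[of x] by simp
  then show ?thesis using w_P[of 0 x] by (simp add: eq)
qed

end

lemma U_0_right_deriv:
  assumes "tame c" shows "((\<lambda>\<epsilon>. (\<Sum>k. \<epsilon> ^ k * c k x)) has_real_derivative c 1 x) (at 0 within {0..})"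
proof -
  have "norm (0 :: real) < fps_conv_radius (Abs_fps (\<lambda>k. c k x))"
    by (rule less_le_trans[OF _ tame_conv_radius[OF assms]]) simp
  from has_field_derivative_eval_fps[OF this]
  have "(eval_fps (Abs_fps (\<lambda>k. c k x)) has_real_derivative c 1 x) (at 0 within {0..})"
    unfolding eval_fps_at_0 by simp
  moreover have "eval_fps (Abs_fps (\<lambda>k. c k x)) = (\<lambda>\<epsilon>. \<Sum>k. \<epsilon> ^ k * c k x)"
    by (simp add: eval_fps_def mult.commute fun_eq_iff)
  ultimately show ?thesis by simp
qed

lemma exists_non_soliton_member:
  "\<exists>\<epsilon>>0. \<epsilon> \<le> 1 / 4 \<and> (\<forall>c>0. \<forall>x0. \<not> (AE x in lborel. U \<epsilon> Z 0 x = Qc p c (x + x0)))"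
proof (rule ccontr)
  assume "\<not> ?thesis"
  then have sol: "\<exists>c>0. \<exists>x0. AE x in lborel. U \<epsilon> Z 0 x = Qc p c (x + x0)" if "0 < \<epsilon>" "\<epsilon> \<le> 1 / 4" for \<epsilon> using that by blast
  define W V where "W \<epsilon> x = (\<Sum>k. \<epsilon> ^ k * Z k x)" and "V \<epsilon> x = (\<Sum>k. \<epsilon> ^ k * P k x)" for \<epsilon> x
  have F0: "power_coeff p Z 0 x = Q p x ^ p" for x by (simp add: power_coeff_def Z_0 fps_power_zeroth)
  have Z'0: "Z' 0 = Q1" using DERIV_unique[OF Z_deriv[of 0] Q_deriv[folded Z_0]] by blast
  have Z''0: "Z'' 0 = Q2" using DERIV_unique[OF Z'_deriv[of 0] Q1_deriv[folded Z'0]] by blast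
  have P0: "P 0 = Q p" by (rule ext) (simp add: P_def F0 Z''0 Q2_def)
  have at0: "(\<Sum>k. 0 ^ k * c k x) = c 0 x" for c :: "nat \<Rightarrow> real \<Rightarrow> real" and x
    using powser_zero[of "\<lambda>k. c k x"] by (simp add: mult.commute)
  \<comment> \<open>The speed \<open>c\<close> depends on \<open>\<epsilon>\<close> in an
    uncontrolled way. Forming the cross product with the values at the point \<open>0\<close>
    eliminates it before anything is differentiated in \<open>\<epsilon>\<close>.\<close>
  have VW: "V \<epsilon> x * W \<epsilon> 0 - V \<epsilon> 0 * W \<epsilon> x = 0" if e: "0 \<le> \<epsilon>" "\<epsilon> \<le> 1 / 4" for \<epsilon> x
  proof (cases "\<epsilon> = 0")
    case True
    then show ?thesis by (simp add: W_def V_def at0 P0 Z_0)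
  next
    case False
    then have e': "0 < \<epsilon>" using e by simp
    obtain c x0 where c: "c > 0" "AE x in lborel. U \<epsilon> Z 0 x = Qc p c (x + x0)" using sol[OF e' e(2)] by blast
    have "V \<epsilon> x = c * W \<epsilon> x" for x
      using soliton_data_proportional[OF e' e(2) c, of x] by (simp add: U_def V_def W_def sig_def)
    then show ?thesis by simp
  qed
  have dW: "((\<lambda>\<epsilon>. W \<epsilon> x) has_real_derivative Z 1 x) (at 0 within {0..})" for x unfolding W_def by (rule U_0_right_deriv[OF tame_Z])
  have dV: "((\<lambda>\<epsilon>. V \<epsilon> x) has_real_derivative P 1 x) (at 0 within {0..})" for x unfolding V_def by (rule U_0_right_deriv[OF tame_P])
  have order1: "P 1 x * Q p 0 + Q p x * Z 1 0 - (P 1 0 * Q p x + Q p 0 * Z 1 x) = 0" for x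
  proof -
    have "((\<lambda>\<epsilon>. V \<epsilon> x * W \<epsilon> 0 - V \<epsilon> 0 * W \<epsilon> x) has_real_derivative P 1 x * W 0 0 + Z 1 0 * V 0 x - (P 1 0 * W 0 x + Z 1 x * V 0 0)) (at 0 within {0..})"
      by (intro DERIV_diff DERIV_mult dV dW)
    then have "((\<lambda>\<epsilon>. (V \<epsilon> x * W \<epsilon> 0 - V \<epsilon> 0 * W \<epsilon> x) / \<epsilon>) \<longlongrightarrow> P 1 x * W 0 0 + Z 1 0 * V 0 x - (P 1 0 * W 0 x + Z 1 x * V 0 0)) (at_right 0)"
      using VW[of 0 x] unfolding has_field_derivative_iff by (simp add: at_within_Ici_at_right)
    moreover have "((\<lambda>\<epsilon>. (V \<epsilon> x * W \<epsilon> 0 - V \<epsilon> 0 * W \<epsilon> x) / \<epsilon>) \<longlongrightarrow> 0) (at_right 0)"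
    proof (rule tendsto_eventually)
      have "\<forall>\<^sub>F \<epsilon> in at_right (0 :: real). \<epsilon> < 1 / 4" "\<forall>\<^sub>F \<epsilon> in at_right (0 :: real). \<epsilon> > 0"
        by (rule order_tendstoD(2)[OF tendsto_ident_at], simp) (rule eventually_at_right_less)
      then show "\<forall>\<^sub>F \<epsilon> in at_right 0. (V \<epsilon> x * W \<epsilon> 0 - V \<epsilon> 0 * W \<epsilon> x) / \<epsilon> = 0"
        by eventually_elim (simp add: VW)
    qed
    ultimately have "P 1 x * W 0 0 + Z 1 0 * V 0 x - (P 1 0 * W 0 x + Z 1 x * V 0 0) = 0"
      by (rule tendsto_unique[OF trivial_limit_at_right_real])
    then show ?thesis by (simp add: W_def V_def at0 P0 Z_0 mult.commute)
  qed
  \<comment> \<open>At first order the proportionality says that \<open>P 1 - Z 1\<close> is a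
    multiple of \<open>Q\<close>. Differentiating in \<open>x\<close>, where the eigenvalue equation
    leaves \<open>e0 * Z 1\<close>, shows that \<open>Z 1\<close> is a multiple of
    \<open>Q'\<close>.\<close>
  define b where "b = (P 1 0 - Z 1 0) / Q p 0"
  have PZ: "P 1 x - Z 1 x = b * Q p x" for x
    using order1[of x] Q_pos[of 0] by (simp add: b_def field_simps)
  have "((\<lambda>x. P 1 x - Z 1 x) has_real_derivative e0 * Z 1 x) (at x)" for x
    using DERIV_diff[OF P_deriv[of 1 x] Z_deriv[of 1 x]] by simp
  moreover have "((\<lambda>x. P 1 x - Z 1 x) has_real_derivative b * Q1 x) (at x)" for x
    unfolding PZ by (rule DERIV_cmult[OF Q_deriv])
  ultimately have "e0 * Z 1 x = b * Q1 x" for x by (rule DERIV_unique)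
  then have Z1: "Z 1 = (\<lambda>x. b / e0 * Q1 x)" using e0_pos by (auto simp: fun_eq_iff field_simps)
  have "Z' 1 x = b / e0 * Q2 x" for x
    by (rule DERIV_unique[OF Z_deriv[of 1]]) (unfold Z1, rule DERIV_cmult[OF Q1_deriv])
  then have Z'1: "Z' 1 = (\<lambda>x. b / e0 * Q2 x)" by blast
  have Z''1: "Z'' 1 x = b / e0 * ((1 - q x) * Q1 x)" for x
    by (rule DERIV_unique[OF Z'_deriv[of 1]]) (unfold Z'1, rule DERIV_cmult[OF Q2_deriv])
  have pc: "power_coeff p Z 1 x = q x * Z 1 x" for x
    using power_coeff_split[of 1 p Z x] lower_power_coeff_1[of p Z x] by (simp add: Z_0 q_def)
  \<comment> \<open>On multiples of \<open>Q'\<close> the operator \<open>d^2/dx^2 + q\<close> acts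
    as the identity, so \<open>P 1 - Z 1\<close> vanishes. This forces \<open>b = 0\<close> and
    \<open>Z 1 = 0\<close>.\<close>
  have "P 1 x = Z 1 x" for x unfolding P_def Z''1 pc unfolding Z1 by (simp add: algebra_simps)
  then have "b = 0" using PZ[of 0] Q_pos[of 0] by simp
  then show False using Z1 Z_1 by simp
qed

end

theorem theorem3p13:
  fixes p :: nat
  assumes "p > 5"
  shows "\<exists>(w :: real \<Rightarrow> real \<Rightarrow> real) (cp :: real) (\<rho> :: real \<Rightarrow> real).
           global_gKdV_solution p w \<and> cp > 0 \<and>
           ((\<lambda>t. H1_norm (\<lambda>x. w t x - Qc p cp (x - \<rho> t))) \<longlongrightarrow> 0) at_top \<and>
           (\<forall>c>0. \<forall>x0. \<not> (AE x in lborel. w 0 x = Qc p c (x + x0)))"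
proof -
  interpret soliton p by standard (rule assms)
  obtain a e0 K Z Z' Z'' where "unstable_series p a e0 K Z Z' Z''" using unstable_series_exists by blast
  then interpret unstable_series p a e0 K Z Z' Z'' .
  obtain \<epsilon> where \<epsilon>: "0 < \<epsilon>" "\<epsilon> \<le> 1 / 4" "\<forall>c>0. \<forall>x0. \<not> (AE x in lborel. U \<epsilon> Z 0 x = Qc p c (x + x0))"
    using exists_non_soliton_member by blast
  show ?thesis
    using w_global[OF \<epsilon>(1,2)] w_tendsto[OF \<epsilon>(1,2)] \<epsilon>(3)
    by (intro exI[of _ "U \<epsilon> Z"] exI[of _ "1 :: real"] exI[of _ "\<lambda>t. t"]) simp
qed

end
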